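(* Let $n\ge 2$, let $\rho>0$, $L>0$ and $\gamma>0$ with $\gamma>\rho^n|\mathbb S^{n-1}|$, and let $$\mathcal F := \Big\{ f\in W^{1,\infty}(\mathbb S^{n-1}) \;:\; f\ge\rho \text{ on }\mathbb S^{n-1},\ \|\nabla_T f\|_{L^\infty(\mathbb S^{n-1})}\le L,\ \int_{\mathbb S^{n-1}} f(\omega)^n\,\mathrm{d}o_\omega=\gamma\Big\}.$$ Let $R := \big(|\mathbb S^{n-1}|^{-1}\gamma\big)^{1/n}+\pi L$, let $D:=B_R(0)\subset\mathbb R^n$, and let $F,z\in L^2(D)$ be given. For $f\in\mathcal F$ define $$J(f) := \frac12\int_{\Omega_f}|u-z|^2\,\mathrm{d}x,$$ where $u\in H^1_0(\Omega_f)$ is the unique solution of $$\int_{\Omega_f}\nabla u\cdot\nabla\eta\,\mathrm{d}x=\int_{\Omega_f}F\,\eta\,\mathrm{d}x\qquad\forall\,\eta\in H^1_0(\Omega_f).$$ Then there exists $f_*\in\mathcal F$ such that $J(f_* )=\min_{f\in\mathcal F}J(f)$.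
   Context: $\mathbb S^{n-1}=\{x\in\mathbb R^n:|x|=1\}$ carries the $(n-1)$-dimensional Hausdorff measure, $\mathrm{d}o_\omega$ is its surface element and $|\mathbb S^{n-1}|$ its total measure. $W^{1,\infty}(\mathbb S^{n-1})$ is identified with the Lipschitz functions on $\mathbb S^{n-1}$, and $\nabla_T f$ is the ($\mathbb R^n$-valued, a.e. defined) tangential gradient of $f$ on the sphere. $B_R(0)$ is the open ball of radius $R$ about the origin. For a positive function $f\colon\mathbb S^{n-1}\to\mathbb R$, $$\Omega_f:=\{x\in\mathbb R^n : x=0\text{ or } |x|<f(x/|x|),\ x\ne0\}.$$ For every $f\in\mathcal F$ one has $f\le R$ on $\mathbb S^{n-1}$, so $\Omega_f\subset D$ and $J$ is well defined. *)

theory Defs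
  imports "HOL-Analysis.Analysis"
begin

text \<open>
  The normalisation by \<open>unit_ball_vol d\<close> is the one for which the \<open>d\<close>-dimensional Hausdorff
  measure is the usual \<open>d\<close>-dimensional area.  The library's \<^const>\<open>diameter\<close> is only
  meaningful for bounded sets, whence the boundedness requirement; empty members of a cover
  contribute nothing (this matters only for \<open>d = 0\<close>).
\<close>

definition hausdorff_pre :: "nat \<Rightarrow> real \<Rightarrow> 'a::metric_space set \<Rightarrow> ennreal" where
  "hausdorff_pre d \<delta> A =
     Inf {(\<Sum>i. if C i = {} then 0 else ennreal (unit_ball_vol (real d) * (diameter (C i) / 2) ^ d))
          | C :: nat \<Rightarrow> 'a set.
            A \<subseteq> (\<Union>i. C i) \<and> (\<forall>i. bounded (C i) \<and> diameter (C i) \<le> \<delta>)}"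

definition hausdorff_outer :: "nat \<Rightarrow> 'a::metric_space set \<Rightarrow> ennreal" where
  "hausdorff_outer d A = (SUP \<delta>\<in>{0<..}. hausdorff_pre d \<delta> A)"

definition hausdorff_measure :: "nat \<Rightarrow> 'a::metric_space measure" where
  "hausdorff_measure d = measure_of UNIV (sets borel) (hausdorff_outer d)"

definition sphere_measure :: "(real^'n) measure" where
  "sphere_measure = restrict_space (hausdorff_measure (CARD('n) - 1)) (sphere 0 1)"

text \<open>
  Functions on the sphere are represented by functions on the whole space of which only the values
  on the sphere matter.  The derivative is taken within the sphere, so it is determined
  on the tangent space only; orthogonality to \<open>\<omega>\<close> makes the representing vector unique.  By
  Rademacher's theorem it exists almost everywhere if \<open>f\<close> is Lipschitz on the sphere.
\<close>

definition has_tangential_gradient :: "(real^'n \<Rightarrow> real) \<Rightarrow> real^'n \<Rightarrow> real^'n \<Rightarrow> bool" where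
  "has_tangential_gradient f v \<omega> \<longleftrightarrow>
     v \<bullet> \<omega> = 0 \<and> (f has_derivative (\<lambda>h. v \<bullet> h)) (at \<omega> within sphere 0 1)"

definition tangential_gradient :: "(real^'n \<Rightarrow> real) \<Rightarrow> real^'n \<Rightarrow> real^'n" where
  "tangential_gradient f \<omega> = (THE v. has_tangential_gradient f v \<omega>)"

definition grad :: "(real^'n \<Rightarrow> real) \<Rightarrow> real^'n \<Rightarrow> real^'n" where
  "grad \<phi> x = (\<chi> i. frechet_derivative \<phi> (at x) (axis i 1))"

primrec C_k :: "nat \<Rightarrow> (real^'n \<Rightarrow> real) \<Rightarrow> bool" where
  "C_k 0 \<phi> \<longleftrightarrow> continuous_on UNIV \<phi>"
| "C_k (Suc k) \<phi> \<longleftrightarrow> (\<forall>x. \<phi> differentiable (at x)) \<and> (\<forall>i. C_k k (\<lambda>x. grad \<phi> x $ i))"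

definition test_functions :: "(real^'n) set \<Rightarrow> (real^'n \<Rightarrow> real) set" where
  "test_functions \<Omega> =
     {\<phi>. (\<forall>k. C_k k \<phi>) \<and> compact (closure {x. \<phi> x \<noteq> 0}) \<and> closure {x. \<phi> x \<noteq> 0} \<subseteq> \<Omega>}"

text \<open>
  Elements of Lebesgue and Sobolev spaces are functions, not classes modulo null sets.
\<close>

definition L2 :: "(real^'n) set \<Rightarrow> (real^'n \<Rightarrow> 'b::real_normed_vector) set" where
  "L2 \<Omega> = {u. u \<in> borel_measurable (lebesgue_on \<Omega>) \<and>
              integrable (lebesgue_on \<Omega>) (\<lambda>x. (norm (u x))\<^sup>2)}"

definition has_weak_gradient ::
    "(real^'n) set \<Rightarrow> (real^'n \<Rightarrow> real) \<Rightarrow> (real^'n \<Rightarrow> real^'n) \<Rightarrow> bool" where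
  "has_weak_gradient \<Omega> u g \<longleftrightarrow>
     u \<in> L2 \<Omega> \<and> g \<in> L2 \<Omega> \<and>
     (\<forall>\<phi>\<in>test_functions \<Omega>.
        (\<integral>x. u x *\<^sub>R grad \<phi> x \<partial>lebesgue_on \<Omega>) = - (\<integral>x. \<phi> x *\<^sub>R g x \<partial>lebesgue_on \<Omega>))"

definition H1 :: "(real^'n) set \<Rightarrow> (real^'n \<Rightarrow> real) set" where
  "H1 \<Omega> = {u. \<exists>g. has_weak_gradient \<Omega> u g}"

definition weak_grad :: "(real^'n) set \<Rightarrow> (real^'n \<Rightarrow> real) \<Rightarrow> real^'n \<Rightarrow> real^'n" where
  "weak_grad \<Omega> u = (SOME g. has_weak_gradient \<Omega> u g)"

definition H1_norm :: "(real^'n) set \<Rightarrow> (real^'n \<Rightarrow> real) \<Rightarrow> real" where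
  "H1_norm \<Omega> u =
     sqrt ((\<integral>x. (u x)\<^sup>2 \<partial>lebesgue_on \<Omega>) + (\<integral>x. (norm (weak_grad \<Omega> u x))\<^sup>2 \<partial>lebesgue_on \<Omega>))"

definition H10 :: "(real^'n) set \<Rightarrow> (real^'n \<Rightarrow> real) set" where
  "H10 \<Omega> = {u \<in> H1 \<Omega>. \<exists>\<phi> :: nat \<Rightarrow> real^'n \<Rightarrow> real.
      (\<forall>k. \<phi> k \<in> test_functions \<Omega>) \<and>
      (\<lambda>k. H1_norm \<Omega> (\<lambda>x. u x - \<phi> k x)) \<longlonglongrightarrow> 0}"

definition Omega :: "(real^'n \<Rightarrow> real) \<Rightarrow> (real^'n) set" where
  "Omega f = {x. x = 0 \<or> (x \<noteq> 0 \<and> norm x < f (x /\<^sub>R norm x))}"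

definition admissible :: "real \<Rightarrow> real \<Rightarrow> real \<Rightarrow> (real^'n \<Rightarrow> real) set" where
  "admissible \<rho> L \<gamma> =
     {f. (\<exists>K. K-lipschitz_on (sphere 0 1) f) \<and>
         (\<forall>\<omega>\<in>sphere 0 1. \<rho> \<le> f \<omega>) \<and>
         (AE \<omega> in sphere_measure. norm (tangential_gradient f \<omega>) \<le> L) \<and>
         (\<integral>\<omega>. f \<omega> ^ CARD('n) \<partial>sphere_measure) = \<gamma>}"

definition weak_solution ::
    "(real^'n \<Rightarrow> real) \<Rightarrow> (real^'n) set \<Rightarrow> (real^'n \<Rightarrow> real) \<Rightarrow> bool" where
  "weak_solution F \<Omega> u \<longleftrightarrow>
     u \<in> H10 \<Omega> \<and>
     (\<forall>\<eta>\<in>H10 \<Omega>. (\<integral>x. weak_grad \<Omega> u x \<bullet> weak_grad \<Omega> \<eta> x \<partial>lebesgue_on \<Omega>)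
                = (\<integral>x. F x * \<eta> x \<partial>lebesgue_on \<Omega>))"

text \<open>
  The weak solution is unique only up to null sets, hence \<open>SOME\<close> rather than \<open>THE\<close>.
\<close>

definition state :: "(real^'n \<Rightarrow> real) \<Rightarrow> (real^'n) set \<Rightarrow> real^'n \<Rightarrow> real" where
  "state F \<Omega> = (SOME u. weak_solution F \<Omega> u)"

definition cost :: "(real^'n \<Rightarrow> real) \<Rightarrow> (real^'n \<Rightarrow> real) \<Rightarrow> (real^'n \<Rightarrow> real) \<Rightarrow> real" where
  "cost F z f = 1 / 2 * (\<integral>x. (state F (Omega f) x - z x)\<^sup>2 \<partial>lebesgue_on (Omega f))"

end

theory Submission
  imports Defs "HOL-Complex_Analysis.Great_Picard"
begin

text \<open>
  By Rademacher's theorem on the cone over the sphere and averaging over small translates of great circles, a Lipschitz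
  function on the sphere satisfies the gradient bound iff it is \<open>L\<close>-Lipschitz for the geodesic distance.  As the minimum
  of an admissible function is at most its \<open>n\<close>-mean, admissible functions are bounded by \<open>R\<close>, so by Arzela-Ascoli a
  minimising sequence \<open>f\<^sub>k\<close> has a uniformly convergent subsequence with an admissible limit \<open>f\<close>.

  Since the domains are star-shaped and \<open>f, f\<^sub>k \<ge> \<rho>\<close>, uniform convergence gives \<open>\<Omega>\<^sub>f, \<Omega>\<^sub>f\<^sub>k \<subseteq> s \<Omega>\<^sub>f\<close> and \<open>\<Omega>\<^sub>f \<subseteq> s \<Omega>\<^sub>f\<^sub>k\<close> for
  every \<open>s > 1\<close> and large \<open>k\<close>.  For nested domains the solution on the smaller one is the orthogonal projection of the
  one on the larger, so \<open>\<parallel>\<nabla>u'' - \<nabla>u\<parallel>\<^sup>2 = \<parallel>\<nabla>u''\<parallel>\<^sup>2 - \<parallel>\<nabla>u\<parallel>\<^sup>2\<close>, and \<open>\<parallel>\<nabla>u\<parallel>\<close> is the norm of the functional \<open>\<phi> \<mapsto> \<integral> F \<phi>\<close> on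
  test functions, which changes by \<open>O(s - 1)\<close> under the dilation \<open>\<phi> \<mapsto> \<phi>(s \<cdot>)\<close>.  Hence the gradients of the states on \<open>\<Omega>\<^sub>f\<^sub>k\<close> and
  \<open>\<Omega>\<^sub>f\<close> differ by \<open>O(sqrt (s - 1))\<close> in \<open>L\<^sup>2\<close>: the states converge strongly, without compactness or boundary
  regularity, and the cost is lower semicontinuous.
\<close>

section \<open>Square-integrable functions\<close>

text \<open>The states live on different domains, so they are compared only after extension by zero
  to the whole space; membership in H^1_0 then means being an L2 limit of test functions whose
  gradients converge as well, a notion visibly monotone in the domain. Of the dilated domains, the
  one of \<open>\<Omega>\<^sub>f\<close> contains both domains and is the common reference; that of
  \<open>\<Omega>\<^sub>f\<^sub>k\<close> keeps the energy on
  \<open>\<Omega>\<^sub>f\<^sub>k\<close> from falling far below the energy on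
  \<open>\<Omega>\<^sub>f\<close>. The dilation estimate relies on n >= 2, because the Dirichlet
  norm scales like s^(1 - n/2).

  On the sphere the obstacle is that the gradient bound holds only almost everywhere, while a great
  circle is a null set for n >= 3, and that \<open>tangential_gradient\<close> is an unspecified
  value where no gradient exists. Hence Rademacher's theorem, and averages over a neighbourhood of
  the circle. The surface measure enters through its finiteness, positivity and null sets, so crude
  constants suffice when it is compared with Lebesgue measure.\<close>

definition square_integrable :: "'a measure \<Rightarrow> ('a \<Rightarrow> 'b::euclidean_space) set" where
  "square_integrable M = {u \<in> borel_measurable M. integrable M (\<lambda>x. (norm (u x))\<^sup>2)}"

definition l2norm :: "'a measure \<Rightarrow> ('a \<Rightarrow> 'b::euclidean_space) \<Rightarrow> real" where
  "l2norm M u = sqrt (\<integral>x. (norm (u x))\<^sup>2 \<partial>M)"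

lemma square_integrable_measurable: "u \<in> square_integrable M \<Longrightarrow> u \<in> borel_measurable M"
  by (simp add: square_integrable_def)

lemma square_integrable_norm: "u \<in> square_integrable M \<Longrightarrow> integrable M (\<lambda>x. (norm (u x))\<^sup>2)"
  by (simp add: square_integrable_def)

lemma l2norm_nonneg: "0 \<le> l2norm M u"
  by (simp add: l2norm_def)

lemma l2norm_square: "(l2norm M u)\<^sup>2 = (\<integral>x. (norm (u x))\<^sup>2 \<partial>M)"
  by (simp add: l2norm_def)

lemma l2norm_zero: "l2norm M (\<lambda>_. 0) = 0"
  by (simp add: l2norm_def)

lemma square_integrable_scaleR:
  "u \<in> square_integrable M \<Longrightarrow> (\<lambda>x. c *\<^sub>R u x) \<in> square_integrable M"
  by (auto simp: square_integrable_def power_mult_distrib)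

lemma square_integrable_add:
  assumes "u \<in> square_integrable M" "v \<in> square_integrable M"
  shows "(\<lambda>x. u x + v x) \<in> square_integrable M"
proof -
  have [measurable]: "u \<in> borel_measurable M" "v \<in> borel_measurable M"
    using assms by (auto simp: square_integrable_def)
  have i: "integrable M (\<lambda>x. 2 * (norm (u x))\<^sup>2 + 2 * (norm (v x))\<^sup>2)"
    using assms by (auto simp: square_integrable_def)
  have "(norm (u x + v x))\<^sup>2 \<le> 2 * (norm (u x))\<^sup>2 + 2 * (norm (v x))\<^sup>2" for x
  proof -
    have "(norm (u x + v x))\<^sup>2 \<le> (norm (u x) + norm (v x))\<^sup>2"
      by (intro power_mono norm_triangle_ineq) auto
    also have "\<dots> \<le> 2 * (norm (u x))\<^sup>2 + 2 * (norm (v x))\<^sup>2"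
      using sum_squares_bound[of "norm (u x)" "norm (v x)"] by (simp add: power2_sum)
    finally show ?thesis .
  qed
  then have "integrable M (\<lambda>x. (norm (u x + v x))\<^sup>2)"
    by (intro Bochner_Integration.integrable_bound[OF i] AE_I2) auto
  then show ?thesis by (auto simp: square_integrable_def)
qed

lemma square_integrable_diff:
  assumes "u \<in> square_integrable M" "v \<in> square_integrable M"
  shows "(\<lambda>x. u x - v x) \<in> square_integrable M"
  using square_integrable_add[OF assms(1) square_integrable_scaleR[OF assms(2), of "-1"]] by simp

lemma square_integrable_bound:
  fixes u :: "'a \<Rightarrow> 'b::euclidean_space" and v :: "'a \<Rightarrow> 'c::euclidean_space"
  assumes "v \<in> square_integrable M" "u \<in> borel_measurable M" "AE x in M. norm (u x) \<le> norm (v x)"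
  shows "u \<in> square_integrable M"
proof -
  note [measurable] = assms(2)
  have "integrable M (\<lambda>x. (norm (u x))\<^sup>2)"
  proof (rule Bochner_Integration.integrable_bound[OF square_integrable_norm[OF assms(1)]])
    show "AE x in M. norm ((norm (u x))\<^sup>2) \<le> norm ((norm (v x))\<^sup>2)"
      using assms(3) by eventually_elim (simp add: power_mono)
  qed simp
  then show ?thesis using assms(2) by (simp add: square_integrable_def)
qed

lemma integrable_inner_square_integrable:
  assumes "u \<in> square_integrable M" "v \<in> square_integrable M"
  shows "integrable M (\<lambda>x. u x \<bullet> v x)"
proof -
  have [measurable]: "u \<in> borel_measurable M" "v \<in> borel_measurable M"
    using assms by (auto simp: square_integrable_def)
  have i: "integrable M (\<lambda>x. (norm (u x))\<^sup>2 + (norm (v x))\<^sup>2)"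
    using assms by (auto simp: square_integrable_def)
  have "\<bar>u x \<bullet> v x\<bar> \<le> (norm (u x))\<^sup>2 + (norm (v x))\<^sup>2" for x
    using Cauchy_Schwarz_ineq2[of "u x" "v x"] sum_squares_bound[of "norm (u x)" "norm (v x)"]
      zero_le_power2[of "norm (u x)"] zero_le_power2[of "norm (v x)"] by linarith
  then show ?thesis
    by (intro Bochner_Integration.integrable_bound[OF i] AE_I2) auto
qed

lemma integrable_scaleR_square_integrable:
  fixes u :: "'a \<Rightarrow> real" and v :: "'a \<Rightarrow> 'b::euclidean_space"
  assumes "u \<in> square_integrable M" "v \<in> square_integrable M"
  shows "integrable M (\<lambda>x. u x *\<^sub>R v x)"
proof -
  have [measurable]: "u \<in> borel_measurable M" "v \<in> borel_measurable M"
    using assms by (auto simp: square_integrable_def)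
  have i: "integrable M (\<lambda>x. (norm (u x))\<^sup>2 + (norm (v x))\<^sup>2)"
    using assms by (auto simp: square_integrable_def)
  have "norm (u x *\<^sub>R v x) \<le> (norm (u x))\<^sup>2 + (norm (v x))\<^sup>2" for x
    using sum_squares_bound[of "norm (u x)" "norm (v x)"]
      zero_le_power2[of "norm (u x)"] zero_le_power2[of "norm (v x)"]
    by (simp only: norm_scaleR real_norm_def)
  then show ?thesis
    by (intro Bochner_Integration.integrable_bound[OF i] AE_I2) auto
qed

lemma l2norm_add_square:
  assumes "u \<in> square_integrable M" "v \<in> square_integrable M"
  shows "(l2norm M (\<lambda>x. u x + v x))\<^sup>2 = (l2norm M u)\<^sup>2 + 2 * (\<integral>x. u x \<bullet> v x \<partial>M) + (l2norm M v)\<^sup>2"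
proof -
  have "(norm (u x + v x))\<^sup>2 = (norm (u x))\<^sup>2 + 2 * (u x \<bullet> v x) + (norm (v x))\<^sup>2" for x
    by (simp add: power2_norm_eq_inner inner_add_left inner_add_right inner_commute)
  then show ?thesis
    using assms by (simp add: l2norm_square integrable_inner_square_integrable square_integrable_norm)
qed

lemma l2norm_scaleR: "l2norm M (\<lambda>x. c *\<^sub>R u x) = \<bar>c\<bar> * l2norm M u"
  by (simp add: l2norm_def power_mult_distrib real_sqrt_mult)

lemma l2norm_diff_square:
  assumes "u \<in> square_integrable M" "v \<in> square_integrable M"
  shows "(l2norm M (\<lambda>x. u x - v x))\<^sup>2 = (l2norm M u)\<^sup>2 - 2 * (\<integral>x. u x \<bullet> v x \<partial>M) + (l2norm M v)\<^sup>2"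
  using l2norm_add_square[OF assms(1) square_integrable_scaleR[OF assms(2), of "-1"]]
  by (simp add: l2norm_scaleR[of M "-1", simplified])

text \<open>The quadratic form (s, t) -> |s u + t v|^2 is nonnegative; keeping both parameters
  avoids division by a norm that may vanish.\<close>

lemma l2_Cauchy_Schwarz:
  assumes "u \<in> square_integrable M" "v \<in> square_integrable M"
  shows "\<bar>\<integral>x. u x \<bullet> v x \<partial>M\<bar> \<le> l2norm M u * l2norm M v"
proof -
  define a b c where "a = l2norm M u" and "b = l2norm M v" and "c = (\<integral>x. u x \<bullet> v x \<partial>M)"
  have nn: "0 \<le> a" "0 \<le> b" by (auto simp: a_def b_def l2norm_nonneg)
  have q: "0 \<le> s\<^sup>2 * a\<^sup>2 + 2 * s * t * c + t\<^sup>2 * b\<^sup>2" for s t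
  proof -
    have "(l2norm M (\<lambda>x. s *\<^sub>R u x + t *\<^sub>R v x))\<^sup>2 = (\<bar>s\<bar> * a)\<^sup>2 + 2 * (s * t * c) + (\<bar>t\<bar> * b)\<^sup>2"
      using l2norm_add_square[OF square_integrable_scaleR[OF assms(1), of s]
          square_integrable_scaleR[OF assms(2), of t]]
      by (simp add: l2norm_scaleR a_def b_def c_def mult.assoc[symmetric])
    then show ?thesis
      using zero_le_power2[of "l2norm M (\<lambda>x. s *\<^sub>R u x + t *\<^sub>R v x)"]
      by (simp add: power_mult_distrib)
  qed
  have "c\<^sup>2 \<le> (a * b)\<^sup>2"
  proof (cases "b = 0")
    case True
    have "c = 0"
    proof (rule ccontr)
      assume "c \<noteq> 0"
      \<comment> \<open>With b = 0 this value of t turns the form into a^2 + 2 t c = -1.\<close>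
      then show False using q[of 1 "- (a\<^sup>2 + 1) / (2 * c)"] True by (simp add: field_simps)
    qed
    then show ?thesis by simp
  next
    case False
    then have "0 < b\<^sup>2" by simp
    have "0 \<le> b\<^sup>2 * (a\<^sup>2 * b\<^sup>2 - c\<^sup>2)"
      using q[of "b\<^sup>2" "-c"] by (simp add: power2_eq_square algebra_simps)
    then show ?thesis using \<open>0 < b\<^sup>2\<close> by (simp add: zero_le_mult_iff power_mult_distrib)
  qed
  then show ?thesis
    using nn by (simp add: abs_le_square_iff[symmetric] a_def b_def c_def)
qed

lemma l2norm_triangle:
  assumes "u \<in> square_integrable M" "v \<in> square_integrable M"
  shows "l2norm M (\<lambda>x. u x + v x) \<le> l2norm M u + l2norm M v"
proof (rule power2_le_imp_le)
  show "(l2norm M (\<lambda>x. u x + v x))\<^sup>2 \<le> (l2norm M u + l2norm M v)\<^sup>2"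
    using l2norm_add_square[OF assms] l2_Cauchy_Schwarz[OF assms] by (simp add: power2_sum)
qed (simp add: l2norm_nonneg)

lemma l2norm_uminus: "l2norm M (\<lambda>x. - u x) = l2norm M u"
  by (simp add: l2norm_def)

lemma l2norm_minus_commute: "l2norm M (\<lambda>x. u x - v x) = l2norm M (\<lambda>x. v x - u x)"
  by (simp add: l2norm_def norm_minus_commute)

lemma l2norm_triangle_diff:
  assumes "u \<in> square_integrable M" "v \<in> square_integrable M"
  shows "l2norm M (\<lambda>x. u x - v x) \<le> l2norm M u + l2norm M v"
  using l2norm_triangle[OF assms(1) square_integrable_scaleR[OF assms(2), of "-1"]]
  by (simp add: l2norm_uminus)

lemma l2norm_triangle3:
  assumes "u \<in> square_integrable M" "v \<in> square_integrable M" "w \<in> square_integrable M"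
  shows "l2norm M (\<lambda>x. u x - w x) \<le> l2norm M (\<lambda>x. u x - v x) + l2norm M (\<lambda>x. v x - w x)"
  using l2norm_triangle[OF square_integrable_diff[OF assms(1,2)] square_integrable_diff[OF assms(2,3)]]
  by simp

lemma l2norm_reverse_triangle:
  assumes "u \<in> square_integrable M" "v \<in> square_integrable M"
  shows "\<bar>l2norm M u - l2norm M v\<bar> \<le> l2norm M (\<lambda>x. u x - v x)"
  using l2norm_triangle[OF square_integrable_diff[OF assms] assms(2)]
    l2norm_triangle[OF square_integrable_diff[OF assms(2,1)] assms(1)]
    l2norm_minus_commute[of M u v] by simp

lemma l2norm_cong_AE:
  assumes "u \<in> borel_measurable M" "v \<in> borel_measurable M" "AE x in M. u x = v x"
  shows "l2norm M u = l2norm M v"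
proof -
  note [measurable] = assms(1,2)
  show ?thesis
    unfolding l2norm_def by (rule arg_cong[where f=sqrt], rule integral_cong_AE) (use assms(3) in auto)
qed

section \<open>Strong convergence and completeness in L2\<close>

lemma l2_tendsto_norm:
  assumes "\<And>k. U k \<in> square_integrable M" "u \<in> square_integrable M"
    and "(\<lambda>k. l2norm M (\<lambda>x. u x - U k x)) \<longlonglongrightarrow> 0"
  shows "(\<lambda>k. l2norm M (U k)) \<longlonglongrightarrow> l2norm M u"
proof (rule LIMSEQ_I)
  fix e :: real assume "0 < e"
  with assms(3) obtain N where N: "\<And>k. k \<ge> N \<Longrightarrow> \<bar>l2norm M (\<lambda>x. u x - U k x)\<bar> < e"
    by (auto simp: lim_sequentially dist_real_def)
  have "\<bar>l2norm M (U k) - l2norm M u\<bar> < e" if "k \<ge> N" for k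
    using l2norm_reverse_triangle[OF assms(2,1), of k] N[OF that] by linarith
  then show "\<exists>N. \<forall>k\<ge>N. norm (l2norm M (U k) - l2norm M u) < e" by auto
qed

lemma l2_tendsto_inner:
  assumes U: "\<And>k. U k \<in> square_integrable M" "u \<in> square_integrable M"
    and cu: "(\<lambda>k. l2norm M (\<lambda>x. u x - U k x)) \<longlonglongrightarrow> 0"
    and V: "\<And>k. V k \<in> square_integrable M" "v \<in> square_integrable M"
    and cv: "(\<lambda>k. l2norm M (\<lambda>x. v x - V k x)) \<longlonglongrightarrow> 0"
  shows "(\<lambda>k. \<integral>x. U k x \<bullet> V k x \<partial>M) \<longlonglongrightarrow> (\<integral>x. u x \<bullet> v x \<partial>M)"
proof -
  have b: "norm ((\<integral>x. U k x \<bullet> V k x \<partial>M) - (\<integral>x. u x \<bullet> v x \<partial>M))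
      \<le> l2norm M (U k) * l2norm M (\<lambda>x. v x - V k x) + l2norm M (\<lambda>x. u x - U k x) * l2norm M v" for k
  proof -
    have "(\<integral>x. U k x \<bullet> V k x \<partial>M) - (\<integral>x. u x \<bullet> v x \<partial>M)
        = - (\<integral>x. U k x \<bullet> (v x - V k x) \<partial>M) - (\<integral>x. (u x - U k x) \<bullet> v x \<partial>M)"
      using U V by (simp add: integrable_inner_square_integrable inner_diff_left inner_diff_right)
    moreover have "\<bar>\<integral>x. U k x \<bullet> (v x - V k x) \<partial>M\<bar> \<le> l2norm M (U k) * l2norm M (\<lambda>x. v x - V k x)"
      by (intro l2_Cauchy_Schwarz U V square_integrable_diff)
    moreover have "\<bar>\<integral>x. (u x - U k x) \<bullet> v x \<partial>M\<bar> \<le> l2norm M (\<lambda>x. u x - U k x) * l2norm M v"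
      by (intro l2_Cauchy_Schwarz U V square_integrable_diff)
    ultimately show ?thesis unfolding real_norm_def by linarith
  qed
  have "(\<lambda>k. l2norm M (U k) * l2norm M (\<lambda>x. v x - V k x) + l2norm M (\<lambda>x. u x - U k x) * l2norm M v)
      \<longlonglongrightarrow> l2norm M u * 0 + 0 * l2norm M v"
    by (intro tendsto_intros l2_tendsto_norm assms)
  then have "(\<lambda>k. l2norm M (U k) * l2norm M (\<lambda>x. v x - V k x) + l2norm M (\<lambda>x. u x - U k x) * l2norm M v)
      \<longlonglongrightarrow> 0" by simp
  then have "(\<lambda>k. (\<integral>x. U k x \<bullet> V k x \<partial>M) - (\<integral>x. u x \<bullet> v x \<partial>M)) \<longlonglongrightarrow> 0"
    by (rule Lim_null_comparison[rotated]) (use b in auto)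
  then show ?thesis by (simp add: LIM_zero_iff)
qed

lemma l2_tendsto_inner_const:
  assumes "\<And>k. U k \<in> square_integrable M" "u \<in> square_integrable M"
    and "(\<lambda>k. l2norm M (\<lambda>x. u x - U k x)) \<longlonglongrightarrow> 0" "v \<in> square_integrable M"
  shows "(\<lambda>k. \<integral>x. U k x \<bullet> v x \<partial>M) \<longlonglongrightarrow> (\<integral>x. u x \<bullet> v x \<partial>M)"
  using l2_tendsto_inner[OF assms(1-3), of "\<lambda>_. v" v] assms(4) by (simp add: l2norm_zero)

text \<open>Riesz-Fischer. On an infinite measure space square integrable functions need not be
  integrable, so the increments of a fast subsequence are summed as weighted squares: if the sum of
  2^j (w j)^2 is finite at a point, then \<open>w j\<close> decays there like 2^(-j/2), which is
  summable. Fatou's lemma turns the pointwise limit of the subsequence into an L2 limit of the full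
  sequence.\<close>

lemma l2_complete:
  fixes U :: "nat \<Rightarrow> 'a \<Rightarrow> 'b::euclidean_space"
  assumes U: "\<And>k. U k \<in> square_integrable M"
    and C: "\<And>e. 0 < e \<Longrightarrow> \<exists>N. \<forall>m\<ge>N. \<forall>n\<ge>N. l2norm M (\<lambda>x. U m x - U n x) < e"
  obtains u where "u \<in> square_integrable M" "(\<lambda>k. l2norm M (\<lambda>x. u x - U k x)) \<longlonglongrightarrow> 0"
proof -
  have [measurable]: "U k \<in> borel_measurable M" for k
    using U by (rule square_integrable_measurable)
  have "\<exists>r. strict_mono r \<and> (\<forall>j. \<forall>m\<ge>r j. \<forall>n\<ge>r j. l2norm M (\<lambda>x. U m x - U n x) < (1/2)^j)"
  proof -
    have "\<exists>N. \<forall>m\<ge>N. \<forall>n\<ge>N. l2norm M (\<lambda>x. U m x - U n x) < (1/2)^j" for j by (rule C) simp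
    then obtain N where N: "\<And>j m n. m \<ge> N j \<Longrightarrow> n \<ge> N j \<Longrightarrow> l2norm M (\<lambda>x. U m x - U n x) < (1/2)^j"
      by metis
    \<comment> \<open>Partial sums dominate each single \<open>N j\<close>, and the
      \<open>Suc\<close> makes them strictly increasing.\<close>
    define r where "r j = (\<Sum>i\<le>j. Suc (N i))" for j
    have "strict_mono r" by (rule strict_monoI_Suc) (simp add: r_def)
    moreover have "N j \<le> r j" for j
      unfolding r_def by (rule order_trans[OF _ member_le_sum[of j]]) auto
    ultimately show ?thesis using N by (meson order_trans)
  qed
  then obtain r where r: "strict_mono r"
    and rC: "\<And>j m n. m \<ge> r j \<Longrightarrow> n \<ge> r j \<Longrightarrow> l2norm M (\<lambda>x. U m x - U n x) < (1/2)^j" by blast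
  define w where "w j x = norm (U (r (Suc j)) x - U (r j) x)" for j x
  have [measurable]: "w j \<in> borel_measurable M" for j by (simp add: w_def[abs_def])
  have wi: "(\<integral>\<^sup>+x. ennreal (2^j * (w j x)\<^sup>2) \<partial>M) \<le> ennreal ((1/2)^j)" for j
  proof -
    have i: "integrable M (\<lambda>x. (w j x)\<^sup>2)"
      unfolding w_def by (intro square_integrable_norm square_integrable_diff U)
    have "(\<integral>x. 2^j * (w j x)\<^sup>2 \<partial>M) = 2^j * (l2norm M (\<lambda>x. U (r (Suc j)) x - U (r j) x))\<^sup>2"
      by (simp add: l2norm_square w_def)
    also have "\<dots> \<le> 2^j * ((1/2)^j)\<^sup>2"
    proof (intro mult_left_mono power_mono l2norm_nonneg)
      show "l2norm M (\<lambda>x. U (r (Suc j)) x - U (r j) x) \<le> (1/2)^j"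
        by (rule less_imp_le, rule rC) (use strict_monoD[OF r, of j "Suc j"] in auto)
    qed auto
    also have "\<dots> = (1/2)^j" by (simp add: power2_eq_square power_mult_distrib[symmetric] flip: mult.assoc)
    finally have "(\<integral>x. 2^j * (w j x)\<^sup>2 \<partial>M) \<le> (1/2)^j" .
    moreover have "(\<integral>\<^sup>+x. ennreal (2^j * (w j x)\<^sup>2) \<partial>M) = ennreal (\<integral>x. 2^j * (w j x)\<^sup>2 \<partial>M)"
      using i by (intro nn_integral_eq_integral) auto
    ultimately show ?thesis by (simp add: ennreal_leI)
  qed
  have "(\<integral>\<^sup>+x. (\<Sum>j. ennreal (2^j * (w j x)\<^sup>2)) \<partial>M) = (\<Sum>j. \<integral>\<^sup>+x. ennreal (2^j * (w j x)\<^sup>2) \<partial>M)"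
    by (rule nn_integral_suminf) simp
  also have "\<dots> \<le> (\<Sum>j. ennreal ((1/2)^j))"
    by (intro suminf_le wi) auto
  also have "\<dots> = ennreal (\<Sum>j. (1/2)^j)"
    by (intro suminf_ennreal2 summable_geometric) auto
  also have "\<dots> < \<infinity>" by simp
  finally have "AE x in M. (\<Sum>j. ennreal (2^j * (w j x)\<^sup>2)) \<noteq> \<infinity>"
    by (intro nn_integral_noteq_infinite) auto
  then have conv: "AE x in M. convergent (\<lambda>j. U (r j) x)"
  proof eventually_elim
    case (elim x)
    have "summable (\<lambda>j. 2^j * (w j x)\<^sup>2)"
      by (rule summable_suminf_not_top) (use elim in auto)
    then have "Bseq (\<lambda>j. 2^j * (w j x)\<^sup>2)" by (meson convergent_imp_Bseq summable_imp_convergent convergentI summable_LIMSEQ_zero)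
    then obtain B where B: "0 < B" "\<And>j. 2^j * (w j x)\<^sup>2 \<le> B"
      by (auto simp: Bseq_def)
    have "w j x \<le> sqrt B * (1 / sqrt 2)^j" for j
    proof (rule power2_le_imp_le)
      have "(w j x)\<^sup>2 \<le> B / 2^j" using B(2)[of j] by (simp add: field_simps)
      also have "\<dots> = (sqrt B * (1 / sqrt 2)^j)\<^sup>2"
        using B(1) by (simp add: power_mult_distrib power_divide real_sqrt_power[symmetric])
      finally show "(w j x)\<^sup>2 \<le> (sqrt B * (1 / sqrt 2)^j)\<^sup>2" .
    qed (use B in auto)
    then have "norm (U (r (Suc j)) x - U (r j) x) \<le> sqrt B * (1 / sqrt 2)^j" for j
      by (simp add: w_def)
    moreover have "summable (\<lambda>j. sqrt B * (1 / sqrt 2)^j)"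
      by (intro summable_mult summable_geometric) auto
    ultimately have "summable (\<lambda>j. U (r (Suc j)) x - U (r j) x)"
      by (metis (no_types, lifting) summable_comparison_test)
    then have "convergent (\<lambda>n. (\<Sum>j<n. U (r (Suc j)) x - U (r j) x))"
      by (simp add: summable_iff_convergent)
    then have "convergent (\<lambda>n. U (r n) x - U (r 0) x)"
      by (simp only: sum_lessThan_telescope[of "\<lambda>j. U (r j) x"])
    then have "convergent (\<lambda>n. (U (r n) x - U (r 0) x) + U (r 0) x)"
      by (intro convergent_add convergent_const)
    then show ?case by simp
  qed
  define u where "u x = lim (\<lambda>j. U (r j) x)" for x
  have um[measurable]: "u \<in> borel_measurable M"
    unfolding u_def[abs_def] by (rule borel_measurable_lim_metric) simp
  have lim: "AE x in M. (\<lambda>j. U (r j) x) \<longlonglongrightarrow> u x"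
    using conv by eventually_elim (simp add: u_def convergent_LIMSEQ_iff)
  have est: "(\<integral>\<^sup>+x. ennreal ((norm (u x - U k x))\<^sup>2) \<partial>M) \<le> ennreal (((1/2)^j)\<^sup>2)" if k: "k \<ge> r j" for j k
  proof -
    have "(\<integral>\<^sup>+x. ennreal ((norm (u x - U k x))\<^sup>2) \<partial>M)
        = (\<integral>\<^sup>+x. liminf (\<lambda>i. ennreal ((norm (U (r i) x - U k x))\<^sup>2)) \<partial>M)"
    proof (rule nn_integral_cong_AE, use lim in eventually_elim)
      case (elim x)
      have "(\<lambda>i. ennreal ((norm (U (r i) x - U k x))\<^sup>2)) \<longlonglongrightarrow> ennreal ((norm (u x - U k x))\<^sup>2)"
        by (intro tendsto_ennrealI tendsto_intros elim)
      from this show ?case using lim_imp_Liminf[OF trivial_limit_sequentially] by metis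
    qed
    also have "\<dots> \<le> liminf (\<lambda>i. \<integral>\<^sup>+x. ennreal ((norm (U (r i) x - U k x))\<^sup>2) \<partial>M)"
      by (rule nn_integral_liminf) simp
    also have "\<dots> \<le> ennreal (((1/2)^j)\<^sup>2)"
    proof (rule Liminf_le)
      have "(\<integral>\<^sup>+x. ennreal ((norm (U (r i) x - U k x))\<^sup>2) \<partial>M) \<le> ennreal (((1/2)^j)\<^sup>2)" if i: "i \<ge> j" for i
      proof -
        have "(\<integral>\<^sup>+x. ennreal ((norm (U (r i) x - U k x))\<^sup>2) \<partial>M)
            = ennreal ((l2norm M (\<lambda>x. U (r i) x - U k x))\<^sup>2)"
          unfolding l2norm_square
          by (intro nn_integral_eq_integral square_integrable_norm square_integrable_diff U) auto
        also have "\<dots> \<le> ennreal (((1/2)^j)\<^sup>2)"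
          using rC[of j "r i" k] k i strict_mono_less_eq[OF r, of j i]
          by (intro ennreal_leI power_mono l2norm_nonneg) auto
        finally show ?thesis .
      qed
      then show "\<forall>\<^sub>F i in sequentially. (\<integral>\<^sup>+x. ennreal ((norm (U (r i) x - U k x))\<^sup>2) \<partial>M) \<le> ennreal (((1/2)^j)\<^sup>2)"
        by (auto simp: eventually_sequentially)
    qed simp
    finally show ?thesis .
  qed
  \<comment> \<open>The limit is square integrable because it differs from a square integrable
    function by one that is.\<close>
  have dsq: "(\<lambda>x. u x - U k x) \<in> square_integrable M" if "k \<ge> r 0" for k
  proof -
    have "integrable M (\<lambda>x. (norm (u x - U k x))\<^sup>2)"
      by (rule integrableI_bounded)
        (use est[OF that] in \<open>auto simp: ennreal_power[symmetric] intro: le_less_trans\<close>)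
    then show ?thesis by (simp add: square_integrable_def)
  qed
  have "u \<in> square_integrable M"
    using square_integrable_add[OF dsq[OF order_refl] U[of "r 0"]] by simp
  moreover have "(\<lambda>k. l2norm M (\<lambda>x. u x - U k x)) \<longlonglongrightarrow> 0"
  proof (rule LIMSEQ_I)
    fix e :: real assume "0 < e"
    obtain j :: nat where j: "(1/2)^j < e" using real_arch_pow_inv[OF \<open>0 < e\<close>, of "1/2"] by auto
    have "norm (l2norm M (\<lambda>x. u x - U k x) - 0) < e" if k: "k \<ge> r j" for k
    proof -
      have k0: "k \<ge> r 0" using k strict_mono_less_eq[OF r, of 0 j] by simp
      have "ennreal ((l2norm M (\<lambda>x. u x - U k x))\<^sup>2) \<le> ennreal (((1/2)^j)\<^sup>2)"
        unfolding l2norm_square using est[OF k]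
        by (subst nn_integral_eq_integral[symmetric]) (auto intro: square_integrable_norm dsq[OF k0])
      then have "(l2norm M (\<lambda>x. u x - U k x))\<^sup>2 \<le> ((1/2)^j)\<^sup>2" by (subst (asm) ennreal_le_iff) auto
      then have "l2norm M (\<lambda>x. u x - U k x) \<le> (1/2)^j" by (rule power2_le_imp_le) simp
      then show ?thesis using j by (simp add: l2norm_nonneg)
    qed
    then show "\<exists>N. \<forall>k\<ge>N. norm (l2norm M (\<lambda>x. u x - U k x) - 0) < e" by blast
  qed
  ultimately show thesis by (rule that)
qed

text \<open>Stated at one point: the null set where the pointwise derivative fails may depend on
  \<open>t\<^sub>0\<close>, and the domination concerns difference quotients. This suits Lipschitz
  integrands, which are differentiable only almost everywhere.\<close>

lemma has_derivative_integral_dominated: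
  fixes f :: "real \<Rightarrow> 'a \<Rightarrow> real"
  assumes int: "\<And>t. \<bar>t - t\<^sub>0\<bar> < d \<Longrightarrow> integrable M (f t)"
    and der: "AE x in M. ((\<lambda>t. f t x) has_real_derivative f' x) (at t\<^sub>0)"
    and G: "integrable M G" and d: "0 < d"
    and bnd: "\<And>t. \<bar>t - t\<^sub>0\<bar> < d \<Longrightarrow> AE x in M. \<bar>f t x - f t\<^sub>0 x\<bar> \<le> G x * \<bar>t - t\<^sub>0\<bar>"
    and f'm: "f' \<in> borel_measurable M"
  shows "((\<lambda>t. \<integral>x. f t x \<partial>M) has_real_derivative (\<integral>x. f' x \<partial>M)) (at t\<^sub>0)"
proof -
  have "(\<lambda>h. ((\<integral>x. f h x \<partial>M) - (\<integral>x. f t\<^sub>0 x \<partial>M)) / (h - t\<^sub>0)) \<midarrow>t\<^sub>0\<rightarrow> (\<integral>x. f' x \<partial>M)"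
    unfolding tendsto_at_iff_sequentially
  proof (intro allI impI)
    fix X assume X: "\<forall>i. X i \<in> UNIV - {t\<^sub>0}" "X \<longlonglongrightarrow> t\<^sub>0"
    obtain N where N: "\<And>i. i \<ge> N \<Longrightarrow> \<bar>X i - t\<^sub>0\<bar> < d"
      using X(2) d by (auto simp: lim_sequentially dist_real_def)
    \<comment> \<open>The shift brings every term into the interval where \<open>int\<close> and
      \<open>bnd\<close> apply.\<close>
    define Y where "Y i = X (i + N)" for i
    have Y: "Y i \<noteq> t\<^sub>0" "\<bar>Y i - t\<^sub>0\<bar> < d" for i
      using X N by (auto simp: Y_def)
    have Yl: "Y \<longlonglongrightarrow> t\<^sub>0" unfolding Y_def using X(2) by (rule LIMSEQ_ignore_initial_segment)
    have "(\<lambda>i. \<integral>x. (f (Y i) x - f t\<^sub>0 x) / (Y i - t\<^sub>0) \<partial>M) \<longlonglongrightarrow> (\<integral>x. f' x \<partial>M)"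
    proof (rule integral_dominated_convergence[OF f'm _ G])
      show "(\<lambda>x. (f (Y i) x - f t\<^sub>0 x) / (Y i - t\<^sub>0)) \<in> borel_measurable M" for i
        using borel_measurable_integrable[OF int[OF Y(2)[of i]]] borel_measurable_integrable[OF int[of t\<^sub>0]] d
        by (intro borel_measurable_divide borel_measurable_diff) auto
      show "AE x in M. (\<lambda>i. (f (Y i) x - f t\<^sub>0 x) / (Y i - t\<^sub>0)) \<longlonglongrightarrow> f' x"
        using der
      proof eventually_elim
        case (elim x)
        then have "(\<lambda>h. (f h x - f t\<^sub>0 x) / (h - t\<^sub>0)) \<midarrow>t\<^sub>0\<rightarrow> f' x"
          by (simp add: has_field_derivative_iff)
        then show ?case
          unfolding tendsto_at_iff_sequentially using Y Yl by (auto simp: comp_def)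
      qed
      show "AE x in M. norm ((f (Y i) x - f t\<^sub>0 x) / (Y i - t\<^sub>0)) \<le> G x" for i
        using bnd[OF Y(2)[of i]]
        by eventually_elim (use Y(1)[of i] in \<open>simp add: field_simps\<close>)
    qed
    moreover have "(\<integral>x. (f (Y i) x - f t\<^sub>0 x) / (Y i - t\<^sub>0) \<partial>M)
        = ((\<integral>x. f (Y i) x \<partial>M) - (\<integral>x. f t\<^sub>0 x \<partial>M)) / (Y i - t\<^sub>0)" for i
      using int[OF Y(2)[of i]] int[of t\<^sub>0] d by simp
    ultimately have "(\<lambda>i. ((\<integral>x. f (X (i+N)) x \<partial>M) - (\<integral>x. f t\<^sub>0 x \<partial>M)) / (X (i+N) - t\<^sub>0)) \<longlonglongrightarrow> (\<integral>x. f' x \<partial>M)"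
      by (simp only: Y_def)
    from LIMSEQ_offset[OF this]
    show "((\<lambda>h. ((\<integral>x. f h x \<partial>M) - (\<integral>x. f t\<^sub>0 x \<partial>M)) / (h - t\<^sub>0)) \<circ> X) \<longlonglongrightarrow> (\<integral>x. f' x \<partial>M)"
      by (simp add: comp_def)
  qed
  then show ?thesis by (simp add: has_field_derivative_iff)
qed

section \<open>Smooth functions and the fundamental lemma of the calculus of variations\<close>

lemma has_derivative_grad:
  assumes "\<phi> differentiable (at x)"
  shows "(\<phi> has_derivative (\<lambda>h. grad \<phi> x \<bullet> h)) (at x)"
proof -
  let ?D = "frechet_derivative \<phi> (at x)"
  have D: "(\<phi> has_derivative ?D) (at x)" using assms by (simp add: frechet_derivative_works)
  then have lin: "linear ?D" by (rule has_derivative_linear)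
  have "?D h = grad \<phi> x \<bullet> h" for h
  proof -
    have "?D h = ?D (\<Sum>i\<in>UNIV. h $ i *\<^sub>R axis i 1)"
      by (simp add: basis_expansion scalar_mult_eq_scaleR[symmetric])
    also have "\<dots> = (\<Sum>i\<in>UNIV. h $ i * ?D (axis i 1))"
      by (simp add: linear_sum[OF lin] linear_cmul[OF lin])
    also have "\<dots> = grad \<phi> x \<bullet> h" by (simp add: grad_def inner_vec_def mult.commute)
    finally show ?thesis .
  qed
  then have "?D = (\<lambda>h. grad \<phi> x \<bullet> h)" by blast
  then show ?thesis using D by simp
qed

lemma grad_eqI:
  assumes "(\<phi> has_derivative (\<lambda>h. g \<bullet> h)) (at x)"
  shows "grad \<phi> x = g"
proof -
  have "frechet_derivative \<phi> (at x) = (\<lambda>h. g \<bullet> h)" using assms by (metis frechet_derivative_at)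
  then show ?thesis by (simp add: grad_def vec_eq_iff inner_axis)
qed

lemma C_k_Suc_imp: "C_k (Suc k) \<phi> \<Longrightarrow> C_k k \<phi>"
proof (induction k arbitrary: \<phi>)
  case 0
  then have "\<forall>x. \<phi> differentiable (at x)" by simp
  then show ?case
    by (simp add: continuous_on_eq_continuous_within differentiable_imp_continuous_within)
next
  case (Suc k)
  then show ?case by (metis C_k.simps(2))
qed

lemma C_k_const: "C_k k (\<lambda>_ :: real^'a. c)"
proof (induction k arbitrary: c)
  case (Suc k)
  have "grad (\<lambda>_. c) x = 0" for x :: "real^'a" by (rule grad_eqI) simp
  moreover have "C_k k (\<lambda>x :: real^'a. (0::real^'a) $ i)" for i using Suc[of 0] by simp
  ultimately show ?case by simp
qed simp

lemma C_k_add: "C_k k \<phi> \<Longrightarrow> C_k k \<psi> \<Longrightarrow> C_k k (\<lambda>x. \<phi> x + \<psi> x)"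
proof (induction k arbitrary: \<phi> \<psi>)
  case 0
  then show ?case by (simp add: continuous_on_add)
next
  case (Suc k)
  have "grad (\<lambda>x. \<phi> x + \<psi> x) x = grad \<phi> x + grad \<psi> x" for x
    by (rule grad_eqI)
       (use Suc.prems in \<open>auto intro!: derivative_eq_intros has_derivative_grad simp: inner_add_left\<close>)
  then show ?case using Suc by (auto intro!: differentiable_add)
qed

lemma C_k_mult: "C_k k \<phi> \<Longrightarrow> C_k k \<psi> \<Longrightarrow> C_k k (\<lambda>x. \<phi> x * \<psi> x)"
proof (induction k arbitrary: \<phi> \<psi>)
  case 0
  then show ?case by (simp add: continuous_on_mult)
next
  case (Suc k)
  have "grad (\<lambda>x. \<phi> x * \<psi> x) x = \<phi> x *\<^sub>R grad \<psi> x + \<psi> x *\<^sub>R grad \<phi> x" for x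
    by (rule grad_eqI)
       (use Suc.prems in \<open>auto intro!: derivative_eq_intros has_derivative_grad simp: inner_add_left algebra_simps\<close>)
  moreover have "C_k k (\<lambda>x. \<phi> x * grad \<psi> x $ i + \<psi> x * grad \<phi> x $ i)" for i
    using Suc.prems C_k_Suc_imp by (intro C_k_add Suc.IH) auto
  ultimately show ?case using Suc.prems by (auto intro!: differentiable_mult)
qed

lemma C_k_prod: "finite I \<Longrightarrow> (\<And>i. i \<in> I \<Longrightarrow> C_k k (\<phi> i)) \<Longrightarrow> C_k k (\<lambda>x. \<Prod>i\<in>I. \<phi> i x)"
  by (induction I rule: finite_induct) (auto simp: C_k_const C_k_mult)

lemma C_k_scale: "C_k k \<phi> \<Longrightarrow> C_k k (\<lambda>x. \<phi> (s *\<^sub>R x))"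
proof (induction k arbitrary: \<phi>)
  case 0
  then show ?case by (auto intro!: continuous_intros intro: continuous_on_compose2)
next
  case (Suc k)
  have d: "((\<lambda>x. \<phi> (s *\<^sub>R x)) has_derivative (\<lambda>h. (s *\<^sub>R grad \<phi> (s *\<^sub>R x)) \<bullet> h)) (at x)" for x
  proof -
    have "((*\<^sub>R) s has_derivative (*\<^sub>R) s) (at x)" by (auto intro!: derivative_eq_intros)
    moreover have "(\<phi> has_derivative (\<lambda>h. grad \<phi> (s *\<^sub>R x) \<bullet> h)) (at (s *\<^sub>R x))"
      using Suc.prems by (intro has_derivative_grad) auto
    ultimately show ?thesis using has_derivative_compose by fastforce
  qed
  then have "grad (\<lambda>x. \<phi> (s *\<^sub>R x)) x = s *\<^sub>R grad \<phi> (s *\<^sub>R x)" for x by (rule grad_eqI)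
  moreover have "C_k k (\<lambda>x. s * grad \<phi> (s *\<^sub>R x) $ i)" for i
    by (intro C_k_mult C_k_const Suc.IH) (use Suc.prems in auto)
  ultimately show ?case using d by (auto simp: differentiable_def)
qed

text \<open>With the whole sequence \<open>D\<close> of derivatives as parameter, the induction
  trades one order of smoothness for one step along \<open>D\<close>.\<close>

lemma C_k_comp_coordinate:
  fixes D :: "nat \<Rightarrow> real \<Rightarrow> real" and i :: "'n::finite"
  assumes "\<And>j t. (D j has_real_derivative D (Suc j) t) (at t)"
  shows "C_k k (\<lambda>x :: real^'n. D j (c * x $ i + d))"
proof (induction k arbitrary: j)
  case 0
  have "continuous_on UNIV (D j)"
    using assms by (meson DERIV_isCont continuous_at_imp_continuous_on)
  then show ?case by (auto intro!: continuous_intros intro: continuous_on_compose2)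
next
  case (Suc k)
  have d: "((\<lambda>x. D j (c * x $ i + d)) has_derivative
      (\<lambda>h. ((c * D (Suc j) (c * x $ i + d)) *\<^sub>R axis i 1) \<bullet> h)) (at x)" for x :: "real^'n"
  proof -
    have l: "((\<lambda>x. c * x $ i + d) has_derivative (\<lambda>h. c * h $ i)) (at x)"
      by (auto intro!: derivative_eq_intros bounded_linear.has_derivative[OF bounded_linear_vec_nth])
    have "(D j has_derivative (\<lambda>h. h * D (Suc j) (c * x $ i + d))) (at (c * x $ i + d))"
      using assms[of j "c * x $ i + d"]
      by (simp add: has_field_derivative_def mult.commute[of _ "D (Suc j) (c * x $ i + d)"])
    from has_derivative_compose[OF l this] show ?thesis
      by (simp add: inner_axis' algebra_simps)
  qed
  then have "grad (\<lambda>x. D j (c * x $ i + d)) x = (c * D (Suc j) (c * x $ i + d)) *\<^sub>R axis i 1" for x :: "real^'n"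
    by (rule grad_eqI)
  moreover have "C_k k (\<lambda>x :: real^'n. c * D (Suc j) (c * x $ i + d) * axis i 1 $ i')" for i'
    by (intro C_k_mult C_k_const Suc)
  ultimately show ?case using d by (auto simp: differentiable_def)
qed

section \<open>Bump functions on a box\<close>

text \<open>The \<open>k\<close>-th derivative of \<open>exp (- 1 / t)\<close> on \<open>t > 0\<close> is \<open>p\<^sub>k (1 / t) * exp (- 1 / t)\<close> with these \<open>p\<^sub>k\<close>.\<close>
primrec flat_poly :: "nat \<Rightarrow> real poly" where
  "flat_poly 0 = 1"
| "flat_poly (Suc k) = [:0, 0, 1:] * (flat_poly k - pderiv (flat_poly k))"

definition flat :: "nat \<Rightarrow> real \<Rightarrow> real" where
  "flat k t = (if 0 < t then poly (flat_poly k) (1 / t) * exp (- 1 / t) else 0)"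

lemma tendsto_poly_exp_neg_0:
  fixes p :: "real poly"
  shows "((\<lambda>s. poly p s * exp (- s)) \<longlongrightarrow> 0) at_top"
proof -
  have "((\<lambda>s. \<Sum>i\<le>degree p. coeff p i * (s ^ i / exp s)) \<longlongrightarrow> 0) at_top"
    by (intro tendsto_null_sum tendsto_mult_right_zero tendsto_power_div_exp_0)
  then show ?thesis
    by (simp add: poly_altdef exp_minus sum_distrib_right divide_inverse mult.assoc)
qed

lemma DERIV_flat: "(flat k has_real_derivative flat (Suc k) t) (at t)"
proof -
  consider "t < 0" | "t = 0" | "0 < t" by linarith
  then show ?thesis
  proof cases
    case 1
    show ?thesis
      by (rule has_field_derivative_transform_within_open[where f="\<lambda>_. 0" and S="{..<0}"])
         (use 1 in \<open>auto simp: flat_def\<close>)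
  next
    case 3
    show ?thesis
    proof (rule has_field_derivative_transform_within_open[where S="{0<..}"])
      show "((\<lambda>t. poly (flat_poly k) (1 / t) * exp (- 1 / t)) has_real_derivative flat (Suc k) t) (at t)"
        using 3 by (auto intro!: derivative_eq_intros poly_DERIV[THEN DERIV_chain2]
            simp: flat_def field_simps power2_eq_square)
    qed (use 3 in \<open>auto simp: flat_def\<close>)
  next
    case 2
    let ?q = "\<lambda>h. (flat k h - flat k 0) / (h - 0)"
    \<comment> \<open>The additional factor \<open>[:0,1:]\<close> is the 1 / h of the difference
      quotient.\<close>
    have "((\<lambda>h. poly ([:0,1:] * flat_poly k) (inverse h) * exp (- inverse h)) \<longlongrightarrow> 0) (at_right 0)"
      by (rule filterlim_compose[OF tendsto_poly_exp_neg_0 filterlim_inverse_at_top_right])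
    then have "(?q \<longlongrightarrow> 0) (at_right 0)"
      by (rule Lim_transform_eventually)
         (auto simp: flat_def eventually_at_right_field field_simps intro!: exI[of _ 1])
    moreover have "(?q \<longlongrightarrow> 0) (at_left 0)"
      by (rule tendsto_eventually) (auto simp: flat_def eventually_at_left_field intro!: exI[of _ "-1"])
    ultimately have "(?q \<longlongrightarrow> 0) (at 0)" by (simp add: filterlim_split_at)
    then show ?thesis using 2 by (simp add: has_field_derivative_iff flat_def)
  qed
qed

text \<open>For m > 0 the value inside the box is exp (- T / m) with some T > 0 depending on the
  point. The support stays in the closed box while the values rise to 1, so dominated convergence
  carries statements about test functions to indicators of boxes.\<close>

definition box_bump :: "real^'n \<Rightarrow> real^'n \<Rightarrow> nat \<Rightarrow> real^'n \<Rightarrow> real" where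
  "box_bump a b m x = (\<Prod>i\<in>UNIV. flat 0 (real m * (x $ i - a $ i)) * flat 0 (real m * (b $ i - x $ i)))"

lemma flat_0_bounds: "0 \<le> flat 0 t" "flat 0 t \<le> 1"
  by (auto simp: flat_def)

lemma box_bump_bounds: "0 \<le> box_bump a b m x" "box_bump a b m x \<le> 1"
  by (auto simp: box_bump_def intro!: prod_nonneg prod_le_1 mult_nonneg_nonneg mult_le_one flat_0_bounds)

lemma box_bump_eq_0: "x \<notin> box a b \<Longrightarrow> box_bump a b m x = 0"
  by (force simp: box_bump_def mem_box_cart flat_def zero_less_mult_iff)

lemma box_bump_tendsto:
  fixes x :: "real^'n"
  shows "(\<lambda>m. box_bump a b (Suc m) x) \<longlonglongrightarrow> indicator (box a b) x"
proof (cases "x \<in> box a b")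
  case True
  have l: "(\<lambda>m. flat 0 (real (Suc m) * t)) \<longlonglongrightarrow> 1" if "0 < t" for t
  proof -
    have "(\<lambda>m. exp (- (inverse (real (Suc m)) * (1 / t)))) \<longlonglongrightarrow> exp (- (0 * (1 / t)))"
      by (intro tendsto_intros LIMSEQ_inverse_real_of_nat)
    moreover have "flat 0 (real (Suc m) * t) = exp (- (inverse (real (Suc m)) * (1 / t)))" for m
      using that by (simp add: flat_def divide_inverse)
    ultimately show ?thesis by simp
  qed
  have "(\<lambda>m. box_bump a b (Suc m) x) \<longlonglongrightarrow> (\<Prod>i\<in>(UNIV::'n set). 1 * 1)"
    unfolding box_bump_def by (intro tendsto_intros l) (use True in \<open>auto simp: mem_box_cart\<close>)
  then show ?thesis using True by simp
qed (simp add: box_bump_eq_0)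

lemma box_bump_test_function:
  assumes "cbox a b \<subseteq> \<Omega>"
  shows "box_bump a b m \<in> test_functions \<Omega>"
proof -
  have "C_k k (box_bump a b m)" for k
  proof -
    have "C_k k (\<lambda>x. flat 0 (real m * x $ i + (- real m * a $ i)) * flat 0 ((- real m) * x $ i + real m * b $ i))" for i
      by (intro C_k_mult C_k_comp_coordinate DERIV_flat)
    then have "C_k k (\<lambda>x. \<Prod>i\<in>UNIV. flat 0 (real m * x $ i + (- real m * a $ i)) * flat 0 ((- real m) * x $ i + real m * b $ i))"
      by (intro C_k_prod) auto
    moreover have "box_bump a b m = (\<lambda>x. \<Prod>i\<in>UNIV. flat 0 (real m * x $ i + (- real m * a $ i)) * flat 0 ((- real m) * x $ i + real m * b $ i))"
      by (simp add: box_bump_def fun_eq_iff algebra_simps)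
    ultimately show ?thesis by simp
  qed
  moreover have "{x. box_bump a b m x \<noteq> 0} \<subseteq> cbox a b"
    using box_bump_eq_0 box_subset_cbox by blast
  then have s: "closure {x. box_bump a b m x \<noteq> 0} \<subseteq> cbox a b" by (intro closure_minimal) auto
  then have "compact (closure {x. box_bump a b m x \<noteq> 0})"
    by (metis bounded_cbox bounded_subset closed_closure compact_eq_bounded_closed)
  ultimately show ?thesis using s assms by (auto simp: test_functions_def)
qed

text \<open>Boxes are an intersection-stable generator of the Borel sets, and the vanishing total
  integral takes care of complements. Once all Borel sets are reached, the function is tested on the
  sets where it is positive or negative.\<close>

lemma AE_eq_0_box_integrals:
  fixes h :: "'a::euclidean_space \<Rightarrow> real"
  assumes h: "integrable lborel h" and z: "\<And>a b. (\<integral>x. indicator (box a b) x *\<^sub>R h x \<partial>lborel) = 0"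
    and t: "(\<integral>x. h x \<partial>lborel) = 0"
  shows "AE x in lborel. h x = 0"
proof -
  have all: "(\<integral>x. indicator A x *\<^sub>R h x \<partial>lborel) = 0" if A: "A \<in> sets borel" for A
  proof -
    have "Int_stable (range (\<lambda>(a, b). box a b :: 'a set))"
      by (auto simp: Int_stable_def box_Int_box)
    moreover have "(range (\<lambda>(a, b). box a b :: 'a set)) \<subseteq> Pow UNIV" by auto
    moreover have "A \<in> sigma_sets UNIV (range (\<lambda>(a, b). box a b))"
      using A unfolding borel_eq_box by simp
    ultimately show ?thesis
    proof (induction rule: sigma_sets_induct_disjoint)
      case (basic A)
      then show ?case using z by auto
    next
      case empty
      then show ?case by simp
    next
      case (compl A)
      then have [measurable]: "A \<in> sets borel" by (simp add: borel_eq_box)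
      have i: "integrable lborel (\<lambda>x. indicator A x *\<^sub>R h x)"
        by (rule integrable_mult_indicator[OF _ h]) auto
      have "(\<integral>x. indicator (UNIV - A) x *\<^sub>R h x \<partial>lborel) = (\<integral>x. h x - indicator A x *\<^sub>R h x \<partial>lborel)"
        by (rule Bochner_Integration.integral_cong) (auto simp: indicator_def)
      also have "\<dots> = 0" using h i t compl by simp
      finally show ?case .
    next
      case (union F)
      then have m[measurable]: "\<And>i. F i \<in> sets borel" by (simp add: borel_eq_box subset_eq)
      have "(LINT x:(\<Union>i. F i)|lborel. h x) = (\<Sum>i. (LINT x:(F i)|lborel. h x))"
        using union(1) h by (intro lebesgue_integral_countable_add)
          (auto simp: disjoint_family_on_def set_integrable_def simp del: real_scaleR_def
            intro!: integrable_mult_indicator)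
      then show ?case using union by (simp add: set_lebesgue_integral_def)
    qed
  qed
  have [measurable]: "h \<in> borel_measurable borel" using borel_measurable_integrable[OF h] by simp
  have p: "AE x in lborel. s * h x \<le> 0" for s
  proof -
    let ?A = "{x. 0 < s * h x}"
    have A[measurable]: "?A \<in> sets borel" by measurable
    have "(\<integral>x. s * (indicator ?A x *\<^sub>R h x) \<partial>lborel) = 0" using all[OF A] by simp
    moreover have "integrable lborel (\<lambda>x. s * (indicator ?A x *\<^sub>R h x))"
      by (intro integrable_mult_right integrable_mult_indicator h) auto
    moreover have "0 \<le> s * (indicator ?A x *\<^sub>R h x)" for x by (auto simp: indicator_def)
    ultimately have "AE x in lborel. s * (indicator ?A x *\<^sub>R h x) = 0"
      using integral_nonneg_eq_0_iff_AE by blast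
    then show ?thesis by eventually_elim (auto simp: indicator_def split: if_splits)
  qed
  show ?thesis using p[of 1] p[of "-1"] by eventually_elim auto
qed

text \<open>Bump functions reduce the claim to integrals over boxes. One closed box inside \<Omega>
  is treated at a time, since \<open>g\<close> is integrable only there; countably many of them
  cover \<Omega>.\<close>

lemma fundamental_lemma_variations:
  fixes g :: "real^'n \<Rightarrow> real"
  assumes "open \<Omega>" and gm: "g \<in> borel_measurable lebesgue"
    and gi: "\<And>a b. cbox a b \<subseteq> \<Omega> \<Longrightarrow> integrable lebesgue (\<lambda>x. indicator (cbox a b) x *\<^sub>R g x)"
    and z: "\<And>\<phi>. \<phi> \<in> test_functions \<Omega> \<Longrightarrow> (\<integral>x. \<phi> x * g x \<partial>lebesgue) = 0"
  shows "AE x in lebesgue. x \<in> \<Omega> \<longrightarrow> g x = 0"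
proof -
  have box0: "(\<integral>x. indicator (box a b) x *\<^sub>R g x \<partial>lebesgue) = 0" if ab: "cbox a b \<subseteq> \<Omega>" for a b
  proof -
    have "(\<lambda>m. \<integral>x. box_bump a b (Suc m) x * g x \<partial>lebesgue) \<longlonglongrightarrow> (\<integral>x. indicator (box a b) x *\<^sub>R g x \<partial>lebesgue)"
    proof (rule integral_dominated_convergence)
      show "integrable lebesgue (\<lambda>x. norm (indicator (cbox a b) x *\<^sub>R g x))"
        by (intro integrable_norm gi ab)
      have "box_bump a b (Suc m) \<in> borel_measurable lebesgue" for m
      proof (rule measurable_completion)
        have "C_k 0 (box_bump a b (Suc m))" using box_bump_test_function[OF ab] unfolding test_functions_def by blast
        then show "box_bump a b (Suc m) \<in> borel_measurable lborel"
          by (simp add: borel_measurable_continuous_onI)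
      qed
      then show "(\<lambda>x. box_bump a b (Suc m) x * g x) \<in> borel_measurable lebesgue" for m
        using gm by (intro borel_measurable_times)
      show "(\<lambda>x. indicator (box a b) x *\<^sub>R g x) \<in> borel_measurable lebesgue"
        using gm by (intro borel_measurable_scaleR borel_measurable_indicator) auto
      show "AE x in lebesgue. (\<lambda>m. box_bump a b (Suc m) x * g x) \<longlonglongrightarrow> indicator (box a b) x *\<^sub>R g x"
        by (auto intro!: tendsto_intros box_bump_tendsto)
      show "AE x in lebesgue. norm (box_bump a b (Suc m) x * g x) \<le> norm (indicator (cbox a b) x *\<^sub>R g x)" for m
      proof (rule AE_I2)
        fix x
        show "norm (box_bump a b (Suc m) x * g x) \<le> norm (indicator (cbox a b) x *\<^sub>R g x)"
          using box_bump_bounds[of a b "Suc m" x] box_bump_eq_0[of x a b "Suc m"] box_subset_cbox[of a b]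
          by (cases "x \<in> cbox a b") (simp_all add: abs_mult mult_left_le_one_le subset_iff, metis abs_zero mult_zero_left order_refl)
      qed
    qed
    moreover have "(\<integral>x. box_bump a b (Suc m) x * g x \<partial>lebesgue) = 0" for m
      by (intro z box_bump_test_function ab)
    ultimately show ?thesis by (simp add: LIMSEQ_const_iff)
  qed
  \<comment> \<open>The argument with boxes lives on Borel sets and \<open>lborel\<close>, so a
    Borel representative of \<open>g\<close> is needed.\<close>
  obtain g' where g'm[measurable]: "g' \<in> borel_measurable lborel" and g': "AE x in lborel. g x = g' x"
    using completion_ex_borel_measurable_real[OF gm] by blast
  have g'c: "AE x in lebesgue. g x = g' x" using g' by (rule AE_completion)
  have cb: "AE x in lebesgue. x \<in> box a b \<longrightarrow> g x = 0" if ab: "cbox a b \<subseteq> \<Omega>" for a b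
  proof -
    define h where "h x = indicator (box a b) x *\<^sub>R g' x" for x
    have [measurable]: "h \<in> borel_measurable lborel" by (simp add: h_def[abs_def])
    have eq: "(\<integral>x. indicator A x *\<^sub>R h x \<partial>lborel) = (\<integral>x. indicator (A \<inter> box a b) x *\<^sub>R g x \<partial>lebesgue)"
      if [measurable]: "A \<in> sets borel" for A
    proof -
      have "(\<integral>x. indicator A x *\<^sub>R h x \<partial>lborel) = (\<integral>x. indicator A x *\<^sub>R h x \<partial>lebesgue)"
        by (rule integral_completion[symmetric]) simp
      also have "\<dots> = (\<integral>x. indicator (A \<inter> box a b) x *\<^sub>R g x \<partial>lebesgue)"
      proof (rule integral_cong_AE)
        show "(\<lambda>x. indicator A x *\<^sub>R h x) \<in> borel_measurable lebesgue"
          by (rule measurable_completion) simp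
        show "(\<lambda>x. indicator (A \<inter> box a b) x *\<^sub>R g x) \<in> borel_measurable lebesgue"
          using gm by (intro borel_measurable_scaleR borel_measurable_indicator) auto
        show "AE x in lebesgue. indicator A x *\<^sub>R h x = indicator (A \<inter> box a b) x *\<^sub>R g x"
          using g'c by eventually_elim (auto simp: h_def indicator_def)
      qed
      finally show ?thesis .
    qed
    have "integrable lebesgue (\<lambda>x. indicator (box a b) x *\<^sub>R (indicator (cbox a b) x *\<^sub>R g x))"
      by (intro integrable_mult_indicator gi ab) auto
    then have "integrable lebesgue h"
    proof (rule integrable_cong_AE_imp)
      show "h \<in> borel_measurable lebesgue" by (rule measurable_completion) simp
      show "AE x in lebesgue. indicator (box a b) x *\<^sub>R (indicator (cbox a b) x *\<^sub>R g x) = h x"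
        using g'c by eventually_elim (use box_subset_cbox[of a b] in \<open>auto simp: h_def indicator_def\<close>)
    qed
    then have hi: "integrable lborel h" by (subst (asm) integrable_completion) auto
    have "AE x in lborel. h x = 0"
    proof (rule AE_eq_0_box_integrals[OF hi])
      fix c d :: "real^'n"
      obtain e f where e: "box c d \<inter> box a b = box e f" unfolding box_Int_box by blast
      \<comment> \<open>If the open box is empty, the closed one may be a nonempty degenerate box
        outside \<open>cbox a b\<close>.\<close>
      then have f: "box e f \<noteq> {} \<Longrightarrow> cbox e f \<subseteq> cbox a b"
      proof -
        have "box e f \<subseteq> cbox a b" using e box_subset_cbox[of a b] by blast
        then have "closure (box e f) \<subseteq> cbox a b" by (rule closure_minimal[OF _ closed_cbox])
        then show "cbox e f \<subseteq> cbox a b" if "box e f \<noteq> {}" using closure_box[OF that] by simp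
      qed
      note ef = e f
      show "(\<integral>x. indicator (box c d) x *\<^sub>R h x \<partial>lborel) = 0"
      proof (cases "box e f = {}")
        case True
        then show ?thesis using eq[of "box c d"] ef by simp
      next
        case False
        then show ?thesis using eq[of "box c d"] ef box0[of e f] ab by auto
      qed
    next
      show "(\<integral>x. h x \<partial>lborel) = 0" using eq[of UNIV] box0[OF ab] by simp
    qed
    then have "AE x in lebesgue. h x = 0" by (rule AE_completion)
    then show ?thesis using g'c by eventually_elim (auto simp: h_def)
  qed
  obtain D where D: "countable D" "D \<subseteq> Pow \<Omega>" "\<And>X. X \<in> D \<Longrightarrow> \<exists>a b. X = cbox a b" "\<Union>D = \<Omega>"
    using open_countable_Union_open_cbox[OF \<open>open \<Omega>\<close>] by metis
  have "AE x in lebesgue. \<forall>X\<in>D. x \<in> X \<longrightarrow> g x = 0"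
  proof (subst AE_ball_countable[OF D(1)], rule ballI)
    fix X assume X: "X \<in> D"
    obtain a b where ab: "X = cbox a b" using D(3)[OF X] by blast
    have "AE x in lebesgue. x \<in> box a b \<longrightarrow> g x = 0" using cb X D(2) ab by auto
    \<comment> \<open>The cover consists of closed boxes and the conclusion holds on open ones; the
      faces in between are negligible.\<close>
    moreover have "AE x in lebesgue. x \<notin> cbox a b - box a b"
      by (rule AE_not_in, subst negligible_iff_null_sets[symmetric], rule negligible_frontier_interval)
    ultimately show "AE x in lebesgue. x \<in> X \<longrightarrow> g x = 0" by eventually_elim (auto simp: ab)
  qed
  then show ?thesis by eventually_elim (use D(4) in blast)
qed

section \<open>Test functions\<close>

lemma test_function_C_k: "\<phi> \<in> test_functions \<Omega> \<Longrightarrow> C_k k \<phi>"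
  by (simp add: test_functions_def)

lemma test_function_differentiable: "\<phi> \<in> test_functions \<Omega> \<Longrightarrow> \<phi> differentiable (at x)"
  using test_function_C_k[of \<phi> \<Omega> "Suc 0"] by simp

lemmas test_function_has_derivative = has_derivative_grad[OF test_function_differentiable]

lemma test_function_continuous: "\<phi> \<in> test_functions \<Omega> \<Longrightarrow> continuous_on UNIV \<phi>"
  using test_function_C_k[of \<phi> \<Omega> 0] by simp

lemma test_function_grad_continuous: "\<phi> \<in> test_functions \<Omega> \<Longrightarrow> continuous_on UNIV (grad \<phi>)"
  using test_function_C_k[of \<phi> \<Omega> "Suc 0"] continuous_on_vec_lambda[of UNIV "\<lambda>i x. grad \<phi> x $ i"] by simp

definition support :: "(real^'n \<Rightarrow> real) \<Rightarrow> (real^'n) set" where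
  "support \<phi> = closure {x. \<phi> x \<noteq> 0}"

lemma test_function_support: "\<phi> \<in> test_functions \<Omega> \<Longrightarrow> compact (support \<phi>)" "\<phi> \<in> test_functions \<Omega> \<Longrightarrow> support \<phi> \<subseteq> \<Omega>"
  by (auto simp: test_functions_def support_def)

lemma eq_0_outside_support: "x \<notin> support \<phi> \<Longrightarrow> \<phi> x = 0"
  using closure_subset[of "{x. \<phi> x \<noteq> 0}"] by (auto simp: support_def)

lemma grad_eq_0_outside_support:
  assumes "x \<notin> support \<phi>"
  shows "grad \<phi> x = 0"
proof (rule grad_eqI)
  have "((\<lambda>_. 0) has_derivative (\<lambda>h. 0 \<bullet> h)) (at x)" by simp
  then show "(\<phi> has_derivative (\<lambda>h. 0 \<bullet> h)) (at x)"
  proof (rule has_derivative_transform_within_open[where s="- support \<phi>"])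
    show "open (- support \<phi>)" by (simp add: support_def open_Compl)
  qed (use assms in \<open>simp_all add: eq_0_outside_support\<close>)
qed

lemma compact_support_bounded:
  fixes f :: "'a::euclidean_space \<Rightarrow> 'b::real_normed_vector"
  assumes "continuous_on UNIV f" "compact K" "\<And>x. x \<notin> K \<Longrightarrow> f x = 0"
  obtains B where "0 < B" "\<And>x. norm (f x) \<le> B"
proof -
  have "compact (f ` K)"
    using assms by (meson compact_continuous_image continuous_on_subset subset_UNIV)
  then obtain B where B: "0 < B" "\<forall>y\<in>f ` K. norm y \<le> B"
    using compact_imp_bounded bounded_pos by blast
  have "norm (f x) \<le> B" for x using assms(3)[of x] B by (cases "x \<in> K") auto
  with B(1) show thesis by (rule that)
qed

lemma continuous_lebesgue_measurable:
  fixes f :: "'a::euclidean_space \<Rightarrow> 'b::euclidean_space"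
  shows "continuous_on UNIV f \<Longrightarrow> f \<in> borel_measurable lebesgue"
  by (rule measurable_completion) (simp add: borel_measurable_continuous_onI)

lemma compact_support_square_integrable:
  fixes f :: "'a::euclidean_space \<Rightarrow> 'b::euclidean_space"
  assumes f: "continuous_on UNIV f" "compact K" "\<And>x. x \<notin> K \<Longrightarrow> f x = 0"
  shows "f \<in> square_integrable lebesgue"
proof -
  obtain B where B: "0 < B" "\<And>x. norm (f x) \<le> B" using compact_support_bounded[OF f] by blast
  have K: "(\<lambda>x. indicator K x *\<^sub>R B) \<in> square_integrable lebesgue"
  proof -
    have "integrable lebesgue (\<lambda>x. indicator K x *\<^sub>R (B * B))"
      using lmeasurable_compact[OF f(2)]
      by (intro integrable_scaleR_left integrable_real_indicator) (auto simp: fmeasurable_def)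
    moreover have "(indicator K x *\<^sub>R B)\<^sup>2 = indicator K x *\<^sub>R (B * B)" for x
      by (simp add: indicator_def power2_eq_square)
    moreover have "(\<lambda>x. indicator K x *\<^sub>R B) \<in> borel_measurable lebesgue"
      using lmeasurable_compact[OF f(2)] by (intro borel_measurable_scaleR borel_measurable_indicator) auto
    ultimately show ?thesis by (simp add: square_integrable_def)
  qed
  show ?thesis
  proof (rule square_integrable_bound[OF K])
    show "f \<in> borel_measurable lebesgue" by (rule continuous_lebesgue_measurable[OF f(1)])
    show "AE x in lebesgue. norm (f x) \<le> norm (indicator K x *\<^sub>R B)"
      using B f(3) by (auto simp: indicator_def)
  qed
qed

lemma compact_support_integrable:
  fixes f :: "'a::euclidean_space \<Rightarrow> 'b::euclidean_space"
  assumes f: "continuous_on UNIV f" "compact K" "\<And>x. x \<notin> K \<Longrightarrow> f x = 0"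
  shows "integrable lebesgue f"
proof -
  obtain B where B: "0 < B" "\<And>x. norm (f x) \<le> B" using compact_support_bounded[OF f] by blast
  have K: "integrable lebesgue (\<lambda>x. indicator K x *\<^sub>R B)"
    using lmeasurable_compact[OF f(2)]
    by (intro integrable_scaleR_left integrable_real_indicator) (auto simp: fmeasurable_def)
  show ?thesis
    by (rule Bochner_Integration.integrable_bound[OF K continuous_lebesgue_measurable[OF f(1)]])
       (use B f(3) in \<open>auto simp: indicator_def\<close>)
qed

lemma test_function_square_integrable:
  assumes "\<phi> \<in> test_functions \<Omega>"
  shows "\<phi> \<in> square_integrable lebesgue" "grad \<phi> \<in> square_integrable lebesgue"
  using compact_support_square_integrable[OF _ test_function_support(1)[OF assms]]
    test_function_continuous[OF assms] test_function_grad_continuous[OF assms]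
    eq_0_outside_support grad_eq_0_outside_support by blast+

lemma test_function_lipschitz:
  assumes "\<phi> \<in> test_functions \<Omega>"
  obtains B where "0 < B" "\<And>x y. \<bar>\<phi> x - \<phi> y\<bar> \<le> B * norm (x - y)"
proof -
  obtain B where B: "0 < B" "\<And>x. norm (grad \<phi> x) \<le> B"
    using compact_support_bounded[OF test_function_grad_continuous[OF assms] test_function_support(1)[OF assms]]
      grad_eq_0_outside_support by blast
  have "norm (\<phi> x - \<phi> y) \<le> B * norm (x - y)" for x y
  proof (rule differentiable_bound[of UNIV \<phi> "\<lambda>x h. grad \<phi> x \<bullet> h"])
    show "onorm (\<lambda>h. grad \<phi> x \<bullet> h) \<le> B" for x
    proof (rule onorm_le)
      show "norm (grad \<phi> x \<bullet> h) \<le> B * norm h" for h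
        using order_trans[OF Cauchy_Schwarz_ineq2 mult_right_mono[OF B(2)]] by simp
    qed
  qed (use test_function_has_derivative[OF assms] in auto)
  then show thesis using B(1) that by auto
qed

lemma test_function_mono: "\<phi> \<in> test_functions \<Omega> \<Longrightarrow> \<Omega> \<subseteq> \<Omega>' \<Longrightarrow> \<phi> \<in> test_functions \<Omega>'"
  by (auto simp: test_functions_def)

lemma test_function_supportI:
  assumes "\<And>k. C_k k \<phi>" "compact K" "K \<subseteq> \<Omega>" "\<And>x. x \<notin> K \<Longrightarrow> \<phi> x = 0"
  shows "\<phi> \<in> test_functions \<Omega>"
proof -
  have "closure {x. \<phi> x \<noteq> 0} \<subseteq> K"
    using assms by (intro closure_minimal) (auto simp: compact_imp_closed)
  then show ?thesis using assms
    unfolding test_functions_def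
    using closed_closure bounded_subset[OF compact_imp_bounded[OF \<open>compact K\<close>]] by (auto simp: compact_eq_bounded_closed)
qed

lemma test_function_lincomb:
  assumes "\<phi> \<in> test_functions \<Omega>" "\<psi> \<in> test_functions \<Omega>"
  shows "(\<lambda>x. a * \<phi> x + b * \<psi> x) \<in> test_functions \<Omega>"
proof (rule test_function_supportI)
  show "C_k k (\<lambda>x. a * \<phi> x + b * \<psi> x)" for k
    by (intro C_k_add C_k_mult C_k_const test_function_C_k[OF assms(1)] test_function_C_k[OF assms(2)])
  show "compact (support \<phi> \<union> support \<psi>)" using assms by (blast intro: test_function_support compact_Un)
  show "support \<phi> \<union> support \<psi> \<subseteq> \<Omega>" using assms test_function_support(2) by blast
qed (simp add: eq_0_outside_support)

lemma grad_lincomb: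
  assumes "\<phi> \<in> test_functions \<Omega>" "\<psi> \<in> test_functions \<Omega>"
  shows "grad (\<lambda>x. a * \<phi> x + b * \<psi> x) x = a *\<^sub>R grad \<phi> x + b *\<^sub>R grad \<psi> x"
  by (rule grad_eqI)
     (auto intro!: derivative_eq_intros test_function_has_derivative assms simp: inner_add_left)

lemma test_function_diff:
  assumes "\<phi> \<in> test_functions \<Omega>" "\<psi> \<in> test_functions \<Omega>"
  shows "(\<lambda>x. \<phi> x - \<psi> x) \<in> test_functions \<Omega>" "grad (\<lambda>x. \<phi> x - \<psi> x) x = grad \<phi> x - grad \<psi> x"
  using test_function_lincomb[OF assms, of 1 "-1"] grad_lincomb[OF assms, of 1 "-1" x] by simp_all

lemma test_function_mult:
  assumes "\<phi> \<in> test_functions \<Omega>" "\<psi> \<in> test_functions \<Omega>"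
  shows "(\<lambda>x. \<phi> x * \<psi> x) \<in> test_functions \<Omega>"
    and "grad (\<lambda>x. \<phi> x * \<psi> x) x = \<phi> x *\<^sub>R grad \<psi> x + \<psi> x *\<^sub>R grad \<phi> x"
proof -
  show "(\<lambda>x. \<phi> x * \<psi> x) \<in> test_functions \<Omega>"
  proof (rule test_function_supportI)
    show "C_k k (\<lambda>x. \<phi> x * \<psi> x)" for k
      by (intro C_k_mult test_function_C_k[OF assms(1)] test_function_C_k[OF assms(2)])
    show "compact (support \<phi>)" "support \<phi> \<subseteq> \<Omega>" by (rule test_function_support[OF assms(1)])+
  qed (simp add: eq_0_outside_support)
  show "grad (\<lambda>x. \<phi> x * \<psi> x) x = \<phi> x *\<^sub>R grad \<psi> x + \<psi> x *\<^sub>R grad \<phi> x"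
    by (rule grad_eqI)
       (auto intro!: derivative_eq_intros test_function_has_derivative assms simp: inner_add_left algebra_simps)
qed

lemma test_function_scale:
  assumes "\<phi> \<in> test_functions ((*\<^sub>R) s ` \<Omega>)" "s \<noteq> 0"
  shows "(\<lambda>x. \<phi> (s *\<^sub>R x)) \<in> test_functions \<Omega>" "grad (\<lambda>x. \<phi> (s *\<^sub>R x)) x = s *\<^sub>R grad \<phi> (s *\<^sub>R x)"
proof -
  show "(\<lambda>x. \<phi> (s *\<^sub>R x)) \<in> test_functions \<Omega>"
  proof (rule test_function_supportI)
    show "C_k k (\<lambda>x. \<phi> (s *\<^sub>R x))" for k by (intro C_k_scale test_function_C_k[OF assms(1)])
    show "compact ((*\<^sub>R) (inverse s) ` support \<phi>)"
      by (intro compact_scaling test_function_support(1)[OF assms(1)])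
    show "(*\<^sub>R) (inverse s) ` support \<phi> \<subseteq> \<Omega>"
      using test_function_support(2)[OF assms(1)] assms(2) by force
    show "\<phi> (s *\<^sub>R x) = 0" if "x \<notin> (*\<^sub>R) (inverse s) ` support \<phi>" for x
    proof (rule eq_0_outside_support)
      show "s *\<^sub>R x \<notin> support \<phi>" using that assms(2) by (force simp: image_iff)
    qed
  qed
  have "((*\<^sub>R) s has_derivative (*\<^sub>R) s) (at x)" by (auto intro!: derivative_eq_intros)
  moreover have "(\<phi> has_derivative (\<lambda>h. grad \<phi> (s *\<^sub>R x) \<bullet> h)) (at (s *\<^sub>R x))"
    by (intro test_function_has_derivative[OF assms(1)])
  ultimately have "((\<lambda>x. \<phi> (s *\<^sub>R x)) has_derivative (\<lambda>h. grad \<phi> (s *\<^sub>R x) \<bullet> (s *\<^sub>R h))) (at x)"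
    by (rule has_derivative_compose)
  then show "grad (\<lambda>x. \<phi> (s *\<^sub>R x)) x = s *\<^sub>R grad \<phi> (s *\<^sub>R x)"
    by (intro grad_eqI) simp
qed

section \<open>Translations, dilations and the estimates obtained by differentiating along
  them\<close>

lemma lebesgue_integral_translation:
  fixes f :: "'a::euclidean_space \<Rightarrow> 'b::euclidean_space"
  assumes f: "continuous_on UNIV f"
  shows "(\<integral>x. f (x + c) \<partial>lebesgue) = (\<integral>x. f x \<partial>lebesgue)"
proof -
  have m[measurable]: "f \<in> borel_measurable borel" using f by (rule borel_measurable_continuous_onI)
  have "(\<integral>x. f (x + c) \<partial>lebesgue) = (\<integral>x. f (c + x) \<partial>lborel)"
    by (subst integral_completion) (auto simp: add.commute)
  also have "\<dots> = (\<integral>x. f x \<partial>distr lborel borel ((+) c))" by (subst integral_distr) auto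
  also have "\<dots> = (\<integral>x. f x \<partial>lebesgue)" by (simp add: lborel_distr_plus integral_completion)
  finally show ?thesis .
qed

lemma lebesgue_integral_scaling:
  fixes f :: "'a::euclidean_space \<Rightarrow> real"
  assumes f: "continuous_on UNIV f" and s: "s > 0"
  shows "(\<integral>x. f x \<partial>lebesgue) = s ^ DIM('a) * (\<integral>x. f (s *\<^sub>R x) \<partial>lebesgue)"
proof -
  have m[measurable]: "f \<in> borel_measurable borel" using f by (rule borel_measurable_continuous_onI)
  have "(\<integral>x. f x \<partial>lebesgue) = (\<integral>x. f x \<partial>lborel)" by (rule integral_completion) simp
  also have "\<dots> = (\<integral>x. f x \<partial>density (distr lborel borel (\<lambda>x. 0 + s *\<^sub>R x)) (\<lambda>_. \<bar>s\<bar>^DIM('a)))"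
    using s by (intro arg_cong[OF lborel_affine, of _ "\<lambda>M. integral\<^sup>L M f"]) simp
  also have "\<dots> = (\<integral>x. s ^ DIM('a) * f (s *\<^sub>R x) \<partial>lborel)"
    using s by (subst integral_density) (auto simp: integral_distr)
  also have "\<dots> = s ^ DIM('a) * (\<integral>x. f (s *\<^sub>R x) \<partial>lebesgue)"
    by (subst integral_completion) auto
  finally show ?thesis .
qed

lemma has_real_derivative_along:
  assumes "\<phi> \<in> test_functions \<Omega>"
  shows "((\<lambda>t. \<phi> (x + t *\<^sub>R e)) has_real_derivative grad \<phi> (x + t *\<^sub>R e) \<bullet> e) (at t)"
proof -
  have "((\<lambda>t. x + t *\<^sub>R e) has_derivative (\<lambda>h. h *\<^sub>R e)) (at t)" by (auto intro!: derivative_eq_intros)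
  from has_derivative_compose[OF this test_function_has_derivative[OF assms]]
  show ?thesis by (simp add: has_field_derivative_def mult.commute[of _ "_ \<bullet> _"])
qed

text \<open>Serves the Poincare inequality, with \<open>g\<close> equal to \<phi>, and the weak form
  of directional derivatives, with \<open>g\<close> a cut-off Lipschitz function.\<close>

lemma integral_shift_has_derivative:
  assumes \<phi>: "\<phi> \<in> test_functions \<Omega>" and g: "continuous_on UNIV g" "compact K" "\<And>x. x \<notin> K \<Longrightarrow> g x = 0"
  shows "((\<lambda>t. \<integral>x. \<phi> (x + t *\<^sub>R e) * g x \<partial>lebesgue) has_real_derivative
      (\<integral>x. (grad \<phi> (x + t *\<^sub>R e) \<bullet> e) * g x \<partial>lebesgue)) (at t)"
proof -
  obtain B where B: "0 < B" "\<And>x y. \<bar>\<phi> x - \<phi> y\<bar> \<le> B * norm (x - y)" using test_function_lipschitz[OF \<phi>] by blast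
  have cont: "continuous_on UNIV (\<lambda>x. \<phi> (x + t *\<^sub>R e))" for t
    using test_function_continuous[OF \<phi>] by (auto intro!: continuous_intros intro: continuous_on_compose2)
  have gi: "g \<in> square_integrable lebesgue" by (rule compact_support_square_integrable[OF g])
  have int: "integrable lebesgue (\<lambda>x. \<phi> (x + t *\<^sub>R e) * g x)" for t
  proof -
    have "(\<lambda>x. \<phi> (x + t *\<^sub>R e)) \<in> square_integrable lebesgue"
    proof (rule compact_support_square_integrable[OF cont])
      show "compact ((\<lambda>x. x - t *\<^sub>R e) ` support \<phi>)"
        using compact_translation[OF test_function_support(1)[OF \<phi>], of "- (t *\<^sub>R e)"] by (simp add: algebra_simps)
      show "\<phi> (x + t *\<^sub>R e) = 0" if "x \<notin> (\<lambda>x. x - t *\<^sub>R e) ` support \<phi>" for x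
        using that eq_0_outside_support[of "x + t *\<^sub>R e" \<phi>] by (force simp: image_iff)
    qed
    from integrable_inner_square_integrable[OF this gi] show ?thesis by simp
  qed
  show ?thesis
  proof (rule has_derivative_integral_dominated[OF int])
    show "integrable lebesgue (\<lambda>x. B * norm e * \<bar>g x\<bar>)"
      using integrable_abs[OF compact_support_integrable[OF g]] by (intro integrable_mult_right)
    show "AE x in lebesgue. \<bar>\<phi> (x + s *\<^sub>R e) * g x - \<phi> (x + t *\<^sub>R e) * g x\<bar> \<le> B * norm e * \<bar>g x\<bar> * \<bar>s - t\<bar>" for s
    proof (rule AE_I2)
      fix x
      have "\<bar>\<phi> (x + s *\<^sub>R e) - \<phi> (x + t *\<^sub>R e)\<bar> \<le> B * (\<bar>s - t\<bar> * norm e)"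
        using B(2)[of "x + s *\<^sub>R e" "x + t *\<^sub>R e"] by (simp flip: scaleR_left_diff_distrib)
      then have "\<bar>\<phi> (x + s *\<^sub>R e) - \<phi> (x + t *\<^sub>R e)\<bar> * \<bar>g x\<bar> \<le> B * (\<bar>s - t\<bar> * norm e) * \<bar>g x\<bar>"
        by (rule mult_right_mono) simp
      then show "\<bar>\<phi> (x + s *\<^sub>R e) * g x - \<phi> (x + t *\<^sub>R e) * g x\<bar> \<le> B * norm e * \<bar>g x\<bar> * \<bar>s - t\<bar>"
        by (simp add: abs_mult[symmetric] left_diff_distrib algebra_simps)
    qed
    show "AE x in lebesgue. ((\<lambda>t. \<phi> (x + t *\<^sub>R e) * g x) has_real_derivative (grad \<phi> (x + t *\<^sub>R e) \<bullet> e) * g x) (at t)"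
      using has_real_derivative_along[OF \<phi>] by (auto intro!: DERIV_cmult_right)
    show "(\<lambda>x. (grad \<phi> (x + t *\<^sub>R e) \<bullet> e) * g x) \<in> borel_measurable lebesgue"
      by (intro continuous_lebesgue_measurable continuous_intros g
          continuous_on_compose2[OF test_function_grad_continuous[OF \<phi>]]) auto
  qed (rule zero_less_one)
qed

lemma grad_square_integrable_inner:
  assumes "\<phi> \<in> test_functions \<Omega>"
  shows "(\<lambda>x. grad \<phi> x \<bullet> e) \<in> square_integrable lebesgue"
  by (rule compact_support_square_integrable[OF _ test_function_support(1)[OF assms]])
     (auto intro!: continuous_intros test_function_grad_continuous[OF assms] simp: grad_eq_0_outside_support)

text \<open>Differentiate \<open>t \<mapsto> \<integral> \<phi> (x + t e) dx\<close>, which is constant.\<close>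
lemma integral_grad_eq_0:
  fixes \<phi> :: "real^'n \<Rightarrow> real"
  assumes \<phi>: "\<phi> \<in> test_functions \<Omega>"
  shows "(\<integral>x. grad \<phi> x \<bullet> e \<partial>lebesgue) = 0"
proof -
  obtain r where r: "support \<phi> \<subseteq> ball 0 r"
    using bounded_subset_ballD[OF compact_imp_bounded[OF test_function_support(1)[OF \<phi>]]] by blast
  obtain B where B: "0 < B" "\<And>x y. \<bar>\<phi> x - \<phi> y\<bar> \<le> B * norm (x - y)" using test_function_lipschitz[OF \<phi>] by blast
  \<comment> \<open>Contains the supports of all translates with |t| <= 1, so that one integrable
    function dominates them.\<close>
  let ?K = "cball (0::real^'n) (r + norm e)"
  have zero: "\<phi> (x + t *\<^sub>R e) = 0" if "x \<notin> ?K" "\<bar>t\<bar> \<le> 1" for x t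
  proof (rule eq_0_outside_support)
    have "norm x \<le> norm (x + t *\<^sub>R e) + norm (t *\<^sub>R e)"
      using norm_triangle_ineq4[of "x + t *\<^sub>R e" "t *\<^sub>R e"] by simp
    moreover have "norm (t *\<^sub>R e) \<le> norm e" using that(2) by (simp add: mult_left_le_one_le)
    ultimately have "r < norm (x + t *\<^sub>R e)" using that(1) by simp
    then show "x + t *\<^sub>R e \<notin> support \<phi>" using r by auto
  qed
  have "((\<lambda>t. \<integral>x. \<phi> (x + t *\<^sub>R e) \<partial>lebesgue) has_real_derivative (\<integral>x. grad \<phi> (x + 0 *\<^sub>R e) \<bullet> e \<partial>lebesgue)) (at 0)"
  proof (rule has_derivative_integral_dominated[of 0 1])
    show "integrable lebesgue (\<lambda>x. \<phi> (x + t *\<^sub>R e))" if "\<bar>t - 0\<bar> < 1" for t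
      by (rule compact_support_integrable[of _ ?K])
         (use that zero[of _ t] test_function_continuous[OF \<phi>] in
            \<open>auto intro!: continuous_intros intro: continuous_on_compose2\<close>)
    show "integrable lebesgue (\<lambda>x. indicator ?K x *\<^sub>R (B * norm e))"
      using lmeasurable_cball[of "0::real^'n" "r + norm e"]
      by (intro integrable_scaleR_left integrable_real_indicator) (auto simp: fmeasurable_def)
    show "AE x in lebesgue. \<bar>\<phi> (x + t *\<^sub>R e) - \<phi> (x + 0 *\<^sub>R e)\<bar> \<le> indicator ?K x *\<^sub>R (B * norm e) * \<bar>t - 0\<bar>"
      if "\<bar>t - 0\<bar> < 1" for t
    proof (rule AE_I2)
      fix x
      show "\<bar>\<phi> (x + t *\<^sub>R e) - \<phi> (x + 0 *\<^sub>R e)\<bar> \<le> indicator ?K x *\<^sub>R (B * norm e) * \<bar>t - 0\<bar>"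
        using B(2)[of "x + t *\<^sub>R e" x] zero[of x t] zero[of x 0] that
        by (cases "x \<in> ?K") (auto simp: mult.assoc mult.commute[of "norm e"])
    qed
    show "AE x in lebesgue. ((\<lambda>t. \<phi> (x + t *\<^sub>R e)) has_real_derivative grad \<phi> (x + 0 *\<^sub>R e) \<bullet> e) (at 0)"
      using has_real_derivative_along[OF \<phi>, of _ e 0] by simp
    show "(\<lambda>x. grad \<phi> (x + 0 *\<^sub>R e) \<bullet> e) \<in> borel_measurable lebesgue"
      using grad_square_integrable_inner[OF \<phi>] by (simp add: square_integrable_def)
  qed simp
  moreover have "(\<integral>x. \<phi> (x + t *\<^sub>R e) \<partial>lebesgue) = (\<integral>x. \<phi> x \<partial>lebesgue)" for t
    by (rule lebesgue_integral_translation[OF test_function_continuous[OF \<phi>]])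
  ultimately have "((\<lambda>t::real. \<integral>x. \<phi> x \<partial>lebesgue) has_real_derivative (\<integral>x. grad \<phi> x \<bullet> e \<partial>lebesgue)) (at 0)"
    by simp
  then show ?thesis using DERIV_unique[OF _ DERIV_const] by blast
qed

text \<open>The gradient of the product of two test functions has integral zero.\<close>

lemma integration_by_parts:
  assumes "\<phi> \<in> test_functions \<Omega>" "\<psi> \<in> test_functions \<Omega>"
  shows "(\<integral>x. \<phi> x *\<^sub>R grad \<psi> x \<partial>lebesgue) = - (\<integral>x. \<psi> x *\<^sub>R grad \<phi> x \<partial>lebesgue)"
proof -
  have i: "integrable lebesgue (\<lambda>x. \<phi> x *\<^sub>R grad \<psi> x)" "integrable lebesgue (\<lambda>x. \<psi> x *\<^sub>R grad \<phi> x)"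
    using assms by (auto intro!: integrable_scaleR_square_integrable test_function_square_integrable)
  have "(\<integral>x. \<phi> x *\<^sub>R grad \<psi> x + \<psi> x *\<^sub>R grad \<phi> x \<partial>lebesgue) \<bullet> e = 0" for e
  proof -
    have "(\<integral>x. (\<phi> x *\<^sub>R grad \<psi> x + \<psi> x *\<^sub>R grad \<phi> x) \<bullet> e \<partial>lebesgue) = 0"
      using integral_grad_eq_0[OF test_function_mult(1)[OF assms], of e] by (simp add: test_function_mult(2)[OF assms])
    then show ?thesis using i by (subst integral_inner_left[symmetric]) auto
  qed
  then have "(\<integral>x. \<phi> x *\<^sub>R grad \<psi> x + \<psi> x *\<^sub>R grad \<phi> x \<partial>lebesgue) = 0"
    by (rule inner_eq_zero_iff[THEN iffD1])
  then show ?thesis using i by (simp add: add_eq_0_iff)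
qed

lemma l2norm_translation:
  fixes f :: "'a::euclidean_space \<Rightarrow> 'b::euclidean_space"
  assumes "continuous_on UNIV f"
  shows "l2norm lebesgue (\<lambda>x. f (x + c)) = l2norm lebesgue f"
  unfolding l2norm_def
  by (rule arg_cong[where f=sqrt], rule lebesgue_integral_translation)
     (intro continuous_on_power continuous_on_norm assms)

lemma l2norm_scaling:
  fixes f :: "'a::euclidean_space \<Rightarrow> 'b::euclidean_space"
  assumes "continuous_on UNIV f" "s > 0"
  shows "(l2norm lebesgue f)\<^sup>2 = s ^ DIM('a) * (l2norm lebesgue (\<lambda>x. f (s *\<^sub>R x)))\<^sup>2"
  unfolding l2norm_square
  by (rule lebesgue_integral_scaling) (intro continuous_on_power continuous_on_norm assms)+

lemma DERIV_bounded_imp_diff_bound: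
  fixes h :: "real \<Rightarrow> real"
  assumes "a \<le> b" and d: "\<And>t. a \<le> t \<Longrightarrow> t \<le> b \<Longrightarrow> (h has_real_derivative h' t) (at t)"
    and c: "\<And>t. a \<le> t \<Longrightarrow> t \<le> b \<Longrightarrow> \<bar>h' t\<bar> \<le> C"
  shows "\<bar>h b - h a\<bar> \<le> C * (b - a)"
proof (cases "a = b")
  case False
  with assms obtain z where "a < z" "z < b" "h b - h a = (b - a) * h' z"
    using MVT2[of a b h h'] by auto
  then show ?thesis using c[of z] by (simp add: abs_mult mult.commute mult_left_mono)
qed simp

text \<open>Differentiating \<open>t \<mapsto> \<integral> \<phi> (x + t e) \<phi> x dx\<close>, which vanishes at \<open>t = 2 r\<close>.\<close>
lemma Poincare_inequality:
  fixes \<phi> :: "real^'n \<Rightarrow> real"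
  assumes \<phi>: "\<phi> \<in> test_functions \<Omega>" and \<Omega>: "\<Omega> \<subseteq> ball 0 r" and r: "0 < r"
  shows "l2norm lebesgue \<phi> \<le> 2 * r * l2norm lebesgue (grad \<phi>)"
proof -
  obtain e :: "real^'n" where e: "norm e = 1" using vector_choose_size[of 1] by auto
  define h where "h t = (\<integral>x. \<phi> (x + t *\<^sub>R e) * \<phi> x \<partial>lebesgue)" for t
  have h': "(h has_real_derivative (\<integral>x. (grad \<phi> (x + t *\<^sub>R e) \<bullet> e) * \<phi> x \<partial>lebesgue)) (at t)" for t
    unfolding h_def
    by (rule integral_shift_has_derivative[OF \<phi> test_function_continuous[OF \<phi>] test_function_support(1)[OF \<phi>]])
       (rule eq_0_outside_support)
  have b: "\<bar>\<integral>x. (grad \<phi> (x + t *\<^sub>R e) \<bullet> e) * \<phi> x \<partial>lebesgue\<bar> \<le> l2norm lebesgue (grad \<phi>) * l2norm lebesgue \<phi>" for t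
  proof -
    have c: "continuous_on UNIV (\<lambda>x. grad \<phi> x \<bullet> e)"
      by (intro continuous_intros test_function_grad_continuous[OF \<phi>])
    have s: "(\<lambda>x. grad \<phi> (x + t *\<^sub>R e) \<bullet> e) \<in> square_integrable lebesgue"
    proof (rule compact_support_square_integrable)
      show "continuous_on UNIV (\<lambda>x. grad \<phi> (x + t *\<^sub>R e) \<bullet> e)"
        by (intro continuous_on_compose2[OF c] continuous_intros) auto
      show "compact ((\<lambda>x. x - t *\<^sub>R e) ` support \<phi>)"
        using compact_translation[OF test_function_support(1)[OF \<phi>], of "- (t *\<^sub>R e)"] by (simp add: algebra_simps)
      show "grad \<phi> (x + t *\<^sub>R e) \<bullet> e = 0" if "x \<notin> (\<lambda>x. x - t *\<^sub>R e) ` support \<phi>" for x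
      proof -
        have "x + t *\<^sub>R e \<notin> support \<phi>" using that by (force simp: image_iff)
        then show ?thesis by (simp add: grad_eq_0_outside_support)
      qed
    qed
    have "\<bar>\<integral>x. (grad \<phi> (x + t *\<^sub>R e) \<bullet> e) * \<phi> x \<partial>lebesgue\<bar>
        \<le> l2norm lebesgue (\<lambda>x. grad \<phi> (x + t *\<^sub>R e) \<bullet> e) * l2norm lebesgue \<phi>"
      using l2_Cauchy_Schwarz[OF s test_function_square_integrable(1)[OF \<phi>]] by simp
    also have "l2norm lebesgue (\<lambda>x. grad \<phi> (x + t *\<^sub>R e) \<bullet> e) = l2norm lebesgue (\<lambda>x. grad \<phi> x \<bullet> e)"
      by (rule l2norm_translation[OF c])
    also have "\<dots> \<le> l2norm lebesgue (grad \<phi>)"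
      unfolding l2norm_def
    proof (intro real_sqrt_le_mono integral_mono)
      show "(norm (grad \<phi> x \<bullet> e))\<^sup>2 \<le> (norm (grad \<phi> x))\<^sup>2" for x
        using Cauchy_Schwarz_ineq2[of "grad \<phi> x" e] e by (intro power_mono) auto
    qed (use grad_square_integrable_inner[OF \<phi>] test_function_square_integrable(2)[OF \<phi>] in \<open>auto simp: square_integrable_def\<close>)
    finally show ?thesis by (simp add: mult_right_mono l2norm_nonneg)
  qed
  have "\<bar>h (2 * r) - h 0\<bar> \<le> l2norm lebesgue (grad \<phi>) * l2norm lebesgue \<phi> * (2 * r - 0)"
    by (rule DERIV_bounded_imp_diff_bound[OF _ h' b]) (use r in simp)
  moreover have "h (2 * r) = 0"
  proof -
    have "\<phi> (x + (2 * r) *\<^sub>R e) * \<phi> x = 0" for x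
    proof (cases "x \<in> support \<phi>")
      case True
      then have "norm x < r" using test_function_support(2)[OF \<phi>] \<Omega> by auto
      moreover have "norm ((2 * r) *\<^sub>R e) \<le> norm (x + (2 * r) *\<^sub>R e) + norm x"
        using norm_triangle_ineq4[of "x + (2 * r) *\<^sub>R e" x] by simp
      ultimately have "x + (2 * r) *\<^sub>R e \<notin> ball 0 r" using e r by simp
      then have "x + (2 * r) *\<^sub>R e \<notin> support \<phi>" using test_function_support(2)[OF \<phi>] \<Omega> by blast
      then show ?thesis by (simp add: eq_0_outside_support)
    qed (simp add: eq_0_outside_support)
    then show ?thesis unfolding h_def by (simp only: Bochner_Integration.integral_zero)
  qed
  moreover have "h 0 = (l2norm lebesgue \<phi>)\<^sup>2" unfolding l2norm_square by (simp add: h_def power2_eq_square)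
  ultimately have "l2norm lebesgue \<phi> * l2norm lebesgue \<phi> \<le> (2 * r * l2norm lebesgue (grad \<phi>)) * l2norm lebesgue \<phi>"
    using r by (simp add: power2_eq_square algebra_simps)
  then show ?thesis using l2norm_nonneg[of lebesgue \<phi>] r l2norm_nonneg[of lebesgue "grad \<phi>"]
    by (cases "l2norm lebesgue \<phi> = 0") (auto simp: mult_le_cancel_right)
qed

text \<open>Differentiating \<open>s \<mapsto> \<integral> F x \<phi> (s x) dx\<close>.\<close>
lemma integral_dilation_diff_bound:
  fixes \<phi> :: "real^'n \<Rightarrow> real"
  assumes \<phi>: "\<phi> \<in> test_functions \<Omega>" and \<Omega>: "\<Omega> \<subseteq> ball 0 r" and r: "0 < r"
    and F: "F \<in> square_integrable lebesgue" and s: "1 \<le> s"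
  shows "\<bar>(\<integral>x. F x * \<phi> (s *\<^sub>R x) \<partial>lebesgue) - (\<integral>x. F x * \<phi> x \<partial>lebesgue)\<bar>
    \<le> r * l2norm lebesgue F * l2norm lebesgue (grad \<phi>) * (s - 1)"
proof -
  define h where "h t = (\<integral>x. F x * \<phi> (t *\<^sub>R x) \<partial>lebesgue)" for t
  define h' where "h' t = (\<integral>x. F x * (grad \<phi> (t *\<^sub>R x) \<bullet> x) \<partial>lebesgue)" for t
  obtain B where B: "0 < B" "\<And>x y. \<bar>\<phi> x - \<phi> y\<bar> \<le> B * norm (x - y)" using test_function_lipschitz[OF \<phi>] by blast
  \<comment> \<open>The derivative at t >= 1 is two-sided, so dilation factors down to 1/2 occur;
    these enlarge the support at most twofold.\<close>
  have supp: "x \<in> cball 0 (2 * r)" if "1 / 2 \<le> t" "t *\<^sub>R x \<in> support \<phi>" for t x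
  proof -
    have "norm (t *\<^sub>R x) < r" using that test_function_support(2)[OF \<phi>] \<Omega> by auto
    moreover have "1 / 2 * norm x \<le> t * norm x" using that(1) by (intro mult_right_mono) auto
    then have "1 / 2 * norm x \<le> norm (t *\<^sub>R x)" using that(1) by simp
    ultimately show ?thesis by simp
  qed
  have c1: "continuous_on UNIV (\<lambda>x. \<phi> (t *\<^sub>R x))" for t
    by (intro continuous_on_compose2[OF test_function_continuous[OF \<phi>]] continuous_intros) auto
  have c2: "continuous_on UNIV (\<lambda>x. grad \<phi> (t *\<^sub>R x))" for t
    by (intro continuous_on_compose2[OF test_function_grad_continuous[OF \<phi>]] continuous_intros) auto
  have s1: "(\<lambda>x. \<phi> (t *\<^sub>R x)) \<in> square_integrable lebesgue" if "1 / 2 \<le> t" for t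
  proof (rule compact_support_square_integrable[OF c1])
    show "\<phi> (t *\<^sub>R x) = 0" if "x \<notin> cball 0 (2 * r)" for x
      using supp[OF \<open>1 / 2 \<le> t\<close>, of x] that by (intro eq_0_outside_support) blast
  qed simp
  have z2: "grad \<phi> (t *\<^sub>R x) = 0" if "x \<notin> cball 0 (2 * r)" "1 / 2 \<le> t" for x t
    using supp[of t x] that by (intro grad_eq_0_outside_support) blast
  have s2: "(\<lambda>x. grad \<phi> (t *\<^sub>R x) \<bullet> x) \<in> square_integrable lebesgue" if "1 / 2 \<le> t" for t
    by (rule compact_support_square_integrable[of _ "cball 0 (2 * r)"])
       (use that z2 in \<open>auto intro!: continuous_intros c2 simp del: mem_cball\<close>)
  have der: "(h has_real_derivative h' t) (at t)" if t: "1 \<le> t" for t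
    unfolding h_def h'_def
  proof (rule has_derivative_integral_dominated[of t "1/2"])
    show "integrable lebesgue (\<lambda>x. F x * \<phi> (u *\<^sub>R x))" if "\<bar>u - t\<bar> < 1 / 2" for u
    proof -
      have "1 / 2 \<le> u" using that t by linarith
      then show ?thesis using integrable_inner_square_integrable[OF F s1[of u]] by simp
    qed
    have "(\<lambda>x :: real^'n. indicator (cball 0 (2 * r)) x *\<^sub>R (B * (2 * r))) \<in> square_integrable lebesgue"
    proof -
      have "(\<lambda>x :: real^'n. indicator (cball 0 (2 * r)) x *\<^sub>R (B * (2 * r))) \<in> borel_measurable lebesgue"
        by (intro borel_measurable_scaleR borel_measurable_indicator) auto
      moreover have "integrable lebesgue (\<lambda>x. indicator (cball (0::real^'n) (2 * r)) x *\<^sub>R (B * (2 * r))\<^sup>2)"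
        using lmeasurable_cball[of "0::real^'n" "2 * r"]
        by (intro integrable_scaleR_left integrable_real_indicator) (auto simp: fmeasurable_def)
      moreover have "(norm (indicator (cball 0 (2 * r)) x *\<^sub>R (B * (2 * r))))\<^sup>2
          = indicator (cball 0 (2 * r)) x *\<^sub>R (B * (2 * r))\<^sup>2" for x :: "real^'n"
        by (auto simp: indicator_def)
      ultimately show ?thesis unfolding square_integrable_def mem_Collect_eq by presburger
    qed
    from integrable_abs[OF integrable_inner_square_integrable[OF F this]]
    show "integrable lebesgue (\<lambda>x. \<bar>F x \<bullet> (indicator (cball 0 (2 * r)) x *\<^sub>R (B * (2 * r)))\<bar>)" .
    show "AE x in lebesgue. \<bar>F x * \<phi> (u *\<^sub>R x) - F x * \<phi> (t *\<^sub>R x)\<bar>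
        \<le> \<bar>F x \<bullet> (indicator (cball 0 (2 * r)) x *\<^sub>R (B * (2 * r)))\<bar> * \<bar>u - t\<bar>" if u: "\<bar>u - t\<bar> < 1 / 2" for u
    proof (rule AE_I2)
      fix x
      show "\<bar>F x * \<phi> (u *\<^sub>R x) - F x * \<phi> (t *\<^sub>R x)\<bar>
        \<le> \<bar>F x \<bullet> (indicator (cball 0 (2 * r)) x *\<^sub>R (B * (2 * r)))\<bar> * \<bar>u - t\<bar>"
      proof (cases "x \<in> cball 0 (2 * r)")
        case True
        have "\<bar>\<phi> (u *\<^sub>R x) - \<phi> (t *\<^sub>R x)\<bar> \<le> B * (\<bar>u - t\<bar> * norm x)"
          using B(2)[of "u *\<^sub>R x" "t *\<^sub>R x"] by (simp flip: scaleR_left_diff_distrib)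
        also have "\<dots> \<le> B * (\<bar>u - t\<bar> * (2 * r))"
          using True B(1) by (intro mult_left_mono) auto
        finally have "\<bar>F x\<bar> * \<bar>\<phi> (u *\<^sub>R x) - \<phi> (t *\<^sub>R x)\<bar> \<le> \<bar>F x\<bar> * (B * (\<bar>u - t\<bar> * (2 * r)))"
          by (intro mult_left_mono) auto
        moreover have "\<bar>F x * \<phi> (u *\<^sub>R x) - F x * \<phi> (t *\<^sub>R x)\<bar> = \<bar>F x\<bar> * \<bar>\<phi> (u *\<^sub>R x) - \<phi> (t *\<^sub>R x)\<bar>"
          unfolding right_diff_distrib[symmetric] abs_mult ..
        moreover have "\<bar>F x \<bullet> (indicator (cball 0 (2 * r)) x *\<^sub>R (B * (2 * r)))\<bar> * \<bar>u - t\<bar>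
            = \<bar>F x\<bar> * (B * (\<bar>u - t\<bar> * (2 * r)))"
          using True B(1) r by (simp add: abs_mult)
        ultimately show ?thesis by presburger
      next
        case False
        have "\<phi> (u *\<^sub>R x) = 0" "\<phi> (t *\<^sub>R x) = 0"
        proof -
          have "1 / 2 \<le> u" "1 / 2 \<le> t" using u t by linarith+
          then show "\<phi> (u *\<^sub>R x) = 0" "\<phi> (t *\<^sub>R x) = 0"
            using supp[of u x] supp[of t x] False by (blast intro: eq_0_outside_support)+
        qed
        then show ?thesis by simp
      qed
    qed
    show "AE x in lebesgue. ((\<lambda>t. F x * \<phi> (t *\<^sub>R x)) has_real_derivative F x * (grad \<phi> (t *\<^sub>R x) \<bullet> x)) (at t)"
      using has_real_derivative_along[OF \<phi>, of 0] by (auto intro!: DERIV_cmult)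
    show "(\<lambda>x. F x * (grad \<phi> (t *\<^sub>R x) \<bullet> x)) \<in> borel_measurable lebesgue"
      using F s2[of t] t by (intro borel_measurable_times) (auto simp: square_integrable_def)
  qed simp
  have bnd: "\<bar>h' t\<bar> \<le> r * l2norm lebesgue F * l2norm lebesgue (grad \<phi>)" if t: "1 \<le> t" for t
  proof -
    have "\<bar>h' t\<bar> \<le> l2norm lebesgue F * l2norm lebesgue (\<lambda>x. grad \<phi> (t *\<^sub>R x) \<bullet> x)"
      using l2_Cauchy_Schwarz[OF F s2[of t]] t by (simp add: h'_def)
    note h'b = this
    have "l2norm lebesgue (\<lambda>x. grad \<phi> (t *\<^sub>R x) \<bullet> x) \<le> l2norm lebesgue (\<lambda>x. r *\<^sub>R grad \<phi> (t *\<^sub>R x))"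
      unfolding l2norm_def
    proof (intro real_sqrt_le_mono integral_mono)
      have sg: "(\<lambda>x. r *\<^sub>R grad \<phi> (t *\<^sub>R x)) \<in> square_integrable lebesgue"
        by (rule compact_support_square_integrable[of _ "cball 0 (2 * r)"])
           (use z2[of _ t] t in \<open>auto intro!: continuous_intros c2 simp del: mem_cball\<close>)
      then show "integrable lebesgue (\<lambda>x. (norm (r *\<^sub>R grad \<phi> (t *\<^sub>R x)))\<^sup>2)" by (rule square_integrable_norm)
      show "integrable lebesgue (\<lambda>x. (norm (grad \<phi> (t *\<^sub>R x) \<bullet> x))\<^sup>2)"
        using s2[of t] t by (intro square_integrable_norm) simp
      show "(norm (grad \<phi> (t *\<^sub>R x) \<bullet> x))\<^sup>2 \<le> (norm (r *\<^sub>R grad \<phi> (t *\<^sub>R x)))\<^sup>2" for x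
      proof (cases "t *\<^sub>R x \<in> support \<phi>")
        case True
        then have "norm (t *\<^sub>R x) < r" using test_function_support(2)[OF \<phi>] \<Omega> by auto
        moreover have "1 * norm x \<le> t * norm x" using t by (intro mult_right_mono) auto
        then have "1 * norm x \<le> norm (t *\<^sub>R x)" using t by simp
        ultimately have "norm x \<le> r" by simp
        then have "norm (grad \<phi> (t *\<^sub>R x)) * norm x \<le> norm (grad \<phi> (t *\<^sub>R x)) * r"
          by (intro mult_left_mono) auto
        then show ?thesis
          using Cauchy_Schwarz_ineq2[of "grad \<phi> (t *\<^sub>R x)" x] r
          by (intro power_mono) (auto simp: mult.commute)
      qed (simp add: grad_eq_0_outside_support)
    qed
    also have "\<dots> = r * l2norm lebesgue (\<lambda>x. grad \<phi> (t *\<^sub>R x))" using r by (simp add: l2norm_scaleR)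
    also have "\<dots> \<le> r * l2norm lebesgue (grad \<phi>)"
    proof (intro mult_left_mono)
      have "(l2norm lebesgue (\<lambda>x. grad \<phi> (t *\<^sub>R x)))\<^sup>2 * 1 \<le> (l2norm lebesgue (\<lambda>x. grad \<phi> (t *\<^sub>R x)))\<^sup>2 * t ^ DIM(real^'n)"
        using t by (intro mult_left_mono one_le_power) auto
      also have "\<dots> = (l2norm lebesgue (grad \<phi>))\<^sup>2"
        using l2norm_scaling[OF test_function_grad_continuous[OF \<phi>], of t] t by (simp add: mult.commute)
      finally have "(l2norm lebesgue (\<lambda>x. grad \<phi> (t *\<^sub>R x)))\<^sup>2 \<le> (l2norm lebesgue (grad \<phi>))\<^sup>2" by simp
      then show "l2norm lebesgue (\<lambda>x. grad \<phi> (t *\<^sub>R x)) \<le> l2norm lebesgue (grad \<phi>)"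
        by (rule power2_le_imp_le[OF _ l2norm_nonneg])
    qed (use r in simp)
    finally have "l2norm lebesgue (\<lambda>x. grad \<phi> (t *\<^sub>R x) \<bullet> x) \<le> r * l2norm lebesgue (grad \<phi>)" .
    then have "l2norm lebesgue F * l2norm lebesgue (\<lambda>x. grad \<phi> (t *\<^sub>R x) \<bullet> x)
        \<le> l2norm lebesgue F * (r * l2norm lebesgue (grad \<phi>))"
      by (rule mult_left_mono) (rule l2norm_nonneg)
    with h'b show ?thesis by (simp add: mult.assoc mult.left_commute)
  qed
  have "\<bar>h s - h 1\<bar> \<le> r * l2norm lebesgue F * l2norm lebesgue (grad \<phi>) * (s - 1)"
    by (rule DERIV_bounded_imp_diff_bound[OF s]) (use der bnd in auto)
  then show ?thesis by (simp add: h_def)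
qed

lemma l2norm_cong: "(\<And>x. norm (u x) = norm (v x)) \<Longrightarrow> l2norm M u = l2norm M v"
  by (simp add: l2norm_def)

text \<open>The squared Dirichlet norm is multiplied by s^(2 - n) under the dilation, and this is at
  most 1 for s >= 1 because n >= 2.\<close>

lemma l2norm_grad_scale:
  fixes \<phi> :: "real^'n \<Rightarrow> real"
  assumes \<phi>: "\<phi> \<in> test_functions ((*\<^sub>R) s ` \<Omega>)" and s: "1 \<le> s" and n: "2 \<le> CARD('n)"
  shows "l2norm lebesgue (grad (\<lambda>x. \<phi> (s *\<^sub>R x))) \<le> l2norm lebesgue (grad \<phi>)"
proof (rule power2_le_imp_le)
  have "(l2norm lebesgue (grad (\<lambda>x. \<phi> (s *\<^sub>R x))))\<^sup>2 = s\<^sup>2 * (l2norm lebesgue (\<lambda>x. grad \<phi> (s *\<^sub>R x)))\<^sup>2"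
  proof -
    have "l2norm lebesgue (grad (\<lambda>x. \<phi> (s *\<^sub>R x))) = l2norm lebesgue (\<lambda>x. s *\<^sub>R grad \<phi> (s *\<^sub>R x))"
      using s by (intro l2norm_cong) (simp add: test_function_scale(2)[OF \<phi>])
    then show ?thesis by (simp add: l2norm_scaleR power_mult_distrib)
  qed
  also have "\<dots> \<le> s ^ CARD('n) * (l2norm lebesgue (\<lambda>x. grad \<phi> (s *\<^sub>R x)))\<^sup>2"
    using s n by (intro mult_right_mono power_increasing) auto
  also have "\<dots> = (l2norm lebesgue (grad \<phi>))\<^sup>2"
    using l2norm_scaling[OF test_function_grad_continuous[OF \<phi>], of s] s by simp
  finally show "(l2norm lebesgue (grad (\<lambda>x. \<phi> (s *\<^sub>R x))))\<^sup>2 \<le> (l2norm lebesgue (grad \<phi>))\<^sup>2" .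
qed (rule l2norm_nonneg)

section \<open>Weak solutions of the Dirichlet problem\<close>

lemma LIMSEQ_0_le:
  fixes f h :: "nat \<Rightarrow> real"
  assumes "h \<longlonglongrightarrow> 0" "\<And>k. 0 \<le> f k" "\<And>k. f k \<le> h k"
  shows "f \<longlonglongrightarrow> 0"
  by (rule tendsto_sandwich[OF _ _ tendsto_const assms(1)]) (use assms in auto)

text \<open>Places functions on different domains in the single space of square integrable functions
  over \<open>lebesgue\<close>.\<close>

definition zero_ext :: "'a set \<Rightarrow> ('a \<Rightarrow> 'b::real_vector) \<Rightarrow> 'a \<Rightarrow> 'b" where
  "zero_ext \<Omega> u x = indicator \<Omega> x *\<^sub>R u x"

lemma L2_iff_zero_ext:
  fixes u :: "real^'n \<Rightarrow> 'b::euclidean_space"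
  assumes "\<Omega> \<in> sets lebesgue"
  shows "u \<in> L2 \<Omega> \<longleftrightarrow> zero_ext \<Omega> u \<in> square_integrable lebesgue"
proof -
  have "(norm (zero_ext \<Omega> u x))\<^sup>2 = indicator \<Omega> x *\<^sub>R (norm (u x))\<^sup>2" for x
    by (simp add: zero_ext_def indicator_def)
  moreover have "(\<lambda>x. indicator \<Omega> x *\<^sub>R u x) = zero_ext \<Omega> u" by (simp add: fun_eq_iff zero_ext_def)
  ultimately show ?thesis using assms
    by (simp add: L2_def square_integrable_def integrable_restrict_space borel_measurable_restrict_space_iff)
qed

lemma lebesgue_on_integral_eq:
  fixes f :: "real^'n \<Rightarrow> 'b::euclidean_space"
  assumes "\<Omega> \<in> sets lebesgue"
  shows "(\<integral>x. f x \<partial>lebesgue_on \<Omega>) = (\<integral>x. zero_ext \<Omega> f x \<partial>lebesgue)"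
  using assms by (simp add: integral_restrict_space zero_ext_def)

lemma zero_ext_square_integrable:
  assumes "u \<in> square_integrable lebesgue" "\<Omega> \<in> sets lebesgue"
  shows "zero_ext \<Omega> u \<in> square_integrable lebesgue"
proof (rule square_integrable_bound[OF assms(1)])
  show "zero_ext \<Omega> u \<in> borel_measurable lebesgue"
    using assms unfolding zero_ext_def[abs_def]
    by (intro borel_measurable_scaleR borel_measurable_indicator) (auto simp: square_integrable_def)
qed (auto simp: zero_ext_def indicator_def)

lemma l2norm_zero_ext_le:
  assumes "u \<in> square_integrable lebesgue" "\<Omega> \<in> sets lebesgue"
  shows "l2norm lebesgue (zero_ext \<Omega> u) \<le> l2norm lebesgue u"
  unfolding l2norm_def
  by (intro real_sqrt_le_mono integral_mono square_integrable_norm zero_ext_square_integrable assms)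
     (auto simp: zero_ext_def indicator_def)

lemma zero_ext_test_function:
  assumes "\<phi> \<in> test_functions \<Omega>"
  shows "zero_ext \<Omega> \<phi> = \<phi>" "zero_ext \<Omega> (grad \<phi>) = grad \<phi>"
  using test_function_support(2)[OF assms] eq_0_outside_support[of _ \<phi>] grad_eq_0_outside_support[of _ \<phi>]
  by (force simp: zero_ext_def fun_eq_iff indicator_def)+

section \<open>Weak gradients in terms of zero extensions\<close>

lemma has_weak_gradient_iff:
  fixes u :: "real^'n \<Rightarrow> real"
  assumes \<Omega>: "\<Omega> \<in> sets lebesgue"
  shows "has_weak_gradient \<Omega> u g \<longleftrightarrow>
    zero_ext \<Omega> u \<in> square_integrable lebesgue \<and> zero_ext \<Omega> g \<in> square_integrable lebesgue \<and>
    (\<forall>\<phi>\<in>test_functions \<Omega>. (\<integral>x. zero_ext \<Omega> u x *\<^sub>R grad \<phi> x \<partial>lebesgue) = - (\<integral>x. \<phi> x *\<^sub>R zero_ext \<Omega> g x \<partial>lebesgue))"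
proof -
  have "zero_ext \<Omega> (\<lambda>x. u x *\<^sub>R grad \<phi> x) = (\<lambda>x. zero_ext \<Omega> u x *\<^sub>R grad \<phi> x)"
    "zero_ext \<Omega> (\<lambda>x. \<phi> x *\<^sub>R g x) = (\<lambda>x. \<phi> x *\<^sub>R zero_ext \<Omega> g x)" for \<phi>
    by (auto simp: zero_ext_def fun_eq_iff)
  then show ?thesis
    using \<Omega> by (simp add: has_weak_gradient_def L2_iff_zero_ext lebesgue_on_integral_eq)
qed

lemma square_integrable_nth:
  fixes g :: "'a \<Rightarrow> real^'n"
  assumes "g \<in> square_integrable M"
  shows "(\<lambda>x. g x $ i) \<in> square_integrable M"
proof (rule square_integrable_bound[OF assms])
  have [measurable]: "g \<in> borel_measurable M" using assms by (rule square_integrable_measurable)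
  show "(\<lambda>x. g x $ i) \<in> borel_measurable M"
    using borel_measurable_inner[OF \<open>g \<in> borel_measurable M\<close> borel_measurable_const, of "axis i 1"]
    by (simp add: inner_axis)
qed (simp add: component_le_norm_cart)

lemma box_indicator_square_integrable:
  "(\<lambda>x. indicator (cbox a b) x :: real) \<in> square_integrable lebesgue"
proof -
  have "(norm (indicator (cbox a b) x :: real))\<^sup>2 = indicator (cbox a b) x" for x
    by (simp add: indicator_def)
  moreover have "integrable lebesgue (indicat_real (cbox a b))"
    using lmeasurable_cbox[of a b] by (intro integrable_real_indicator) (auto simp: fmeasurable_def)
  ultimately show ?thesis by (simp add: square_integrable_def)
qed

text \<open>Two weak gradients have equal integrals against every test function, so the fundamental
  lemma applies to each component of their difference. As \<open>weak_grad\<close> is an arbitrary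
  choice, this identifies it with any weak gradient at hand.\<close>

lemma weak_gradient_unique:
  fixes u :: "real^'n \<Rightarrow> real"
  assumes \<Omega>: "open \<Omega>" and g: "has_weak_gradient \<Omega> u g" and k: "has_weak_gradient \<Omega> u k"
  shows "AE x in lebesgue. zero_ext \<Omega> g x = zero_ext \<Omega> k x"
proof -
  have m: "\<Omega> \<in> sets lebesgue" using \<Omega> by auto
  let ?d = "\<lambda>x. zero_ext \<Omega> g x - zero_ext \<Omega> k x"
  have gk: "zero_ext \<Omega> g \<in> square_integrable lebesgue" "zero_ext \<Omega> k \<in> square_integrable lebesgue"
    using g k by (auto simp: has_weak_gradient_iff[OF m])
  then have d: "?d \<in> square_integrable lebesgue" by (rule square_integrable_diff)
  have "AE x in lebesgue. x \<in> \<Omega> \<longrightarrow> ?d x $ i = 0" for i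
  proof (rule fundamental_lemma_variations[OF \<Omega>])
    show "(\<lambda>x. ?d x $ i) \<in> borel_measurable lebesgue"
      by (rule square_integrable_measurable[OF square_integrable_nth[OF d]])
    show "integrable lebesgue (\<lambda>x. indicator (cbox a b) x *\<^sub>R (?d x $ i))" for a b
      by (rule integrable_scaleR_square_integrable[OF box_indicator_square_integrable square_integrable_nth[OF d]])
    fix \<phi> assume \<phi>: "\<phi> \<in> test_functions \<Omega>"
    have s: "\<phi> \<in> square_integrable lebesgue" by (rule test_function_square_integrable[OF \<phi>])
    have e: "(\<integral>x. \<phi> x *\<^sub>R zero_ext \<Omega> g x \<partial>lebesgue) = (\<integral>x. \<phi> x *\<^sub>R zero_ext \<Omega> k x \<partial>lebesgue)"
      using g k \<phi> by (auto simp: has_weak_gradient_iff[OF m])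
    have "(\<integral>x. \<phi> x *\<^sub>R ?d x \<partial>lebesgue) = 0"
      using e by (simp add: scaleR_diff_right integrable_scaleR_square_integrable s gk)
    moreover have "(\<integral>x. \<phi> x * (?d x $ i) \<partial>lebesgue) = (\<integral>x. \<phi> x *\<^sub>R ?d x \<partial>lebesgue) $ i"
      using integral_bounded_linear[OF bounded_linear_vec_nth[of i] integrable_scaleR_square_integrable[OF s d]]
      by simp
    ultimately show "(\<integral>x. \<phi> x * (?d x $ i) \<partial>lebesgue) = 0" by simp
  qed
  then have "AE x in lebesgue. \<forall>i. x \<in> \<Omega> \<longrightarrow> ?d x $ i = 0"
    by (intro AE_all_countable[THEN iffD2] allI)
  then show ?thesis
    by eventually_elim (auto simp: vec_eq_iff zero_ext_def indicator_def)
qed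

lemma test_function_weak_gradient:
  assumes "open \<Omega>" "\<phi> \<in> test_functions \<Omega>"
  shows "has_weak_gradient \<Omega> \<phi> (grad \<phi>)"
proof -
  have m: "\<Omega> \<in> sets lebesgue" using assms by auto
  show ?thesis
    using assms test_function_square_integrable[OF assms(2)]
    by (simp add: has_weak_gradient_iff[OF m] zero_ext_test_function integration_by_parts[OF assms(2)])
qed

lemma has_weak_gradient_diff:
  assumes \<Omega>: "open \<Omega>" and "has_weak_gradient \<Omega> u g" "has_weak_gradient \<Omega> v k"
  shows "has_weak_gradient \<Omega> (\<lambda>x. u x - v x) (\<lambda>x. g x - k x)"
proof -
  have m: "\<Omega> \<in> sets lebesgue" using \<Omega> by auto
  have e: "zero_ext \<Omega> (\<lambda>x. u x - v x) = (\<lambda>x. zero_ext \<Omega> u x - zero_ext \<Omega> v x)"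
    "zero_ext \<Omega> (\<lambda>x. g x - k x) = (\<lambda>x. zero_ext \<Omega> g x - zero_ext \<Omega> k x)"
    by (auto simp: zero_ext_def fun_eq_iff scaleR_diff_right right_diff_distrib)
  have s: "zero_ext \<Omega> u \<in> square_integrable lebesgue" "zero_ext \<Omega> g \<in> square_integrable lebesgue"
    "zero_ext \<Omega> v \<in> square_integrable lebesgue" "zero_ext \<Omega> k \<in> square_integrable lebesgue"
    using assms by (auto simp: has_weak_gradient_iff[OF m])
  show ?thesis
    unfolding has_weak_gradient_iff[OF m] e
  proof (intro conjI ballI square_integrable_diff s)
    fix \<phi> assume \<phi>: "\<phi> \<in> test_functions \<Omega>"
    note t = test_function_square_integrable[OF \<phi>]
    show "(\<integral>x. (zero_ext \<Omega> u x - zero_ext \<Omega> v x) *\<^sub>R grad \<phi> x \<partial>lebesgue)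
        = - (\<integral>x. \<phi> x *\<^sub>R (zero_ext \<Omega> g x - zero_ext \<Omega> k x) \<partial>lebesgue)"
      using assms \<phi>
      by (simp add: scaleR_diff_left scaleR_diff_right integrable_scaleR_square_integrable s t has_weak_gradient_iff[OF m])
  qed
qed

lemma weak_grad_eq:
  assumes "open \<Omega>" "has_weak_gradient \<Omega> u g"
  shows "has_weak_gradient \<Omega> u (weak_grad \<Omega> u)"
    and "AE x in lebesgue. zero_ext \<Omega> (weak_grad \<Omega> u) x = zero_ext \<Omega> g x"
proof -
  show "has_weak_gradient \<Omega> u (weak_grad \<Omega> u)"
    unfolding weak_grad_def by (rule someI[of "has_weak_gradient \<Omega> u"]) (rule assms(2))
  then show "AE x in lebesgue. zero_ext \<Omega> (weak_grad \<Omega> u) x = zero_ext \<Omega> g x"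
    using weak_gradient_unique assms by blast
qed

lemma H1_norm_eq:
  assumes \<Omega>: "open \<Omega>" and g: "has_weak_gradient \<Omega> u g"
  shows "H1_norm \<Omega> u = sqrt ((l2norm lebesgue (zero_ext \<Omega> u))\<^sup>2 + (l2norm lebesgue (zero_ext \<Omega> g))\<^sup>2)"
proof -
  have m: "\<Omega> \<in> sets lebesgue" using \<Omega> by auto
  have "zero_ext \<Omega> (\<lambda>x. (norm (w x))\<^sup>2) x = (norm (zero_ext \<Omega> w x))\<^sup>2" for w :: "real^'a \<Rightarrow> 'b::euclidean_space" and x
    by (simp add: zero_ext_def indicator_def)
  then have "(\<integral>x. (norm (w x))\<^sup>2 \<partial>lebesgue_on \<Omega>) = (l2norm lebesgue (zero_ext \<Omega> w))\<^sup>2" for w :: "real^'a \<Rightarrow> 'b::euclidean_space"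
    unfolding l2norm_square lebesgue_on_integral_eq[OF m] by (intro Bochner_Integration.integral_cong) auto
  note e = this[of u] this[of "weak_grad \<Omega> u"]
  have "l2norm lebesgue (zero_ext \<Omega> (weak_grad \<Omega> u)) = l2norm lebesgue (zero_ext \<Omega> g)"
    using weak_grad_eq[OF assms] g
    by (intro l2norm_cong_AE) (auto simp: has_weak_gradient_iff[OF m] square_integrable_def)
  then show ?thesis using e by (simp add: H1_norm_def)
qed

text \<open>A description of H^1_0 that is free of the choice in \<open>weak_grad\<close>:
  \<open>u\<close> and \<open>g\<close> are functions on the whole space, and \<Omega> enters only
  through the supports of the approximants. An inclusion of domains thus gives an inclusion of the
  spaces at once.\<close>

definition H10_limit :: "(real^'n) set \<Rightarrow> (nat \<Rightarrow> real^'n \<Rightarrow> real) \<Rightarrow> (real^'n \<Rightarrow> real) \<Rightarrow> (real^'n \<Rightarrow> real^'n) \<Rightarrow> bool" where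
  "H10_limit \<Omega> \<phi> u g \<longleftrightarrow> (\<forall>k. \<phi> k \<in> test_functions \<Omega>) \<and>
     u \<in> square_integrable lebesgue \<and> g \<in> square_integrable lebesgue \<and>
     (\<lambda>k. l2norm lebesgue (\<lambda>x. u x - \<phi> k x)) \<longlonglongrightarrow> 0 \<and>
     (\<lambda>k. l2norm lebesgue (\<lambda>x. g x - grad (\<phi> k) x)) \<longlonglongrightarrow> 0"

lemma H10_imp_limit:
  assumes \<Omega>: "open \<Omega>" and u: "u \<in> H10 \<Omega>"
  obtains \<phi> where "H10_limit \<Omega> \<phi> (zero_ext \<Omega> u) (zero_ext \<Omega> (weak_grad \<Omega> u))"
proof -
  have m: "\<Omega> \<in> sets lebesgue" using \<Omega> by auto
  obtain \<phi> where \<phi>: "\<And>k. \<phi> k \<in> test_functions \<Omega>" and c: "(\<lambda>k. H1_norm \<Omega> (\<lambda>x. u x - \<phi> k x)) \<longlonglongrightarrow> 0"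
    using u by (auto simp: H10_def)
  obtain g where "has_weak_gradient \<Omega> u g" using u by (auto simp: H10_def H1_def)
  then have g: "has_weak_gradient \<Omega> u (weak_grad \<Omega> u)" using weak_grad_eq \<Omega> by blast
  have e: "zero_ext \<Omega> (\<lambda>x. u x - \<phi> k x) = (\<lambda>x. zero_ext \<Omega> u x - \<phi> k x)"
    "zero_ext \<Omega> (\<lambda>x. weak_grad \<Omega> u x - grad (\<phi> k) x) = (\<lambda>x. zero_ext \<Omega> (weak_grad \<Omega> u) x - grad (\<phi> k) x)" for k
  proof -
    have "zero_ext \<Omega> (\<lambda>x. u x - \<phi> k x) = (\<lambda>x. zero_ext \<Omega> u x - zero_ext \<Omega> (\<phi> k) x)"
      by (auto simp: zero_ext_def fun_eq_iff right_diff_distrib)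
    then show "zero_ext \<Omega> (\<lambda>x. u x - \<phi> k x) = (\<lambda>x. zero_ext \<Omega> u x - \<phi> k x)"
      by (simp add: zero_ext_test_function[OF \<phi>])
    have "zero_ext \<Omega> (\<lambda>x. weak_grad \<Omega> u x - grad (\<phi> k) x) = (\<lambda>x. zero_ext \<Omega> (weak_grad \<Omega> u) x - zero_ext \<Omega> (grad (\<phi> k)) x)"
      by (auto simp: zero_ext_def fun_eq_iff scaleR_diff_right)
    then show "zero_ext \<Omega> (\<lambda>x. weak_grad \<Omega> u x - grad (\<phi> k) x) = (\<lambda>x. zero_ext \<Omega> (weak_grad \<Omega> u) x - grad (\<phi> k) x)"
      by (simp add: zero_ext_test_function[OF \<phi>])
  qed
  have n: "H1_norm \<Omega> (\<lambda>x. u x - \<phi> k x) = sqrt ((l2norm lebesgue (\<lambda>x. zero_ext \<Omega> u x - \<phi> k x))\<^sup>2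
      + (l2norm lebesgue (\<lambda>x. zero_ext \<Omega> (weak_grad \<Omega> u) x - grad (\<phi> k) x))\<^sup>2)" for k
    using H1_norm_eq[OF \<Omega> has_weak_gradient_diff[OF \<Omega> g test_function_weak_gradient[OF \<Omega> \<phi>]]] by (simp add: e)
  have "(\<lambda>k. l2norm lebesgue (\<lambda>x. zero_ext \<Omega> u x - \<phi> k x)) \<longlonglongrightarrow> 0"
    by (rule LIMSEQ_0_le[OF c l2norm_nonneg]) (simp add: n real_le_rsqrt)
  moreover have "(\<lambda>k. l2norm lebesgue (\<lambda>x. zero_ext \<Omega> (weak_grad \<Omega> u) x - grad (\<phi> k) x)) \<longlonglongrightarrow> 0"
    by (rule LIMSEQ_0_le[OF c l2norm_nonneg]) (simp add: n real_le_rsqrt)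
  ultimately have "H10_limit \<Omega> \<phi> (zero_ext \<Omega> u) (zero_ext \<Omega> (weak_grad \<Omega> u))"
    using \<phi> g by (simp add: H10_limit_def has_weak_gradient_iff[OF m])
  then show thesis by (rule that)
qed

lemma H10_limitD:
  assumes "H10_limit \<Omega> \<phi> u g"
  shows "\<phi> k \<in> test_functions \<Omega>" "u \<in> square_integrable lebesgue" "g \<in> square_integrable lebesgue"
    "(\<lambda>k. l2norm lebesgue (\<lambda>x. u x - \<phi> k x)) \<longlonglongrightarrow> 0"
    "(\<lambda>k. l2norm lebesgue (\<lambda>x. g x - grad (\<phi> k) x)) \<longlonglongrightarrow> 0"
    "\<phi> k \<in> square_integrable lebesgue" "grad (\<phi> k) \<in> square_integrable lebesgue"
  using assms test_function_square_integrable[of "\<phi> k" \<Omega>] by (auto simp: H10_limit_def)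

lemma H10_limit_tendsto_integral:
  assumes l: "H10_limit \<Omega> \<phi> u g" and F: "F \<in> square_integrable lebesgue"
  shows "(\<lambda>k. \<integral>x. F x * \<phi> k x \<partial>lebesgue) \<longlonglongrightarrow> (\<integral>x. F x * u x \<partial>lebesgue)"
  using l2_tendsto_inner_const[OF H10_limitD(6)[OF l] H10_limitD(2)[OF l] H10_limitD(4)[OF l] F]
  by (simp add: mult.commute)

lemma H10_limit_tendsto_grad_integral:
  assumes l: "H10_limit \<Omega> \<phi> u g" and G: "G \<in> square_integrable lebesgue"
  shows "(\<lambda>k. \<integral>x. G x \<bullet> grad (\<phi> k) x \<partial>lebesgue) \<longlonglongrightarrow> (\<integral>x. G x \<bullet> g x \<partial>lebesgue)"
  using l2_tendsto_inner_const[OF H10_limitD(7)[OF l] H10_limitD(3)[OF l] H10_limitD(5)[OF l] G]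
  by (simp add: inner_commute)

text \<open>Integration by parts holds for the approximants and passes to the limit. It is tested
  against a fixed vector \<open>e\<close>, so that limits of scalar products suffice.\<close>

lemma H10_limit_has_weak_gradient:
  assumes \<Omega>: "open \<Omega>" and l: "H10_limit \<Omega> \<phi> u g"
  shows "has_weak_gradient \<Omega> u g"
proof -
  have m: "\<Omega> \<in> sets lebesgue" using \<Omega> by auto
  note s = H10_limitD(2,3)[OF l]
  show ?thesis
    unfolding has_weak_gradient_iff[OF m]
  proof (intro conjI ballI zero_ext_square_integrable s m)
    fix \<psi> assume \<psi>: "\<psi> \<in> test_functions \<Omega>"
    note t = test_function_square_integrable[OF \<psi>]
    have z: "zero_ext \<Omega> u x *\<^sub>R grad \<psi> x = u x *\<^sub>R grad \<psi> x" "\<psi> x *\<^sub>R zero_ext \<Omega> g x = \<psi> x *\<^sub>R g x" for x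
      using fun_cong[OF zero_ext_test_function(1)[OF \<psi>], of x] fun_cong[OF zero_ext_test_function(2)[OF \<psi>], of x]
      by (cases "x \<in> \<Omega>"; simp add: zero_ext_def)+
    have "(\<integral>x. u x *\<^sub>R grad \<psi> x \<partial>lebesgue) \<bullet> e = - (\<integral>x. \<psi> x *\<^sub>R g x \<partial>lebesgue) \<bullet> e" for e
    proof -
      have A: "(\<lambda>k. \<integral>x. \<phi> k x * (grad \<psi> x \<bullet> e) \<partial>lebesgue) \<longlonglongrightarrow> (\<integral>x. u x * (grad \<psi> x \<bullet> e) \<partial>lebesgue)"
        using H10_limit_tendsto_integral[OF l grad_square_integrable_inner[OF \<psi>, of e]] by (simp add: mult.commute)
      have B: "(\<lambda>k. \<integral>x. (\<psi> x *\<^sub>R e) \<bullet> grad (\<phi> k) x \<partial>lebesgue) \<longlonglongrightarrow> (\<integral>x. (\<psi> x *\<^sub>R e) \<bullet> g x \<partial>lebesgue)"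
      proof (rule H10_limit_tendsto_grad_integral[OF l])
        show "(\<lambda>x. \<psi> x *\<^sub>R e) \<in> square_integrable lebesgue"
          by (rule compact_support_square_integrable[OF _ test_function_support(1)[OF \<psi>]])
             (auto intro!: continuous_intros test_function_continuous[OF \<psi>] simp: eq_0_outside_support)
      qed
      have E: "(\<integral>x. \<phi> k x * (grad \<psi> x \<bullet> e) \<partial>lebesgue) = - (\<integral>x. (\<psi> x *\<^sub>R e) \<bullet> grad (\<phi> k) x \<partial>lebesgue)" for k
      proof -
        note i = integrable_scaleR_square_integrable[OF H10_limitD(6)[OF l] t(2)]
          integrable_scaleR_square_integrable[OF t(1) H10_limitD(7)[OF l]]
        have "(\<integral>x. (\<phi> k x *\<^sub>R grad \<psi> x) \<bullet> e \<partial>lebesgue) = (\<integral>x. \<phi> k x *\<^sub>R grad \<psi> x \<partial>lebesgue) \<bullet> e"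
          by (rule integral_inner_left) (rule i)
        also have "\<dots> = - ((\<integral>x. \<psi> x *\<^sub>R grad (\<phi> k) x \<partial>lebesgue) \<bullet> e)"
          by (simp add: integration_by_parts[OF H10_limitD(1)[OF l] \<psi>])
        also have "(\<integral>x. \<psi> x *\<^sub>R grad (\<phi> k) x \<partial>lebesgue) \<bullet> e = (\<integral>x. (\<psi> x *\<^sub>R grad (\<phi> k) x) \<bullet> e \<partial>lebesgue)"
          by (rule integral_inner_left[symmetric]) (rule i)
        finally show ?thesis by (simp add: inner_commute[of e])
      qed
      have "(\<lambda>k. \<integral>x. \<phi> k x * (grad \<psi> x \<bullet> e) \<partial>lebesgue) \<longlonglongrightarrow> - (\<integral>x. (\<psi> x *\<^sub>R e) \<bullet> g x \<partial>lebesgue)"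
        unfolding E by (rule tendsto_minus[OF B])
      then have "(\<integral>x. u x * (grad \<psi> x \<bullet> e) \<partial>lebesgue) = - (\<integral>x. (\<psi> x *\<^sub>R e) \<bullet> g x \<partial>lebesgue)"
        by (rule LIMSEQ_unique[OF A])
      then have "(\<integral>x. (u x *\<^sub>R grad \<psi> x) \<bullet> e \<partial>lebesgue) = - (\<integral>x. (\<psi> x *\<^sub>R g x) \<bullet> e \<partial>lebesgue)"
        by (simp add: inner_commute[of e])
      moreover have "(\<integral>x. (u x *\<^sub>R grad \<psi> x) \<bullet> e \<partial>lebesgue) = (\<integral>x. u x *\<^sub>R grad \<psi> x \<partial>lebesgue) \<bullet> e"
        by (rule integral_inner_left) (rule integrable_scaleR_square_integrable[OF s(1) t(2)])
      moreover have "(\<integral>x. (\<psi> x *\<^sub>R g x) \<bullet> e \<partial>lebesgue) = (\<integral>x. \<psi> x *\<^sub>R g x \<partial>lebesgue) \<bullet> e"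
        by (rule integral_inner_left) (rule integrable_scaleR_square_integrable[OF t(1) s(2)])
      ultimately show ?thesis by simp
    qed
    then have "(\<integral>x. u x *\<^sub>R grad \<psi> x \<partial>lebesgue) = - (\<integral>x. \<psi> x *\<^sub>R g x \<partial>lebesgue)"
      by (subst euclidean_eq_iff) blast
    then show "(\<integral>x. zero_ext \<Omega> u x *\<^sub>R grad \<psi> x \<partial>lebesgue) = - (\<integral>x. \<psi> x *\<^sub>R zero_ext \<Omega> g x \<partial>lebesgue)"
      by (simp only: z)
  qed
qed

lemma H10_limit_imp_H10:
  assumes \<Omega>: "open \<Omega>" and l: "H10_limit \<Omega> \<phi> u g"
  shows "u \<in> H10 \<Omega>"
proof -
  have m: "\<Omega> \<in> sets lebesgue" using \<Omega> by auto
  have g: "has_weak_gradient \<Omega> u g" by (rule H10_limit_has_weak_gradient[OF assms])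
  have b: "H1_norm \<Omega> (\<lambda>x. u x - \<phi> k x) \<le> l2norm lebesgue (\<lambda>x. u x - \<phi> k x) + l2norm lebesgue (\<lambda>x. g x - grad (\<phi> k) x)" for k
  proof -
    have "H1_norm \<Omega> (\<lambda>x. u x - \<phi> k x) \<le> l2norm lebesgue (zero_ext \<Omega> (\<lambda>x. u x - \<phi> k x))
        + l2norm lebesgue (zero_ext \<Omega> (\<lambda>x. g x - grad (\<phi> k) x))"
      unfolding H1_norm_eq[OF \<Omega> has_weak_gradient_diff[OF \<Omega> g test_function_weak_gradient[OF \<Omega> H10_limitD(1)[OF l]]]]
      by (intro sqrt_sum_squares_le_sum l2norm_nonneg)
    also have "\<dots> \<le> l2norm lebesgue (\<lambda>x. u x - \<phi> k x) + l2norm lebesgue (\<lambda>x. g x - grad (\<phi> k) x)"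
      using l by (intro add_mono l2norm_zero_ext_le square_integrable_diff m) (auto dest: H10_limitD)
    finally show ?thesis .
  qed
  have "(\<lambda>k. l2norm lebesgue (\<lambda>x. u x - \<phi> k x) + l2norm lebesgue (\<lambda>x. g x - grad (\<phi> k) x)) \<longlonglongrightarrow> 0 + 0"
    by (intro tendsto_add H10_limitD(4,5)[OF l])
  then have "(\<lambda>k. H1_norm \<Omega> (\<lambda>x. u x - \<phi> k x)) \<longlonglongrightarrow> 0"
    by (intro LIMSEQ_0_le[OF _ _ b]) (simp_all add: H1_norm_def)
  then show ?thesis using g H10_limitD(1)[OF l] by (auto simp: H10_def H1_def)
qed

text \<open>\<open>F\<close> is a function on the whole space, so solutions on different domains
  share one right-hand side. The equation is tested with test functions only;
  \<open>H10_solution_limit\<close> extends it by density.\<close>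

definition H10_solution :: "(real^'n \<Rightarrow> real) \<Rightarrow> (real^'n) set \<Rightarrow> (real^'n \<Rightarrow> real) \<Rightarrow> (real^'n \<Rightarrow> real^'n) \<Rightarrow> bool" where
  "H10_solution F \<Omega> u g \<longleftrightarrow> (\<exists>\<phi>. H10_limit \<Omega> \<phi> u g) \<and>
     (\<forall>\<psi>\<in>test_functions \<Omega>. (\<integral>x. g x \<bullet> grad \<psi> x \<partial>lebesgue) = (\<integral>x. F x * \<psi> x \<partial>lebesgue))"

lemma H10_solution_square_integrable:
  assumes "H10_solution F \<Omega> u g"
  shows "u \<in> square_integrable lebesgue" "g \<in> square_integrable lebesgue"
  using assms by (auto simp: H10_solution_def H10_limit_def)

lemma H10_solution_limit:
  assumes s: "H10_solution F \<Omega> u g" and F: "F \<in> square_integrable lebesgue" and l: "H10_limit \<Omega> \<psi> v k"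
  shows "(\<integral>x. g x \<bullet> k x \<partial>lebesgue) = (\<integral>x. F x * v x \<partial>lebesgue)"
proof -
  have "(\<integral>x. g x \<bullet> grad (\<psi> j) x \<partial>lebesgue) = (\<integral>x. F x * \<psi> j x \<partial>lebesgue)" for j
    using s H10_limitD(1)[OF l] by (auto simp: H10_solution_def)
  then have "(\<lambda>j. \<integral>x. F x * \<psi> j x \<partial>lebesgue) \<longlonglongrightarrow> (\<integral>x. g x \<bullet> k x \<partial>lebesgue)"
    using H10_limit_tendsto_grad_integral[OF l H10_solution_square_integrable(2)[OF s]] by simp
  then show ?thesis using LIMSEQ_unique H10_limit_tendsto_integral[OF l F] by blast
qed

lemma H10_limit_const:
  assumes "\<phi> \<in> test_functions \<Omega>"
  shows "H10_limit \<Omega> (\<lambda>_. \<phi>) \<phi> (grad \<phi>)"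
  using assms test_function_square_integrable[OF assms] by (simp add: H10_limit_def l2norm_zero)

lemma H10_limit_mono: "H10_limit \<Omega> \<phi> u g \<Longrightarrow> \<Omega> \<subseteq> \<Omega>' \<Longrightarrow> H10_limit \<Omega>' \<phi> u g"
  by (auto simp: H10_limit_def intro: test_function_mono)

lemma H10_limit_diff:
  assumes u: "H10_limit \<Omega> \<phi> u g" and v: "H10_limit \<Omega> \<psi> v k"
  shows "H10_limit \<Omega> (\<lambda>j x. \<phi> j x - \<psi> j x) (\<lambda>x. u x - v x) (\<lambda>x. g x - k x)"
  unfolding H10_limit_def
proof (intro conjI allI square_integrable_diff)
  note us = H10_limitD[OF u] and vs = H10_limitD[OF v]
  show "(\<lambda>x. \<phi> j x - \<psi> j x) \<in> test_functions \<Omega>" for j by (rule test_function_diff(1)[OF us(1) vs(1)])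
  have "l2norm lebesgue (\<lambda>x. u x - v x - (\<phi> j x - \<psi> j x)) \<le>
      l2norm lebesgue (\<lambda>x. u x - \<phi> j x) + l2norm lebesgue (\<lambda>x. v x - \<psi> j x)" for j
    using l2norm_triangle_diff[OF square_integrable_diff[OF us(2) us(6)[of j]] square_integrable_diff[OF vs(2) vs(6)[of j]]]
    by (simp add: algebra_simps)
  then show "(\<lambda>j. l2norm lebesgue (\<lambda>x. u x - v x - (\<phi> j x - \<psi> j x))) \<longlonglongrightarrow> 0"
    by (rule LIMSEQ_0_le[OF tendsto_add[OF us(4) vs(4), simplified] l2norm_nonneg])
  have "l2norm lebesgue (\<lambda>x. g x - k x - grad (\<lambda>x. \<phi> j x - \<psi> j x) x) \<le>
      l2norm lebesgue (\<lambda>x. g x - grad (\<phi> j) x) + l2norm lebesgue (\<lambda>x. k x - grad (\<psi> j) x)" for j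
    using l2norm_triangle_diff[OF square_integrable_diff[OF us(3) us(7)[of j]] square_integrable_diff[OF vs(3) vs(7)[of j]]]
    by (simp add: algebra_simps test_function_diff(2)[OF us(1) vs(1)])
  then show "(\<lambda>j. l2norm lebesgue (\<lambda>x. g x - k x - grad (\<lambda>x. \<phi> j x - \<psi> j x) x)) \<longlonglongrightarrow> 0"
    by (rule LIMSEQ_0_le[OF tendsto_add[OF us(5) vs(5), simplified] l2norm_nonneg])
qed (use assms in \<open>auto dest: H10_limitD\<close>)

lemma H10_limit_Poincare:
  assumes l: "H10_limit \<Omega> \<phi> u g" and "\<Omega> \<subseteq> ball 0 r" "0 < r"
  shows "l2norm lebesgue u \<le> 2 * r * l2norm lebesgue g"
proof (rule LIMSEQ_le)
  show "(\<lambda>k. l2norm lebesgue (\<phi> k)) \<longlonglongrightarrow> l2norm lebesgue u"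
    by (rule l2_tendsto_norm[OF H10_limitD(6,2,4)[OF l]])
  show "(\<lambda>k. 2 * r * l2norm lebesgue (grad (\<phi> k))) \<longlonglongrightarrow> 2 * r * l2norm lebesgue g"
    by (intro tendsto_mult_left l2_tendsto_norm[OF H10_limitD(7,3,5)[OF l]])
qed (use Poincare_inequality[OF H10_limitD(1)[OF l] assms(2,3)] in blast)

text \<open>The solution on the smaller domain is the orthogonal projection of that on the larger one.\<close>
lemma H10_solution_nested:
  assumes u: "H10_solution F \<Omega> u g" and v: "H10_solution F \<Omega>' v k" and "\<Omega> \<subseteq> \<Omega>'"
    and F: "F \<in> square_integrable lebesgue"
  shows "(l2norm lebesgue (\<lambda>x. k x - g x))\<^sup>2 = (l2norm lebesgue k)\<^sup>2 - (l2norm lebesgue g)\<^sup>2"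
proof -
  obtain \<phi> where l: "H10_limit \<Omega> \<phi> u g" using u by (auto simp: H10_solution_def)
  note s = H10_solution_square_integrable(2)[OF u] H10_solution_square_integrable(2)[OF v]
  \<comment> \<open>Both equations may be tested with \<open>u\<close>, and both right-hand sides
    are then the integral of F u.\<close>
  have "(\<integral>x. k x \<bullet> g x \<partial>lebesgue) = (\<integral>x. g x \<bullet> g x \<partial>lebesgue)"
    using H10_solution_limit[OF u F l] H10_solution_limit[OF v F H10_limit_mono[OF l \<open>\<Omega> \<subseteq> \<Omega>'\<close>]] by simp
  moreover have "(l2norm lebesgue g)\<^sup>2 = (\<integral>x. g x \<bullet> g x \<partial>lebesgue)"
    by (simp add: l2norm_square power2_norm_eq_inner)
  ultimately show ?thesis using l2norm_diff_square[OF s(2,1)] by simp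
qed

text \<open>Precomposition with the dilation turns a test function on the large domain into one on
  \<Omega> without increasing its Dirichlet norm, while its integral against \<open>F\<close>
  changes by O(s - 1). Letting the approximants tend to \<open>v\<close> bounds the square of
  \<open>l2norm lebesgue k\<close> by \<open>?C\<close> times
  \<open>l2norm lebesgue k\<close>.\<close>

lemma H10_solution_dilation:
  fixes u :: "real^'n \<Rightarrow> real"
  assumes u: "H10_solution F \<Omega> u g" and v: "H10_solution F ((*\<^sub>R) s ` \<Omega>) v k"
    and F: "F \<in> square_integrable lebesgue" and b: "(*\<^sub>R) s ` \<Omega> \<subseteq> ball 0 r" and r: "0 < r" and s: "1 \<le> s"
    and n: "2 \<le> CARD('n)"
  shows "l2norm lebesgue k \<le> l2norm lebesgue g + r * l2norm lebesgue F * (s - 1)"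
proof -
  obtain \<psi> where l: "H10_limit ((*\<^sub>R) s ` \<Omega>) \<psi> v k" using v by (auto simp: H10_solution_def)
  let ?C = "l2norm lebesgue g + r * l2norm lebesgue F * (s - 1)"
  have "(\<integral>x. F x * \<psi> j x \<partial>lebesgue) \<le> ?C * l2norm lebesgue (grad (\<psi> j))" for j
  proof -
    note t = H10_limitD(1)[OF l, of j]
    have ts: "(\<lambda>x. \<psi> j (s *\<^sub>R x)) \<in> test_functions \<Omega>" using test_function_scale(1)[OF t] s by simp
    have "(\<integral>x. F x * \<psi> j (s *\<^sub>R x) \<partial>lebesgue) = (\<integral>x. g x \<bullet> grad (\<lambda>x. \<psi> j (s *\<^sub>R x)) x \<partial>lebesgue)"
      using u ts by (simp add: H10_solution_def)
    also have "\<dots> \<le> l2norm lebesgue g * l2norm lebesgue (grad (\<lambda>x. \<psi> j (s *\<^sub>R x)))"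
      using l2_Cauchy_Schwarz[OF H10_solution_square_integrable(2)[OF u] test_function_square_integrable(2)[OF ts]]
      by simp
    also have "\<dots> \<le> l2norm lebesgue g * l2norm lebesgue (grad (\<psi> j))"
      by (intro mult_left_mono l2norm_nonneg l2norm_grad_scale[OF t s n])
    finally have "(\<integral>x. F x * \<psi> j (s *\<^sub>R x) \<partial>lebesgue) \<le> l2norm lebesgue g * l2norm lebesgue (grad (\<psi> j))" .
    then show ?thesis
      using integral_dilation_diff_bound[OF t b r F s] by (simp add: algebra_simps)
  qed
  then have "(\<integral>x. F x * v x \<partial>lebesgue) \<le> ?C * l2norm lebesgue k"
    by (intro LIMSEQ_le[OF H10_limit_tendsto_integral[OF l F] tendsto_mult_left[OF l2_tendsto_norm[OF H10_limitD(7,3,5)[OF l]]]]) auto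
  moreover have "(\<integral>x. F x * v x \<partial>lebesgue) = (l2norm lebesgue k)\<^sup>2"
    using H10_solution_limit[OF v F l] by (simp add: l2norm_square power2_norm_eq_inner)
  ultimately have le: "l2norm lebesgue k * l2norm lebesgue k \<le> ?C * l2norm lebesgue k" by (simp add: power2_eq_square)
  have "0 \<le> ?C" using r s by (intro add_nonneg_nonneg mult_nonneg_nonneg l2norm_nonneg) auto
  then show ?thesis using le l2norm_nonneg[of lebesgue k]
    by (cases "l2norm lebesgue k = 0") (auto simp: mult_le_cancel_right)
qed

text \<open>The dilate of \<Omega> contains both domains, so the squared distance of
  \<open>l\<close> from each of \<open>g\<close> and \<open>k\<close> is an energy gap. The gap to
  \<open>k\<close> requires a lower bound on the energy of \<open>k\<close>, and this comes from the
  inclusion of \<Omega> in the dilate of \<Omega>'.\<close>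

lemma H10_solution_stability:
  fixes u :: "real^'n \<Rightarrow> real"
  assumes n: "2 \<le> CARD('n)" and F: "F \<in> square_integrable lebesgue" and r: "0 < r"
    and s: "1 \<le> s" and u: "H10_solution F \<Omega> u g" and v: "H10_solution F \<Omega>' v k"
    and w: "H10_solution F ((*\<^sub>R) s ` \<Omega>) w l" and w': "H10_solution F ((*\<^sub>R) s ` \<Omega>') w' l'"
    and sub: "\<Omega> \<subseteq> (*\<^sub>R) s ` \<Omega>" "\<Omega>' \<subseteq> (*\<^sub>R) s ` \<Omega>" "\<Omega> \<subseteq> (*\<^sub>R) s ` \<Omega>'"
    and b: "(*\<^sub>R) s ` \<Omega> \<subseteq> ball 0 r" "(*\<^sub>R) s ` \<Omega>' \<subseteq> ball 0 r"
  defines "c \<equiv> r * l2norm lebesgue F * (s - 1)"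
  shows "l2norm lebesgue (\<lambda>x. u x - v x) \<le> 4 * r * sqrt (4 * c * (l2norm lebesgue g + c))"
proof -
  define a where "a = l2norm lebesgue g"
  have nn: "0 \<le> c" "0 \<le> a" unfolding a_def c_def using r s by (auto intro!: mult_nonneg_nonneg l2norm_nonneg)
  note gs = H10_solution_square_integrable(2)[OF u] and ks = H10_solution_square_integrable(2)[OF v]
    and ls = H10_solution_square_integrable(2)[OF w]
  have la: "l2norm lebesgue l \<le> a + c"
    using H10_solution_dilation[OF u w F b(1) r s n] by (simp add: a_def c_def)
  have "a\<^sup>2 \<le> (l2norm lebesgue l')\<^sup>2"
    using H10_solution_nested[OF u w' sub(3) F] zero_le_power2[of "l2norm lebesgue (\<lambda>x. l' x - g x)"]
    unfolding a_def by linarith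
  then have "a \<le> l2norm lebesgue l'" using l2norm_nonneg by (rule power2_le_imp_le)
  also have "\<dots> \<le> l2norm lebesgue k + c"
    using H10_solution_dilation[OF v w' F b(2) r s n] by (simp add: c_def)
  finally have ka: "a - c \<le> l2norm lebesgue k" by simp
  have lsq: "(l2norm lebesgue l)\<^sup>2 \<le> (a + c)\<^sup>2" using la by (intro power_mono l2norm_nonneg)
  have "(l2norm lebesgue (\<lambda>x. l x - k x))\<^sup>2 \<le> 4 * c * (a + c)"
  \<comment> \<open>For c > a the lower bound a - c is negative and cannot be squared; then (a +
    c)^2 itself is at most 4 c (a + c).\<close>
  proof (cases "c \<le> a")
    case True
    then have "(a - c)\<^sup>2 \<le> (l2norm lebesgue k)\<^sup>2" using ka by (intro power_mono) auto
    moreover have "(a + c)\<^sup>2 - (a - c)\<^sup>2 \<le> 4 * c * (a + c)"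
      using nn by (simp add: power2_eq_square algebra_simps)
    ultimately show ?thesis using H10_solution_nested[OF v w sub(2) F] lsq by linarith
  next
    case False
    have "(a + c) * (a + c) \<le> (4 * c) * (a + c)" using False nn by (intro mult_right_mono) auto
    then have "(a + c)\<^sup>2 \<le> 4 * c * (a + c)" by (simp add: power2_eq_square)
    then show ?thesis using H10_solution_nested[OF v w sub(2) F] lsq zero_le_power2[of "l2norm lebesgue k"]
      by linarith
  qed
  then have lk: "l2norm lebesgue (\<lambda>x. l x - k x) \<le> sqrt (4 * c * (a + c))" by (rule real_le_rsqrt)
  have "(l2norm lebesgue (\<lambda>x. l x - g x))\<^sup>2 \<le> (a + c)\<^sup>2 - a\<^sup>2"
    using H10_solution_nested[OF u w sub(1) F] lsq by (simp add: a_def)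
  also have "\<dots> \<le> 4 * c * (a + c)"
    using nn by (simp add: power2_eq_square algebra_simps)
  finally have lg: "l2norm lebesgue (\<lambda>x. l x - g x) \<le> sqrt (4 * c * (a + c))" by (rule real_le_rsqrt)
  have gk: "l2norm lebesgue (\<lambda>x. g x - k x) \<le> 2 * sqrt (4 * c * (a + c))"
    using l2norm_triangle3[OF gs ls ks] lg lk l2norm_minus_commute[of lebesgue g l] by simp
  obtain \<phi> \<psi> where "H10_limit \<Omega> \<phi> u g" "H10_limit \<Omega>' \<psi> v k" using u v by (auto simp: H10_solution_def)
  \<comment> \<open>The difference is an H^1_0 limit on the common superset, so the Poincare
    inequality with constant 2 r applies to it.\<close>
  then have "H10_limit ((*\<^sub>R) s ` \<Omega>) (\<lambda>j x. \<phi> j x - \<psi> j x) (\<lambda>x. u x - v x) (\<lambda>x. g x - k x)"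
    using sub by (intro H10_limit_diff) (auto intro: H10_limit_mono)
  from H10_limit_Poincare[OF this b(1) r]
  have "l2norm lebesgue (\<lambda>x. u x - v x) \<le> 2 * r * l2norm lebesgue (\<lambda>x. g x - k x)" .
  also have "\<dots> \<le> 2 * r * (2 * sqrt (4 * c * (a + c)))"
    using r by (intro mult_left_mono gk) simp
  finally have "l2norm lebesgue (\<lambda>x. u x - v x) \<le> 2 * r * (2 * sqrt (4 * c * (a + c)))" .
  then show ?thesis by (simp add: a_def)
qed

lemma test_function_zero: "(\<lambda>_. 0) \<in> test_functions \<Omega>"
  by (rule test_function_supportI[of _ "{}"]) (auto intro: C_k_const)

text \<open>Dirichlet's principle: a sequence of test functions minimising the energy
  \<open>E\<close> is Cauchy in the Dirichlet norm by the parallelogram identity, hence in L2 by the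
  Poincare inequality. The first variation of \<open>E\<close> vanishes in the limit, which is the
  equation.\<close>

lemma H10_solution_exists:
  fixes F :: "real^'n \<Rightarrow> real"
  assumes F: "F \<in> square_integrable lebesgue" and \<Omega>: "\<Omega> \<subseteq> ball 0 r" and r: "0 < r"
  obtains u g where "H10_solution F \<Omega> u g"
proof -
  define N :: "(real^'n \<Rightarrow> real) \<Rightarrow> real" where "N \<phi> = l2norm lebesgue (grad \<phi>)" for \<phi>
  define E where "E \<phi> = (N \<phi>)\<^sup>2 / 2 - (\<integral>x. F x * \<phi> x \<partial>lebesgue)" for \<phi>
  \<comment> \<open>Cauchy-Schwarz and Poincare bound the linear term by
    \<open>K * N \<phi>\<close>, and completing the square bounds \<open>E\<close> from
    below.\<close>
  define K where "K = 2 * r * l2norm lebesgue F"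
  note ts = test_function_square_integrable
  have Fi: "integrable lebesgue (\<lambda>x. F x * \<phi> x)" if "\<phi> \<in> test_functions \<Omega>" for \<phi>
    using integrable_inner_square_integrable[OF F ts(1)[OF that]] by simp
  \<comment> \<open>The factor 1 keeps the shape of \<open>test_function_lincomb\<close>, which
    shows that the sum is a test function.\<close>
  have expand: "E (\<lambda>x. 1 * \<phi> x + t * \<psi> x) = E \<phi> + t * ((\<integral>x. grad \<phi> x \<bullet> grad \<psi> x \<partial>lebesgue) - (\<integral>x. F x * \<psi> x \<partial>lebesgue))
      + t\<^sup>2 / 2 * (N \<psi>)\<^sup>2" if \<phi>: "\<phi> \<in> test_functions \<Omega>" and \<psi>: "\<psi> \<in> test_functions \<Omega>" for \<phi> \<psi> t
  proof -
    have "(N (\<lambda>x. 1 * \<phi> x + t * \<psi> x))\<^sup>2 = (l2norm lebesgue (\<lambda>x. grad \<phi> x + t *\<^sub>R grad \<psi> x))\<^sup>2"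
      unfolding N_def by (simp add: grad_lincomb[OF \<phi> \<psi>, of 1 t, simplified] cong: l2norm_cong)
    also have "\<dots> = (N \<phi>)\<^sup>2 + 2 * (t * (\<integral>x. grad \<phi> x \<bullet> grad \<psi> x \<partial>lebesgue)) + t\<^sup>2 * (N \<psi>)\<^sup>2"
      by (simp add: N_def l2norm_add_square[OF ts(2)[OF \<phi>] square_integrable_scaleR[OF ts(2)[OF \<psi>]]]
          l2norm_scaleR power_mult_distrib)
    finally have "(N (\<lambda>x. 1 * \<phi> x + t * \<psi> x))\<^sup>2 = \<dots>" .
    moreover have "(\<integral>x. F x * (1 * \<phi> x + t * \<psi> x) \<partial>lebesgue) = (\<integral>x. F x * \<phi> x \<partial>lebesgue) + t * (\<integral>x. F x * \<psi> x \<partial>lebesgue)"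
    proof -
      have "(\<integral>x. F x * (1 * \<phi> x + t * \<psi> x) \<partial>lebesgue) = (\<integral>x. F x * \<phi> x + t * (F x * \<psi> x) \<partial>lebesgue)"
        by (simp add: algebra_simps)
      also have "\<dots> = (\<integral>x. F x * \<phi> x \<partial>lebesgue) + (\<integral>x. t * (F x * \<psi> x) \<partial>lebesgue)"
        by (intro Bochner_Integration.integral_add Fi \<phi> integrable_mult_right \<psi>)
      finally show ?thesis by simp
    qed
    ultimately show ?thesis by (simp add: E_def field_simps)
  qed
  have low: "- (K\<^sup>2 / 2) \<le> E \<phi>" if \<phi>: "\<phi> \<in> test_functions \<Omega>" for \<phi>
  proof -
    have "(\<integral>x. F x * \<phi> x \<partial>lebesgue) \<le> l2norm lebesgue F * l2norm lebesgue \<phi>"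
      using l2_Cauchy_Schwarz[OF F ts(1)[OF \<phi>]] by simp
    also have "\<dots> \<le> l2norm lebesgue F * (2 * r * N \<phi>)"
      unfolding N_def by (intro mult_left_mono Poincare_inequality[OF \<phi> \<Omega> r] l2norm_nonneg)
    also have "\<dots> = K * N \<phi>" by (simp add: K_def)
    finally have "(\<integral>x. F x * \<phi> x \<partial>lebesgue) \<le> K * N \<phi>" .
    moreover have "2 * (K * N \<phi>) \<le> (N \<phi>)\<^sup>2 + K\<^sup>2"
      using zero_le_power2[of "N \<phi> - K"] by (simp add: power2_diff algebra_simps)
    ultimately show ?thesis unfolding E_def by linarith
  qed
  define I where "I = Inf (E ` test_functions \<Omega>)"
  have bdd: "bdd_below (E ` test_functions \<Omega>)" using low by (intro bdd_belowI2) auto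
  have I: "I \<le> E \<phi>" if "\<phi> \<in> test_functions \<Omega>" for \<phi>
    unfolding I_def by (intro cInf_lower bdd) (use that in auto)
  have "\<exists>\<phi>. \<phi> \<in> test_functions \<Omega> \<and> E \<phi> < I + inverse (real (Suc k))" for k
  proof -
    have "I < I + inverse (real (Suc k))" by simp
    then show ?thesis
      unfolding I_def using cInf_lessD[of "E ` test_functions \<Omega>"] test_function_zero[of \<Omega>] by blast
  qed
  then obtain \<phi> where \<phi>: "\<And>k. \<phi> k \<in> test_functions \<Omega>" and E\<phi>: "\<And>k. E (\<phi> k) < I + inverse (real (Suc k))"
    by metis
  have gc: "(l2norm lebesgue (\<lambda>x. grad (\<phi> j) x - grad (\<phi> k) x))\<^sup>2 \<le> 4 * (inverse (real (Suc j)) + inverse (real (Suc k)))" for j k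
  proof -
    let ?A = "\<integral>x. grad (\<phi> j) x \<bullet> grad (\<phi> k) x \<partial>lebesgue"
    let ?B = "\<integral>x. F x * \<phi> k x \<partial>lebesgue"
    have t: "(\<lambda>x. 1/2 * \<phi> j x + 1/2 * \<phi> k x) \<in> test_functions \<Omega>" by (rule test_function_lincomb[OF \<phi> \<phi>])
    have "(N (\<lambda>x. 1/2 * \<phi> j x + 1/2 * \<phi> k x))\<^sup>2 = (l2norm lebesgue (\<lambda>x. (1/2) *\<^sub>R (grad (\<phi> j) x + grad (\<phi> k) x)))\<^sup>2"
      unfolding N_def by (simp add: grad_lincomb[OF \<phi>[of j] \<phi>[of k], of "1/2" "1/2", simplified] scaleR_add_right cong: l2norm_cong)
    also have "\<dots> = 1/4 * ((N (\<phi> j))\<^sup>2 + 2 * ?A + (N (\<phi> k))\<^sup>2)"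
      by (simp only: l2norm_scaleR power_mult_distrib l2norm_add_square[OF ts(2)[OF \<phi>] ts(2)[OF \<phi>]] N_def)
         (simp add: power2_eq_square)
    finally have n: "(N (\<lambda>x. 1/2 * \<phi> j x + 1/2 * \<phi> k x))\<^sup>2 = 1/4 * ((N (\<phi> j))\<^sup>2 + 2 * ?A + (N (\<phi> k))\<^sup>2)" .
    have f: "(\<integral>x. F x * (1/2 * \<phi> j x + 1/2 * \<phi> k x) \<partial>lebesgue) = 1/2 * (\<integral>x. F x * \<phi> j x \<partial>lebesgue) + 1/2 * ?B"
    proof -
      have "(\<integral>x. F x * (1/2 * \<phi> j x + 1/2 * \<phi> k x) \<partial>lebesgue) = (\<integral>x. 1/2 * (F x * \<phi> j x) + 1/2 * (F x * \<phi> k x) \<partial>lebesgue)"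
        by (simp add: algebra_simps)
      also have "\<dots> = (\<integral>x. 1/2 * (F x * \<phi> j x) \<partial>lebesgue) + (\<integral>x. 1/2 * (F x * \<phi> k x) \<partial>lebesgue)"
        by (intro Bochner_Integration.integral_add Fi \<phi> integrable_mult_right)
      finally show ?thesis by simp
    qed
    have "(l2norm lebesgue (\<lambda>x. grad (\<phi> j) x - grad (\<phi> k) x))\<^sup>2 = (N (\<phi> j))\<^sup>2 - 2 * ?A + (N (\<phi> k))\<^sup>2"
      by (simp add: N_def l2norm_diff_square[OF ts(2)[OF \<phi>] ts(2)[OF \<phi>]])
    \<comment> \<open>The linear terms of \<open>E\<close> cancel in the parallelogram
      identity.\<close>
    also have "\<dots> = 4 * (E (\<phi> j) + E (\<phi> k) - 2 * E (\<lambda>x. 1/2 * \<phi> j x + 1/2 * \<phi> k x))"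
      unfolding E_def n f by (simp add: field_simps)
    also have "\<dots> \<le> 4 * (inverse (real (Suc j)) + inverse (real (Suc k)))"
    proof -
      have "4 * (a + b - 2 * c) \<le> 4 * (p + q)" if "I \<le> c" "a < I + p" "b < I + q" for a b c p q :: real
        using that by argo
      then show ?thesis using I[OF t] E\<phi>[of j] E\<phi>[of k] by blast
    qed
    finally show ?thesis .
  qed
  have C: "\<exists>M. \<forall>j\<ge>M. \<forall>k\<ge>M. l2norm lebesgue (\<lambda>x. grad (\<phi> j) x - grad (\<phi> k) x) < e" if e: "0 < e" for e
  proof -
    have "0 < e\<^sup>2 / 8" using e by simp
    then obtain M where M: "inverse (real (Suc M)) < e\<^sup>2 / 8" using reals_Archimedean by blast
    have "l2norm lebesgue (\<lambda>x. grad (\<phi> j) x - grad (\<phi> k) x) < e" if "j \<ge> M" "k \<ge> M" for j k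
    proof (rule power2_less_imp_less)
      have "inverse (real (Suc j)) \<le> inverse (real (Suc M))" "inverse (real (Suc k)) \<le> inverse (real (Suc M))"
        using that by (auto intro!: le_imp_inverse_le)
      then show "(l2norm lebesgue (\<lambda>x. grad (\<phi> j) x - grad (\<phi> k) x))\<^sup>2 < e\<^sup>2" using gc[of j k] M by argo
    qed (use e in simp)
    then show ?thesis by blast
  qed
  obtain g where g: "g \<in> square_integrable lebesgue" "(\<lambda>k. l2norm lebesgue (\<lambda>x. g x - grad (\<phi> k) x)) \<longlonglongrightarrow> 0"
    using l2_complete[of "\<lambda>k. grad (\<phi> k)" lebesgue] ts(2)[OF \<phi>] C by blast
  have C': "\<exists>M. \<forall>j\<ge>M. \<forall>k\<ge>M. l2norm lebesgue (\<lambda>x. \<phi> j x - \<phi> k x) < e" if e: "0 < e" for e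
  proof -
    have "0 < e / (2 * r)" using e r by simp
    then obtain M where M: "\<And>j k. j \<ge> M \<Longrightarrow> k \<ge> M \<Longrightarrow> l2norm lebesgue (\<lambda>x. grad (\<phi> j) x - grad (\<phi> k) x) < e / (2 * r)"
      using C by blast
    have "l2norm lebesgue (\<lambda>x. \<phi> j x - \<phi> k x) < e" if "j \<ge> M" "k \<ge> M" for j k
    proof -
      have "l2norm lebesgue (\<lambda>x. \<phi> j x - \<phi> k x) \<le> 2 * r * l2norm lebesgue (\<lambda>x. grad (\<phi> j) x - grad (\<phi> k) x)"
        using Poincare_inequality[OF test_function_diff(1)[OF \<phi>[of j] \<phi>[of k]] \<Omega> r]
        by (simp add: test_function_diff(2)[OF \<phi> \<phi>] cong: l2norm_cong)
      also have "\<dots> < e" using M[OF that] r by (simp add: field_simps)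
      finally show ?thesis .
    qed
    then show ?thesis by blast
  qed
  obtain u where u: "u \<in> square_integrable lebesgue" "(\<lambda>k. l2norm lebesgue (\<lambda>x. u x - \<phi> k x)) \<longlonglongrightarrow> 0"
    using l2_complete[of \<phi> lebesgue] ts(1)[OF \<phi>] C' by blast
  have l: "H10_limit \<Omega> \<phi> u g" using \<phi> u g by (simp add: H10_limit_def)
  have "(\<integral>x. g x \<bullet> grad \<psi> x \<partial>lebesgue) = (\<integral>x. F x * \<psi> x \<partial>lebesgue)" if \<psi>: "\<psi> \<in> test_functions \<Omega>" for \<psi>
  proof -
    define A where "A = (\<integral>x. g x \<bullet> grad \<psi> x \<partial>lebesgue) - (\<integral>x. F x * \<psi> x \<partial>lebesgue)"
    \<comment> \<open>The variation t = - s A lowers the energy to first order. The 1 in the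
      denominator makes s at most the reciprocal of the quadratic coefficient and covers
      \<open>N \<psi> = 0\<close>.\<close>
    define s where "s = 1 / ((N \<psi>)\<^sup>2 + 1)"
    define t where "t = - s * A"
    have lim: "(\<lambda>k. inverse (real (Suc k)) + t * ((\<integral>x. grad (\<phi> k) x \<bullet> grad \<psi> x \<partial>lebesgue) - (\<integral>x. F x * \<psi> x \<partial>lebesgue))
        + t\<^sup>2 / 2 * (N \<psi>)\<^sup>2) \<longlonglongrightarrow> 0 + t * A + t\<^sup>2 / 2 * (N \<psi>)\<^sup>2"
      unfolding A_def
      by (intro tendsto_intros LIMSEQ_inverse_real_of_nat l2_tendsto_inner_const[OF H10_limitD(7,3,5)[OF l] ts(2)[OF \<psi>]])
    have "0 \<le> inverse (real (Suc k)) + t * ((\<integral>x. grad (\<phi> k) x \<bullet> grad \<psi> x \<partial>lebesgue) - (\<integral>x. F x * \<psi> x \<partial>lebesgue))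
        + t\<^sup>2 / 2 * (N \<psi>)\<^sup>2" for k
      using I[OF test_function_lincomb[OF \<phi>[of k] \<psi>, of 1 t]] E\<phi>[of k] expand[OF \<phi>[of k] \<psi>, of t] by linarith
    then have "0 \<le> 0 + t * A + t\<^sup>2 / 2 * (N \<psi>)\<^sup>2"
      by (intro LIMSEQ_le_const[OF lim]) auto
    also have "\<dots> = - (A\<^sup>2 * s) * (1 - s * (N \<psi>)\<^sup>2 / 2)"
      by (simp add: t_def power2_eq_square algebra_simps)
    finally have 1: "A\<^sup>2 * s * (1 - s * (N \<psi>)\<^sup>2 / 2) \<le> 0" by simp
    have s: "0 < s" unfolding s_def by (simp add: add_nonneg_pos)
    have "s * (N \<psi>)\<^sup>2 \<le> 1"
      unfolding s_def using add_nonneg_pos[of "(N \<psi>)\<^sup>2" 1] by (simp add: field_simps)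
    then have "0 < s * (1 - s * (N \<psi>)\<^sup>2 / 2)" using s by (intro mult_pos_pos) auto
    with 1 have "A\<^sup>2 \<le> 0" by (metis mult.assoc mult_le_0_iff not_le)
    then show ?thesis by (simp add: A_def)
  qed
  then have "H10_solution F \<Omega> u g" using l by (auto simp: H10_solution_def)
  then show thesis by (rule that)
qed


section \<open>Weak solutions on a domain and their extensions by zero\<close>

lemma zero_ext_mult:
  fixes F u :: "'a \<Rightarrow> real" and g k :: "'a \<Rightarrow> 'b::real_inner"
  shows "zero_ext \<Omega> (\<lambda>x. F x * u x) = (\<lambda>x. zero_ext \<Omega> F x * zero_ext \<Omega> u x)"
    "zero_ext \<Omega> (\<lambda>x. g x \<bullet> k x) = (\<lambda>x. zero_ext \<Omega> g x \<bullet> zero_ext \<Omega> k x)"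
  by (auto simp: zero_ext_def indicator_def fun_eq_iff)

lemma zero_ext_subset_mult:
  fixes F u :: "'a \<Rightarrow> real"
  shows "\<Omega> \<subseteq> D \<Longrightarrow> zero_ext \<Omega> F x * zero_ext \<Omega> u x = zero_ext D F x * zero_ext \<Omega> u x"
  by (auto simp: zero_ext_def indicator_def)

lemma weak_solution_imp_H10_solution:
  assumes \<Omega>: "open \<Omega>" "\<Omega> \<subseteq> D" and u: "weak_solution F \<Omega> u"
  shows "H10_solution (zero_ext D F) \<Omega> (zero_ext \<Omega> u) (zero_ext \<Omega> (weak_grad \<Omega> u))"
  unfolding H10_solution_def
proof (intro conjI ballI)
  have m: "\<Omega> \<in> sets lebesgue" using \<Omega> by auto
  show "\<exists>\<phi>. H10_limit \<Omega> \<phi> (zero_ext \<Omega> u) (zero_ext \<Omega> (weak_grad \<Omega> u))"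
    using H10_imp_limit[OF \<Omega>(1)] u unfolding weak_solution_def by blast
  then have gs: "zero_ext \<Omega> (weak_grad \<Omega> u) \<in> square_integrable lebesgue" by (auto simp: H10_limit_def)
  fix \<psi> assume \<psi>: "\<psi> \<in> test_functions \<Omega>"
  have e: "zero_ext \<Omega> F x * \<psi> x = zero_ext D F x * \<psi> x" for x
    using zero_ext_subset_mult[OF \<Omega>(2), of F x \<psi>] by (simp add: zero_ext_test_function[OF \<psi>])
  note wg = weak_grad_eq[OF \<Omega>(1) test_function_weak_gradient[OF \<Omega>(1) \<psi>]]
  have "\<psi> \<in> H10 \<Omega>" by (rule H10_limit_imp_H10[OF \<Omega>(1) H10_limit_const[OF \<psi>]])
  then have "(\<integral>x. weak_grad \<Omega> u x \<bullet> weak_grad \<Omega> \<psi> x \<partial>lebesgue_on \<Omega>) = (\<integral>x. F x * \<psi> x \<partial>lebesgue_on \<Omega>)"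
    using u by (auto simp: weak_solution_def)
  then have "(\<integral>x. zero_ext \<Omega> (weak_grad \<Omega> u) x \<bullet> zero_ext \<Omega> (weak_grad \<Omega> \<psi>) x \<partial>lebesgue)
      = (\<integral>x. zero_ext D F x * \<psi> x \<partial>lebesgue)"
    by (simp add: lebesgue_on_integral_eq[OF m] zero_ext_mult zero_ext_test_function[OF \<psi>] e)
  moreover have "(\<integral>x. zero_ext \<Omega> (weak_grad \<Omega> u) x \<bullet> zero_ext \<Omega> (weak_grad \<Omega> \<psi>) x \<partial>lebesgue)
      = (\<integral>x. zero_ext \<Omega> (weak_grad \<Omega> u) x \<bullet> grad \<psi> x \<partial>lebesgue)"
  proof (rule integral_cong_AE)
    show "AE x in lebesgue. zero_ext \<Omega> (weak_grad \<Omega> u) x \<bullet> zero_ext \<Omega> (weak_grad \<Omega> \<psi>) x = zero_ext \<Omega> (weak_grad \<Omega> u) x \<bullet> grad \<psi> x"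
      using wg(2) by eventually_elim (simp add: zero_ext_test_function[OF \<psi>])
  qed (use gs wg(1) test_function_square_integrable[OF \<psi>] in
      \<open>auto simp: has_weak_gradient_iff[OF m] square_integrable_def intro!: borel_measurable_inner\<close>)
  ultimately show "(\<integral>x. zero_ext \<Omega> (weak_grad \<Omega> u) x \<bullet> grad \<psi> x \<partial>lebesgue) = (\<integral>x. zero_ext D F x * \<psi> x \<partial>lebesgue)"
    by simp
qed

lemma H10_solution_imp_weak_solution:
  assumes \<Omega>: "open \<Omega>" "\<Omega> \<subseteq> D" and F: "zero_ext D F \<in> square_integrable lebesgue"
    and u: "H10_solution (zero_ext D F) \<Omega> u g"
  shows "weak_solution F \<Omega> u"
  unfolding weak_solution_def
proof (intro conjI ballI)
  have m: "\<Omega> \<in> sets lebesgue" using \<Omega> by auto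
  obtain \<phi> where l: "H10_limit \<Omega> \<phi> u g" using u by (auto simp: H10_solution_def)
  show "u \<in> H10 \<Omega>" by (rule H10_limit_imp_H10[OF \<Omega>(1) l])
  note wg = weak_grad_eq[OF \<Omega>(1) H10_limit_has_weak_gradient[OF \<Omega>(1) l]]
  fix \<eta> assume \<eta>: "\<eta> \<in> H10 \<Omega>"
  obtain \<psi> where k: "H10_limit \<Omega> \<psi> (zero_ext \<Omega> \<eta>) (zero_ext \<Omega> (weak_grad \<Omega> \<eta>))"
    using H10_imp_limit[OF \<Omega>(1) \<eta>] by blast
  have "(\<integral>x. g x \<bullet> zero_ext \<Omega> (weak_grad \<Omega> \<eta>) x \<partial>lebesgue) = (\<integral>x. zero_ext D F x * zero_ext \<Omega> \<eta> x \<partial>lebesgue)"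
    by (rule H10_solution_limit[OF u F k])
  moreover have "(\<integral>x. zero_ext \<Omega> (weak_grad \<Omega> u) x \<bullet> zero_ext \<Omega> (weak_grad \<Omega> \<eta>) x \<partial>lebesgue)
      = (\<integral>x. g x \<bullet> zero_ext \<Omega> (weak_grad \<Omega> \<eta>) x \<partial>lebesgue)"
  proof (rule integral_cong_AE)
    show "AE x in lebesgue. zero_ext \<Omega> (weak_grad \<Omega> u) x \<bullet> zero_ext \<Omega> (weak_grad \<Omega> \<eta>) x = g x \<bullet> zero_ext \<Omega> (weak_grad \<Omega> \<eta>) x"
      using wg(2) by eventually_elim (auto simp: zero_ext_def indicator_def)
  qed (use H10_limitD(3)[OF k] H10_limitD(3)[OF l] wg(1) in
      \<open>auto simp: has_weak_gradient_iff[OF m] square_integrable_def intro!: borel_measurable_inner\<close>)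
  ultimately show "(\<integral>x. weak_grad \<Omega> u x \<bullet> weak_grad \<Omega> \<eta> x \<partial>lebesgue_on \<Omega>) = (\<integral>x. F x * \<eta> x \<partial>lebesgue_on \<Omega>)"
    by (simp add: lebesgue_on_integral_eq[OF m] zero_ext_mult zero_ext_subset_mult[OF \<Omega>(2)])
qed

text \<open>\<open>state\<close> is a choice, so it solves the equation only because a solution
  exists. The extension of \<open>F\<close> from \<open>D\<close> is the right-hand side for all
  domains at once.\<close>

lemma state_H10_solution:
  assumes \<Omega>: "open \<Omega>" "\<Omega> \<subseteq> D" "\<Omega> \<subseteq> ball 0 r" "0 < r" and F: "zero_ext D F \<in> square_integrable lebesgue"
  obtains g where "H10_solution (zero_ext D F) \<Omega> (zero_ext \<Omega> (state F \<Omega>)) g"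
proof -
  obtain u g where "H10_solution (zero_ext D F) \<Omega> u g" by (rule H10_solution_exists[OF F \<Omega>(3,4)])
  then have "weak_solution F \<Omega> u" by (rule H10_solution_imp_weak_solution[OF \<Omega>(1,2) F])
  then have "weak_solution F \<Omega> (state F \<Omega>)" unfolding state_def by (rule someI[of "weak_solution F \<Omega>"])
  from weak_solution_imp_H10_solution[OF \<Omega>(1,2) this] show thesis by (rule that)
qed

section \<open>Hausdorff measure\<close>

definition hausdorff_weight :: "nat \<Rightarrow> 'a::metric_space set \<Rightarrow> ennreal" where
  "hausdorff_weight d C = (if C = {} then 0 else ennreal (unit_ball_vol (real d) * (diameter C / 2) ^ d))"

lemma hausdorff_weight_empty: "hausdorff_weight d {} = 0"
  by (simp add: hausdorff_weight_def)

lemma hausdorff_pre_eq: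
  "hausdorff_pre d \<delta> A = Inf {(\<Sum>i. hausdorff_weight d (C i)) | C :: nat \<Rightarrow> 'a::metric_space set.
     A \<subseteq> (\<Union>i. C i) \<and> (\<forall>i. bounded (C i) \<and> diameter (C i) \<le> \<delta>)}"
  by (simp add: hausdorff_pre_def hausdorff_weight_def)

lemma hausdorff_pre_le:
  assumes "A \<subseteq> (\<Union>i. C i)" "\<And>i. bounded (C i)" "\<And>i. diameter (C i) \<le> \<delta>"
  shows "hausdorff_pre d \<delta> A \<le> (\<Sum>i. hausdorff_weight d (C i))"
  unfolding hausdorff_pre_eq by (rule Inf_lower) (use assms in blast)

lemma hausdorff_pre_less:
  assumes "hausdorff_pre d \<delta> A < e"
  obtains C where "A \<subseteq> (\<Union>i. C i)" "\<And>i. bounded (C i)" "\<And>i. diameter (C i) \<le> \<delta>" "(\<Sum>i. hausdorff_weight d (C i)) < e"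
  using assms unfolding hausdorff_pre_eq Inf_less_iff by blast

lemma hausdorff_pre_mono: "A \<subseteq> B \<Longrightarrow> hausdorff_pre d \<delta> A \<le> hausdorff_pre d \<delta> B"
  unfolding hausdorff_pre_eq by (rule Inf_superset_mono) blast

lemma hausdorff_pre_antimono: "\<delta> \<le> \<epsilon> \<Longrightarrow> hausdorff_pre d \<epsilon> A \<le> hausdorff_pre d \<delta> A"
  unfolding hausdorff_pre_eq by (rule Inf_superset_mono) (auto intro: order_trans)

lemma hausdorff_pre_le_outer: "0 < \<delta> \<Longrightarrow> hausdorff_pre d \<delta> A \<le> hausdorff_outer d A"
  unfolding hausdorff_outer_def by (rule SUP_upper) simp

lemma hausdorff_outer_mono: "A \<subseteq> B \<Longrightarrow> hausdorff_outer d A \<le> hausdorff_outer d B"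
  unfolding hausdorff_outer_def by (rule SUP_mono) (use hausdorff_pre_mono in blast)

lemma hausdorff_outer_empty: "hausdorff_outer d {} = 0"
proof -
  have "hausdorff_pre d \<delta> ({} :: 'a set) = 0" if "0 < \<delta>" for \<delta>
    using hausdorff_pre_le[of "{}" "\<lambda>_. {}" \<delta> d] that by (simp add: hausdorff_weight_empty diameter_def)
  then show ?thesis by (simp add: hausdorff_outer_def cong: SUP_cong_simp)
qed

lemma hausdorff_pre_subadditive: "hausdorff_pre d \<delta> (\<Union>n. A n) \<le> (\<Sum>n. hausdorff_pre d \<delta> (A (n::nat)))"
proof (cases "(\<Sum>n. hausdorff_pre d \<delta> (A n)) = top")
  case False
  have fin: "hausdorff_pre d \<delta> (A n) < top" for n
    using False by (metis ennreal_suminf_lessD less_top)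
  show ?thesis
  proof (rule ennreal_le_epsilon)
    fix e :: real assume e: "0 < e"
    have "\<exists>C. A n \<subseteq> (\<Union>i. C i) \<and> (\<forall>i. bounded (C i)) \<and> (\<forall>i. diameter (C i) \<le> \<delta>) \<and>
        (\<Sum>i. hausdorff_weight d (C i)) \<le> hausdorff_pre d \<delta> (A n) + ennreal (e * (1/2)^Suc n)" for n
    proof -
      have "hausdorff_pre d \<delta> (A n) < hausdorff_pre d \<delta> (A n) + ennreal (e * (1/2)^Suc n)"
        using fin[of n] e by (cases "hausdorff_pre d \<delta> (A n)") (auto simp flip: ennreal_plus intro!: ennreal_lessI add_nonneg_pos)
      then show ?thesis by (rule hausdorff_pre_less) (meson less_imp_le)
    qed
    then obtain C where C: "\<And>n. A n \<subseteq> (\<Union>i. C n i)" "\<And>n i. bounded (C n i)" "\<And>n i. diameter (C n i) \<le> \<delta>"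
      "\<And>n. (\<Sum>i. hausdorff_weight d (C n i)) \<le> hausdorff_pre d \<delta> (A n) + ennreal (e * (1/2)^Suc n)"
      by metis
    have "hausdorff_pre d \<delta> (\<Union>n. A n) \<le> (\<Sum>i. hausdorff_weight d ((\<lambda>(m, n). C m n) (prod_decode i)))"
    proof (rule hausdorff_pre_le)
      show "(\<Union>n. A n) \<subseteq> (\<Union>i. (\<lambda>(m, n). C m n) (prod_decode i))"
      proof
        fix x assume "x \<in> (\<Union>n. A n)"
        then obtain m n where "x \<in> C m n" using C(1) by blast
        then have "x \<in> (\<lambda>(m, n). C m n) (prod_decode (prod_encode (m, n)))" by simp
        then show "x \<in> (\<Union>i. (\<lambda>(m, n). C m n) (prod_decode i))" by (intro UN_I[OF UNIV_I])
      qed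
    qed (auto simp: C split: prod.split)
    also have "\<dots> = (\<Sum>m. \<Sum>n. hausdorff_weight d (C m n))"
      using suminf_ennreal_2dimen[where f="\<lambda>p. hausdorff_weight d ((\<lambda>(m, n). C m n) p)"
          and g="\<lambda>m. \<Sum>n. hausdorff_weight d (C m n)"] by simp
    also have "\<dots> \<le> (\<Sum>n. hausdorff_pre d \<delta> (A n) + ennreal (e * (1/2)^Suc n))"
      by (intro suminf_le C) auto
    also have "\<dots> = (\<Sum>n. hausdorff_pre d \<delta> (A n)) + (\<Sum>n. ennreal (e * (1/2)^Suc n))"
      by (rule suminf_add[symmetric]) auto
    also have "(\<Sum>n. ennreal (e * (1/2)^Suc n)) = ennreal e"
      using e sums_mult[OF power_half_series, of e] by (intro suminf_ennreal_eq) auto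
    finally show "hausdorff_pre d \<delta> (\<Union>n. A n) \<le> (\<Sum>n. hausdorff_pre d \<delta> (A n)) + ennreal e" .
  qed
qed simp

lemma hausdorff_outer_subadditive: "hausdorff_outer d (\<Union>n. A n) \<le> (\<Sum>n. hausdorff_outer d (A (n::nat)))"
proof -
  have "hausdorff_pre d \<delta> (\<Union>n. A n) \<le> (\<Sum>n. hausdorff_outer d (A n))" if "0 < \<delta>" for \<delta>
    by (rule order_trans[OF hausdorff_pre_subadditive])
       (intro suminf_le hausdorff_pre_le_outer that, auto)
  then show ?thesis unfolding hausdorff_outer_def[of d "\<Union>n. A n"] by (intro SUP_least) auto
qed

lemma hausdorff_outer_Un_le: "hausdorff_outer d (A \<union> B) \<le> hausdorff_outer d A + hausdorff_outer d B"
proof -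
  let ?S = "\<lambda>n::nat. if n = 0 then A else if n = 1 then B else {}"
  have "(\<Union>n. ?S n) = A \<union> B" by (auto split: if_splits)
  then have "hausdorff_outer d (A \<union> B) \<le> (\<Sum>n. hausdorff_outer d (?S n))"
    using hausdorff_outer_subadditive[of d ?S] by simp
  also have "\<dots> = (\<Sum>n<2. hausdorff_outer d (?S n))"
    by (rule suminf_finite) (auto simp: hausdorff_outer_empty)
  finally show ?thesis by (simp add: numeral_2_eq_2)
qed

text \<open>A set of diameter below \<open>e\<close> cannot meet both \<open>A\<close> and
  \<open>B\<close>, so a fine cover of the union splits into a cover of each.\<close>

lemma hausdorff_outer_metric:
  assumes e: "0 < e" and AB: "\<And>a b. a \<in> A \<Longrightarrow> b \<in> B \<Longrightarrow> e \<le> dist a b"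
  shows "hausdorff_outer d A + hausdorff_outer d B \<le> hausdorff_outer d (A \<union> B)"
proof -
  have pre: "hausdorff_pre d \<delta> A + hausdorff_pre d \<delta> B \<le> hausdorff_pre d \<delta> (A \<union> B)" if \<delta>: "0 < \<delta>" "\<delta> < e" for \<delta>
    unfolding hausdorff_pre_eq[of d \<delta> "A \<union> B"]
  proof (rule Inf_greatest, clarify)
    fix C :: "nat \<Rightarrow> 'a set"
    assume C: "A \<union> B \<subseteq> (\<Union>i. C i)" "\<forall>i. bounded (C i) \<and> diameter (C i) \<le> \<delta>"
    define CA where "CA i = (if C i \<inter> A = {} then {} else C i)" for i
    define CB where "CB i = (if C i \<inter> B = {} then {} else C i)" for i
    have no: "C i \<inter> A = {} \<or> C i \<inter> B = {}" for i
    proof (rule ccontr)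
      assume "\<not> ?thesis"
      then obtain a b where ab: "a \<in> C i" "a \<in> A" "b \<in> C i" "b \<in> B" by blast
      then have "dist a b \<le> diameter (C i)" using C(2) by (intro diameter_bounded_bound) auto
      then show False using AB[OF ab(2,4)] C(2) \<delta> by (meson not_le order_trans)
    qed
    have d0: "diameter ({} :: 'a set) \<le> \<delta>" using \<delta> by (simp add: diameter_def)
    have "hausdorff_pre d \<delta> A \<le> (\<Sum>i. hausdorff_weight d (CA i))"
    proof (rule hausdorff_pre_le)
      show "A \<subseteq> (\<Union>i. CA i)" using C(1) by (force simp: CA_def)
    qed (use C(2) d0 in \<open>auto simp: CA_def\<close>)
    moreover have "hausdorff_pre d \<delta> B \<le> (\<Sum>i. hausdorff_weight d (CB i))"
    proof (rule hausdorff_pre_le)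
      show "B \<subseteq> (\<Union>i. CB i)" using C(1) by (force simp: CB_def)
    qed (use C(2) d0 in \<open>auto simp: CB_def\<close>)
    ultimately have "hausdorff_pre d \<delta> A + hausdorff_pre d \<delta> B
        \<le> (\<Sum>i. hausdorff_weight d (CA i)) + (\<Sum>i. hausdorff_weight d (CB i))"
      by (rule add_mono)
    also have "\<dots> = (\<Sum>i. hausdorff_weight d (CA i) + hausdorff_weight d (CB i))"
      by (rule suminf_add) auto
    also have "\<dots> \<le> (\<Sum>i. hausdorff_weight d (C i))"
    proof (rule suminf_le)
      show "hausdorff_weight d (CA i) + hausdorff_weight d (CB i) \<le> hausdorff_weight d (C i)" for i
        using no[of i] by (auto simp: CA_def CB_def hausdorff_weight_empty)
    qed auto
    finally show "hausdorff_pre d \<delta> A + hausdorff_pre d \<delta> B \<le> (\<Sum>i. hausdorff_weight d (C i))" .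
  qed
  \<comment> \<open>The pre-measures grow as \<delta> shrinks, so both suprema may be taken along a
    common \<delta>.\<close>
  have "hausdorff_outer d A + hausdorff_outer d B = (SUP \<delta>\<in>{0<..}. hausdorff_pre d \<delta> A + hausdorff_pre d \<delta> B)"
    unfolding hausdorff_outer_def
  proof (rule SUP_add_directed_ennreal[symmetric])
    fix \<delta> \<epsilon> :: real assume "\<delta> \<in> {0<..}" "\<epsilon> \<in> {0<..}"
    then show "\<exists>k\<in>{0<..}. hausdorff_pre d \<delta> A + hausdorff_pre d \<epsilon> B \<le> hausdorff_pre d k A + hausdorff_pre d k B"
      by (intro bexI[of _ "min \<delta> \<epsilon>"] add_mono hausdorff_pre_antimono) auto
  qed
  also have "\<dots> \<le> hausdorff_outer d (A \<union> B)"
  proof (rule SUP_least)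
    fix \<delta> :: real assume "\<delta> \<in> {0<..}"
    then have k: "0 < min \<delta> (e/2)" "min \<delta> (e/2) < e" using e by auto
    have "hausdorff_pre d \<delta> A + hausdorff_pre d \<delta> B
        \<le> hausdorff_pre d (min \<delta> (e/2)) A + hausdorff_pre d (min \<delta> (e/2)) B"
      by (intro add_mono hausdorff_pre_antimono) auto
    also have "\<dots> \<le> hausdorff_outer d (A \<union> B)"
      using pre[OF k] hausdorff_pre_le_outer[OF k(1)] by (rule order_trans)
    finally show "hausdorff_pre d \<delta> A + hausdorff_pre d \<delta> B \<le> hausdorff_outer d (A \<union> B)" .
  qed
  finally show ?thesis .
qed

lemma ennreal_suminf_tail:
  fixes f :: "nat \<Rightarrow> ennreal"
  assumes "(\<Sum>i. f i) < top" "0 < e"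
  obtains k where "(\<Sum>i. f (i + k)) \<le> ennreal e"
proof -
  have ft: "f i < top" for i using assms(1) by (metis ennreal_suminf_lessD)
  define g where "g i = enn2real (f i)" for i
  have fg: "f i = ennreal (g i)" for i using ft by (simp add: g_def)
  have g0: "0 \<le> g i" for i by (simp add: g_def)
  have s: "summable g"
    using assms(1) g0 by (intro summable_suminf_not_top) (auto simp: fg)
  obtain k where k: "norm (\<Sum>i. g (i + k)) < e" using suminf_exist_split[OF assms(2) s] by blast
  have "(\<Sum>i. f (i + k)) = ennreal (\<Sum>i. g (i + k))"
    unfolding fg by (rule suminf_ennreal2) (use g0 s in \<open>auto simp: summable_iff_shift\<close>)
  also have "\<dots> \<le> ennreal e" using k by (intro ennreal_leI) auto
  finally show thesis by (rule that)
qed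

text \<open>The shells \<open>1 / (j + 2) \<le> infdist x A < 1 / (j + 1)\<close> whose indices have equal parity keep a positive
  distance from each other, so the measures of all shells sum up to at most twice that of \<open>T\<close>.\<close>
lemma hausdorff_outer_closed_split:
  assumes A: "closed (A :: 'a::metric_space set)"
  shows "hausdorff_outer d (A \<inter> T) + hausdorff_outer d (T - A) \<le> hausdorff_outer d T"
proof (cases "hausdorff_outer d T = top \<or> A = {}")
  case True
  then show ?thesis by (auto simp: hausdorff_outer_empty)
next
  case False
  let ?\<mu> = "hausdorff_outer d"
  define D where "D x = infdist x A" for x
  define R where "R j = {x \<in> T. 1 / real (j + 2) \<le> D x \<and> D x < 1 / real (j + 1)}" for j
  define B where "B k = {x \<in> T. 1 / real (k + 1) \<le> D x}" for k
  have Dl: "D x \<le> D y + dist x y" for x y unfolding D_def by (rule infdist_triangle)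
  have shells: "(\<Sum>j<m. ?\<mu> (R (2 * j + p))) \<le> ?\<mu> (\<Union>j<m. R (2 * j + p))" for m p
  proof (induction m)
    case (Suc m)
    have "?\<mu> (\<Union>j<m. R (2 * j + p)) + ?\<mu> (R (2 * m + p)) \<le> ?\<mu> ((\<Union>j<m. R (2 * j + p)) \<union> R (2 * m + p))"
    proof (cases "m = 0")
      case False
      show ?thesis
      proof (rule hausdorff_outer_metric)
        \<comment> \<open>On the earlier shells of this parity the distance to \<open>A\<close> is
          at least 1 / (2 m + p), on the new one it is below 1 / (2 m + p + 1).\<close>
        show "0 < 1 / real (2 * m + p) - 1 / real (2 * m + p + 1)"
        proof -
          have "1 / real (2 * m + p + 1) < 1 / real (2 * m + p)"
            using False by (intro divide_strict_left_mono) auto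
          then show ?thesis by simp
        qed
        fix a b assume "a \<in> (\<Union>j<m. R (2 * j + p))" "b \<in> R (2 * m + p)"
        then obtain j where j: "j < m" "1 / real (2 * j + p + 2) \<le> D a" "D b < 1 / real (2 * m + p + 1)"
          by (auto simp: R_def)
        have "1 / real (2 * m + p) \<le> 1 / real (2 * j + p + 2)" using j(1) False by (intro divide_left_mono) auto
        then show "1 / real (2 * m + p) - 1 / real (2 * m + p + 1) \<le> dist a b"
          using j Dl[of a b] by linarith
      qed
    qed (simp add: hausdorff_outer_empty)
    moreover have "(\<Union>j<Suc m. R (2 * j + p)) = (\<Union>j<m. R (2 * j + p)) \<union> R (2 * m + p)"
      by (auto simp: less_Suc_eq)
    ultimately show ?case using Suc by (simp add: add_right_mono order_trans[OF add_right_mono])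
  qed (simp add: hausdorff_outer_empty)
  have sum: "(\<Sum>j. ?\<mu> (R (2 * j + p))) \<le> ?\<mu> T" for p
    by (rule suminf_le_const, simp, rule order_trans[OF shells hausdorff_outer_mono]) (auto simp: R_def)
  have fin: "(\<Sum>j. ?\<mu> (R (2 * j + p))) < top" for p
    using False le_less_trans[OF sum] by (simp add: less_top)
  show ?thesis
  proof (rule ennreal_le_epsilon)
    fix e :: real assume e: "0 < e"
    obtain k0 where k0: "(\<Sum>i. ?\<mu> (R (2 * (i + k0) + 0))) \<le> ennreal (e/2)"
      using ennreal_suminf_tail[OF fin[of 0], of "e/2"] e by auto
    obtain k1 where k1: "(\<Sum>i. ?\<mu> (R (2 * (i + k1) + 1))) \<le> ennreal (e/2)"
      using ennreal_suminf_tail[OF fin[of 1], of "e/2"] e by auto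
    \<comment> \<open>Even, and at least 2 k0 and 2 k1, so that a shell of index j >= k belongs to
      the tail of its own parity.\<close>
    define k where "k = 2 * (k0 + k1)"
    let ?U = "\<lambda>k p. \<Union>i. R (2 * (i + k) + p)"
    have "T - A \<subseteq> B k \<union> (?U k0 0 \<union> ?U k1 1)"
    proof
      fix x assume x: "x \<in> T - A"
      then have D0: "0 < D x" unfolding D_def using A False
        by (metis Diff_iff in_closed_iff_infdist_zero infdist_nonneg less_eq_real_def)
      show "x \<in> B k \<union> (?U k0 0 \<union> ?U k1 1)"
      proof (cases "1 / real (k + 1) \<le> D x")
        case False
        \<comment> \<open>The index of the shell is determined by j + 1 < 1 / D x <= j + 2.\<close>
        define j where "j = nat \<lceil>1 / D x\<rceil> - 2"
        have "real (k + 1) < 1 / D x" using False D0 by (simp add: field_simps)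
        then have c: "real (k + 1) < real_of_int \<lceil>1 / D x\<rceil>" by linarith
        then have c2: "int k + 2 \<le> \<lceil>1 / D x\<rceil>" by linarith
        then have j: "real j + 2 = real_of_int \<lceil>1 / D x\<rceil>" "k \<le> j" unfolding j_def by linarith+
        have "1 / D x \<le> real j + 2" "real j + 1 < 1 / D x" using j(1) by linarith+
        then have "x \<in> R j" using D0 x by (simp add: R_def field_simps)
        show ?thesis
        proof (cases "even j")
          case True
          have "\<exists>i. j = 2 * (i + k0) + 0"
            by (rule exI[of _ "j div 2 - k0"]) (use True j(2) in \<open>unfold k_def, presburger\<close>)
          then have "x \<in> ?U k0 0" using \<open>x \<in> R j\<close> by blast
          then show ?thesis by blast
        next
          case False
          have "\<exists>i. j = 2 * (i + k1) + 1"
            by (rule exI[of _ "j div 2 - k1"]) (use False j(2) in \<open>unfold k_def, presburger\<close>)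
          then have "x \<in> ?U k1 1" using \<open>x \<in> R j\<close> by blast
          then show ?thesis by blast
        qed
      qed (use x in \<open>auto simp: B_def\<close>)
    qed
    then have "?\<mu> (T - A) \<le> ?\<mu> (B k \<union> (?U k0 0 \<union> ?U k1 1))" by (rule hausdorff_outer_mono)
    also have "\<dots> \<le> ?\<mu> (B k) + (?\<mu> (?U k0 0) + ?\<mu> (?U k1 1))"
      by (intro order_trans[OF hausdorff_outer_Un_le] add_left_mono hausdorff_outer_Un_le)
    also have "\<dots> \<le> ?\<mu> (B k) + (ennreal (e/2) + ennreal (e/2))"
      by (intro add_left_mono add_mono order_trans[OF hausdorff_outer_subadditive] k0 k1)
    also have "ennreal (e/2) + ennreal (e/2) = ennreal e" using e by (simp flip: ennreal_plus)
    finally have 1: "?\<mu> (T - A) \<le> ?\<mu> (B k) + ennreal e" .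
    have "?\<mu> (A \<inter> T) + ?\<mu> (B k) \<le> ?\<mu> ((A \<inter> T) \<union> B k)"
    proof (rule hausdorff_outer_metric)
      fix a b assume ab: "a \<in> A \<inter> T" "b \<in> B k"
      then have "1 / real (k + 1) \<le> D b" by (simp add: B_def)
      also have "D b \<le> dist b a" unfolding D_def using ab by (intro infdist_le) auto
      finally show "1 / real (k + 1) \<le> dist a b" by (simp add: dist_commute)
    qed simp
    also have "\<dots> \<le> ?\<mu> T" by (rule hausdorff_outer_mono) (auto simp: B_def)
    finally have "?\<mu> (A \<inter> T) + ?\<mu> (B k) \<le> ?\<mu> T" .
    then have 2: "?\<mu> (A \<inter> T) + ?\<mu> (B k) + ennreal e \<le> ?\<mu> T + ennreal e" by (rule add_right_mono)
    show "?\<mu> (A \<inter> T) + ?\<mu> (T - A) \<le> ?\<mu> T + ennreal e"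
      using order_trans[OF add_left_mono[OF 1] 2[unfolded add.assoc]] .
  qed
qed

text \<open>\<open>measure_of\<close> assigns zero to every set unless it is given a measure.
  Caratheodory's construction supplies one: the closed sets are measurable by
  \<open>hausdorff_outer_closed_split\<close>, and they generate the Borel sets.\<close>

lemma measure_space_hausdorff_outer:
  "measure_space (UNIV :: 'a::metric_space set) (sets borel) (hausdorff_outer d)"
proof -
  interpret P: sigma_algebra "UNIV :: 'a set" "Pow UNIV" by (rule sigma_algebra_Pow)
  let ?L = "lambda_system (UNIV :: 'a set) (Pow UNIV) (hausdorff_outer d)"
  have "outer_measure_space (Pow (UNIV :: 'a set)) (hausdorff_outer d)"
    unfolding outer_measure_space_def positive_def increasing_def countably_subadditive_def
    by (auto simp: hausdorff_outer_empty hausdorff_outer_mono hausdorff_outer_subadditive)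
  then have ms: "measure_space UNIV ?L (hausdorff_outer d)"
    using P.caratheodory_lemma by blast
  then have sa: "sigma_algebra UNIV ?L" by (simp add: measure_space_def)
  have cl: "A \<in> ?L" if A: "closed A" for A :: "'a set"
  proof -
    have "hausdorff_outer d (A \<inter> T) + hausdorff_outer d ((UNIV - A) \<inter> T) = hausdorff_outer d T" for T
    proof (rule antisym)
      have e: "(UNIV - A) \<inter> T = T - A" by auto
      show "hausdorff_outer d (A \<inter> T) + hausdorff_outer d ((UNIV - A) \<inter> T) \<le> hausdorff_outer d T"
        unfolding e by (rule hausdorff_outer_closed_split[OF A])
      have "hausdorff_outer d T \<le> hausdorff_outer d ((A \<inter> T) \<union> ((UNIV - A) \<inter> T))"
        by (rule hausdorff_outer_mono) auto
      also have "\<dots> \<le> hausdorff_outer d (A \<inter> T) + hausdorff_outer d ((UNIV - A) \<inter> T)"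
        by (rule hausdorff_outer_Un_le)
      finally show "hausdorff_outer d T \<le> hausdorff_outer d (A \<inter> T) + hausdorff_outer d ((UNIV - A) \<inter> T)" .
    qed
    then show ?thesis by (simp add: lambda_system_def)
  qed
  have "sets (borel :: 'a measure) = sigma_sets UNIV (Collect closed)"
    by (subst borel_eq_closed) simp
  also have "\<dots> \<subseteq> ?L"
    using sigma_algebra.sigma_sets_subset[OF sa, of "Collect closed"] cl by auto
  finally have "sets (borel :: 'a measure) \<subseteq> ?L" .
  moreover have "sigma_algebra UNIV (sets (borel :: 'a measure))"
    by (metis sets.sigma_algebra_axioms space_borel)
  ultimately show ?thesis using measure_down[OF ms] by blast
qed

lemma sets_hausdorff_measure: "sets (hausdorff_measure d) = sets borel"
  unfolding hausdorff_measure_def by (metis sets.sigma_sets_eq sets_measure_of space_borel subset_Pow_Union top_greatest Pow_UNIV)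

lemma space_hausdorff_measure: "space (hausdorff_measure d) = UNIV"
  by (simp add: hausdorff_measure_def)

lemma emeasure_hausdorff_measure:
  assumes "A \<in> sets borel"
  shows "emeasure (hausdorff_measure d) A = hausdorff_outer d A"
  unfolding hausdorff_measure_def
  using measure_space_hausdorff_outer[where 'a='a, of d] assms
  by (intro emeasure_measure_of_sigma) (auto simp: measure_space_def)

section \<open>The measure of the sphere\<close>

text \<open>The cone over a cap of radius r is covered by about 1 / r balls of radius 2 r centred on
  the ray through \<omega>: a point is within r of the ray, and the next centre within another r.
  The number of balls is at most 1 / r + 2 <= 3 / r.\<close>

lemma radial_tube_covered:
  fixes \<omega> :: "real^'n"
  assumes \<omega>: "norm \<omega> = 1" and r: "0 < r" "r \<le> 1"
  obtains T where "T \<in> sets borel" "{x. x \<noteq> 0 \<and> norm x \<le> 1 \<and> dist (x /\<^sub>R norm x) \<omega> \<le> r} \<subseteq> T"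
    "emeasure lborel T \<le> ennreal (3 * unit_ball_vol (real CARD('n)) * 2 ^ CARD('n) * r ^ (CARD('n) - 1))"
proof -
  define m where "m = nat \<lceil>1 / r\<rceil>"
  define T where "T = (\<Union>j\<le>m. cball ((real j * r) *\<^sub>R \<omega>) (2 * r))"
  have "T \<in> sets borel" by (simp add: T_def)
  moreover have "{x. x \<noteq> 0 \<and> norm x \<le> 1 \<and> dist (x /\<^sub>R norm x) \<omega> \<le> r} \<subseteq> T"
  proof clarify
    fix x :: "real^'n" assume x: "x \<noteq> 0" "norm x \<le> 1" "dist (x /\<^sub>R norm x) \<omega> \<le> r"
    define j where "j = nat \<lfloor>norm x / r\<rfloor>"
    have jr: "real j \<le> norm x / r" "norm x / r < real j + 1"
      using r unfolding j_def by (auto simp: of_nat_nat floor_le_iff)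
    have "norm x / r \<le> 1 / r" using x r by (simp add: divide_right_mono)
    then have "real j \<le> 1 / r" using jr by linarith
    then have jm: "j \<le> m" unfolding m_def by linarith
    have "norm (x - norm x *\<^sub>R \<omega>) = norm x * dist (x /\<^sub>R norm x) \<omega>"
    proof -
      have "x - norm x *\<^sub>R \<omega> = norm x *\<^sub>R (x /\<^sub>R norm x - \<omega>)" using x(1) by (simp add: scaleR_diff_right)
      then show ?thesis by (simp add: dist_norm)
    qed
    also have "\<dots> \<le> 1 * r" using x r by (intro mult_mono) auto
    finally have a: "norm (x - norm x *\<^sub>R \<omega>) \<le> r" by simp
    have "\<bar>norm x - real j * r\<bar> \<le> r" using jr r by (simp add: field_simps abs_le_iff)
    then have b: "norm (norm x *\<^sub>R \<omega> - (real j * r) *\<^sub>R \<omega>) \<le> r"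
      using \<omega> by (simp flip: scaleR_left_diff_distrib)
    have "norm (x - (real j * r) *\<^sub>R \<omega>) \<le> 2 * r"
      using norm_triangle_ineq[of "x - norm x *\<^sub>R \<omega>" "norm x *\<^sub>R \<omega> - (real j * r) *\<^sub>R \<omega>"] a b by simp
    then show "x \<in> T" using jm unfolding T_def by (auto simp: dist_norm norm_minus_commute)
  qed
  moreover have "emeasure lborel T \<le> ennreal (3 * unit_ball_vol (real CARD('n)) * 2 ^ CARD('n) * r ^ (CARD('n) - 1))"
  proof -
    let ?v = "unit_ball_vol (real CARD('n)) * (2 * r) ^ CARD('n)"
    have "emeasure lborel T \<le> (\<Sum>j\<le>m. emeasure lborel (cball ((real j * r) *\<^sub>R \<omega>) (2 * r)))"
      unfolding T_def by (rule emeasure_subadditive_finite) auto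
    also have "\<dots> = (\<Sum>j\<le>m. ennreal ?v)" using r by (simp add: emeasure_cball)
    also have "\<dots> = ennreal (real (Suc m) * ?v)"
      using r by (simp add: ennreal_of_nat_eq_real_of_nat ennreal_mult')
    also have "\<dots> \<le> ennreal (3 / r * ?v)"
    proof (intro ennreal_leI mult_right_mono)
      have "real m \<le> 1 / r + 1" unfolding m_def using r by (simp add: of_nat_nat)
      moreover have "1 \<le> 1 / r" using r by simp
      ultimately show "real (Suc m) \<le> 3 / r" by simp
    qed (use r in auto)
    also have "3 / r * ?v = 3 * unit_ball_vol (real CARD('n)) * 2 ^ CARD('n) * r ^ (CARD('n) - 1)"
      using r power_minus_mult[of "CARD('n)" r] by (simp add: power_mult_distrib field_simps)
    finally show ?thesis .
  qed
  ultimately show thesis by (rule that)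
qed

text \<open>The matching lower bound comes from about 1 / (3 r) disjoint balls of radius r / 4
  strung along \<omega>.\<close>

lemma radial_tube_contains:
  fixes \<omega> :: "real^'n"
  assumes \<omega>: "norm \<omega> = 1" and r: "0 < r" "r \<le> 1/2"
  obtains Q where "Q \<in> sets borel" "Q \<subseteq> {x. 1/2 \<le> norm x \<and> norm x \<le> 1 \<and> dist (x /\<^sub>R norm x) \<omega> \<le> r}"
    "ennreal (unit_ball_vol (real CARD('n)) / (3 * 4 ^ CARD('n)) * r ^ (CARD('n) - 1)) \<le> emeasure lborel Q"
proof -
  \<comment> \<open>The centres lie in [5/8, 7/8] and s <= 1/8, so the balls stay in 1/2 <= |x| <=
    1. The spacing 3 s exceeds the diameter 2 s, and an offset of 2 s at distance at least 1/2 from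
    the origin changes the direction by at most 4 s = r.\<close>
  define s where "s = r / 4"
  define m where "m = nat \<lfloor>1 / (3 * r)\<rfloor>"
  define t where "t j = 5/8 + 3 * s * real j" for j
  define Q where "Q = (\<Union>j\<le>m. cball (t j *\<^sub>R \<omega>) s)"
  have s: "0 < s" "s \<le> 1/8" using r by (auto simp: s_def)
  have mr: "real m \<le> 1 / (3 * r)" "1 / (3 * r) < real m + 1"
    using r unfolding m_def by (auto simp: of_nat_nat)
  have tj: "5/8 \<le> t j" "t j \<le> 7/8" if "j \<le> m" for j
  proof -
    have "3 * s * real j \<le> 3 * s * (1 / (3 * r))" using that mr(1) s by (intro mult_left_mono) auto
    also have "\<dots> = 1/4" using r by (simp add: s_def)
    finally show "t j \<le> 7/8" by (simp add: t_def)
    show "5/8 \<le> t j" using s by (simp add: t_def)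
  qed
  have "Q \<in> sets borel" by (simp add: Q_def)
  moreover have "Q \<subseteq> {x. 1/2 \<le> norm x \<and> norm x \<le> 1 \<and> dist (x /\<^sub>R norm x) \<omega> \<le> r}"
  proof
    fix x assume "x \<in> Q"
    then obtain j where j: "j \<le> m" "norm (x - t j *\<^sub>R \<omega>) \<le> s"
      by (auto simp: Q_def dist_norm norm_minus_commute)
    have nt: "norm (t j *\<^sub>R \<omega>) = t j" using tj[OF j(1)] \<omega> by simp
    have nx: "\<bar>norm x - t j\<bar> \<le> s" using norm_triangle_ineq3[of x "t j *\<^sub>R \<omega>"] j(2) nt by simp
    then have h: "1/2 \<le> norm x" "norm x \<le> 1" using tj[OF j(1)] s by linarith+
    have "norm (t j *\<^sub>R \<omega> - norm x *\<^sub>R \<omega>) \<le> s"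
      using nx \<omega> by (simp add: abs_minus_commute flip: scaleR_left_diff_distrib)
    then have d: "norm (x - norm x *\<^sub>R \<omega>) \<le> 2 * s"
      using norm_triangle_ineq[of "x - t j *\<^sub>R \<omega>" "t j *\<^sub>R \<omega> - norm x *\<^sub>R \<omega>"] j(2) by simp
    have "norm x * dist (x /\<^sub>R norm x) \<omega> = norm (x - norm x *\<^sub>R \<omega>)"
    proof -
      have "x \<noteq> 0" using h(1) by auto
      then have "x - norm x *\<^sub>R \<omega> = norm x *\<^sub>R (x /\<^sub>R norm x - \<omega>)" by (simp add: scaleR_diff_right)
      then show ?thesis by (simp add: dist_norm)
    qed
    then have "norm x * dist (x /\<^sub>R norm x) \<omega> \<le> r / 2" using d by (simp add: s_def)
    moreover have "1/2 * dist (x /\<^sub>R norm x) \<omega> \<le> norm x * dist (x /\<^sub>R norm x) \<omega>"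
      using h by (intro mult_right_mono) auto
    ultimately have "dist (x /\<^sub>R norm x) \<omega> \<le> r" by simp
    then show "x \<in> {x. 1/2 \<le> norm x \<and> norm x \<le> 1 \<and> dist (x /\<^sub>R norm x) \<omega> \<le> r}" using h by simp
  qed
  moreover have "ennreal (unit_ball_vol (real CARD('n)) / (3 * 4 ^ CARD('n)) * r ^ (CARD('n) - 1)) \<le> emeasure lborel Q"
  proof -
    let ?v = "unit_ball_vol (real CARD('n)) * s ^ CARD('n)"
    have disj: "disjoint_family_on (\<lambda>j. cball (t j *\<^sub>R \<omega>) s) {..m}"
      unfolding disjoint_family_on_def
    proof (intro ballI impI)
      fix i j assume "i \<in> {..m}" "j \<in> {..m}" and ij: "i \<noteq> j"
      show "cball (t i *\<^sub>R \<omega>) s \<inter> cball (t j *\<^sub>R \<omega>) s = {}"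
      proof (rule ccontr)
        assume "\<not> ?thesis"
        then obtain x where "dist (t i *\<^sub>R \<omega>) x \<le> s" "dist (t j *\<^sub>R \<omega>) x \<le> s" by auto
        then have "dist (t i *\<^sub>R \<omega>) (t j *\<^sub>R \<omega>) \<le> 2 * s"
          using dist_triangle2[of "t i *\<^sub>R \<omega>" "t j *\<^sub>R \<omega>" x] by linarith
        moreover have "dist (t i *\<^sub>R \<omega>) (t j *\<^sub>R \<omega>) = \<bar>t i - t j\<bar>"
          using \<omega> by (simp add: dist_norm flip: scaleR_left_diff_distrib)
        moreover have "\<bar>t i - t j\<bar> = 3 * s * \<bar>real i - real j\<bar>"
        proof -
          have "t i - t j = 3 * s * (real i - real j)" by (simp add: t_def algebra_simps)
          then show ?thesis using s by (simp add: abs_mult)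
        qed
        moreover have "1 \<le> \<bar>real i - real j\<bar>" using ij by linarith
        then have "3 * s * 1 \<le> 3 * s * \<bar>real i - real j\<bar>" using s by (intro mult_left_mono) auto
        ultimately show False using s by linarith
      qed
    qed
    have "ennreal (unit_ball_vol (real CARD('n)) / (3 * 4 ^ CARD('n)) * r ^ (CARD('n) - 1)) = ennreal (1 / (3 * r) * ?v)"
      using r power_minus_mult[of "CARD('n)" r] by (simp add: s_def power_divide field_simps)
    also have "\<dots> \<le> ennreal (real (Suc m) * ?v)"
      using mr s by (intro ennreal_leI mult_right_mono) auto
    also have "\<dots> = (\<Sum>j\<le>m. ennreal ?v)"
      using s by (simp add: ennreal_of_nat_eq_real_of_nat ennreal_mult')
    also have "\<dots> = (\<Sum>j\<le>m. emeasure lborel (cball (t j *\<^sub>R \<omega>) s))" using s by (simp add: emeasure_cball)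
    also have "\<dots> = emeasure lborel Q"
      unfolding Q_def by (rule sum_emeasure) (use disj in auto)
    finally show ?thesis .
  qed
  ultimately show thesis by (rule that)
qed

lemma negligible_emeasure_lborel:
  assumes "\<And>e. 0 < e \<Longrightarrow> \<exists>T. T \<in> sets borel \<and> S \<subseteq> T \<and> emeasure lborel T \<le> ennreal e"
  shows "negligible (S :: 'a::euclidean_space set)"
  unfolding negligible_outer_le
proof (intro allI impI)
  fix e :: real assume e: "0 < e"
  obtain T where T: "T \<in> sets borel" "S \<subseteq> T" "emeasure lborel T \<le> ennreal e" using assms[OF e] by blast
  have "T \<in> lmeasurable" using T by (intro fmeasurableI) (auto intro: le_less_trans)
  moreover have "measure lebesgue T \<le> e"
    using T e by (simp add: measure_def enn2real_leI)
  ultimately show "\<exists>T. S \<subseteq> T \<and> T \<in> lmeasurable \<and> measure lebesgue T \<le> e" using T(2) by blast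
qed

text \<open>Each member of a fine cover of \<open>N\<close> is replaced by the tube over a cap
  around one of its points, whose volume is comparable to the Hausdorff weight of that
  member.\<close>

lemma negligible_cone:
  fixes N :: "(real^'n) set"
  assumes n: "2 \<le> CARD('n)" and N: "N \<subseteq> sphere 0 1" and z: "hausdorff_outer (CARD('n) - 1) N = 0"
  shows "negligible {x. x \<noteq> 0 \<and> norm x \<le> 1 \<and> x /\<^sub>R norm x \<in> N}"
proof (rule negligible_emeasure_lborel)
  fix e :: real assume e: "0 < e"
  define d where "d = CARD('n) - 1"
  have d: "1 \<le> d" using n by (simp add: d_def)
  define K where "K = 3 * unit_ball_vol (real CARD('n)) * 2 ^ CARD('n)"
  define B where "B = unit_ball_vol (real d) / 2 ^ d"
  have K: "0 < K" and B: "0 < B" by (auto simp: K_def B_def)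
  \<comment> \<open>Total weight q costs volume K q / B = e / 2; the other half of e pays for
    enlarging the radii.\<close>
  define q where "q = B * e / (2 * K)"
  have q: "0 < q" using K B e by (simp add: q_def)
  have "hausdorff_pre d (1/2) N < ennreal q"
    using hausdorff_pre_le_outer[of "1/2" d N] z q by (simp add: d_def)
  then obtain C where C: "N \<subseteq> (\<Union>i. C i)" "\<And>i. bounded (C i)" "\<And>i. diameter (C i) \<le> 1/2"
    "(\<Sum>i. hausdorff_weight d (C i)) < ennreal q" by (rule hausdorff_pre_less) blast
  have "\<exists>T. T \<in> sets borel \<and> {x. x \<noteq> 0 \<and> norm x \<le> 1 \<and> x /\<^sub>R norm x \<in> N \<inter> C i} \<subseteq> T \<and>
      emeasure lborel T \<le> ennreal (K / B) * hausdorff_weight d (C i) + ennreal (e / 2 * (1/2) ^ Suc i)" for i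
  proof (cases "N \<inter> C i = {}")
    case False
    then obtain \<omega> where \<omega>: "\<omega> \<in> N" "\<omega> \<in> C i" by blast
    have w: "norm \<omega> = 1" using N \<omega> by auto
    \<comment> \<open>The diameter may be 0, whereas a tube needs a positive radius; a radius
      slightly above the diameter costs arbitrarily little.\<close>
    have "((\<lambda>r. K * r ^ d) \<longlongrightarrow> K * diameter (C i) ^ d) (at_right (diameter (C i)))"
      by (intro tendsto_intros)
    moreover have "K * diameter (C i) ^ d < K * diameter (C i) ^ d + e / 2 * (1/2) ^ Suc i" using e by simp
    ultimately have "\<forall>\<^sub>F r in at_right (diameter (C i)). K * r ^ d < K * diameter (C i) ^ d + e / 2 * (1/2) ^ Suc i"
      by (rule order_tendstoD(2))
    moreover have "\<forall>\<^sub>F r in at_right (diameter (C i)). diameter (C i) < r \<and> r < 1"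
      using C(3)[of i] by (auto simp: eventually_at_right_field intro!: exI[of _ 1])
    ultimately have "\<forall>\<^sub>F r in at_right (diameter (C i)). (K * r ^ d < K * diameter (C i) ^ d + e / 2 * (1/2) ^ Suc i)
        \<and> diameter (C i) < r \<and> r < 1"
      by (rule eventually_conj)
    then obtain r where r: "K * r ^ d < K * diameter (C i) ^ d + e / 2 * (1/2) ^ Suc i" "diameter (C i) < r" "r < 1"
      using eventually_happens'[OF trivial_limit_at_right_real] by blast
    have r0: "0 < r" using r(2) diameter_ge_0[OF C(2)[of i]] by linarith
    obtain T where T: "T \<in> sets borel" "{x. x \<noteq> 0 \<and> norm x \<le> 1 \<and> dist (x /\<^sub>R norm x) \<omega> \<le> r} \<subseteq> T"
      "emeasure lborel T \<le> ennreal (K * r ^ d)"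
      using radial_tube_covered[OF w r0 less_imp_le[OF r(3)]] unfolding K_def d_def by blast
    have "{x. x \<noteq> 0 \<and> norm x \<le> 1 \<and> x /\<^sub>R norm x \<in> N \<inter> C i} \<subseteq> T"
    proof (rule order_trans[OF _ T(2)], clarify)
      fix x assume "x /\<^sub>R norm x \<in> C i"
      then have "dist (x /\<^sub>R norm x) \<omega> \<le> diameter (C i)" using \<omega> C(2) by (intro diameter_bounded_bound)
      then show "dist (x /\<^sub>R norm x) \<omega> \<le> r" using r by simp
    qed
    moreover have "emeasure lborel T \<le> ennreal (K / B) * hausdorff_weight d (C i) + ennreal (e / 2 * (1/2) ^ Suc i)"
    proof -
      have w: "hausdorff_weight d (C i) = ennreal (B * diameter (C i) ^ d)"
        using \<omega>(2) by (auto simp: hausdorff_weight_def B_def power_divide)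
      have "ennreal (K / B) * hausdorff_weight d (C i) = ennreal (K / B * (B * diameter (C i) ^ d))"
        unfolding w using K B diameter_ge_0[OF C(2)[of i]] by (intro ennreal_mult[symmetric]) auto
      also have "K / B * (B * diameter (C i) ^ d) = K * diameter (C i) ^ d" using B by simp
      finally have "ennreal (K / B) * hausdorff_weight d (C i) + ennreal (e / 2 * (1/2) ^ Suc i)
          = ennreal (K * diameter (C i) ^ d + e / 2 * (1/2) ^ Suc i)"
        using K e diameter_ge_0[OF C(2)[of i]] by (simp add: ennreal_plus)
      then show ?thesis using T(3) r(1) by (simp only:) (meson ennreal_leI less_imp_le order_trans)
    qed
    ultimately show ?thesis using T(1) by blast
  qed (auto intro!: exI[of _ "{}"])
  from choice[OF allI[OF this]]
  obtain T where "\<forall>i. T i \<in> sets borel \<and> {x. x \<noteq> 0 \<and> norm x \<le> 1 \<and> x /\<^sub>R norm x \<in> N \<inter> C i} \<subseteq> T i \<and>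
    emeasure lborel (T i) \<le> ennreal (K / B) * hausdorff_weight d (C i) + ennreal (e / 2 * (1/2) ^ Suc i)" ..
  then have T: "\<And>i. T i \<in> sets borel" "\<And>i. {x. x \<noteq> 0 \<and> norm x \<le> 1 \<and> x /\<^sub>R norm x \<in> N \<inter> C i} \<subseteq> T i"
    "\<And>i. emeasure lborel (T i) \<le> ennreal (K / B) * hausdorff_weight d (C i) + ennreal (e / 2 * (1/2) ^ Suc i)"
    by blast+
  have "emeasure lborel (\<Union>i. T i) \<le> (\<Sum>i. emeasure lborel (T i))"
    using T(1) by (intro emeasure_subadditive_countably) auto
  also have "\<dots> \<le> (\<Sum>i. ennreal (K / B) * hausdorff_weight d (C i) + ennreal (e / 2 * (1/2) ^ Suc i))"
    by (intro suminf_le T(3)) auto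
  also have "\<dots> = ennreal (K / B) * (\<Sum>i. hausdorff_weight d (C i)) + (\<Sum>i. ennreal (e / 2 * (1/2) ^ Suc i))"
    by (simp add: suminf_add[symmetric])
  also have "(\<Sum>i. ennreal (e / 2 * (1/2) ^ Suc i)) = ennreal (e / 2)"
    using e sums_mult[OF power_half_series, of "e / 2"] by (intro suminf_ennreal_eq) auto
  also have "ennreal (K / B) * (\<Sum>i. hausdorff_weight d (C i)) \<le> ennreal (K / B) * ennreal q"
    using C(4) by (intro mult_left_mono) auto
  also have "\<dots> = ennreal (e / 2)" using K B q by (simp add: q_def flip: ennreal_mult)
  also have "ennreal (e / 2) + ennreal (e / 2) = ennreal e" using e by (simp flip: ennreal_plus)
  finally have "emeasure lborel (\<Union>i. T i) \<le> ennreal e" by (simp add: add_right_mono)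
  moreover have "{x. x \<noteq> 0 \<and> norm x \<le> 1 \<and> x /\<^sub>R norm x \<in> N} \<subseteq> (\<Union>i. T i)"
  proof
    fix x assume x: "x \<in> {x. x \<noteq> 0 \<and> norm x \<le> 1 \<and> x /\<^sub>R norm x \<in> N}"
    then obtain i where "x /\<^sub>R norm x \<in> C i" using C(1) by blast
    then show "x \<in> (\<Union>i. T i)" using x T(2)[of i] by blast
  qed
  ultimately show "\<exists>T. T \<in> sets borel \<and> {x. x \<noteq> 0 \<and> norm x \<le> 1 \<and> x /\<^sub>R norm x \<in> N} \<subseteq> T \<and> emeasure lborel T \<le> ennreal e"
    using T(1) by (intro exI[of _ "\<Union>i. T i"]) auto
qed

text \<open>Vitali: balls covering \<open>N\<close> whose shrunk copies are disjoint, so the radial tubes over the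
  latter are disjoint subsets of \<open>V\<close>.\<close>
lemma hausdorff_outer_sphere_le:
  fixes N V :: "(real^'n) set"
  assumes N: "N \<subseteq> sphere 0 1" and V: "open V" and NV: "\<And>\<omega> t. \<omega> \<in> N \<Longrightarrow> 1/2 \<le> t \<Longrightarrow> t \<le> 1 \<Longrightarrow> t *\<^sub>R \<omega> \<in> V"
  shows "hausdorff_outer (CARD('n) - 1) N \<le> ennreal (unit_ball_vol (real (CARD('n) - 1)) * 5 ^ (CARD('n) - 1)
    * (3 * 4 ^ CARD('n)) / unit_ball_vol (real CARD('n))) * emeasure lborel V"
proof -
  define d where "d = CARD('n) - 1"
  define c where "c = unit_ball_vol (real CARD('n)) / (3 * 4 ^ CARD('n))"
  define K where "K = unit_ball_vol (real d) * 5 ^ d / c"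
  have c: "0 < c" by (simp add: c_def)
  have K: "0 < K" using c by (simp add: K_def)
  have "hausdorff_pre d \<delta> N \<le> ennreal K * emeasure lborel V" if \<delta>: "0 < \<delta>" for \<delta>
  proof -
    \<comment> \<open>The radial segment over \<omega> is compact in the open set \<open>V\<close>,
      which leaves room for a tube. The bound on 10 r is there because the Vitali balls are enlarged
      fivefold.\<close>
    have "\<exists>r. 0 < r \<and> r \<le> 1/2 \<and> 10 * r \<le> \<delta> \<and> {x. 1/2 \<le> norm x \<and> norm x \<le> 1 \<and> dist (x /\<^sub>R norm x) \<omega> \<le> r} \<subseteq> V"
      if \<omega>: "\<omega> \<in> N" for \<omega>
    proof -
      have w: "norm \<omega> = 1" using N \<omega> by auto
      let ?S = "(\<lambda>t. t *\<^sub>R \<omega>) ` {1/2..1}"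
      have "compact ?S" by (intro compact_continuous_image continuous_intros) auto
      moreover have "?S \<subseteq> V" using NV[OF \<omega>] by auto
      ultimately obtain e where e: "0 < e" "(\<Union>x\<in>?S. ball x e) \<subseteq> V"
        using compact_subset_open_imp_ball_epsilon_subset[OF _ V] by metis
      define r where "r = min (min (1/2) (\<delta> / 10)) (e / 2)"
      have "{x. 1/2 \<le> norm x \<and> norm x \<le> 1 \<and> dist (x /\<^sub>R norm x) \<omega> \<le> r} \<subseteq> V"
      proof clarify
        fix x :: "real^'n" assume x: "1/2 \<le> norm x" "norm x \<le> 1" "dist (x /\<^sub>R norm x) \<omega> \<le> r"
        have "x \<noteq> 0" using x(1) by auto
        then have "x - norm x *\<^sub>R \<omega> = norm x *\<^sub>R (x /\<^sub>R norm x - \<omega>)" by (simp add: scaleR_diff_right)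
        then have "dist (norm x *\<^sub>R \<omega>) x = norm x * dist (x /\<^sub>R norm x) \<omega>"
          by (simp add: dist_norm norm_minus_commute[of _ x])
        also have "\<dots> \<le> 1 * r" using x by (intro mult_mono) auto
        also have "\<dots> < e" using e(1) by (simp add: r_def)
        finally have "x \<in> ball (norm x *\<^sub>R \<omega>) e" by simp
        moreover have "norm x *\<^sub>R \<omega> \<in> ?S" using x by (intro imageI) simp
        ultimately show "x \<in> V" using e(2) by blast
      qed
      then show ?thesis using e(1) \<delta> by (intro exI[of _ r]) (auto simp: r_def)
    qed
    from bchoice[OF ballI[OF this]]
    obtain r where r0: "\<forall>\<omega>\<in>N. 0 < r \<omega> \<and> r \<omega> \<le> 1/2 \<and> 10 * r \<omega> \<le> \<delta> \<and>
      {x. 1/2 \<le> norm x \<and> norm x \<le> 1 \<and> dist (x /\<^sub>R norm x) \<omega> \<le> r \<omega>} \<subseteq> V" ..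
    then have r: "\<And>\<omega>. \<omega> \<in> N \<Longrightarrow> 0 < r \<omega>" "\<And>\<omega>. \<omega> \<in> N \<Longrightarrow> r \<omega> \<le> 1/2" "\<And>\<omega>. \<omega> \<in> N \<Longrightarrow> 10 * r \<omega> \<le> \<delta>"
      "\<And>\<omega>. \<omega> \<in> N \<Longrightarrow> {x. 1/2 \<le> norm x \<and> norm x \<le> 1 \<and> dist (x /\<^sub>R norm x) \<omega> \<le> r \<omega>} \<subseteq> V"
      by blast+
    have "N \<subseteq> (\<Union>\<omega>\<in>N. cball \<omega> (r \<omega>))" using r(1) by (force intro: less_imp_le)
    moreover have "\<And>\<omega>. \<omega> \<in> N \<Longrightarrow> 0 < r \<omega> \<and> r \<omega> \<le> 1/2" using r(1,2) by blast
    ultimately obtain C where C: "countable C" "C \<subseteq> N"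
      "pairwise (\<lambda>i j. disjnt (cball i (r i)) (cball j (r j))) C" "N \<subseteq> (\<Union>\<omega>\<in>C. cball \<omega> (5 * r \<omega>))"
      by (rule Vitali_covering_lemma_cballs[where a="\<lambda>\<omega>. \<omega>"])
    have "\<exists>Q. Q \<in> sets borel \<and> Q \<subseteq> {x. 1/2 \<le> norm x \<and> norm x \<le> 1 \<and> dist (x /\<^sub>R norm x) \<omega> \<le> r \<omega>}
        \<and> ennreal (c * r \<omega> ^ d) \<le> emeasure lborel Q" if "\<omega> \<in> N" for \<omega>
    proof -
      have "norm \<omega> = 1" using N that by auto
      from radial_tube_contains[OF this r(1,2)[OF that]]
      obtain Q where "Q \<in> sets borel" "Q \<subseteq> {x. 1/2 \<le> norm x \<and> norm x \<le> 1 \<and> dist (x /\<^sub>R norm x) \<omega> \<le> r \<omega>}"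
        "ennreal (c * r \<omega> ^ d) \<le> emeasure lborel Q" unfolding c_def d_def by this
      then show ?thesis by (intro exI[of _ Q] conjI)
    qed
    from bchoice[OF ballI[OF this]]
    obtain Q where "\<forall>\<omega>\<in>N. Q \<omega> \<in> sets borel \<and> Q \<omega> \<subseteq> {x. 1/2 \<le> norm x \<and> norm x \<le> 1 \<and> dist (x /\<^sub>R norm x) \<omega> \<le> r \<omega>}
        \<and> ennreal (c * r \<omega> ^ d) \<le> emeasure lborel (Q \<omega>)" ..
    then have Q: "\<And>\<omega>. \<omega> \<in> N \<Longrightarrow> Q \<omega> \<in> sets borel"
      "\<And>\<omega>. \<omega> \<in> N \<Longrightarrow> Q \<omega> \<subseteq> {x. 1/2 \<le> norm x \<and> norm x \<le> 1 \<and> dist (x /\<^sub>R norm x) \<omega> \<le> r \<omega>}"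
      "\<And>\<omega>. \<omega> \<in> N \<Longrightarrow> ennreal (c * r \<omega> ^ d) \<le> emeasure lborel (Q \<omega>)" by blast+
    \<comment> \<open>The countable family is indexed by natural numbers, with empty sets at the
      remaining indices.\<close>
    define I where "I = to_nat_on C ` C"
    define p where "p = from_nat_into C"
    have pC: "p i \<in> C" if "i \<in> I" for i
      using that C(1) by (auto simp: I_def p_def)
    have pinj: "i = j" if "i \<in> I" "j \<in> I" "p i = p j" for i j
      using that C(1) by (auto simp: I_def p_def)
    have psurj: "\<exists>i\<in>I. p i = \<omega>" if "\<omega> \<in> C" for \<omega>
      using that C(1) by (auto simp: I_def p_def intro!: bexI[of _ \<omega>])
    define U where "U i = (if i \<in> I then cball (p i) (5 * r (p i)) else {})" for i
    define W where "W i = (if i \<in> I then Q (p i) else {})" for i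
    have disj: "disjoint_family W"
      unfolding disjoint_family_on_def
    proof (intro ballI impI)
      fix i j :: nat assume ij: "i \<noteq> j"
      show "W i \<inter> W j = {}"
      proof (cases "i \<in> I \<and> j \<in> I")
        case True
        then have ne: "p i \<noteq> p j" using pinj ij by blast
        have pN: "p i \<in> N" "p j \<in> N" using True pC C(2) by auto
        show ?thesis
        proof (rule ccontr)
          assume "W i \<inter> W j \<noteq> {}"
          then obtain x where "x \<in> Q (p i)" "x \<in> Q (p j)" using True by (auto simp: W_def)
          then have m: "x /\<^sub>R norm x \<in> cball (p i) (r (p i))" "x /\<^sub>R norm x \<in> cball (p j) (r (p j))"
            using Q(2)[OF pN(1)] Q(2)[OF pN(2)] by (auto simp: dist_commute)
          have "p i \<in> C" "p j \<in> C" using True pC by auto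
          from pairwiseD[OF C(3) this ne] m show False unfolding disjnt_def by blast
        qed
      qed (auto simp: W_def)
    qed
    have "hausdorff_pre d \<delta> N \<le> (\<Sum>i. hausdorff_weight d (U i))"
    proof (rule hausdorff_pre_le)
      show "N \<subseteq> (\<Union>i. U i)"
      proof
        fix x assume "x \<in> N"
        then obtain \<omega> where "\<omega> \<in> C" "x \<in> cball \<omega> (5 * r \<omega>)" using C(4) by blast
        then show "x \<in> (\<Union>i. U i)" using psurj[of \<omega>] by (auto simp: U_def)
      qed
      show "diameter (U i) \<le> \<delta>" for i
      proof (cases "i \<in> I")
        case True
        then have pN: "p i \<in> N" using pC C(2) by auto
        then show ?thesis using r(1)[OF pN] r(3)[OF pN] True by (simp add: U_def)
      qed (use \<delta> in \<open>simp add: U_def diameter_def\<close>)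
    qed (auto simp: U_def)
    also have "\<dots> \<le> (\<Sum>i. ennreal K * emeasure lborel (W i))"
    proof (rule suminf_le)
      show "hausdorff_weight d (U i) \<le> ennreal K * emeasure lborel (W i)" for i
      proof (cases "i \<in> I")
        case True
        then have pN: "p i \<in> N" using pC C(2) by auto
        have "hausdorff_weight d (U i) \<le> ennreal (unit_ball_vol (real d) * (5 * r (p i)) ^ d)"
          using True r(1)[OF pN] by (simp add: hausdorff_weight_def U_def)
        also have "\<dots> = ennreal K * ennreal (c * r (p i) ^ d)"
          using c K r(1)[OF pN] by (simp add: K_def power_mult_distrib flip: ennreal_mult)
        also have "\<dots> \<le> ennreal K * emeasure lborel (W i)"
          using True Q(3)[OF pN] by (simp add: W_def mult_left_mono)
        finally show ?thesis .
      qed (simp add: U_def hausdorff_weight_empty)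
    qed auto
    also have "\<dots> = ennreal K * (\<Sum>i. emeasure lborel (W i))" by simp
    also have "(\<Sum>i. emeasure lborel (W i)) = emeasure lborel (\<Union>i. W i)"
    proof (rule suminf_emeasure[OF _ disj])
      show "range W \<subseteq> sets lborel" using Q(1) pC C(2) by (auto simp: W_def)
    qed
    also have "\<dots> \<le> emeasure lborel V"
    proof (rule emeasure_mono)
      show "(\<Union>i. W i) \<subseteq> V"
      proof
        fix x assume "x \<in> (\<Union>i. W i)"
        then obtain i where "i \<in> I" "x \<in> Q (p i)" by (auto simp: W_def split: if_splits)
        then show "x \<in> V" using Q(2) r(4) pC C(2) by blast
      qed
    qed (use V in auto)
    finally show ?thesis by (simp add: mult_left_mono)
  qed
  then have "hausdorff_outer d N \<le> ennreal K * emeasure lborel V"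
    unfolding hausdorff_outer_def by (intro SUP_least) auto
  then show ?thesis by (simp add: K_def c_def d_def)
qed

section \<open>Finiteness, positivity and null sets of the surface measure\<close>

lemma sphere_outer_finite: "hausdorff_outer (CARD('n) - 1) (sphere (0 :: real^'n) 1) < top"
proof -
  let ?K = "unit_ball_vol (real (CARD('n) - 1)) * 5 ^ (CARD('n) - 1) * (3 * 4 ^ CARD('n)) / unit_ball_vol (real CARD('n))"
  have "hausdorff_outer (CARD('n) - 1) (sphere (0 :: real^'n) 1) \<le> ennreal ?K * emeasure lborel (ball (0 :: real^'n) 2)"
    by (rule hausdorff_outer_sphere_le) (auto simp: power2_eq_square)
  also have "\<dots> < top" by (simp add: emeasure_ball ennreal_mult_less_top)
  finally show ?thesis .
qed

lemma sphere_in_borel: "sphere (0 :: real^'n) 1 \<in> sets borel"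
  by (intro borel_closed) (simp add: compact_imp_closed)

lemma space_sphere_measure: "space (sphere_measure :: (real^'n) measure) = sphere 0 1"
  by (simp add: sphere_measure_def space_restrict_space space_hausdorff_measure)

lemma sets_sphere_measure: "sets (sphere_measure :: (real^'n) measure) = sets (restrict_space borel (sphere 0 1))"
  unfolding sphere_measure_def by (rule sets_restrict_space_cong[OF sets_hausdorff_measure])

lemma emeasure_sphere_measure:
  fixes A :: "(real^'n) set"
  assumes "A \<in> sets borel" "A \<subseteq> sphere 0 1"
  shows "emeasure sphere_measure A = hausdorff_outer (CARD('n) - 1) A"
  unfolding sphere_measure_def
  using assms sphere_in_borel[where 'n='n]
  by (subst emeasure_restrict_space) (auto simp: sets_hausdorff_measure emeasure_hausdorff_measure)

lemma finite_sphere_measure: "finite_measure (sphere_measure :: (real^'n) measure)"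
  by (rule finite_measureI)
     (use sphere_outer_finite[where 'n='n] in
       \<open>simp add: space_sphere_measure emeasure_sphere_measure[OF sphere_in_borel] less_top\<close>)

text \<open>Otherwise the truncated cone over the whole sphere, which is the punctured unit ball,
  would be negligible.\<close>

lemma measure_sphere_pos:
  assumes n: "2 \<le> CARD('n)"
  shows "0 < measure (sphere_measure :: (real^'n) measure) (sphere 0 1)"
proof -
  interpret finite_measure "sphere_measure :: (real^'n) measure" by (rule finite_sphere_measure)
  have "hausdorff_outer (CARD('n) - 1) (sphere (0 :: real^'n) 1) \<noteq> 0"
  proof
    assume z: "hausdorff_outer (CARD('n) - 1) (sphere (0 :: real^'n) 1) = 0"
    have "negligible {x :: real^'n. x \<noteq> 0 \<and> norm x \<le> 1 \<and> x /\<^sub>R norm x \<in> sphere 0 1}"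
      by (rule negligible_cone[OF n _ z]) simp
    moreover have "{x :: real^'n. x \<noteq> 0 \<and> norm x \<le> 1 \<and> x /\<^sub>R norm x \<in> sphere 0 1} = cball 0 1 - {0}" by auto
    ultimately have "negligible (insert 0 (cball (0 :: real^'n) 1 - {0}))" by (simp only: negligible_insert)
    then have "negligible (cball (0 :: real^'n) 1)"
      by (rule negligible_subset) auto
    then show False using negligible_imp_measure0[of "cball (0::real^'n) 1"] content_cball_pos[of 1 "0::real^'n"] by simp
  qed
  then have "emeasure (sphere_measure :: (real^'n) measure) (sphere 0 1) \<noteq> 0"
    by (simp add: emeasure_sphere_measure sphere_in_borel)
  then have "measure (sphere_measure :: (real^'n) measure) (sphere 0 1) \<noteq> 0"
    unfolding emeasure_eq_measure by (metis ennreal_0)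
  then show ?thesis by (simp add: zero_less_measure_iff)
qed

text \<open>\<open>N\<close> itself may fail to be measurable. \<open>G\<close> collects the
  directions whose segment 1/2 <= t <= 1 lies in every open neighbourhood \<open>V k\<close> of the
  cone, which makes it a countable intersection of relatively open sets.\<close>

lemma negligible_imp_sphere_null:
  fixes N :: "(real^'n) set"
  assumes N: "N \<subseteq> sphere 0 1" and neg: "negligible {x. x \<noteq> 0 \<and> x /\<^sub>R norm x \<in> N}"
  obtains G where "G \<in> null_sets (sphere_measure :: (real^'n) measure)" "N \<subseteq> G"
proof -
  let ?K = "unit_ball_vol (real (CARD('n) - 1)) * 5 ^ (CARD('n) - 1) * (3 * 4 ^ CARD('n)) / unit_ball_vol (real CARD('n))"
  let ?S = "{x. x \<noteq> 0 \<and> x /\<^sub>R norm x \<in> N}"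
  have null: "emeasure lebesgue ?S = 0" "?S \<in> sets lebesgue"
    using neg by (auto simp: negligible_iff_null_sets)
  have "\<exists>V. open V \<and> ?S \<subseteq> V \<and> emeasure lborel V \<le> ennreal (1 / real (Suc k))" for k
  proof -
    obtain V where V: "open V" "?S \<subseteq> V" "V - ?S \<in> lmeasurable" "emeasure lebesgue (V - ?S) < ennreal (1 / real (Suc k))"
      using sets_lebesgue_outer_open[OF null(2), of "1 / real (Suc k)"] by auto
    have "emeasure lebesgue V \<le> emeasure lebesgue (V - ?S) + emeasure lebesgue ?S"
      using V null by (intro order_trans[OF emeasure_mono emeasure_subadditive]) auto
    then have "emeasure lborel V \<le> ennreal (1 / real (Suc k))"
      using V null by simp
    then show ?thesis using V by blast
  qed
  from choice[OF allI[OF this]]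
  obtain V where "\<forall>k. open (V k) \<and> ?S \<subseteq> V k \<and> emeasure lborel (V k) \<le> ennreal (1 / real (Suc k))" ..
  then have V: "\<And>k. open (V k)" "\<And>k. ?S \<subseteq> V k" "\<And>k. emeasure lborel (V k) \<le> ennreal (1 / real (Suc k))"
    by blast+
  define G where "G = (\<Inter>k. {\<omega> \<in> sphere 0 1. \<forall>t\<in>{1/2..1}. t *\<^sub>R \<omega> \<in> V k})"
  have op: "\<exists>U. open U \<and> {\<omega> \<in> sphere 0 1. \<forall>t\<in>{1/2..1}. t *\<^sub>R \<omega> \<in> V k} = sphere 0 1 \<inter> U" for k
  proof -
    have "open {\<omega>. \<forall>t\<in>{1/2..1}. t *\<^sub>R \<omega> \<in> V k}"
      unfolding open_contains_ball
    proof clarify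
      fix \<omega> assume \<omega>: "\<forall>t\<in>{1/2..1}. t *\<^sub>R \<omega> \<in> V k"
      have "compact ((\<lambda>t. t *\<^sub>R \<omega>) ` {1/2..1})" by (intro compact_continuous_image continuous_intros) auto
      moreover have "(\<lambda>t. t *\<^sub>R \<omega>) ` {1/2..1} \<subseteq> V k" using \<omega> by auto
      ultimately obtain e where e: "0 < e" "(\<Union>x\<in>(\<lambda>t. t *\<^sub>R \<omega>) ` {1/2..1}. ball x e) \<subseteq> V k"
        using compact_subset_open_imp_ball_epsilon_subset[OF _ V(1)] by metis
      have "t *\<^sub>R \<omega>' \<in> V k" if "\<omega>' \<in> ball \<omega> e" "t \<in> {1/2..1}" for \<omega>' t
      proof -
        have "dist (t *\<^sub>R \<omega>) (t *\<^sub>R \<omega>') = t * dist \<omega> \<omega>'" using that by (simp add: dist_norm flip: scaleR_diff_right)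
        also have "\<dots> \<le> 1 * dist \<omega> \<omega>'" using that by (intro mult_right_mono) auto
        also have "\<dots> < e" using that by simp
        finally have "t *\<^sub>R \<omega>' \<in> ball (t *\<^sub>R \<omega>) e" by simp
        then show ?thesis using e(2) that by blast
      qed
      then show "\<exists>e>0. ball \<omega> e \<subseteq> {\<omega>. \<forall>t\<in>{1/2..1}. t *\<^sub>R \<omega> \<in> V k}" using e(1) by blast
    qed
    then show ?thesis by blast
  qed
  have "G \<in> sets borel"
    unfolding G_def
  proof (rule sets.countable_INT'')
    fix k
    obtain U where "open U" "{\<omega> \<in> sphere 0 1. \<forall>t\<in>{1/2..1}. t *\<^sub>R \<omega> \<in> V k} = sphere 0 1 \<inter> U" using op by blast
    then show "{\<omega> \<in> sphere 0 1. \<forall>t\<in>{1/2..1}. t *\<^sub>R \<omega> \<in> V k} \<in> sets borel"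
      using sphere_in_borel by (metis borel_open sets.Int)
  qed auto
  moreover have Gs: "G \<subseteq> sphere 0 1" by (auto simp: G_def)
  moreover have "hausdorff_outer (CARD('n) - 1) G = 0"
  proof -
    have "hausdorff_outer (CARD('n) - 1) G \<le> ennreal (?K * (1 / real (Suc k)))" for k
    proof -
      have "hausdorff_outer (CARD('n) - 1) G \<le> ennreal ?K * emeasure lborel (V k)"
        by (rule hausdorff_outer_sphere_le[OF Gs V(1)]) (auto simp: G_def)
      also have "\<dots> \<le> ennreal ?K * ennreal (1 / real (Suc k))" by (intro mult_left_mono V(3)) simp
      also have "\<dots> = ennreal (?K * (1 / real (Suc k)))" by (intro ennreal_mult[symmetric]) auto
      finally show ?thesis .
    qed
    moreover have "(\<lambda>k. ennreal (?K * (1 / real (Suc k)))) \<longlonglongrightarrow> ennreal (?K * 0)"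
      using LIMSEQ_inverse_real_of_nat by (intro tendsto_ennrealI tendsto_mult tendsto_const) (simp add: inverse_eq_divide)
    ultimately have "hausdorff_outer (CARD('n) - 1) G \<le> ennreal (?K * 0)"
      by (intro LIMSEQ_le_const) auto
    then show ?thesis by simp
  qed
  ultimately have "G \<in> null_sets (sphere_measure :: (real^'n) measure)"
    using sphere_in_borel[where 'n='n]
    by (auto simp: null_sets_def emeasure_sphere_measure sets_sphere_measure sets_restrict_space_iff)
  moreover have "N \<subseteq> G"
    using N V(2) by (fastforce simp: G_def)
  ultimately show thesis by (rule that)
qed

lemma negligible_scaled:
  assumes "negligible (S :: 'a::euclidean_space set)"
  shows "negligible ((*\<^sub>R) c ` S)"
  by (rule negligible_differentiable_image_negligible[OF _ assms]) (auto simp: differentiable_on_def)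

text \<open>The dictionary between sphere and cone, through which Lebesgue measure theory becomes
  available on the sphere; \<open>P\<close> may be any predicate.\<close>

lemma AE_sphere_measure_iff:
  assumes n: "2 \<le> CARD('n)"
  shows "(AE \<omega> in (sphere_measure :: (real^'n) measure). P \<omega>) \<longleftrightarrow> negligible {x. x \<noteq> 0 \<and> \<not> P (x /\<^sub>R norm x)}"
proof
  assume "AE \<omega> in (sphere_measure :: (real^'n) measure). P \<omega>"
  then obtain G where G: "G \<in> null_sets (sphere_measure :: (real^'n) measure)" "{\<omega> \<in> sphere 0 1. \<not> P \<omega>} \<subseteq> G"
    by (auto elim!: AE_E simp: space_sphere_measure null_sets_def)
  have Gs: "G \<subseteq> sphere 0 1" "G \<in> sets borel"
    using G(1) sphere_in_borel[where 'n='n] by (auto simp: null_sets_def sets_sphere_measure sets_restrict_space_iff)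
  then have "hausdorff_outer (CARD('n) - 1) G = 0"
    using G(1) emeasure_sphere_measure[OF Gs(2,1)] by (simp add: null_sets_def)
  from negligible_cone[OF n Gs(1) this]
  have c: "negligible {x. x \<noteq> 0 \<and> norm x \<le> 1 \<and> x /\<^sub>R norm x \<in> G}" .
  \<comment> \<open>Integer dilates of the truncated cone exhaust the full one.\<close>
  have "negligible (\<Union>k::nat. (*\<^sub>R) (real k) ` {x. x \<noteq> 0 \<and> norm x \<le> 1 \<and> x /\<^sub>R norm x \<in> G})"
    by (rule negligible_countable_Union[of "range f" for f, simplified]) (auto intro: negligible_scaled c)
  then show "negligible {x. x \<noteq> 0 \<and> \<not> P (x /\<^sub>R norm x)}"
  proof (rule negligible_subset, clarify)
    fix x :: "real^'n" assume x: "x \<noteq> 0" "\<not> P (x /\<^sub>R norm x)"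
    obtain k :: nat where k: "norm x < real k" using reals_Archimedean2 by blast
    then have k0: "0 < real k" using norm_ge_zero[of x] by linarith
    let ?y = "x /\<^sub>R real k"
    have y: "?y \<noteq> 0" "norm ?y \<le> 1" using x k k0 by (auto simp: divide_simps)
    have "?y /\<^sub>R norm ?y = x /\<^sub>R norm x" using k0 x by (simp add: divide_simps)
    moreover have "x /\<^sub>R norm x \<in> G" using G(2) x by auto
    ultimately have "?y /\<^sub>R norm ?y \<in> G" by (simp only:)
    with y have "?y \<in> {x. x \<noteq> 0 \<and> norm x \<le> 1 \<and> x /\<^sub>R norm x \<in> G}" by blast
    moreover have "x = real k *\<^sub>R ?y" using k0 by simp
    ultimately have "x \<in> (*\<^sub>R) (real k) ` {x. x \<noteq> 0 \<and> norm x \<le> 1 \<and> x /\<^sub>R norm x \<in> G}" by (rule rev_image_eqI)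
    then show "x \<in> (\<Union>k::nat. (*\<^sub>R) (real k) ` {x. x \<noteq> 0 \<and> norm x \<le> 1 \<and> x /\<^sub>R norm x \<in> G})"
      by (rule UN_I[OF UNIV_I])
  qed
next
  assume a: "negligible {x :: real^'n. x \<noteq> 0 \<and> \<not> P (x /\<^sub>R norm x)}"
  have "{x :: real^'n. x \<noteq> 0 \<and> x /\<^sub>R norm x \<in> {\<omega> \<in> sphere 0 1. \<not> P \<omega>}} = {x. x \<noteq> 0 \<and> \<not> P (x /\<^sub>R norm x)}" by auto
  with a have "negligible {x :: real^'n. x \<noteq> 0 \<and> x /\<^sub>R norm x \<in> {\<omega> \<in> sphere 0 1. \<not> P \<omega>}}" by (simp only:)
  from negligible_imp_sphere_null[OF _ this]
  obtain G where "G \<in> null_sets (sphere_measure :: (real^'n) measure)" "{\<omega> \<in> sphere 0 1. \<not> P \<omega>} \<subseteq> G" by blast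
  then show "AE \<omega> in (sphere_measure :: (real^'n) measure). P \<omega>"
    by (intro AE_I'[of G]) (auto simp: space_sphere_measure)
qed

section \<open>Rademacher's theorem\<close>

definition diff_quotient :: "('a::real_vector \<Rightarrow> real) \<Rightarrow> 'a \<Rightarrow> 'a \<Rightarrow> real \<Rightarrow> real" where
  "diff_quotient f v x h = (f (x + h *\<^sub>R v) - f x) / h"

text \<open>For bounded difference quotients, the directional derivative fails to exist exactly on
  the union of these sets over rational p < q.\<close>

definition oscillation_set :: "('a::real_vector \<Rightarrow> real) \<Rightarrow> 'a \<Rightarrow> real \<Rightarrow> real \<Rightarrow> 'a set" where
  "oscillation_set f v p q = {x. (\<exists>\<^sub>F h in at 0. diff_quotient f v x h < p) \<and> (\<exists>\<^sub>F h in at 0. q < diff_quotient f v x h)}"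

text \<open>Being frequent near 0 is a countable intersection over radii of unions over h. These
  unions are uncountable, but they are unions of open sets, as the quotients are continuous in
  x.\<close>

lemma oscillation_set_borel:
  fixes f :: "'a::euclidean_space \<Rightarrow> real"
  assumes f: "continuous_on UNIV f"
  shows "oscillation_set f v p q \<in> sets borel"
proof -
  have c: "continuous_on UNIV (\<lambda>x. diff_quotient f v x h)" for h
    unfolding diff_quotient_def divide_inverse
    by (intro continuous_intros continuous_on_compose2[OF f] f) auto
  have fr: "(\<exists>\<^sub>F h in at 0. P h) \<longleftrightarrow> (\<forall>k. \<exists>h. h \<noteq> 0 \<and> \<bar>h\<bar> < inverse (real (Suc k)) \<and> P h)" for P :: "real \<Rightarrow> bool"
    unfolding frequently_at
  proof safe
    fix k assume "\<forall>d>0. \<exists>x\<in>UNIV. x \<noteq> 0 \<and> dist x 0 < d \<and> P x"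
    then show "\<exists>h. h \<noteq> 0 \<and> \<bar>h\<bar> < inverse (real (Suc k)) \<and> P h" by (auto dest!: spec[of _ "inverse (real (Suc k))"])
  next
    fix d :: real assume a: "\<forall>k. \<exists>h. h \<noteq> 0 \<and> \<bar>h\<bar> < inverse (real (Suc k)) \<and> P h" and "0 < d"
    then obtain k where "inverse (real (Suc k)) < d" using reals_Archimedean by blast
    then show "\<exists>x\<in>UNIV. x \<noteq> 0 \<and> dist x 0 < d \<and> P x" using spec[OF a, of k] by (auto intro: less_trans)
  qed
  have "oscillation_set f v p q =
      (\<Inter>k. \<Union>h\<in>{h. h \<noteq> 0 \<and> \<bar>h\<bar> < inverse (real (Suc k))}. {x. diff_quotient f v x h < p}) \<inter>
      (\<Inter>k. \<Union>h\<in>{h. h \<noteq> 0 \<and> \<bar>h\<bar> < inverse (real (Suc k))}. {x. q < diff_quotient f v x h})"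
    unfolding oscillation_set_def fr by blast
  also have "\<dots> \<in> sets borel"
    by (intro sets.Int sets.countable_INT'' borel_open open_UN ballI open_Collect_less c continuous_on_const) auto
  finally show ?thesis .
qed

text \<open>The candidate is the lower limit, written as a supremum; if the upper limit were larger,
  two rationals would fit in between.\<close>

lemma bounded_imp_oscillation_or_convergent:
  fixes r :: "real \<Rightarrow> real"
  assumes b: "\<And>h. h \<noteq> 0 \<Longrightarrow> \<bar>r h\<bar> \<le> B"
    and no: "\<And>p q. p \<in> \<rat> \<Longrightarrow> q \<in> \<rat> \<Longrightarrow> p < q \<Longrightarrow> \<not> ((\<exists>\<^sub>F h in at 0. r h < p) \<and> (\<exists>\<^sub>F h in at 0. q < r h))"
  obtains l where "(r \<longlongrightarrow> l) (at 0)"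
proof -
  define S where "S = {p. \<forall>\<^sub>F h in at 0. p \<le> r h}"
  have evB: "\<forall>\<^sub>F h in at 0. \<bar>r h\<bar> \<le> B" using b by (auto simp: eventually_at intro!: exI[of _ 1])
  have ub: "p \<le> B" if "p \<in> S" for p
  proof -
    have "\<forall>\<^sub>F h in at (0::real). p \<le> B" using that evB unfolding S_def mem_Collect_eq by eventually_elim auto
    then show ?thesis by simp
  qed
  have "-B \<in> S" unfolding S_def mem_Collect_eq using evB by eventually_elim auto
  then have ne: "S \<noteq> {}" by blast
  have bdd: "bdd_above S" by (rule bdd_aboveI[OF ub])
  have "(r \<longlongrightarrow> Sup S) (at 0)"
  proof (rule order_tendstoI)
    fix a assume "a < Sup S"
    then obtain p where "p \<in> S" "a < p" using less_cSup_iff[OF ne bdd] by blast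
    then show "\<forall>\<^sub>F h in at 0. a < r h" unfolding S_def mem_Collect_eq by (auto elim: eventually_mono)
  next
    fix a assume "Sup S < a"
    then obtain q where q: "q \<in> \<rat>" "Sup S < q" "q < a" using Rats_dense_in_real by blast
    obtain p where p: "p \<in> \<rat>" "Sup S < p" "p < q" using Rats_dense_in_real q(2) by blast
    have "p \<notin> S" using p(2) cSup_upper[OF _ bdd] by (meson not_le)
    then have "\<exists>\<^sub>F h in at 0. r h < p" by (simp add: S_def frequently_def not_less)
    then have "\<not> (\<exists>\<^sub>F h in at 0. q < r h)" using no[OF p(1) q(1) p(3)] by blast
    then show "\<forall>\<^sub>F h in at 0. r h < a"
      unfolding not_frequently by (rule eventually_mono) (use q in auto)
  qed
  then show thesis by (rule that)
qed

text \<open>Lebesgue measure is determined by its values on boxes, where the increments of F and of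
  x - F x add up to the length. The two monotonicity assumptions make F Lipschitz with constant 1,
  so endpoints carry no mass.\<close>

lemma lborel_eq_sum_interval_measure:
  fixes F :: "real \<Rightarrow> real"
  assumes F: "mono F" and G: "mono (\<lambda>x. x - F x)" and A: "A \<in> sets borel"
  shows "emeasure (interval_measure F) A + emeasure (interval_measure (\<lambda>x. x - F x)) A = emeasure lborel A"
proof -
  let ?G = "\<lambda>x. x - F x"
  have lip: "\<bar>F x - F y\<bar> \<le> \<bar>x - y\<bar>" for x y
    using monoD[OF F, of x y] monoD[OF F, of y x] monoD[OF G, of x y] monoD[OF G, of y x] by linarith
  have cF: "continuous_on UNIV F"
    by (rule continuous_onI) (metis dist_real_def lip le_less_trans less_imp_le)
  then have cG: "continuous_on UNIV ?G" by (intro continuous_intros)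
  define M where "M = measure_of UNIV (sets borel) (\<lambda>A. emeasure (interval_measure F) A + emeasure (interval_measure ?G) A)"
  have sM: "sets M = sets borel" "space M = UNIV"
    unfolding M_def by (metis sets.sigma_sets_eq sets_measure_of space_borel sets.space_closed, simp)
  have eM: "emeasure M A = emeasure (interval_measure F) A + emeasure (interval_measure ?G) A" if "A \<in> sets borel" for A
    unfolding M_def
  proof (rule emeasure_measure_of_sigma)
    show "sigma_algebra UNIV (sets (borel :: real measure))" by (metis sets.sigma_algebra_axioms space_borel)
    show "countably_additive (sets borel) (\<lambda>A. emeasure (interval_measure F) A + emeasure (interval_measure ?G) A)"
      unfolding countably_additive_def
    proof (intro allI impI)
      fix A :: "nat \<Rightarrow> real set" assume a: "range A \<subseteq> sets borel" "disjoint_family A"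
      have "(\<Sum>i. emeasure (interval_measure F) (A i) + emeasure (interval_measure ?G) (A i))
          = (\<Sum>i. emeasure (interval_measure F) (A i)) + (\<Sum>i. emeasure (interval_measure ?G) (A i))"
        by (rule suminf_add[symmetric]) auto
      also have "\<dots> = emeasure (interval_measure F) (\<Union>i. A i) + emeasure (interval_measure ?G) (\<Union>i. A i)"
        using a by (intro arg_cong2[where f="(+)"] suminf_emeasure) auto
      finally show "(\<Sum>i. emeasure (interval_measure F) (A i) + emeasure (interval_measure ?G) (A i))
          = emeasure (interval_measure F) (\<Union>i. A i) + emeasure (interval_measure ?G) (\<Union>i. A i)" .
    qed
  qed (use that in \<open>auto simp: positive_def\<close>)
  have "lborel = M"
  proof (rule lborel_eqI)
    fix l u :: real assume lu: "\<And>b. b \<in> Basis \<Longrightarrow> l \<bullet> b \<le> u \<bullet> b"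
    then have "l \<le> u" by simp
    have icc: "emeasure M {a..b} = ennreal (b - a)" if "a \<le> b" for a b
      using that monoD[OF F that] monoD[OF G that]
      by (simp add: eM emeasure_interval_measure_Icc monoD[OF F] monoD[OF G] cF cG flip: ennreal_plus)
    have n: "{l, u} \<in> null_sets M"
    proof -
      have "{l} \<in> null_sets M" "{u} \<in> null_sets M"
        using icc[of l l] icc[of u u] by (auto simp: null_sets_def sM)
      then have "{l} \<union> {u} \<in> null_sets M" by (rule null_sets.Un)
      then show ?thesis by (simp add: insert_commute)
    qed
    have "box l u = {l..u} - {l, u}" by (auto simp: box_real)
    then have "emeasure M (box l u) = emeasure M {l..u}"
      using n by (simp add: emeasure_Diff_null_set sM)
    then show "emeasure M (box l u) = (\<Prod>b\<in>Basis. (u - l) \<bullet> b)" using icc[OF \<open>l \<le> u\<close>] by simp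
  qed (simp add: sM)
  then show ?thesis using eM[OF A] by simp
qed

text \<open>Vitali's theorem for intervals starting at points of \<open>E\<close> on which F grows
  by at most p times the length. The part of \<open>E\<close> left uncovered is Lebesgue null, hence
  null for the measure of F, which Lebesgue measure dominates.\<close>

lemma interval_measure_le_of_small_quotient:
  fixes F :: "real \<Rightarrow> real"
  assumes F: "mono F" and G: "mono (\<lambda>x. x - F x)"
    and E: "E \<in> sets borel" and bE: "bounded E" and p: "0 \<le> p"
    and q: "\<And>x. x \<in> E \<Longrightarrow> \<exists>\<^sub>F h in at 0. diff_quotient F 1 x h < p"
  shows "emeasure (interval_measure F) E \<le> ennreal p * emeasure lborel E"
proof (rule ennreal_le_epsilon)
  let ?\<mu> = "emeasure (interval_measure F)"
  have le: "?\<mu> A \<le> emeasure lborel A" if "A \<in> sets borel" for A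
    using lborel_eq_sum_interval_measure[OF F G that] by (metis le_iff_add)
  have lip: "\<bar>F x - F y\<bar> \<le> \<bar>x - y\<bar>" for x y
    using monoD[OF F, of x y] monoD[OF F, of y x] monoD[OF G, of x y] monoD[OF G, of y x] by linarith
  have cF: "continuous_on UNIV F"
    by (rule continuous_onI) (metis dist_real_def lip le_less_trans less_imp_le)
  fix e :: real assume e: "0 < e"
  \<comment> \<open>Makes p e' <= e, also for p = 0.\<close>
  define e' where "e' = e / (p + 1)"
  have e': "0 < e'" using e p by (simp add: e'_def)
  have El: "E \<in> sets lebesgue" using E by simp
  obtain U where U: "open U" "E \<subseteq> U" "emeasure lebesgue (U - E) < ennreal e'"
    by (rule sets_lebesgue_outer_open[OF El e'])
  define K where "K = {(c, r). 0 < r \<and> cball c r \<subseteq> U \<and> F (c + r) - F (c - r) \<le> p * (2 * r)}"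
  have cov: "\<exists>i. i \<in> K \<and> x \<in> cball (fst i) (snd i) \<and> snd i < d" if x: "x \<in> E" and d: "0 < d" for x d
  proof -
    obtain s where s: "0 < s" "ball x s \<subseteq> U" using U(1,2) x openE by blast
    obtain h where h: "h \<noteq> 0" "\<bar>h\<bar> < min s d" "diff_quotient F 1 x h < p"
      using q[OF x] s(1) d unfolding frequently_at by (auto dest!: spec[of _ "min s d"])
    \<comment> \<open>The interval between x and x + h, whatever the sign of h.\<close>
    let ?c = "x + h / 2" and ?r = "\<bar>h\<bar> / 2"
    have "F (?c + ?r) - F (?c - ?r) \<le> p * (2 * ?r)"
    proof (cases "0 < h")
      case True
      then have "?c + ?r = x + h" "?c - ?r = x" by (auto simp: field_simps)
      then show ?thesis using h(3) True by (simp add: diff_quotient_def pos_divide_less_eq add.commute less_imp_le)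
    next
      case False
      then have "h < 0" using h(1) by simp
      then have "p * h < F (x + h) - F x" using h(3) by (simp add: diff_quotient_def neg_divide_less_eq)
      moreover have "?c + ?r = x" "?c - ?r = x + h" using \<open>h < 0\<close> by (auto simp: field_simps)
      ultimately show ?thesis using \<open>h < 0\<close> by (simp add: add.commute)
    qed
    moreover have "cball ?c ?r \<subseteq> U"
    proof
      fix y assume "y \<in> cball ?c ?r"
      then have "\<bar>x - y\<bar> \<le> \<bar>h\<bar>" unfolding mem_cball dist_real_def by linarith
      then show "y \<in> U" using s(2) h(2) by (auto simp: dist_real_def)
    qed
    moreover have "x \<in> cball ?c ?r" by (simp add: dist_real_def)
    ultimately show ?thesis using h(1,2) by (intro exI[of _ "(?c, ?r)"]) (auto simp: K_def)
  qed
  have Kpos: "0 < snd i" if "i \<in> K" for i using that by (auto simp: K_def)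
  obtain C where C: "countable C" "C \<subseteq> K"
    "pairwise (\<lambda>i j. disjnt (cball (fst i) (snd i)) (cball (fst j) (snd j))) C"
    "negligible (E - (\<Union>i\<in>C. cball (fst i) (snd i)))"
    by (rule Vitali_covering_theorem_cballs[where K=K and r=snd and S=E and a=fst, OF Kpos cov])
  let ?B = "\<lambda>i. cball (fst i) (snd i) :: real set"
  let ?N = "E - (\<Union>i\<in>C. ?B i)"
  have UB: "(\<Union>i\<in>C. ?B i) \<in> sets borel" using C(1) by (intro sets.countable_UN') auto
  have NB: "?N \<in> sets borel" using E UB by auto
  have "emeasure lborel ?N = 0"
    using C(4) NB by (auto simp: negligible_iff_null_sets null_sets_def)
  then have N0: "?\<mu> ?N = 0" using le[OF NB] by simp
  have dj: "disjoint_family_on ?B C"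
    using C(3) by (auto simp: disjoint_family_on_def pairwise_def disjnt_def)
  have bi: "?\<mu> (?B i) \<le> ennreal p * emeasure lborel (?B i)" if "i \<in> C" for i
  proof -
    have i: "0 < snd i" "F (fst i + snd i) - F (fst i - snd i) \<le> p * (2 * snd i)"
      using that C(2) by (auto simp: K_def)
    have "?\<mu> (?B i) = ennreal (F (fst i + snd i) - F (fst i - snd i))"
      using i by (simp add: cball_eq_atLeastAtMost emeasure_interval_measure_Icc monoD[OF F] cF)
    also have "\<dots> \<le> ennreal (p * (2 * snd i))" using i by (intro ennreal_leI)
    also have "\<dots> = ennreal p * emeasure lborel (?B i)"
      using i p by (simp add: cball_eq_atLeastAtMost ennreal_mult)
    finally show ?thesis .
  qed
  have "(\<Union>i\<in>C. ?B i) \<union> ?N \<in> sets (interval_measure F)" using UB NB by (simp only: sets_interval_measure sets.Un)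
  then have "?\<mu> E \<le> ?\<mu> ((\<Union>i\<in>C. ?B i) \<union> ?N)" by (intro emeasure_mono) auto
  also have "\<dots> \<le> ?\<mu> (\<Union>i\<in>C. ?B i) + ?\<mu> ?N" using UB NB by (intro emeasure_subadditive) auto
  also have "\<dots> = (\<integral>\<^sup>+i. ?\<mu> (?B i) \<partial>count_space C)"
    using C(1) dj N0 by (simp add: emeasure_UN_countable)
  also have "\<dots> \<le> (\<integral>\<^sup>+i. ennreal p * emeasure lborel (?B i) \<partial>count_space C)"
    using bi by (intro nn_integral_mono) auto
  also have "\<dots> = ennreal p * emeasure lborel (\<Union>i\<in>C. ?B i)"
    using C(1) dj by (simp add: nn_integral_cmult emeasure_UN_countable)
  also have "\<dots> \<le> ennreal p * emeasure lborel U"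
  proof (intro mult_left_mono emeasure_mono)
    have "?B i \<subseteq> U" if "i \<in> C" for i
    proof -
      have "i \<in> K" using C(2) that by blast
      then show ?thesis unfolding K_def mem_Collect_eq case_prod_beta by blast
    qed
    then show "(\<Union>i\<in>C. ?B i) \<subseteq> U" by blast
  qed (use U(1) in auto)
  also have "emeasure lborel U \<le> emeasure lborel E + ennreal e'"
  proof -
    have "emeasure lborel U \<le> emeasure lborel (E \<union> (U - E))" using U E by (intro emeasure_mono) auto
    also have "\<dots> \<le> emeasure lborel E + emeasure lborel (U - E)" using U E by (intro emeasure_subadditive) auto
    also have "emeasure lborel (U - E) \<le> ennreal e'" using U E by simp
    finally show ?thesis by (simp add: add_left_mono)
  qed
  finally have "?\<mu> E \<le> ennreal p * (emeasure lborel E + ennreal e')" by (simp add: mult_left_mono)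
  also have "\<dots> = ennreal p * emeasure lborel E + ennreal (p * e')"
    using p e' by (simp add: distrib_left ennreal_mult)
  also have "ennreal (p * e') \<le> ennreal e"
  proof (intro ennreal_leI)
    have "p * e' \<le> (p + 1) * e'" using e' by (intro mult_right_mono) auto
    then show "p * e' \<le> e" using p by (simp add: e'_def)
  qed
  finally show "?\<mu> E \<le> ennreal p * emeasure lborel E + ennreal e" by (simp add: add_left_mono)
qed

text \<open>Both the measure of \<open>F\<close> and the complementary one of \<open>x - F x\<close> are small on the oscillation set, whereas they add
  up to Lebesgue measure.\<close>
lemma oscillation_set_null_real:
  fixes F :: "real \<Rightarrow> real"
  assumes F: "mono F" and G: "mono (\<lambda>x. x - F x)" and pq: "p < q"
  shows "emeasure lborel (oscillation_set F 1 p q) = 0"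
proof -
  have dq: "0 \<le> diff_quotient F 1 x h" "diff_quotient F 1 x h \<le> 1" if "h \<noteq> 0" for x h
    using that monoD[OF F, of x "x+h"] monoD[OF F, of "x+h" x] monoD[OF G, of x "x+h"] monoD[OF G, of "x+h" x]
    by (cases "0 < h"; simp add: diff_quotient_def zero_le_divide_iff divide_le_eq)+
  have lip: "\<bar>F x - F y\<bar> \<le> \<bar>x - y\<bar>" for x y
    using monoD[OF F, of x y] monoD[OF F, of y x] monoD[OF G, of x y] monoD[OF G, of y x] by linarith
  have cF: "continuous_on UNIV F"
    by (rule continuous_onI) (metis dist_real_def lip le_less_trans less_imp_le)
  note OB = oscillation_set_borel[OF cF, of 1 p q]
  have gq: "diff_quotient (\<lambda>x. x - F x) 1 x h = 1 - diff_quotient F 1 x h" if "h \<noteq> 0" for x h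
    using that by (simp add: diff_quotient_def field_simps)
  have "emeasure lborel (oscillation_set F 1 p q \<inter> {-real k..real k}) = 0" for k
  \<comment> \<open>The quotients of F lie in [0, 1], so outside this case the oscillation set is
    empty.\<close>
  proof (cases "0 \<le> p \<and> q \<le> 1")
    case True
    let ?E = "oscillation_set F 1 p q \<inter> {-real k..real k}"
    have E: "?E \<in> sets borel" "bounded ?E" using OB by (auto intro: bounded_subset[of "{-real k..real k}"])
    have fin: "emeasure lborel ?E < top"
    proof -
      have "emeasure lborel ?E \<le> emeasure lborel {-real k..real k}" by (rule emeasure_mono) auto
      also have "\<dots> < top" by simp
      finally show ?thesis .
    qed
    have a: "emeasure (interval_measure F) ?E \<le> ennreal p * emeasure lborel ?E"
      using True by (intro interval_measure_le_of_small_quotient[OF F G E]) (auto simp: oscillation_set_def)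
    have "emeasure (interval_measure (\<lambda>x. x - F x)) ?E \<le> ennreal (1 - q) * emeasure lborel ?E"
    proof (rule interval_measure_le_of_small_quotient[OF G _ E])
      show "mono (\<lambda>x. x - (x - F x))" using F by simp
      fix x assume "x \<in> ?E"
      then have fr: "\<exists>\<^sub>F h in at 0. q < diff_quotient F 1 x h" by (simp add: oscillation_set_def)
      have "\<forall>\<^sub>F h in at 0. q < diff_quotient F 1 x h \<longrightarrow> diff_quotient (\<lambda>x. x - F x) 1 x h < 1 - q"
        by (auto simp: eventually_at gq intro!: exI[of _ 1])
      then show "\<exists>\<^sub>F h in at 0. diff_quotient (\<lambda>x. x - F x) 1 x h < 1 - q"
        using fr by (rule frequently_rev_mp[rotated])
    qed (use True in auto)
    note 1 = add_mono[OF a this, unfolded lborel_eq_sum_interval_measure[OF F G E(1)]]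
    have b: "emeasure lborel ?E \<le> ennreal (1 - (q - p)) * emeasure lborel ?E"
    proof -
      have "p + (1 - q) = 1 - (q - p)" by simp
      with 1 show ?thesis using True by (simp only: distrib_right[symmetric] ennreal_plus[symmetric] diff_ge_0_iff_ge)
    qed
    show ?thesis
    proof -
      obtain m where m: "0 \<le> m" "emeasure lborel ?E = ennreal m" using fin by (cases "emeasure lborel ?E") auto
      \<comment> \<open>Concluding m = 0 needs a finite m, hence the restriction to bounded
        pieces.\<close>
      have "m \<le> (1 - (q - p)) * m"
        using b True pq m(1) unfolding m(2) by (subst (asm) ennreal_mult[symmetric]) (auto simp: ennreal_le_iff)
      then have "(q - p) * m \<le> 0" by (simp add: algebra_simps)
      then have "m = 0" using pq m(1) by (simp add: mult_le_0_iff)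
      then show ?thesis using m(2) by simp
    qed
  next
    case False
    have "oscillation_set F 1 p q = {}"
    proof (rule ccontr)
      assume "oscillation_set F 1 p q \<noteq> {}"
      then obtain x where x: "\<exists>\<^sub>F h in at 0. diff_quotient F 1 x h < p" "\<exists>\<^sub>F h in at 0. q < diff_quotient F 1 x h"
        by (auto simp: oscillation_set_def)
      obtain h where "h \<noteq> 0" "diff_quotient F 1 x h < p" using x(1) unfolding frequently_at by (auto dest!: spec[of _ 1])
      moreover obtain h' where "h' \<noteq> 0" "q < diff_quotient F 1 x h'" using x(2) unfolding frequently_at by (auto dest!: spec[of _ 1])
      ultimately show False using False dq[of h x] dq[of h' x] by linarith
    qed
    then show ?thesis by simp
  qed
  then have "(\<Union>k. oscillation_set F 1 p q \<inter> {-real k..real k}) \<in> null_sets lborel"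
    using OB by (intro null_sets_UN) (auto simp: null_sets_def)
  moreover have "(\<Union>k. oscillation_set F 1 p q \<inter> {-real k..real k}) = oscillation_set F 1 p q"
  proof -
    have "\<exists>k. x \<in> {-real k..real k}" for x :: real
    proof -
      obtain k :: nat where "\<bar>x\<bar> \<le> real k" using real_arch_simple by blast
      then show ?thesis by (intro exI[of _ k]) auto
    qed
    then show ?thesis by blast
  qed
  ultimately show ?thesis by (simp add: null_sets_def)
qed

text \<open>Division by M and averaging with the identity bring all slopes into [0, 1]; the
  thresholds undergo the same affine map.\<close>

lemma oscillation_set_null_lipschitz_real:
  fixes f :: "real \<Rightarrow> real"
  assumes f: "K-lipschitz_on UNIV f" and pq: "p < q"
  shows "emeasure lborel (oscillation_set f 1 p q) = 0"
proof -
  define M where "M = K + 1"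
  have M: "0 < M" using lipschitz_on_nonneg[OF f] by (simp add: M_def)
  have lip: "\<bar>f x - f y\<bar> \<le> M * \<bar>x - y\<bar>" for x y
  proof -
    have "\<bar>f x - f y\<bar> \<le> K * \<bar>x - y\<bar>" using lipschitz_onD[OF f, of x y] by (simp add: dist_real_def)
    also have "\<dots> \<le> M * \<bar>x - y\<bar>" by (intro mult_right_mono) (auto simp: M_def)
    finally show ?thesis .
  qed
  define F where "F x = (f x / M + x) / 2" for x
  have a: "\<bar>f x / M - f y / M\<bar> \<le> \<bar>x - y\<bar>" for x y
    using lip[of x y] M by (simp add: field_simps flip: diff_divide_distrib)
  have aux: "(A + x) / 2 \<le> (B + y) / 2 \<and> x - (A + x) / 2 \<le> y - (B + y) / 2"
    if "\<bar>A - B\<bar> \<le> \<bar>x - y\<bar>" "x \<le> y" for A B x y :: real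
  proof -
    have "A - B \<le> y - x" "B - A \<le> y - x" using that by linarith+
    then show ?thesis by (simp add: field_simps)
  qed
  have F: "mono F"
  proof (rule monoI)
    fix x y :: real assume "x \<le> y"
    then show "F x \<le> F y" using aux[OF a[of x y]] unfolding F_def by blast
  qed
  have G: "mono (\<lambda>x. x - F x)"
  proof (rule monoI)
    fix x y :: real assume "x \<le> y"
    then show "x - F x \<le> y - F y" using aux[OF a[of x y]] unfolding F_def by blast
  qed
  have qF: "diff_quotient F 1 x h = (diff_quotient f 1 x h / M + 1) / 2" if "h \<noteq> 0" for x h
    using that M by (simp add: diff_quotient_def F_def field_simps)
  have "(\<exists>\<^sub>F h in at 0. diff_quotient f 1 x h < p) \<longleftrightarrow> (\<exists>\<^sub>F h in at 0. diff_quotient F 1 x h < (p / M + 1) / 2)"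
    "(\<exists>\<^sub>F h in at 0. q < diff_quotient f 1 x h) \<longleftrightarrow> (\<exists>\<^sub>F h in at 0. (q / M + 1) / 2 < diff_quotient F 1 x h)" for x
    by (intro frequently_cong[where P="\<lambda>h. h \<noteq> 0"]; use M in \<open>auto simp: qF eventually_at divide_less_cancel intro!: exI[of _ 1]\<close>)+
  then have "oscillation_set f 1 p q = oscillation_set F 1 ((p / M + 1) / 2) ((q / M + 1) / 2)"
    by (simp add: oscillation_set_def)
  also have "emeasure lborel \<dots> = 0"
    using M pq by (intro oscillation_set_null_real[OF F G]) (simp add: divide_less_cancel)
  finally show ?thesis .
qed

text \<open>Fubini for the indicator of the set at x + t v: integration over t gives 0 by the result
  on the line, whereas integration over x gives the measure of the set for each t.\<close>

lemma oscillation_set_null: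
  fixes f :: "'a::euclidean_space \<Rightarrow> real"
  assumes f: "K-lipschitz_on UNIV f" and pq: "p < q"
  shows "emeasure lborel (oscillation_set f v p q) = 0"
proof -
  let ?E = "oscillation_set f v p q"
  have cf: "continuous_on UNIV f" using f by (rule lipschitz_on_continuous_on)
  have E[measurable]: "?E \<in> sets borel" by (rule oscillation_set_borel[OF cf])
  have m: "(\<lambda>(t, x). indicator ?E (x + t *\<^sub>R v) :: ennreal) \<in> borel_measurable (lborel \<Otimes>\<^sub>M lborel)"
  proof -
    have "(\<lambda>p. snd p + fst p *\<^sub>R v) \<in> borel_measurable (borel \<Otimes>\<^sub>M (borel :: 'a measure))" by measurable
    have "(\<lambda>p. indicator ?E (snd p + fst p *\<^sub>R v) :: ennreal) \<in> borel_measurable (borel \<Otimes>\<^sub>M (borel :: 'a measure))"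
      by measurable
    then show ?thesis by (simp add: case_prod_beta' lborel_prod borel_prod cong: measurable_cong_sets)
  qed
  have line: "(\<integral>\<^sup>+t. indicator ?E (x + t *\<^sub>R v) \<partial>lborel) = 0" for x
  proof -
    define k where "k t = f (x + t *\<^sub>R v)" for t :: real
    have k: "(K * norm v)-lipschitz_on UNIV k"
    proof (rule lipschitz_onI)
      fix s t :: real
      have "dist (k s) (k t) \<le> K * dist (x + s *\<^sub>R v) (x + t *\<^sub>R v)"
        unfolding k_def by (rule lipschitz_onD[OF f]) auto
      then show "dist (k s) (k t) \<le> K * norm v * dist s t"
        by (simp add: dist_norm algebra_simps flip: scaleR_left_diff_distrib)
    qed (use lipschitz_on_nonneg[OF f] in simp)
    have "x + t *\<^sub>R v \<in> ?E \<longleftrightarrow> t \<in> oscillation_set k 1 p q" for t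
      by (simp add: oscillation_set_def diff_quotient_def k_def algebra_simps)
    then have "indicator ?E (x + t *\<^sub>R v) = (indicator (oscillation_set k 1 p q) t :: ennreal)" for t
      by (simp add: indicator_def)
    then have "(\<integral>\<^sup>+t. indicator ?E (x + t *\<^sub>R v) \<partial>lborel) = (\<integral>\<^sup>+t. indicator (oscillation_set k 1 p q) t \<partial>lborel)"
      by simp
    also have "\<dots> = emeasure lborel (oscillation_set k 1 p q)"
      using oscillation_set_borel[OF lipschitz_on_continuous_on[OF k], of 1 p q]
      by (intro nn_integral_indicator) simp
    also have "\<dots> = 0" by (rule oscillation_set_null_lipschitz_real[OF k pq])
    finally show ?thesis .
  qed
  have tr: "(\<integral>\<^sup>+x. indicator ?E (x + t *\<^sub>R v) \<partial>lborel) = emeasure lborel ?E" for t :: real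
  proof -
    have "(\<integral>\<^sup>+x. indicator ?E (x + t *\<^sub>R v) \<partial>lborel) = (\<integral>\<^sup>+x. indicator ?E (t *\<^sub>R v + x) \<partial>lborel)"
      by (simp add: add.commute)
    also have "\<dots> = (\<integral>\<^sup>+x. indicator ?E x \<partial>distr lborel borel ((+) (t *\<^sub>R v)))"
      by (subst nn_integral_distr) auto
    also have "\<dots> = emeasure lborel ?E" by (simp add: lborel_distr_plus)
    finally show ?thesis .
  qed
  have "(\<integral>\<^sup>+x. \<integral>\<^sup>+t. indicator ?E (x + t *\<^sub>R v) \<partial>lborel \<partial>lborel) = (\<integral>\<^sup>+t. \<integral>\<^sup>+x. indicator ?E (x + t *\<^sub>R v) \<partial>lborel \<partial>lborel)"
    using lborel_pair.Fubini'[OF m] by simp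
  then have "(\<integral>\<^sup>+(t::real). emeasure lborel ?E \<partial>lborel) = 0" unfolding line tr by simp
  then show ?thesis by (simp add: ennreal_mult_eq_top_iff)
qed

section \<open>Directional derivatives in space\<close>

lemma lipschitz_AE_directional_derivative:
  fixes f :: "'a::euclidean_space \<Rightarrow> real"
  assumes f: "K-lipschitz_on UNIV f"
  shows "AE x in lborel. \<exists>l. (diff_quotient f v x \<longlongrightarrow> l) (at 0)"
proof -
  have cf: "continuous_on UNIV f" using f by (rule lipschitz_on_continuous_on)
  have "AE x in lborel. x \<notin> oscillation_set f v p q" if "p < q" for p q
    by (rule AE_not_in) (use oscillation_set_borel[OF cf] oscillation_set_null[OF f that] in \<open>simp add: null_sets_def\<close>)
  then have "AE x in lborel. \<forall>p\<in>\<rat>. \<forall>q\<in>\<rat>. p < q \<longrightarrow> x \<notin> oscillation_set f v p q"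
    by (simp add: AE_ball_countable countable_rat)
  then show ?thesis
  proof eventually_elim
    case (elim x)
    have "\<bar>diff_quotient f v x h\<bar> \<le> K * norm v" if "h \<noteq> 0" for h
      using lipschitz_onD[OF f, of "x + h *\<^sub>R v" x] that
      by (simp add: diff_quotient_def dist_norm field_simps)
    then obtain l where "(diff_quotient f v x \<longlongrightarrow> l) (at 0)"
      by (rule bounded_imp_oscillation_or_convergent) (use elim in \<open>auto simp: oscillation_set_def\<close>)
    then show ?case ..
  qed
qed

text \<open>A limit along one fixed sequence, so that the function is measurable even where the
  derivative does not exist.\<close>

definition dir_deriv :: "('a::real_vector \<Rightarrow> real) \<Rightarrow> 'a \<Rightarrow> 'a \<Rightarrow> real" where
  "dir_deriv f v x = lim (\<lambda>k. diff_quotient f v x (inverse (real (Suc k))))"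

lemma dir_deriv_eqI:
  assumes "(diff_quotient f v x \<longlongrightarrow> l) (at 0)"
  shows "dir_deriv f v x = l"
proof -
  have "filterlim (\<lambda>k. inverse (real (Suc k))) (at 0) sequentially"
    using LIMSEQ_inverse_real_of_nat by (simp add: filterlim_at)
  from filterlim_compose[OF assms this] show ?thesis unfolding dir_deriv_def by (rule limI)
qed

lemma AE_dir_deriv:
  fixes f :: "'a::euclidean_space \<Rightarrow> real"
  assumes "K-lipschitz_on UNIV f"
  shows "AE x in lebesgue. (diff_quotient f v x \<longlongrightarrow> dir_deriv f v x) (at 0)"
proof (rule AE_completion)
  show "AE x in lborel. (diff_quotient f v x \<longlongrightarrow> dir_deriv f v x) (at 0)"
    using lipschitz_AE_directional_derivative[OF assms, of v]
    by eventually_elim (auto dest: dir_deriv_eqI)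
qed

lemma dir_deriv_measurable:
  fixes f :: "'a::euclidean_space \<Rightarrow> real"
  assumes "K-lipschitz_on UNIV f"
  shows "dir_deriv f v \<in> borel_measurable lebesgue"
proof (rule measurable_completion)
  have cf: "continuous_on UNIV f" using assms by (rule lipschitz_on_continuous_on)
  have "(\<lambda>x. diff_quotient f v x h) \<in> borel_measurable lborel" for h
  proof -
    have "continuous_on UNIV (\<lambda>x. diff_quotient f v x h)"
      unfolding diff_quotient_def divide_inverse
      by (intro continuous_intros continuous_on_compose2[OF cf] cf) auto
    then show ?thesis by (simp add: borel_measurable_continuous_onI)
  qed
  then show "dir_deriv f v \<in> borel_measurable lborel"
    unfolding dir_deriv_def[abs_def] by (intro borel_measurable_lim_metric)
qed

lemma diff_quotient_le:
  fixes f :: "'a::euclidean_space \<Rightarrow> real"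
  assumes "K-lipschitz_on UNIV f" "h \<noteq> 0"
  shows "\<bar>diff_quotient f v x h\<bar> \<le> K * norm v"
  using lipschitz_onD[OF assms(1), of "x + h *\<^sub>R v" x] assms(2)
  by (simp add: diff_quotient_def dist_norm field_simps)

lemma AE_dir_deriv_le:
  fixes f :: "'a::euclidean_space \<Rightarrow> real"
  assumes "K-lipschitz_on UNIV f"
  shows "AE x in lebesgue. \<bar>dir_deriv f v x\<bar> \<le> K * norm v"
  using AE_dir_deriv[OF assms, of v]
proof eventually_elim
  case (elim x)
  show ?case
  proof (rule tendsto_upperbound[OF tendsto_rabs[OF elim]])
    show "\<forall>\<^sub>F h in at 0. \<bar>diff_quotient f v x h\<bar> \<le> K * norm v"
      using diff_quotient_le[OF assms] by (auto simp: eventually_at intro!: exI[of _ 1])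
  qed simp
qed

lemma dir_deriv_mult_integrable:
  fixes f :: "'a::euclidean_space \<Rightarrow> real"
  assumes f: "K-lipschitz_on UNIV f" and \<phi>: "integrable lebesgue \<phi>"
  shows "integrable lebesgue (\<lambda>x. dir_deriv f v x * \<phi> x)"
proof (rule Bochner_Integration.integrable_bound)
  show "integrable lebesgue (\<lambda>x. (K * norm v) * \<phi> x)" using \<phi> by (rule integrable_mult_right)
  show "(\<lambda>x. dir_deriv f v x * \<phi> x) \<in> borel_measurable lebesgue"
    using dir_deriv_measurable[OF f] \<phi> by (intro borel_measurable_times) auto
  show "AE x in lebesgue. norm (dir_deriv f v x * \<phi> x) \<le> norm (K * norm v * \<phi> x)"
    using AE_dir_deriv_le[OF f, of v]
    by eventually_elim (simp add: abs_mult mult_right_mono lipschitz_on_nonneg[OF f])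
qed

text \<open>Moving the translation from \<open>f\<close> to \<open>\<phi>\<close> and differentiating both integrals.\<close>
lemma dir_deriv_weak:
  fixes f :: "real^'n \<Rightarrow> real"
  assumes f: "K-lipschitz_on UNIV f" and \<phi>: "\<phi> \<in> test_functions \<Omega>"
  shows "(\<integral>x. dir_deriv f v x * \<phi> x \<partial>lebesgue) = - (\<integral>x. f x * (grad \<phi> x \<bullet> v) \<partial>lebesgue)"
proof -
  have cf: "continuous_on UNIV f" using f by (rule lipschitz_on_continuous_on)
  note c\<phi> = test_function_continuous[OF \<phi>] and s\<phi> = test_function_support(1)[OF \<phi>]
  have K: "0 \<le> K" using f by (rule lipschitz_on_nonneg)
  define H where "H s = (\<integral>x. f (x + s *\<^sub>R v) * \<phi> x \<partial>lebesgue)" for s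
  have c1: "continuous_on UNIV (\<lambda>x. f (x + s *\<^sub>R v))" for s
    by (intro continuous_on_compose2[OF cf] continuous_intros) auto
  have 1: "(H has_real_derivative (\<integral>x. dir_deriv f v x * \<phi> x \<partial>lebesgue)) (at 0)"
    unfolding H_def
  proof (rule has_derivative_integral_dominated[of 0 1])
    show "integrable lebesgue (\<lambda>x. f (x + s *\<^sub>R v) * \<phi> x)" for s
      by (rule compact_support_integrable[OF _ s\<phi>])
         (auto intro!: continuous_on_mult c1 c\<phi> simp: eq_0_outside_support)
    show "integrable lebesgue (\<lambda>x. (K * norm v) * \<bar>\<phi> x\<bar>)"
      by (intro integrable_mult_right integrable_abs compact_support_integrable[OF c\<phi> s\<phi>] eq_0_outside_support)
    show "(\<lambda>x. dir_deriv f v x * \<phi> x) \<in> borel_measurable lebesgue"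
      using dir_deriv_measurable[OF f] continuous_lebesgue_measurable[OF c\<phi>] by (intro borel_measurable_times)
    show "AE x in lebesgue. ((\<lambda>s. f (x + s *\<^sub>R v) * \<phi> x) has_real_derivative dir_deriv f v x * \<phi> x) (at 0)"
      using AE_dir_deriv[OF f, of v]
    proof eventually_elim
      case (elim x)
      then have "((\<lambda>s. f (x + s *\<^sub>R v)) has_real_derivative dir_deriv f v x) (at 0)"
        by (simp add: has_field_derivative_iff diff_quotient_def[abs_def])
      then show ?case by (rule DERIV_cmult_right)
    qed
    show "AE x in lebesgue. \<bar>f (x + s *\<^sub>R v) * \<phi> x - f (x + 0 *\<^sub>R v) * \<phi> x\<bar> \<le> K * norm v * \<bar>\<phi> x\<bar> * \<bar>s - 0\<bar>" for s
    proof (rule AE_I2)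
      fix x
      have "\<bar>f (x + s *\<^sub>R v) - f x\<bar> \<le> K * (\<bar>s\<bar> * norm v)"
        using lipschitz_onD[OF f, of "x + s *\<^sub>R v" x] by (simp add: dist_norm)
      then have "\<bar>f (x + s *\<^sub>R v) - f x\<bar> * \<bar>\<phi> x\<bar> \<le> K * (\<bar>s\<bar> * norm v) * \<bar>\<phi> x\<bar>" by (rule mult_right_mono) simp
      moreover have "f (x + s *\<^sub>R v) * \<phi> x - f (x + 0 *\<^sub>R v) * \<phi> x = (f (x + s *\<^sub>R v) - f x) * \<phi> x"
        by (simp add: left_diff_distrib)
      ultimately show "\<bar>f (x + s *\<^sub>R v) * \<phi> x - f (x + 0 *\<^sub>R v) * \<phi> x\<bar> \<le> K * norm v * \<bar>\<phi> x\<bar> * \<bar>s - 0\<bar>"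
        by (simp add: abs_mult mult_ac)
    qed
  qed simp
  obtain r where r: "support \<phi> \<subseteq> ball 0 r" using bounded_subset_ballD[OF compact_imp_bounded[OF s\<phi>]] by blast
  \<comment> \<open>\<open>f\<close> has no compact support, so it is cut off beyond radius R; the
    ball of radius R contains all translates of the support of \<phi> that occur.\<close>
  define R where "R = r + norm v"
  define c where "c x = f x * max 0 (min 1 (R + 1 - norm x))" for x
  have cc: "continuous_on UNIV c" unfolding c_def[abs_def] by (intro continuous_intros cf)
  have c0: "c x = 0" if "x \<notin> cball 0 (R + 1)" for x using that by (simp add: c_def)
  have c1': "c x = f x" if "norm x \<le> R" for x using that by (simp add: c_def)
  have sup: "norm x \<le> R" if "x + s *\<^sub>R (- v) \<in> support \<phi>" "\<bar>s\<bar> \<le> 1" for x s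
  proof -
    have "norm (x + s *\<^sub>R (- v)) < r" using that(1) r by auto
    moreover have "norm x \<le> norm (x + s *\<^sub>R (- v)) + norm (s *\<^sub>R v)"
      using norm_triangle_ineq[of "x + s *\<^sub>R (- v)" "s *\<^sub>R v"] by simp
    moreover have "norm (s *\<^sub>R v) \<le> norm v" using that(2) by (simp add: mult_left_le_one_le)
    ultimately show ?thesis by (simp add: R_def)
  qed
  have "((\<lambda>s. \<integral>x. \<phi> (x + s *\<^sub>R (- v)) * c x \<partial>lebesgue) has_real_derivative
      (\<integral>x. (grad \<phi> (x + 0 *\<^sub>R (- v)) \<bullet> (- v)) * c x \<partial>lebesgue)) (at 0)"
    by (rule integral_shift_has_derivative[OF \<phi> cc compact_cball c0])
  moreover have "(\<integral>x. (grad \<phi> (x + 0 *\<^sub>R (- v)) \<bullet> (- v)) * c x \<partial>lebesgue) = - (\<integral>x. f x * (grad \<phi> x \<bullet> v) \<partial>lebesgue)"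
  proof -
    have e: "(grad \<phi> (x + 0 *\<^sub>R (- v)) \<bullet> (- v)) * c x = - (f x * (grad \<phi> x \<bullet> v))" for x
      using sup[of x 0] c1'[of x] by (cases "x \<in> support \<phi>") (auto simp: grad_eq_0_outside_support)
    show ?thesis unfolding e by simp
  qed
  moreover have "(\<integral>x. \<phi> (x + s *\<^sub>R (- v)) * c x \<partial>lebesgue) = H s" if "s \<in> {-1<..<1}" for s
  proof -
    have "(\<integral>x. \<phi> (x + s *\<^sub>R (- v)) * c x \<partial>lebesgue) = (\<integral>x. \<phi> (x + s *\<^sub>R (- v)) * f x \<partial>lebesgue)"
    proof (rule Bochner_Integration.integral_cong[OF refl])
      fix x show "\<phi> (x + s *\<^sub>R (- v)) * c x = \<phi> (x + s *\<^sub>R (- v)) * f x"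
        using sup[of x s] c1'[of x] that
        by (cases "x + s *\<^sub>R (- v) \<in> support \<phi>") (auto simp: eq_0_outside_support)
    qed
    also have "\<dots> = (\<integral>x. \<phi> (x + s *\<^sub>R v + s *\<^sub>R (- v)) * f (x + s *\<^sub>R v) \<partial>lebesgue)"
      by (rule lebesgue_integral_translation[symmetric])
         (intro continuous_on_mult cf continuous_on_compose2[OF c\<phi>] continuous_intros, auto)
    finally show ?thesis by (simp add: H_def mult.commute)
  qed
  ultimately have "(H has_real_derivative - (\<integral>x. f x * (grad \<phi> x \<bullet> v) \<partial>lebesgue)) (at 0)"
    by (intro has_field_derivative_transform_within_open[where S="{-1<..<1}" and g=H
        and f="\<lambda>s. \<integral>x. \<phi> (x + s *\<^sub>R (- v)) * c x \<partial>lebesgue"]) auto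
  with 1 show ?thesis by (rule DERIV_unique)
qed

text \<open>The weak form depends on \<open>v\<close> only through a scalar product with the
  gradient of the test function; the fundamental lemma transfers this linearity to the pointwise
  derivatives.\<close>

lemma AE_dir_deriv_linear:
  fixes f :: "real^'n \<Rightarrow> real"
  assumes f: "K-lipschitz_on UNIV f"
  shows "AE x in lebesgue. dir_deriv f v x = (\<Sum>i\<in>UNIV. v $ i * dir_deriv f (axis i 1) x)"
proof -
  define h where "h x = dir_deriv f v x - (\<Sum>i\<in>UNIV. v $ i * dir_deriv f (axis i 1) x)" for x
  have cf: "continuous_on UNIV f" using f by (rule lipschitz_on_continuous_on)
  have hm: "(\<lambda>x. h x * \<phi> x) = (\<lambda>x. dir_deriv f v x * \<phi> x - (\<Sum>i\<in>UNIV. v $ i * (dir_deriv f (axis i 1) x * \<phi> x)))" for \<phi>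
    by (simp add: h_def fun_eq_iff left_diff_distrib sum_distrib_right mult.assoc)
  have hi: "integrable lebesgue (\<lambda>x. h x * \<phi> x)" if "integrable lebesgue \<phi>" for \<phi>
    unfolding hm by (intro Bochner_Integration.integrable_diff Bochner_Integration.integrable_sum
        integrable_mult_right dir_deriv_mult_integrable[OF f that])
  have "AE x in lebesgue. x \<in> UNIV \<longrightarrow> h x = 0"
  proof (rule fundamental_lemma_variations)
    show "h \<in> borel_measurable lebesgue"
      unfolding h_def[abs_def]
      by (intro borel_measurable_diff borel_measurable_sum borel_measurable_times borel_measurable_const
          dir_deriv_measurable[OF f])
    show "integrable lebesgue (\<lambda>x. indicator (cbox a b) x *\<^sub>R h x)" for a b
    proof -
      have "integrable lebesgue (indicat_real (cbox a b))"
        using lmeasurable_cbox[of a b] by (intro integrable_real_indicator) (auto simp: fmeasurable_def)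
      from hi[OF this] show ?thesis by (simp add: mult.commute)
    qed
    fix \<phi> :: "real^'n \<Rightarrow> real" assume \<phi>: "\<phi> \<in> test_functions UNIV"
    note c\<phi> = test_function_continuous[OF \<phi>] and s\<phi> = test_function_support(1)[OF \<phi>]
    have \<phi>i: "integrable lebesgue \<phi>"
      by (rule compact_support_integrable[OF c\<phi> s\<phi>]) (rule eq_0_outside_support)
    have gi: "integrable lebesgue (\<lambda>x. f x * (grad \<phi> x \<bullet> w))" for w
      by (rule compact_support_integrable[OF _ s\<phi>])
         (auto intro!: continuous_on_mult cf continuous_on_inner test_function_grad_continuous[OF \<phi>] continuous_on_const
           simp: grad_eq_0_outside_support)
    have "(\<integral>x. h x * \<phi> x \<partial>lebesgue) = (\<integral>x. dir_deriv f v x * \<phi> x \<partial>lebesgue)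
        - (\<Sum>i\<in>UNIV. v $ i * (\<integral>x. dir_deriv f (axis i 1) x * \<phi> x \<partial>lebesgue))"
      unfolding hm by (simp add: dir_deriv_mult_integrable[OF f \<phi>i])
    also have "\<dots> = - (\<integral>x. f x * (grad \<phi> x \<bullet> v) \<partial>lebesgue) + (\<Sum>i\<in>UNIV. v $ i * (\<integral>x. f x * (grad \<phi> x \<bullet> axis i 1) \<partial>lebesgue))"
      by (simp add: dir_deriv_weak[OF f \<phi>] sum_negf)
    also have "(\<Sum>i\<in>UNIV. v $ i * (\<integral>x. f x * (grad \<phi> x \<bullet> axis i 1) \<partial>lebesgue))
        = (\<integral>x. (\<Sum>i\<in>UNIV. v $ i * (f x * (grad \<phi> x \<bullet> axis i 1))) \<partial>lebesgue)"
      using gi by (simp add: Bochner_Integration.integral_sum)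
    also have "\<dots> = (\<integral>x. f x * (grad \<phi> x \<bullet> v) \<partial>lebesgue)"
      by (rule Bochner_Integration.integral_cong)
         (auto simp: inner_axis inner_vec_def[of _ v] sum_distrib_left mult_ac intro!: sum.cong)
    finally show "(\<integral>x. \<phi> x * h x \<partial>lebesgue) = 0" by (simp add: mult.commute)
  qed simp
  then show ?thesis by eventually_elim (simp add: h_def)
qed

text \<open>Off one null set the derivatives in countably many dense directions exist and are linear
  in the direction. At such a point finitely many of these directions form a net of the unit sphere,
  and the Lipschitz bound controls all others uniformly.\<close>

theorem Rademacher:
  fixes f :: "real^'n \<Rightarrow> real"
  assumes f: "K-lipschitz_on UNIV f"
  shows "negligible {x. \<not> f differentiable (at x)}"
proof -
  obtain Q :: "(real^'n) set" where Q: "countable Q" "\<And>X. open X \<Longrightarrow> X \<noteq> {} \<Longrightarrow> \<exists>d\<in>Q. d \<in> X"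
    by (rule countable_dense_setE) blast
  have K: "0 \<le> K" using f by (rule lipschitz_on_nonneg)
  define G :: "real^'n \<Rightarrow> real^'n" where "G x = (\<chi> i. dir_deriv f (axis i 1) x)" for x
  have "AE x in lebesgue. \<forall>v\<in>Q. (diff_quotient f v x \<longlongrightarrow> G x \<bullet> v) (at 0)"
  proof (subst AE_ball_countable[OF Q(1)], rule ballI)
    fix v
    show "AE x in lebesgue. (diff_quotient f v x \<longlongrightarrow> G x \<bullet> v) (at 0)"
      using AE_dir_deriv[OF f, of v] AE_dir_deriv_linear[OF f, of v]
      by eventually_elim (simp add: G_def inner_vec_def mult.commute)
  qed
  then have "AE x in lebesgue. f differentiable (at x)"
  proof eventually_elim
    case (elim x)
    have "(f has_derivative (\<lambda>h. G x \<bullet> h)) (at x)"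
      unfolding has_derivative_at_alt
    proof (intro conjI allI impI)
      show "bounded_linear (\<lambda>h. G x \<bullet> h)" by (rule bounded_linear_inner_right)
      fix e :: real assume e: "0 < e"
      \<comment> \<open>\<open>K\<close> pays for replacing the direction w by v inside
        \<open>f\<close>, \<open>norm (G x)\<close> for doing so in the linear part, and 1 for the
        quotient along v.\<close>
      define C where "C = K + norm (G x) + 1"
      have C: "0 < C" using K by (simp add: C_def add_nonneg_pos)
      define \<eta> where "\<eta> = e / C"
      have \<eta>: "0 < \<eta>" using e C by (simp add: \<eta>_def)
      have "sphere 0 1 \<subseteq> (\<Union>v\<in>Q. ball v \<eta>)"
      proof
        fix w :: "real^'n"
        obtain v where "v \<in> Q" "v \<in> ball w \<eta>" using Q(2)[of "ball w \<eta>"] \<eta> by auto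
        then show "w \<in> (\<Union>v\<in>Q. ball v \<eta>)" by (auto simp: dist_commute)
      qed
      then obtain Q' where Q': "Q' \<subseteq> Q" "finite Q'" "sphere 0 1 \<subseteq> (\<Union>v\<in>Q'. ball v \<eta>)"
        using compactE_image[of "sphere (0::real^'n) 1" Q "\<lambda>v. ball v \<eta>"] by auto
      have "\<forall>\<^sub>F t in at 0. \<forall>v\<in>Q'. dist (diff_quotient f v x t) (G x \<bullet> v) < \<eta>"
        using Q'(1,2) elim \<eta> by (intro eventually_ball_finite ballI tendstoD) auto
      then obtain d where d: "0 < d"
        "\<And>t v. t \<noteq> 0 \<Longrightarrow> \<bar>t\<bar> < d \<Longrightarrow> v \<in> Q' \<Longrightarrow> \<bar>diff_quotient f v x t - G x \<bullet> v\<bar> < \<eta>"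
        by (auto simp: eventually_at dist_real_def)
      have "norm (f y - f x - G x \<bullet> (y - x)) \<le> e * norm (y - x)" if y: "norm (y - x) < d" for y
      proof (cases "y = x")
        case False
        define t where "t = norm (y - x)"
        define w where "w = (y - x) /\<^sub>R t"
        have t: "0 < t" "t < d" using False y by (auto simp: t_def)
        have yw: "y = x + t *\<^sub>R w" using t by (simp add: w_def)
        have "w \<in> sphere 0 1" using t by (simp add: w_def t_def)
        then obtain v where v: "v \<in> Q'" "norm (w - v) \<le> \<eta>"
          using Q'(3) by (force simp: dist_norm norm_minus_commute)
        have 1: "\<bar>f (x + t *\<^sub>R w) - f (x + t *\<^sub>R v)\<bar> \<le> t * (K * \<eta>)"
        proof -
          have "\<bar>f (x + t *\<^sub>R w) - f (x + t *\<^sub>R v)\<bar> \<le> K * norm (t *\<^sub>R (w - v))"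
            using lipschitz_onD[OF f, of "x + t *\<^sub>R w" "x + t *\<^sub>R v"] by (simp add: dist_norm scaleR_diff_right)
          also have "\<dots> = t * (K * norm (w - v))" using t by simp
          also have "\<dots> \<le> t * (K * \<eta>)" using t K v(2) by (intro mult_left_mono) auto
          finally show ?thesis .
        qed
        have 2: "\<bar>f (x + t *\<^sub>R v) - f x - t * (G x \<bullet> v)\<bar> \<le> t * \<eta>"
        proof -
          have "f (x + t *\<^sub>R v) - f x - t * (G x \<bullet> v) = t * (diff_quotient f v x t - G x \<bullet> v)"
            using t by (simp add: diff_quotient_def field_simps)
          then have "\<bar>f (x + t *\<^sub>R v) - f x - t * (G x \<bullet> v)\<bar> = t * \<bar>diff_quotient f v x t - G x \<bullet> v\<bar>"
            using t by (simp add: abs_mult)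
          also have "\<dots> \<le> t * \<eta>" using d(2)[of t v] t v(1) by (intro mult_left_mono) auto
          finally show ?thesis .
        qed
        have 3: "\<bar>t * (G x \<bullet> (v - w))\<bar> \<le> t * (norm (G x) * \<eta>)"
        proof -
          have "\<bar>G x \<bullet> (v - w)\<bar> \<le> norm (G x) * norm (v - w)" by (rule Cauchy_Schwarz_ineq2)
          also have "\<dots> \<le> norm (G x) * \<eta>" using v(2) by (intro mult_left_mono) (auto simp: norm_minus_commute)
          finally show ?thesis using t by (simp add: abs_mult)
        qed
        have "f y - f x - G x \<bullet> (y - x) = (f (x + t *\<^sub>R w) - f (x + t *\<^sub>R v))
            + (f (x + t *\<^sub>R v) - f x - t * (G x \<bullet> v)) + t * (G x \<bullet> (v - w))"
          unfolding yw by (simp add: inner_diff_right algebra_simps)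
        then have "\<bar>f y - f x - G x \<bullet> (y - x)\<bar> \<le> t * (K * \<eta>) + t * \<eta> + t * (norm (G x) * \<eta>)"
          using 1 2 3 by linarith
        also have "\<dots> = t * (C * \<eta>)" by (simp add: C_def algebra_simps)
        also have "\<dots> = e * norm (y - x)" using C by (simp add: \<eta>_def t_def)
        finally show ?thesis by simp
      qed simp
      then show "\<exists>d>0. \<forall>y. norm (y - x) < d \<longrightarrow> norm (f y - f x - G x \<bullet> (y - x)) \<le> e * norm (y - x)"
        using d(1) by blast
    qed
    then show ?case by (auto simp: differentiable_def)
  qed
  then obtain N where "N \<in> null_sets lebesgue" "{x. \<not> f differentiable (at x)} \<subseteq> N"
    by (auto simp: eventually_ae_filter)
  then show ?thesis using negligible_iff_null_sets negligible_subset by blast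
qed

section \<open>Geodesically Lipschitz functions on the sphere\<close>

definition circle :: "'a::real_inner \<Rightarrow> 'a \<Rightarrow> real \<Rightarrow> 'a" where
  "circle a b t = cos t *\<^sub>R a + sin t *\<^sub>R b"

definition orthonormal_pair :: "'a::real_inner \<Rightarrow> 'a \<Rightarrow> bool" where
  "orthonormal_pair a b \<longleftrightarrow> norm a = 1 \<and> norm b = 1 \<and> a \<bullet> b = 0"

lemma circle_0: "circle a b 0 = a"
  by (simp add: circle_def)

lemma norm_circle:
  assumes "orthonormal_pair a b"
  shows "norm (circle a b t) = 1"
proof -
  have "a \<bullet> a = 1" "b \<bullet> b = 1" "a \<bullet> b = 0" "b \<bullet> a = 0"
    using assms by (auto simp: orthonormal_pair_def inner_commute simp flip: power2_norm_eq_inner)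
  then have "circle a b t \<bullet> circle a b t = (cos t)\<^sup>2 + (sin t)\<^sup>2"
    by (simp add: circle_def inner_add_left inner_add_right power2_eq_square)
  then show ?thesis by (simp add: norm_eq_sqrt_inner)
qed

lemma circle_has_derivative:
  "(circle a b has_derivative (\<lambda>h. h *\<^sub>R ((- sin t) *\<^sub>R a + cos t *\<^sub>R b))) (at t)"
  unfolding circle_def[abs_def]
  by (auto intro!: derivative_eq_intros simp: scaleR_add_right scaleR_diff_right mult.commute)

lemma norm_circle_deriv:
  assumes "orthonormal_pair a b"
  shows "norm ((- sin t) *\<^sub>R a + cos t *\<^sub>R b) = 1"
proof -
  have "(- sin t) *\<^sub>R a + cos t *\<^sub>R b = circle a b (t + pi / 2)"
    by (simp add: circle_def cos_add sin_add)
  then show ?thesis using norm_circle[OF assms] by simp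
qed

lemma circle_lipschitz:
  assumes "orthonormal_pair a b"
  shows "norm (circle a b s - circle a b t) \<le> \<bar>s - t\<bar>"
proof -
  have "norm (circle a b s - circle a b t) \<le> 1 * norm (s - t)"
  proof (rule differentiable_bound[of UNIV])
    show "onorm (\<lambda>h. h *\<^sub>R ((- sin t) *\<^sub>R a + cos t *\<^sub>R b)) \<le> 1" for t
      by (rule onorm_le) (simp only: norm_scaleR norm_circle_deriv[OF assms] mult_1 mult_1_right real_norm_def order_refl)
    show "(circle a b has_derivative (\<lambda>h. h *\<^sub>R ((- sin t) *\<^sub>R a + cos t *\<^sub>R b))) (at t within UNIV)" for t
      by (rule circle_has_derivative)
  qed auto
  then show ?thesis by simp
qed

text \<open>The direction \<open>b\<close> is the normalised component of \<omega>' orthogonal to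
  \<omega>.\<close>

lemma sphere_eq_circle:
  fixes \<omega> \<omega>' :: "real^'n"
  assumes n: "2 \<le> CARD('n)" and \<omega>: "norm \<omega> = 1" "norm \<omega>' = 1"
  obtains b \<theta> where "orthonormal_pair \<omega> b" "0 \<le> \<theta>" "\<theta> \<le> pi" "\<omega>' = circle \<omega> b \<theta>"
proof -
  define c where "c = \<omega> \<bullet> \<omega>'"
  define w where "w = \<omega>' - c *\<^sub>R \<omega>"
  have c: "-1 \<le> c" "c \<le> 1" using Cauchy_Schwarz_ineq2[of \<omega> \<omega>'] \<omega> by (auto simp: c_def abs_le_iff)
  have ii: "\<omega> \<bullet> \<omega> = 1" "\<omega>' \<bullet> \<omega>' = 1" using \<omega> by (auto simp flip: power2_norm_eq_inner)
  have "w \<bullet> w = 1 - c\<^sup>2"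
    using ii by (simp add: w_def inner_diff_left inner_diff_right c_def inner_commute power2_eq_square algebra_simps)
  then have nw: "norm w = sin (arccos c)" using c by (simp add: norm_eq_sqrt_inner sin_arccos)
  have ow: "\<omega> \<bullet> w = 0" using ii by (simp add: w_def inner_diff_right c_def)
  show thesis
  proof (cases "w = 0")
    \<comment> \<open>Equal or antipodal points: the sine of the angle vanishes and any unit vector
      orthogonal to \<omega> serves; it exists because n >= 2.\<close>
    case True
    obtain y :: "real^'n" where y: "y \<noteq> 0" "orthogonal \<omega> y"
      using orthogonal_to_vector_exists[of \<omega>] n by auto
    show thesis
    proof (rule that[of "y /\<^sub>R norm y" "arccos c"])
      show "orthonormal_pair \<omega> (y /\<^sub>R norm y)" using y \<omega> by (simp add: orthonormal_pair_def orthogonal_def)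
      show "\<omega>' = circle \<omega> (y /\<^sub>R norm y) (arccos c)"
        using True nw c by (simp add: circle_def w_def)
    qed (use c in \<open>auto intro: arccos_lbound arccos_ubound\<close>)
  next
    case False
    show thesis
    proof (rule that[of "w /\<^sub>R norm w" "arccos c"])
      show "orthonormal_pair \<omega> (w /\<^sub>R norm w)" using False \<omega> ow by (simp add: orthonormal_pair_def)
      have "sin (arccos c) *\<^sub>R (w /\<^sub>R norm w) = w" using False by (simp flip: nw)
      then show "\<omega>' = circle \<omega> (w /\<^sub>R norm w) (arccos c)" using c by (simp add: circle_def w_def)
    qed (use c in \<open>auto intro: arccos_lbound arccos_ubound\<close>)
  qed
qed

text \<open>Up to pi / 3 the derivative cos is at least 1/2; beyond, sin is at least sqrt 3 / 2 >=
  5/6, whereas x / 2 <= 0.8.\<close>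

lemma sin_ge_half:
  assumes "0 \<le> x" "x \<le> pi / 2"
  shows "x / 2 \<le> sin x"
proof (cases "x \<le> pi / 3")
  case True
  have "(\<lambda>x. sin x - x / 2) 0 \<le> (\<lambda>x. sin x - x / 2) x"
  proof (rule DERIV_nonneg_imp_nondecreasing[OF assms(1)])
    fix y assume y: "0 \<le> y" "y \<le> x"
    have "1 / 2 \<le> cos y" using cos_monotone_0_pi_le[of y "pi / 3"] y True by (simp add: cos_60)
    then show "\<exists>d. ((\<lambda>x. sin x - x / 2) has_real_derivative d) (at y) \<and> 0 \<le> d"
      by (intro exI[of _ "cos y - 1 / 2"]) (auto intro!: derivative_eq_intros)
  qed
  then show ?thesis by simp
next
  case False
  have "sin (pi / 3) \<le> sin x" using False assms by (intro sin_monotone_2pi_le) auto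
  moreover have "(5::real) / 3 \<le> sqrt 3" by (rule real_le_rsqrt) (simp add: power2_eq_square)
  moreover have "x \<le> 1.6" using assms(2) pi_less_4 pi_approx by simp
  ultimately show ?thesis by (simp add: sin_60)
qed

text \<open>The chord has length 2 sin (\<theta> / 2).\<close>

lemma angle_le_chord:
  assumes ab: "orthonormal_pair a b" and \<theta>: "0 \<le> \<theta>" "\<theta> \<le> pi"
  shows "\<theta> \<le> 2 * norm (circle a b \<theta> - a)"
proof -
  have i: "a \<bullet> a = 1" "b \<bullet> b = 1" "a \<bullet> b = 0" "b \<bullet> a = 0"
    using ab by (auto simp: orthonormal_pair_def inner_commute simp flip: power2_norm_eq_inner)
  have "(norm (circle a b \<theta> - a))\<^sup>2 = (cos \<theta> - 1)\<^sup>2 + (sin \<theta>)\<^sup>2"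
    unfolding power2_norm_eq_inner
    by (simp add: circle_def inner_add_left inner_add_right inner_diff_left inner_diff_right i power2_eq_square algebra_simps)
  also have "\<dots> = 2 - 2 * cos \<theta>" using sin_cos_squared_add[of \<theta>] by (simp add: power2_diff)
  also have "\<dots> = (2 * sin (\<theta> / 2))\<^sup>2" using cos_double_sin[of "\<theta> / 2"] by (simp add: power_mult_distrib)
  finally have "norm (circle a b \<theta> - a) = 2 * sin (\<theta> / 2)"
    by (rule power2_eq_imp_eq) (use \<theta> in \<open>auto intro!: sin_ge_zero\<close>)
  then show ?thesis using sin_ge_half[of "\<theta> / 2"] \<theta> by simp
qed

text \<open>For \<theta> in [0, pi] the angle is the great-circle distance of the two points. Unlike
  a bound holding almost everywhere on a gradient, this condition passes directly to pointwise
  limits.\<close>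

definition geodesic_lipschitz :: "real \<Rightarrow> (real^'n \<Rightarrow> real) \<Rightarrow> bool" where
  "geodesic_lipschitz L f \<longleftrightarrow>
     (\<forall>a b \<theta>. orthonormal_pair a b \<longrightarrow> 0 \<le> \<theta> \<longrightarrow> \<theta> \<le> pi \<longrightarrow> \<bar>f (circle a b \<theta>) - f a\<bar> \<le> L * \<theta>)"

lemma geodesic_lipschitz_imp_lipschitz:
  fixes f :: "real^'n \<Rightarrow> real"
  assumes n: "2 \<le> CARD('n)" and f: "geodesic_lipschitz L f" and L: "0 \<le> L"
  shows "(2 * L)-lipschitz_on (sphere 0 1) f"
proof (rule lipschitz_onI)
  fix x y :: "real^'n" assume xy: "x \<in> sphere 0 1" "y \<in> sphere 0 1"
  obtain b \<theta> where b: "orthonormal_pair y b" "0 \<le> \<theta>" "\<theta> \<le> pi" "x = circle y b \<theta>"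
    using sphere_eq_circle[OF n, of y x] xy by auto
  have "dist (f x) (f y) \<le> L * \<theta>" using f b by (simp add: geodesic_lipschitz_def dist_real_def)
  also have "\<dots> \<le> L * (2 * norm (circle y b \<theta> - y))" by (intro mult_left_mono L angle_le_chord b)
  finally show "dist (f x) (f y) \<le> 2 * L * dist x y" by (simp add: b(4) dist_norm)
qed (use L in simp)

lemma geodesic_lipschitz_diff:
  fixes f :: "real^'n \<Rightarrow> real"
  assumes n: "2 \<le> CARD('n)" and f: "geodesic_lipschitz L f" and L: "0 \<le> L" and xy: "x \<in> sphere 0 1" "y \<in> sphere 0 1"
  shows "\<bar>f x - f y\<bar> \<le> L * pi"
proof -
  obtain b \<theta> where b: "orthonormal_pair y b" "0 \<le> \<theta>" "\<theta> \<le> pi" "x = circle y b \<theta>"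
    using sphere_eq_circle[OF n, of y x] xy by auto
  have "\<bar>f x - f y\<bar> \<le> L * \<theta>" using f b by (simp add: geodesic_lipschitz_def)
  also have "\<dots> \<le> L * pi" using b L by (intro mult_left_mono)
  finally show ?thesis .
qed

section \<open>Tangential gradients of Lipschitz functions\<close>

lemma tangential_gradient_along_circle:
  assumes v: "has_tangential_gradient f v \<omega>" and b: "orthonormal_pair \<omega> b"
  shows "((\<lambda>t. f (circle \<omega> b t)) has_real_derivative v \<bullet> b) (at 0)"
proof -
  have c: "(circle \<omega> b has_derivative (\<lambda>h. h *\<^sub>R b)) (at 0)"
    using circle_has_derivative[of \<omega> b 0] by simp
  have "(f has_derivative (\<lambda>h. v \<bullet> h)) (at (circle \<omega> b 0) within range (circle \<omega> b))"
    using v norm_circle[OF b] unfolding has_tangential_gradient_def circle_0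
    by (auto intro: has_derivative_subset)
  from has_derivative_in_compose[OF c this] show ?thesis
    by (simp add: has_field_derivative_def mult.commute[of _ "v \<bullet> b"])
qed

text \<open>The difference of two gradients is tangent to the sphere, so it can be tested along the
  great circle in its own direction.\<close>

lemma tangential_gradient_unique:
  fixes v w :: "real^'n"
  assumes \<omega>: "norm \<omega> = 1" and v: "has_tangential_gradient f v \<omega>" and w: "has_tangential_gradient f w \<omega>"
  shows "v = w"
proof (rule ccontr)
  assume "v \<noteq> w"
  define b where "b = (v - w) /\<^sub>R norm (v - w)"
  have "\<omega> \<bullet> (v - w) = 0"
    using v w by (simp add: has_tangential_gradient_def inner_diff_right inner_commute)
  then have b: "orthonormal_pair \<omega> b" using \<omega> \<open>v \<noteq> w\<close> by (simp add: orthonormal_pair_def b_def)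
  have "v \<bullet> b = w \<bullet> b"
    using tangential_gradient_along_circle[OF v b] tangential_gradient_along_circle[OF w b] by (rule DERIV_unique)
  then have "(v - w) \<bullet> (v - w) = 0" using \<open>v \<noteq> w\<close> by (simp add: b_def inner_diff_left)
  then show False using \<open>v \<noteq> w\<close> by simp
qed

lemma tangential_gradient_eq:
  assumes "norm \<omega> = 1" "has_tangential_gradient f v \<omega>"
  shows "tangential_gradient f \<omega> = v"
  unfolding tangential_gradient_def
  using assms tangential_gradient_unique by (intro the_equality) blast+

text \<open>Degree one makes the extension Lipschitz on the whole space, as required by
  \<open>Rademacher\<close>; the extension of degree zero is discontinuous at the origin unless it
  is constant.\<close>

definition homogeneous_ext :: "(real^'n \<Rightarrow> real) \<Rightarrow> real^'n \<Rightarrow> real" where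
  "homogeneous_ext f x = norm x * f (x /\<^sub>R norm x)"

lemma dist_normalized_le:
  fixes x y :: "'a::real_normed_vector"
  assumes "x \<noteq> 0" "y \<noteq> 0"
  shows "norm y * dist (x /\<^sub>R norm x) (y /\<^sub>R norm y) \<le> 2 * dist x y"
proof -
  have "norm y * dist (x /\<^sub>R norm x) (y /\<^sub>R norm y) = norm (norm y *\<^sub>R (x /\<^sub>R norm x - y /\<^sub>R norm y))"
    by (simp add: dist_norm)
  also have "norm y *\<^sub>R (x /\<^sub>R norm x - y /\<^sub>R norm y) = (norm y - norm x) *\<^sub>R (x /\<^sub>R norm x) + (x - y)"
  proof -
    have ex: "norm x *\<^sub>R (x /\<^sub>R norm x) = x" "norm y *\<^sub>R (y /\<^sub>R norm y) = y" using assms by simp_all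
    show ?thesis by (simp only: scaleR_diff_right scaleR_diff_left ex) simp
  qed
  also have "norm \<dots> \<le> norm ((norm y - norm x) *\<^sub>R (x /\<^sub>R norm x)) + norm (x - y)" by (rule norm_triangle_ineq)
  also have "norm ((norm y - norm x) *\<^sub>R (x /\<^sub>R norm x)) = \<bar>norm y - norm x\<bar>"
  proof -
    have "norm (x /\<^sub>R norm x) = 1" using assms by simp
    then show ?thesis by (simp only: norm_scaleR[of "norm y - norm x"] mult_1_right)
  qed
  also have "\<dots> \<le> norm (x - y)" using norm_triangle_ineq3[of y x] by (simp add: norm_minus_commute)
  finally show ?thesis by (simp add: dist_norm)
qed

lemma homogeneous_ext_lipschitz:
  assumes f: "K-lipschitz_on (sphere 0 1) f"
  obtains M where "M-lipschitz_on UNIV (homogeneous_ext f)"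
proof -
  have K: "0 \<le> K" using f by (rule lipschitz_on_nonneg)
  have "bounded (f ` sphere 0 1)"
    using f by (intro compact_imp_bounded compact_continuous_image lipschitz_on_continuous_on) auto
  then obtain B where B: "0 < B" "\<And>\<omega>. norm \<omega> = 1 \<Longrightarrow> \<bar>f \<omega>\<bar> \<le> B"
    unfolding bounded_pos by (auto simp: image_iff)
  have n1: "norm (x /\<^sub>R norm x) = 1" if "x \<noteq> 0" for x :: "real^'a" using that by simp
  have "(B + 2 * K)-lipschitz_on UNIV (homogeneous_ext f)"
  proof (rule lipschitz_onI)
    fix x y :: "real^'a"
    have bound0: "\<bar>homogeneous_ext f z\<bar> \<le> B * norm z" for z
      using B(2)[OF n1[of z]] by (cases "z = 0") (auto simp: homogeneous_ext_def abs_mult mult.commute mult_right_mono)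
    show "dist (homogeneous_ext f x) (homogeneous_ext f y) \<le> (B + 2 * K) * dist x y"
    proof (cases "x = 0 \<or> y = 0")
      case True
      have "0 \<le> K * dist x y" using K by simp
      then show ?thesis using True bound0[of x] bound0[of y]
        by (auto simp: dist_norm homogeneous_ext_def distrib_right)
    next
      case False
      let ?x = "x /\<^sub>R norm x" and ?y = "y /\<^sub>R norm y"
      \<comment> \<open>Radial and angular change; the latter costs the factor 2 of
        \<open>dist_normalized_le\<close>.\<close>
      have "homogeneous_ext f x - homogeneous_ext f y = (norm x - norm y) * f ?x + norm y * (f ?x - f ?y)"
        by (simp add: homogeneous_ext_def algebra_simps)
      then have "dist (homogeneous_ext f x) (homogeneous_ext f y) \<le> \<bar>norm x - norm y\<bar> * \<bar>f ?x\<bar> + norm y * \<bar>f ?x - f ?y\<bar>"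
        unfolding dist_real_def by (metis abs_mult abs_norm_cancel abs_triangle_ineq)
      also have "\<bar>norm x - norm y\<bar> * \<bar>f ?x\<bar> \<le> dist x y * B"
        using B n1 False by (intro mult_mono) (auto simp: dist_norm norm_triangle_ineq3)
      also have "norm y * \<bar>f ?x - f ?y\<bar> \<le> norm y * (K * dist ?x ?y)"
        using lipschitz_onD[OF f, of ?x ?y] n1 False by (intro mult_left_mono) (auto simp: dist_real_def)
      also have "\<dots> = K * (norm y * dist ?x ?y)" by simp
      also have "\<dots> \<le> K * (2 * dist x y)" using False by (intro mult_left_mono dist_normalized_le K) auto
      finally show ?thesis by (simp add: algebra_simps)
    qed
  qed (use B K in simp)
  then show thesis by (rule that)
qed

lemma homogeneous_ext_scale:
  assumes "0 < s"
  shows "homogeneous_ext f (s *\<^sub>R x) = s * homogeneous_ext f x"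
proof -
  have n: "norm (s *\<^sub>R x) = s * norm x" using assms by simp
  have e: "inverse (s * norm x) * s = inverse (norm x)" using assms by (cases "x = 0") (auto simp: field_simps)
  show ?thesis unfolding homogeneous_ext_def n scaleR_scaleR e by simp
qed

text \<open>Homogeneity moves differentiability from x to its projection on the sphere, where the
  restriction sees the tangential part of the gradient.\<close>

lemma homogeneous_ext_differentiable_imp_tangential_gradient:
  assumes x: "x \<noteq> 0" and d: "homogeneous_ext f differentiable (at x)"
  obtains v where "has_tangential_gradient f v (x /\<^sub>R norm x)"
proof -
  let ?g = "homogeneous_ext f" and ?w = "x /\<^sub>R norm x"
  have w: "norm ?w = 1" using x by simp
  have "((\<lambda>y. norm x *\<^sub>R y) has_derivative (\<lambda>h. norm x *\<^sub>R h)) (at ?w)" by (auto intro!: derivative_eq_intros)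
  moreover have "norm x *\<^sub>R ?w = x" using x by simp
  then have "(?g has_derivative (\<lambda>h. grad ?g x \<bullet> h)) (at (norm x *\<^sub>R ?w))" using has_derivative_grad[OF d] by simp
  ultimately have "((\<lambda>y. ?g (norm x *\<^sub>R y)) has_derivative (\<lambda>h. grad ?g x \<bullet> (norm x *\<^sub>R h))) (at ?w)"
    by (rule has_derivative_compose)
  then have "((\<lambda>y. inverse (norm x) * ?g (norm x *\<^sub>R y)) has_derivative (\<lambda>h. inverse (norm x) * (grad ?g x \<bullet> (norm x *\<^sub>R h)))) (at ?w)"
    by (rule has_derivative_mult_right)
  moreover have "(\<lambda>y. inverse (norm x) * ?g (norm x *\<^sub>R y)) = ?g" using x by (simp add: homogeneous_ext_scale fun_eq_iff)
  moreover have "(\<lambda>h. inverse (norm x) * (grad ?g x \<bullet> (norm x *\<^sub>R h))) = (\<lambda>h. grad ?g x \<bullet> h)" using x by (simp add: fun_eq_iff)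
  ultimately have D: "(?g has_derivative (\<lambda>h. grad ?g x \<bullet> h)) (at ?w)" by (simp only:)
  define u where "u = grad ?g x"
  define v where "v = u - (u \<bullet> ?w) *\<^sub>R ?w"
  \<comment> \<open>The linear correction removes the normal part of the derivative. On the sphere
    the last summand cancels it exactly, and its derivative at \<open>?w\<close> is 0, so the
    function agrees with \<open>f\<close> there and has derivative \<open>v\<close>.\<close>
  have G: "((\<lambda>y. ?g y - (u \<bullet> ?w) * (?w \<bullet> y) + (u \<bullet> ?w) * (1 - ((y - ?w) \<bullet> (y - ?w)) / 2)) has_derivative
      (\<lambda>h. u \<bullet> h - (u \<bullet> ?w) * (?w \<bullet> h))) (at ?w)"
    using D unfolding u_def by (auto intro!: derivative_eq_intros)
  have "((\<lambda>y. ?g y - (u \<bullet> ?w) * (?w \<bullet> y) + (u \<bullet> ?w) * (1 - ((y - ?w) \<bullet> (y - ?w)) / 2)) has_derivative (\<lambda>h. v \<bullet> h))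
      (at ?w within sphere 0 1)"
  proof -
    have eq: "(\<lambda>h. u \<bullet> h - (u \<bullet> ?w) * (?w \<bullet> h)) = (\<lambda>h. v \<bullet> h)"
      by (rule ext) (simp only: v_def inner_diff_left inner_scaleR_left)
    show ?thesis using has_derivative_at_withinI[OF G, unfolded eq] .
  qed
  then have "(f has_derivative (\<lambda>h. v \<bullet> h)) (at ?w within sphere 0 1)"
  proof (rule has_derivative_transform[rotated 2])
    show "?w \<in> sphere 0 1" using w by simp
    fix y assume "y \<in> sphere (0::real^'a) 1"
    then have y: "norm y = 1" by simp
    have "(y - ?w) \<bullet> (y - ?w) = 2 - 2 * (?w \<bullet> y)"
    proof -
      have "y \<bullet> y = 1" "?w \<bullet> ?w = 1" using y w by (simp_all only: norm_eq_1)
      then show ?thesis by (simp add: inner_diff_left inner_diff_right inner_commute)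
    qed
    then have "1 - ((y - ?w) \<bullet> (y - ?w)) / 2 = ?w \<bullet> y" by (simp add: diff_divide_distrib)
    then show "f y = ?g y - (u \<bullet> ?w) * (?w \<bullet> y) + (u \<bullet> ?w) * (1 - ((y - ?w) \<bullet> (y - ?w)) / 2)"
      using y by (simp only:) (simp add: homogeneous_ext_def)
  qed
  moreover have "v \<bullet> ?w = 0"
  proof -
    have "?w \<bullet> ?w = 1" using w by (simp only: norm_eq_1)
    then show ?thesis by (simp only: v_def inner_diff_left inner_scaleR_left)
  qed
  ultimately show thesis by (intro that) (simp add: has_tangential_gradient_def)
qed

lemma AE_tangential_gradient_exists:
  fixes f :: "real^'n \<Rightarrow> real"
  assumes n: "2 \<le> CARD('n)" and f: "K-lipschitz_on (sphere 0 1) f"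
  shows "AE \<omega> in sphere_measure. \<exists>v. has_tangential_gradient f v \<omega>"
  unfolding AE_sphere_measure_iff[OF n]
proof -
  obtain M where M: "M-lipschitz_on UNIV (homogeneous_ext f)" by (rule homogeneous_ext_lipschitz[OF f])
  show "negligible {x. x \<noteq> 0 \<and> \<not> (\<exists>v. has_tangential_gradient f v (x /\<^sub>R norm x))}"
  proof (rule negligible_subset[OF Rademacher[OF M]], clarify)
    fix x assume x: "x \<noteq> 0" "\<nexists>v. has_tangential_gradient f v (x /\<^sub>R norm x)" "homogeneous_ext f differentiable (at x)"
    from homogeneous_ext_differentiable_imp_tangential_gradient[OF x(1,3)] x(2) show False by blast
  qed
qed

text \<open>The derivative along the great circle that leaves \<omega> in the direction of
  \<open>v\<close> equals the norm of \<open>v\<close>.\<close>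

lemma geodesic_lipschitz_imp_tangential_gradient_le:
  fixes f :: "real^'n \<Rightarrow> real"
  assumes f: "geodesic_lipschitz L f" and L: "0 \<le> L" and \<omega>: "norm \<omega> = 1" and v: "has_tangential_gradient f v \<omega>"
  shows "norm v \<le> L"
proof (cases "v = 0")
  case False
  define b where "b = v /\<^sub>R norm v"
  have b: "orthonormal_pair \<omega> b"
    using v \<omega> False by (simp add: orthonormal_pair_def b_def has_tangential_gradient_def inner_commute)
  have "((\<lambda>t. (f (circle \<omega> b t) - f (circle \<omega> b 0)) / (t - 0)) \<longlongrightarrow> v \<bullet> b) (at_right 0)"
    using tangential_gradient_along_circle[OF v b] unfolding has_field_derivative_iff
    by (rule tendsto_mono[rotated]) (simp add: at_within_le_at)
  moreover have "\<forall>\<^sub>F t in at_right 0. (f (circle \<omega> b t) - f (circle \<omega> b 0)) / (t - 0) \<le> L"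
    unfolding eventually_at_right_field
  proof (intro exI[of _ pi] conjI allI impI)
    fix t :: real assume t: "0 < t" "t < pi"
    have "\<bar>f (circle \<omega> b t) - f \<omega>\<bar> \<le> L * t" using f b t by (simp add: geodesic_lipschitz_def)
    then have "f (circle \<omega> b t) - f \<omega> \<le> L * t" by linarith
    then show "(f (circle \<omega> b t) - f (circle \<omega> b 0)) / (t - 0) \<le> L" using t by (simp add: circle_0 divide_le_eq)
  qed simp
  ultimately have "v \<bullet> b \<le> L" by (rule tendsto_upperbound) simp
  moreover have "v \<bullet> b = norm v" using False by (simp add: b_def power2_norm_eq_inner[symmetric] power2_eq_square)
  ultimately show ?thesis by simp
qed (use L in simp)

lemma AE_sphere_measure_sphere: "AE \<omega> in (sphere_measure :: (real^'n) measure). \<omega> \<in> sphere 0 1"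
  using AE_space[of "sphere_measure :: (real^'n) measure"] by (simp only: space_sphere_measure)

lemma geodesic_lipschitz_imp_AE_tangential_gradient_le:
  fixes f :: "real^'n \<Rightarrow> real"
  assumes n: "2 \<le> CARD('n)" and f: "geodesic_lipschitz L f" and L: "0 \<le> L"
  shows "AE \<omega> in sphere_measure. norm (tangential_gradient f \<omega>) \<le> L"
proof -
  show ?thesis
    using AE_sphere_measure_sphere AE_tangential_gradient_exists[OF n geodesic_lipschitz_imp_lipschitz[OF n f L]]
  proof eventually_elim
    case (elim \<omega>)
    then obtain v where v: "has_tangential_gradient f v \<omega>" "norm \<omega> = 1" by auto
    then show ?case
      using geodesic_lipschitz_imp_tangential_gradient_le[OF f L v(2,1)] tangential_gradient_eq[OF v(2,1)] by simp
  qed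
qed

text \<open>\<open>v\<close> is orthogonal to x, which kills the term from differentiating 1 /
  |x|.\<close>

lemma radial_has_derivative:
  fixes f :: "real^'n \<Rightarrow> real"
  assumes x: "x \<noteq> 0" and v: "has_tangential_gradient f v (x /\<^sub>R norm x)"
  shows "((\<lambda>y. f (y /\<^sub>R norm y)) has_derivative (\<lambda>h. (v \<bullet> h) / norm x)) (at x)"
proof -
  let ?N = "\<lambda>y :: real^'n. y /\<^sub>R norm y"
  have vx: "v \<bullet> x = 0" using v x by (simp add: has_tangential_gradient_def)
  have "(?N has_derivative (\<lambda>h. (- (inverse (norm x) * (h \<bullet> sgn x) * inverse (norm x))) *\<^sub>R x + inverse (norm x) *\<^sub>R h)) (at x)"
    using x by (auto intro!: derivative_eq_intros has_derivative_norm)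
  then have N: "(?N has_derivative (\<lambda>h. (- (inverse (norm x) * (h \<bullet> sgn x) * inverse (norm x))) *\<^sub>R x + inverse (norm x) *\<^sub>R h)) (at x within - {0})"
    by (rule has_derivative_at_withinI)
  have "?N ` (- {0}) \<subseteq> sphere 0 1"
  proof (rule image_subsetI)
    fix y :: "real^'n" assume "y \<in> - {0}"
    then have "y \<noteq> 0" by simp
    then show "y /\<^sub>R norm y \<in> sphere 0 1" by simp
  qed
  then have "(f has_derivative (\<lambda>h. v \<bullet> h)) (at (?N x) within ?N ` (- {0}))"
    using v unfolding has_tangential_gradient_def by (blast intro: has_derivative_subset)
  from has_derivative_in_compose[OF N this]
  have "((\<lambda>y. f (?N y)) has_derivative (\<lambda>h. v \<bullet> ((- (inverse (norm x) * (h \<bullet> sgn x) * inverse (norm x))) *\<^sub>R x + inverse (norm x) *\<^sub>R h))) (at x within - {0})" .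
  moreover have "(\<lambda>h. v \<bullet> ((- (inverse (norm x) * (h \<bullet> sgn x) * inverse (norm x))) *\<^sub>R x + inverse (norm x) *\<^sub>R h)) = (\<lambda>h. (v \<bullet> h) / norm x)"
    by (rule ext) (simp add: inner_add_right inner_diff_right vx divide_inverse mult.commute)
  moreover have "at x within - {0} = at x" using x by (intro at_within_open) auto
  ultimately show ?thesis by simp
qed

lemma radial_lipschitz:
  fixes f :: "real^'n \<Rightarrow> real"
  assumes f: "K-lipschitz_on (sphere 0 1) f" and x: "1/2 \<le> norm x" and y: "1/2 \<le> norm y"
  shows "\<bar>f (x /\<^sub>R norm x) - f (y /\<^sub>R norm y)\<bar> \<le> 4 * K * norm (x - y)"
proof -
  have K: "0 \<le> K" using f by (rule lipschitz_on_nonneg)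
  have n0: "x \<noteq> 0" "y \<noteq> 0" using x y by auto
  let ?d = "dist (x /\<^sub>R norm x) (y /\<^sub>R norm y)"
  have "1/2 * ?d \<le> norm y * ?d" using y by (intro mult_right_mono) auto
  then have d: "?d \<le> 4 * norm (x - y)" using dist_normalized_le[OF n0] by (simp add: dist_norm)
  have "\<bar>f (x /\<^sub>R norm x) - f (y /\<^sub>R norm y)\<bar> \<le> K * ?d"
    using lipschitz_onD[OF f, of "x /\<^sub>R norm x" "y /\<^sub>R norm y"] n0 by (simp add: dist_real_def)
  also have "\<dots> \<le> K * (4 * norm (x - y))" using d K by (intro mult_left_mono)
  finally show ?thesis by simp
qed

text \<open>The average of the radial extension of \<open>f\<close> over small translates of the circle is differentiable
  along the circle, and almost all translates meet only the points where the bound on the gradient holds.\<close>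
lemma AE_tangential_gradient_le_imp_circle_diff:
  fixes f :: "real^'n \<Rightarrow> real"
  assumes f: "K-lipschitz_on (sphere 0 1) f"
    and neg: "negligible {x. x \<noteq> 0 \<and> \<not> (\<exists>v. has_tangential_gradient f v (x /\<^sub>R norm x) \<and> norm v \<le> L)}"
    and L: "0 \<le> L" and ab: "orthonormal_pair a b" and \<theta>: "0 \<le> \<theta>" and e: "0 < e" "e < 1/2"
  shows "\<bar>f (circle a b \<theta>) - f a\<bar> \<le> L * \<theta> / (1 - e) + 8 * K * e"
proof -
  define p where "p x = f (x /\<^sub>R norm x)" for x
  have K: "0 \<le> K" using f by (rule lipschitz_on_nonneg)
  let ?c = "circle a b"
  define M where "M = lebesgue_on (ball (0 :: real^'n) e)"
  define V where "V = measure M (space M)"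
  have sM: "space M = ball 0 e" by (simp add: M_def)
  interpret finite_measure M unfolding M_def by (rule finite_measure_lebesgue_on) simp
  have V: "0 < V"
    using e(1) content_ball_pos[of e "0::real^'n"] by (simp add: V_def M_def measure_restrict_space)
  \<comment> \<open>The neighbourhood of the circle avoids the origin; at distance at least 1 - e
    from it the gradient of the radial extension is at most L / (1 - e).\<close>
  have half: "1 - e \<le> norm (?c t + y)" "1/2 \<le> norm (?c t + y)" if "y \<in> ball 0 e" for t y
  proof -
    have "norm (?c t) \<le> norm (?c t + y) + norm y" using norm_triangle_ineq4[of "?c t + y" y] by simp
    then show "1 - e \<le> norm (?c t + y)" "1/2 \<le> norm (?c t + y)" using that e norm_circle[OF ab, of t] by auto
  qed
  \<comment> \<open>Near the circle \<open>p\<close> is this continuous extension divided by the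
    norm, which gives measurability.\<close>
  obtain m where "m-lipschitz_on UNIV (homogeneous_ext f)" by (rule homogeneous_ext_lipschitz[OF f])
  then have cg: "continuous_on UNIV (homogeneous_ext f)" by (rule lipschitz_on_continuous_on)
  have pm: "(\<lambda>y. p (?c t + y)) \<in> borel_measurable M" for t
  proof -
    have "(\<lambda>y. homogeneous_ext f (?c t + y)) \<in> borel_measurable lebesgue"
      by (rule continuous_lebesgue_measurable) (intro continuous_on_compose2[OF cg] continuous_intros, auto)
    moreover have "(\<lambda>y. norm (?c t + y)) \<in> borel_measurable lebesgue"
      by (rule continuous_lebesgue_measurable) (intro continuous_intros)
    ultimately have "(\<lambda>y. homogeneous_ext f (?c t + y) / norm (?c t + y)) \<in> borel_measurable M"
      unfolding M_def by (intro measurable_restrict_space1 borel_measurable_divide)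
    then show ?thesis
    proof (rule measurable_cong[THEN iffD1, rotated])
      fix y assume "y \<in> space M"
      then show "homogeneous_ext f (?c t + y) / norm (?c t + y) = p (?c t + y)"
        using half[of y t] sM by (auto simp: homogeneous_ext_def p_def)
    qed
  qed
  have pl: "\<bar>p (?c s + y) - p (?c t + y')\<bar> \<le> 4 * K * norm (?c s + y - (?c t + y'))"
    if "y \<in> ball 0 e" "y' \<in> ball 0 e" for s t y y'
    unfolding p_def by (rule radial_lipschitz[OF f half(2)[OF that(1)] half(2)[OF that(2)]])
  have e0: "(0 :: real^'n) \<in> ball 0 e" using e by simp
  have pi: "integrable M (\<lambda>y. p (?c t + y))" for t
  proof (rule integrable_const_bound[OF _ pm])
    show "AE y in M. norm (p (?c t + y)) \<le> \<bar>p (?c t + 0)\<bar> + 4 * K * e"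
    proof (rule AE_I2)
      fix y assume y: "y \<in> space M"
      have "4 * K * norm (?c t + y - (?c t + 0)) \<le> 4 * K * e"
        using y K by (intro mult_left_mono) (auto simp: sM)
      then show "norm (p (?c t + y)) \<le> \<bar>p (?c t + 0)\<bar> + 4 * K * e"
        using pl[of y 0 t t] y e0 unfolding sM real_norm_def by linarith
    qed
  qed
  define P where "P t = (\<integral>y. p (?c t + y) \<partial>M)" for t
  \<comment> \<open>Again a limit along one sequence, for measurability in y.\<close>
  define q where "q t y = lim (\<lambda>k. (p (?c (t + inverse (real (Suc k))) + y) - p (?c t + y)) / inverse (real (Suc k)))" for t y
  have qm: "q t \<in> borel_measurable M" for t
    unfolding q_def[abs_def] by (intro borel_measurable_lim_metric borel_measurable_divide borel_measurable_diff pm) simp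
  have good: "AE y in M. ((\<lambda>t. p (?c t + y)) has_real_derivative q t y) (at t) \<and> \<bar>q t y\<bar> \<le> L / (1 - e)" for t
  proof -
    let ?Z = "{x. x \<noteq> 0 \<and> \<not> (\<exists>v. has_tangential_gradient f v (x /\<^sub>R norm x) \<and> norm v \<le> L)}"
    have "negligible ((+) (- ?c t) ` ?Z)" by (rule negligible_translation[OF neg])
    then have "AE y in lebesgue. y \<notin> (+) (- ?c t) ` ?Z"
      by (intro AE_not_in) (simp add: negligible_iff_null_sets)
    then have "AE y in M. y \<notin> (+) (- ?c t) ` ?Z"
      unfolding M_def by (subst AE_restrict_space_iff) auto
    then show ?thesis
    proof (rule AE_mp, intro AE_I2 impI)
      fix y assume y: "y \<in> space M" "y \<notin> (+) (- ?c t) ` ?Z"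
      let ?x = "?c t + y"
      have x: "1 - e \<le> norm ?x" "?x \<noteq> 0" using half[of y t] y(1) e sM by auto
      have "?x \<notin> ?Z"
      proof
        assume "?x \<in> ?Z"
        then have "- ?c t + ?x \<in> (+) (- ?c t) ` ?Z" by (rule imageI)
        then show False using y(2) by simp
      qed
      then obtain v where v: "has_tangential_gradient f v (?x /\<^sub>R norm ?x)" "norm v \<le> L" using x(2) by blast
      let ?d = "(- sin t) *\<^sub>R a + cos t *\<^sub>R b"
      have c: "((\<lambda>t. ?c t + y) has_derivative (\<lambda>h. h *\<^sub>R ?d)) (at t)"
        using has_derivative_add[OF circle_has_derivative[of a b t] has_derivative_const[of y]] by simp
      have "((\<lambda>t. p (?c t + y)) has_derivative (\<lambda>h. (v \<bullet> (h *\<^sub>R ?d)) / norm ?x)) (at t)"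
        using has_derivative_compose[OF c radial_has_derivative[OF x(2) v(1)]] unfolding p_def .
      moreover have "(\<lambda>h. (v \<bullet> (h *\<^sub>R ?d)) / norm ?x) = (*) ((v \<bullet> ?d) / norm ?x)" by (simp add: fun_eq_iff)
      ultimately have D: "((\<lambda>t. p (?c t + y)) has_real_derivative (v \<bullet> ?d) / norm ?x) (at t)"
        unfolding has_field_derivative_def by (simp only:)
      have "((\<lambda>h. (p (?c (t + h) + y) - p (?c t + y)) / h) \<longlongrightarrow> (v \<bullet> ?d) / norm ?x) (at 0)"
        using D by (simp add: DERIV_def)
      moreover have "filterlim (\<lambda>k. inverse (real (Suc k))) (at 0) sequentially"
        using LIMSEQ_inverse_real_of_nat by (simp add: filterlim_at)
      ultimately have "(\<lambda>k. (p (?c (t + inverse (real (Suc k))) + y) - p (?c t + y)) / inverse (real (Suc k))) \<longlonglongrightarrow> (v \<bullet> ?d) / norm ?x"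
        by (rule filterlim_compose)
      then have q: "q t y = (v \<bullet> ?d) / norm ?x" unfolding q_def by (rule limI)
      have "\<bar>v \<bullet> ?d\<bar> \<le> norm v * norm ?d" by (rule Cauchy_Schwarz_ineq2)
      also have "\<dots> \<le> L" unfolding norm_circle_deriv[OF ab] using v(2) by simp
      finally have "\<bar>v \<bullet> ?d\<bar> \<le> L" .
      then have "\<bar>q t y\<bar> \<le> L / norm ?x" unfolding q by (simp add: divide_right_mono)
      also have "\<dots> \<le> L / (1 - e)" by (intro divide_left_mono mult_pos_pos; use x(1) e L in linarith)
      finally show "((\<lambda>t. p (?c t + y)) has_real_derivative q t y) (at t) \<and> \<bar>q t y\<bar> \<le> L / (1 - e)" using D q by simp
    qed
  qed
  have der: "(P has_real_derivative (\<integral>y. q t y \<partial>M)) (at t)" for t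
    unfolding P_def
  proof (rule has_derivative_integral_dominated[of t 1])
    show "AE y in M. ((\<lambda>t. p (?c t + y)) has_real_derivative q t y) (at t)" using good[of t] by eventually_elim simp
    show "AE y in M. \<bar>p (?c s + y) - p (?c t + y)\<bar> \<le> 4 * K * \<bar>s - t\<bar>" for s
    proof (rule AE_I2)
      fix y assume y: "y \<in> space M"
      have "\<bar>p (?c s + y) - p (?c t + y)\<bar> \<le> 4 * K * norm (?c s - ?c t)" using pl[of y y s t] y sM by simp
      also have "\<dots> \<le> 4 * K * \<bar>s - t\<bar>" using K by (intro mult_left_mono circle_lipschitz ab) auto
      finally show "\<bar>p (?c s + y) - p (?c t + y)\<bar> \<le> 4 * K * \<bar>s - t\<bar>" .
    qed
  qed (use pi qm in auto)
  have bnd: "\<bar>\<integral>y. q t y \<partial>M\<bar> \<le> L / (1 - e) * V" for t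
  proof -
    have i: "integrable M (q t)"
      by (rule integrable_const_bound[OF _ qm, of _ "L / (1 - e)"]) (use good[of t] in \<open>eventually_elim, simp\<close>)
    have "\<bar>\<integral>y. q t y \<partial>M\<bar> \<le> (\<integral>y. \<bar>q t y\<bar> \<partial>M)" by (rule integral_abs_bound)
    also have "\<dots> \<le> (\<integral>y. L / (1 - e) \<partial>M)"
      by (rule integral_mono_AE) (use i good[of t] in \<open>auto elim: eventually_mono\<close>)
    finally show ?thesis by (simp add: V_def mult_ac)
  qed
  have PP: "\<bar>P \<theta> - P 0\<bar> \<le> L / (1 - e) * V * (\<theta> - 0)"
    by (rule DERIV_bounded_imp_diff_bound[OF \<theta> der bnd])
  \<comment> \<open>The averaging error 4 K e occurs at both ends of the arc, whence 8 K e in the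
    result.\<close>
  have near: "\<bar>P t - V * p (?c t)\<bar> \<le> 4 * K * e * V" for t
  proof -
    have "P t - V * p (?c t) = (\<integral>y. p (?c t + y) - p (?c t) \<partial>M)"
      using pi by (simp add: P_def V_def)
    also have "\<bar>\<dots>\<bar> \<le> (\<integral>y. \<bar>p (?c t + y) - p (?c t)\<bar> \<partial>M)" by (rule integral_abs_bound)
    also have "\<dots> \<le> (\<integral>y. 4 * K * e \<partial>M)"
    proof (rule integral_mono)
      fix y assume y: "y \<in> space M"
      have "\<bar>p (?c t + y) - p (?c t)\<bar> \<le> 4 * K * norm y" using pl[of y 0 t t] y e0 sM by simp
      also have "\<dots> \<le> 4 * K * e" using y K sM by (intro mult_left_mono) auto
      finally show "\<bar>p (?c t + y) - p (?c t)\<bar> \<le> 4 * K * e" .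
    qed (use pi in auto)
    finally show ?thesis by (simp add: V_def mult_ac)
  qed
  have "V * \<bar>p (?c \<theta>) - p (?c 0)\<bar> = \<bar>V * p (?c \<theta>) - V * p (?c 0)\<bar>"
    using V by (simp add: abs_mult flip: right_diff_distrib)
  also have "\<dots> \<le> L / (1 - e) * V * \<theta> + 8 * K * e * V"
    using PP near[of \<theta>] near[of 0] by simp
  also have "\<dots> = V * (L * \<theta> / (1 - e) + 8 * K * e)" by (simp add: algebra_simps)
  finally have "\<bar>p (?c \<theta>) - p (?c 0)\<bar> \<le> L * \<theta> / (1 - e) + 8 * K * e"
    using V by (simp only: mult_le_cancel_left_pos)
  moreover have "p (?c t) = f (?c t)" for t using norm_circle[OF ab, of t] by (simp add: p_def)
  ultimately have "\<bar>f (?c \<theta>) - f (?c 0)\<bar> \<le> L * \<theta> / (1 - e) + 8 * K * e" by (simp only:)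
  then show ?thesis by (simp only: circle_0)
qed

lemma AE_tangential_gradient_le_imp_geodesic_lipschitz:
  fixes f :: "real^'n \<Rightarrow> real"
  assumes n: "2 \<le> CARD('n)" and f: "K-lipschitz_on (sphere 0 1) f" and L: "0 \<le> L"
    and AE: "AE \<omega> in sphere_measure. norm (tangential_gradient f \<omega>) \<le> L"
  shows "geodesic_lipschitz L f"
proof -
  have "AE \<omega> in sphere_measure. \<exists>v. has_tangential_gradient f v \<omega> \<and> norm v \<le> L"
    using AE_sphere_measure_sphere AE AE_tangential_gradient_exists[OF n f]
  proof eventually_elim
    case (elim \<omega>)
    then obtain v where v: "has_tangential_gradient f v \<omega>" "norm \<omega> = 1" by auto
    then show ?case using elim tangential_gradient_eq[OF v(2,1)] by auto
  qed
  then have neg: "negligible {x. x \<noteq> 0 \<and> \<not> (\<exists>v. has_tangential_gradient f v (x /\<^sub>R norm x) \<and> norm v \<le> L)}"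
    by (simp only: AE_sphere_measure_iff[OF n])
  show ?thesis
    unfolding geodesic_lipschitz_def
  proof (intro allI impI)
    fix a b :: "real^'n" and \<theta> :: real assume ab: "orthonormal_pair a b" and \<theta>: "0 \<le> \<theta>" "\<theta> \<le> pi"
    have "((\<lambda>e. L * \<theta> / (1 - e) + 8 * K * e) \<longlongrightarrow> L * \<theta> / (1 - 0) + 8 * K * 0) (at_right 0)"
      by (intro tendsto_intros) simp
    moreover have "\<forall>\<^sub>F e in at_right 0. \<bar>f (circle a b \<theta>) - f a\<bar> \<le> L * \<theta> / (1 - e) + 8 * K * e"
      unfolding eventually_at_right_field
      using AE_tangential_gradient_le_imp_circle_diff[OF f neg L ab \<theta>(1)] by (intro exI[of _ "1/2"]) auto
    ultimately have "\<bar>f (circle a b \<theta>) - f a\<bar> \<le> L * \<theta> / (1 - 0) + 8 * K * 0"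
      by (rule tendsto_lowerbound) simp
    then show "\<bar>f (circle a b \<theta>) - f a\<bar> \<le> L * \<theta>" by simp
  qed
qed

text \<open>Trades the condition holding almost everywhere for one that is stable under uniform
  limits.\<close>

lemma admissible_iff:
  fixes f :: "real^'n \<Rightarrow> real"
  assumes n: "2 \<le> CARD('n)" and L: "0 \<le> L"
  shows "f \<in> admissible \<rho> L \<gamma> \<longleftrightarrow> geodesic_lipschitz L f \<and> (\<forall>\<omega>\<in>sphere 0 1. \<rho> \<le> f \<omega>) \<and>
    (\<integral>\<omega>. f \<omega> ^ CARD('n) \<partial>sphere_measure) = \<gamma>"
  unfolding admissible_def
  using AE_tangential_gradient_le_imp_geodesic_lipschitz[OF n _ L] geodesic_lipschitz_imp_lipschitz[OF n _ L]
    geodesic_lipschitz_imp_AE_tangential_gradient_le[OF n _ L] by blast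

section \<open>Existence of an optimal shape\<close>

lemma open_Omega:
  fixes f :: "real^'n \<Rightarrow> real"
  assumes f: "K-lipschitz_on (sphere 0 1) f" and \<rho>: "0 < \<rho>" "\<And>\<omega>. \<omega> \<in> sphere 0 1 \<Longrightarrow> \<rho> \<le> f \<omega>"
  shows "open (Omega f)"
proof -
  obtain M where "M-lipschitz_on UNIV (homogeneous_ext f)" by (rule homogeneous_ext_lipschitz[OF f])
  then have c: "continuous_on UNIV (homogeneous_ext f)" by (rule lipschitz_on_continuous_on)
  \<comment> \<open>Multiplying the inequality by |x| replaces the radial extension, discontinuous
    at 0, by the continuous homogeneous one; the strict inequality is then lost at 0, which the ball
    restores.\<close>
  have "Omega f = ball 0 \<rho> \<union> {x. norm x * norm x < homogeneous_ext f x}"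
  proof (intro set_eqI)
    fix x
    show "x \<in> Omega f \<longleftrightarrow> x \<in> ball 0 \<rho> \<union> {x. norm x * norm x < homogeneous_ext f x}"
    proof (cases "x = 0")
      case False
      then have "\<rho> \<le> f (x /\<^sub>R norm x)" by (intro \<rho>) simp
      then show ?thesis using False by (auto simp: Omega_def homogeneous_ext_def)
    qed (use \<rho> in \<open>simp add: Omega_def\<close>)
  qed
  also have "open \<dots>"
    by (intro open_Un open_ball open_Collect_less c continuous_intros)
  finally show ?thesis .
qed

lemma Omega_subset_ball:
  assumes "0 < R" "\<And>\<omega>. \<omega> \<in> sphere 0 1 \<Longrightarrow> f \<omega> \<le> R"
  shows "Omega f \<subseteq> ball (0 :: real^'n) R"
proof
  fix x :: "real^'n" assume x: "x \<in> Omega f"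
  show "x \<in> ball 0 R"
  proof (cases "x = 0")
    case False
    then have "f (x /\<^sub>R norm x) \<le> R" by (intro assms) simp
    then show ?thesis using x False by (auto simp: Omega_def)
  qed (use assms in simp)
qed

text \<open>Dilating \<open>Omega g\<close> by \<open>s\<close> multiplies its radial function by
  \<open>s\<close>.\<close>

lemma Omega_subset_scaled:
  assumes s: "0 < s" and f: "\<And>\<omega>. \<omega> \<in> sphere 0 1 \<Longrightarrow> f \<omega> \<le> s * g \<omega>"
  shows "Omega f \<subseteq> (*\<^sub>R) s ` Omega (g :: real^'n \<Rightarrow> real)"
proof
  fix x :: "real^'n" assume x: "x \<in> Omega f"
  have "inverse s *\<^sub>R x \<in> Omega g"
  proof (cases "x = 0")
    case False
    have n: "norm (inverse s *\<^sub>R x) = norm x / s" using s by (simp add: divide_inverse mult.commute)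
    have e: "inverse (norm x / s) * inverse s = inverse (norm x)" using s by (simp add: field_simps)
    have "norm x < f (x /\<^sub>R norm x)" using x False by (simp add: Omega_def)
    also have "\<dots> \<le> s * g (x /\<^sub>R norm x)" using False by (intro f) simp
    finally have "norm x / s < g (x /\<^sub>R norm x)" using s by (simp add: divide_less_eq mult.commute)
    then have "norm (inverse s *\<^sub>R x) < g ((inverse s *\<^sub>R x) /\<^sub>R norm (inverse s *\<^sub>R x))"
      unfolding n scaleR_scaleR e .
    then show ?thesis unfolding Omega_def mem_Collect_eq by blast
  qed (simp add: Omega_def)
  then have "s *\<^sub>R (inverse s *\<^sub>R x) \<in> (*\<^sub>R) s ` Omega g" by (rule imageI)
  then show "x \<in> (*\<^sub>R) s ` Omega g" using s by simp
qed

lemma scaled_subset_ball: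
  assumes "A \<subseteq> ball (0 :: 'a::real_normed_vector) R" "0 \<le> s" "s \<le> 2" "0 < R"
  shows "(*\<^sub>R) s ` A \<subseteq> ball 0 (2 * R)"
proof clarify
  fix x assume "x \<in> A"
  then have "norm x < R" using assms(1) by auto
  have "s * norm x \<le> 2 * norm x" using assms by (intro mult_right_mono) auto
  also have "\<dots> < 2 * R" using \<open>norm x < R\<close> by simp
  finally show "s *\<^sub>R x \<in> ball 0 (2 * R)" using assms by simp
qed

section \<open>Bounds and compactness for admissible functions\<close>

lemma sphere_measure_measurable:
  fixes f :: "real^'n \<Rightarrow> real"
  assumes "continuous_on (sphere 0 1) f"
  shows "f \<in> borel_measurable sphere_measure"
  using borel_measurable_continuous_on_restrict[OF assms] measurable_cong_sets[OF sets_sphere_measure refl] by blast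

lemma sphere_measure_integrable:
  fixes f :: "real^'n \<Rightarrow> real"
  assumes "continuous_on (sphere 0 1) f"
  shows "integrable sphere_measure f"
proof -
  interpret finite_measure "sphere_measure :: (real^'n) measure" by (rule finite_sphere_measure)
  have "bounded (f ` sphere 0 1)" using assms by (intro compact_imp_bounded compact_continuous_image) auto
  then obtain B where "\<And>\<omega>. \<omega> \<in> sphere 0 1 \<Longrightarrow> norm (f \<omega>) \<le> B" unfolding bounded_iff by blast
  then show ?thesis
    by (intro integrable_const_bound[of _ B] sphere_measure_measurable assms) (auto simp: space_sphere_measure)
qed

lemma admissible_continuous:
  fixes f :: "real^'n \<Rightarrow> real"
  assumes "f \<in> admissible \<rho> L \<gamma>"
  obtains K where "K-lipschitz_on (sphere 0 1) f" "continuous_on (sphere 0 1) f"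
  using assms by (auto simp: admissible_def intro: lipschitz_on_continuous_on)

lemma admissible_le:
  fixes f :: "real^'n \<Rightarrow> real"
  assumes n: "2 \<le> CARD('n)" and L: "0 \<le> L" and \<rho>: "0 < \<rho>" and f: "f \<in> admissible \<rho> L \<gamma>" and \<omega>: "\<omega> \<in> sphere 0 1"
  shows "f \<omega> \<le> root CARD('n) (\<gamma> / measure (sphere_measure :: (real^'n) measure) (sphere 0 1)) + pi * L"
proof -
  interpret finite_measure "sphere_measure :: (real^'n) measure" by (rule finite_sphere_measure)
  let ?S = "measure (sphere_measure :: (real^'n) measure) (sphere 0 1)"
  have S: "0 < ?S" by (rule measure_sphere_pos[OF n])
  have g: "geodesic_lipschitz L f" "\<And>\<omega>. \<omega> \<in> sphere 0 1 \<Longrightarrow> \<rho> \<le> f \<omega>" "(\<integral>\<omega>. f \<omega> ^ CARD('n) \<partial>sphere_measure) = \<gamma>"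
    using f by (auto simp: admissible_iff[OF n L])
  obtain K where c: "continuous_on (sphere 0 1) f" using f by (rule admissible_continuous)
  obtain \<omega>\<^sub>0 where \<omega>\<^sub>0: "\<omega>\<^sub>0 \<in> sphere 0 1" "\<And>\<omega>. \<omega> \<in> sphere 0 1 \<Longrightarrow> f \<omega>\<^sub>0 \<le> f \<omega>"
    using continuous_attains_inf[OF compact_sphere _ c] \<omega> by blast
  have p0: "0 \<le> f \<omega>\<^sub>0" using g(2)[OF \<omega>\<^sub>0(1)] \<rho> by simp
  have "f \<omega>\<^sub>0 ^ CARD('n) * ?S = (\<integral>\<omega>. f \<omega>\<^sub>0 ^ CARD('n) \<partial>(sphere_measure :: (real^'n) measure))"
    by (simp add: space_sphere_measure mult.commute)
  also have "\<dots> \<le> (\<integral>\<omega>. f \<omega> ^ CARD('n) \<partial>sphere_measure)"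
  proof (rule integral_mono)
    show "integrable sphere_measure (\<lambda>\<omega>. f \<omega> ^ CARD('n))" by (intro sphere_measure_integrable continuous_on_power c)
    show "f \<omega>\<^sub>0 ^ CARD('n) \<le> f \<omega> ^ CARD('n)" if "\<omega> \<in> space sphere_measure" for \<omega>
      using that p0 \<omega>\<^sub>0(2) by (intro power_mono) (auto simp: space_sphere_measure)
  qed simp
  also have "\<dots> = \<gamma>" by (rule g)
  finally have "f \<omega>\<^sub>0 ^ CARD('n) \<le> \<gamma> / ?S" using S by (simp add: le_divide_eq)
  then have "root CARD('n) (f \<omega>\<^sub>0 ^ CARD('n)) \<le> root CARD('n) (\<gamma> / ?S)" by (intro real_root_le_mono) auto
  then have "f \<omega>\<^sub>0 \<le> root CARD('n) (\<gamma> / ?S)" using p0 by (simp add: real_root_power_cancel)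
  moreover have "\<bar>f \<omega> - f \<omega>\<^sub>0\<bar> \<le> L * pi" by (rule geodesic_lipschitz_diff[OF n g(1) L \<omega> \<omega>\<^sub>0(1)])
  ultimately show ?thesis by (simp add: mult.commute)
qed

lemma geodesic_lipschitz_limit:
  fixes f :: "nat \<Rightarrow> real^'n \<Rightarrow> real"
  assumes f: "\<And>k. geodesic_lipschitz L (f k)" and lim: "\<And>\<omega>. \<omega> \<in> sphere 0 1 \<Longrightarrow> (\<lambda>k. f k \<omega>) \<longlonglongrightarrow> g \<omega>"
  shows "geodesic_lipschitz L g"
  unfolding geodesic_lipschitz_def
proof (intro allI impI)
  fix a b :: "real^'n" and \<theta> :: real assume ab: "orthonormal_pair a b" and \<theta>: "0 \<le> \<theta>" "\<theta> \<le> pi"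
  have "(\<lambda>k. \<bar>f k (circle a b \<theta>) - f k a\<bar>) \<longlonglongrightarrow> \<bar>g (circle a b \<theta>) - g a\<bar>"
    using ab norm_circle[OF ab] by (intro tendsto_intros lim) (auto simp: orthonormal_pair_def)
  then show "\<bar>g (circle a b \<theta>) - g a\<bar> \<le> L * \<theta>"
    by (rule LIMSEQ_le_const2) (use f ab \<theta> in \<open>auto simp: geodesic_lipschitz_def\<close>)
qed

lemma admissible_compact:
  fixes f :: "nat \<Rightarrow> real^'n \<Rightarrow> real"
  assumes n: "2 \<le> CARD('n)" and L: "0 \<le> L" and \<rho>: "0 < \<rho>" and f: "\<And>k. f k \<in> admissible \<rho> L \<gamma>"
  obtains g r where "g \<in> admissible \<rho> L \<gamma>" "strict_mono (r :: nat \<Rightarrow> nat)"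
    "\<And>e. 0 < e \<Longrightarrow> \<exists>N. \<forall>k\<ge>N. \<forall>\<omega>\<in>sphere 0 1. \<bar>f (r k) \<omega> - g \<omega>\<bar> < e"
proof -
  define R where "R = root CARD('n) (\<gamma> / measure (sphere_measure :: (real^'n) measure) (sphere 0 1)) + pi * L"
  have fR: "f k \<omega> \<le> R" if "\<omega> \<in> sphere 0 1" for k \<omega> unfolding R_def by (rule admissible_le[OF n L \<rho> f that])
  have g: "geodesic_lipschitz L (f k)" "\<And>\<omega>. \<omega> \<in> sphere 0 1 \<Longrightarrow> \<rho> \<le> f k \<omega>" "(\<integral>\<omega>. f k \<omega> ^ CARD('n) \<partial>sphere_measure) = \<gamma>" for k
    using f[of k] by (auto simp: admissible_iff[OF n L])
  have fa: "\<bar>f k \<omega>\<bar> \<le> R" if "\<omega> \<in> sphere 0 1" for k \<omega> using fR[OF that, of k] g(2)[OF that, of k] \<rho> by simp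
  have bd: "norm (f k x) \<le> R" if "x \<in> sphere 0 1" for k x using fa[OF that] by simp
  have eq: "\<exists>d>0. \<forall>k y. y \<in> sphere 0 1 \<and> norm (x - y) < d \<longrightarrow> norm (f k x - f k y) < e"
    if x: "x \<in> sphere 0 1" and e: "0 < e" for x e
  proof -
    \<comment> \<open>2 L is a Lipschitz constant common to all \<open>f k\<close>; the added 1
      covers L = 0.\<close>
    have "norm (f k x - f k y) < e" if "y \<in> sphere 0 1" "norm (x - y) < e / (2 * L + 1)" for k y
    proof -
      have "norm (f k x - f k y) \<le> 2 * L * norm (x - y)"
        using lipschitz_onD[OF geodesic_lipschitz_imp_lipschitz[OF n g(1) L] x that(1), of k] by (simp add: dist_norm)
      also have "\<dots> \<le> (2 * L + 1) * norm (x - y)" by (intro mult_right_mono) auto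
      also have "\<dots> < e" using that(2) L by (simp add: less_divide_eq mult.commute)
      finally show ?thesis .
    qed
    then show "\<exists>d>0. \<forall>k y. y \<in> sphere 0 1 \<and> norm (x - y) < d \<longrightarrow> norm (f k x - f k y) < e"
      using e L by (intro exI[of _ "e / (2 * L + 1)"]) (auto intro!: divide_pos_pos)
  qed
  obtain h and r :: "nat \<Rightarrow> nat" where h: "continuous_on (sphere 0 1) h" and r: "strict_mono r"
    and lim: "\<And>e. 0 < e \<Longrightarrow> \<exists>N. \<forall>k x. k \<ge> N \<and> x \<in> sphere 0 1 \<longrightarrow> norm (f (r k) x - h x) < e"
    by (rule Arzela_Ascoli[OF compact_sphere bd eq]) (assumption+, rule that)
  have pw: "(\<lambda>k. f (r k) \<omega>) \<longlonglongrightarrow> h \<omega>" if "\<omega> \<in> sphere 0 1" for \<omega>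
  proof (rule LIMSEQ_I)
    fix e :: real assume "0 < e"
    then obtain N where "\<forall>k x. k \<ge> N \<and> x \<in> sphere 0 1 \<longrightarrow> norm (f (r k) x - h x) < e" using lim by blast
    then show "\<exists>N. \<forall>k\<ge>N. norm (f (r k) \<omega> - h \<omega>) < e" using that by blast
  qed
  have "h \<in> admissible \<rho> L \<gamma>"
    unfolding admissible_iff[OF n L]
  proof (intro conjI ballI)
    show "geodesic_lipschitz L h" by (rule geodesic_lipschitz_limit[OF g(1) pw])
    show "\<rho> \<le> h \<omega>" if "\<omega> \<in> sphere 0 1" for \<omega>
      by (rule LIMSEQ_le_const[OF pw[OF that]]) (use g(2) that in auto)
    interpret finite_measure "sphere_measure :: (real^'n) measure" by (rule finite_sphere_measure)
    have "(\<lambda>k. \<integral>\<omega>. f (r k) \<omega> ^ CARD('n) \<partial>sphere_measure) \<longlonglongrightarrow> (\<integral>\<omega>. h \<omega> ^ CARD('n) \<partial>sphere_measure)"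
    proof (rule integral_dominated_convergence)
      show "integrable (sphere_measure :: (real^'n) measure) (\<lambda>_. R ^ CARD('n))" by simp
      show "(\<lambda>\<omega>. h \<omega> ^ CARD('n)) \<in> borel_measurable sphere_measure"
        by (intro sphere_measure_measurable continuous_on_power h)
      show "(\<lambda>\<omega>. f (r k) \<omega> ^ CARD('n)) \<in> borel_measurable sphere_measure" for k
      proof -
        obtain K where "continuous_on (sphere 0 1) (f (r k))" using f by (rule admissible_continuous)
        then show ?thesis by (intro sphere_measure_measurable continuous_on_power)
      qed
      show "AE \<omega> in sphere_measure. (\<lambda>k. f (r k) \<omega> ^ CARD('n)) \<longlonglongrightarrow> h \<omega> ^ CARD('n)"
        by (intro AE_I2 tendsto_power pw) (simp add: space_sphere_measure)
      show "AE \<omega> in sphere_measure. norm (f (r k) \<omega> ^ CARD('n)) \<le> R ^ CARD('n)" for k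
        by (intro AE_I2) (use fa in \<open>auto simp: space_sphere_measure power_abs intro!: power_mono\<close>)
    qed
    then show "(\<integral>\<omega>. h \<omega> ^ CARD('n) \<partial>sphere_measure) = \<gamma>" using g(3) by (simp add: LIMSEQ_const_iff)
  qed
  moreover have "\<exists>N. \<forall>k\<ge>N. \<forall>\<omega>\<in>sphere 0 1. \<bar>f (r k) \<omega> - h \<omega>\<bar> < e" if e: "0 < e" for e
  proof -
    obtain N where "\<forall>k x. k \<ge> N \<and> x \<in> sphere 0 1 \<longrightarrow> norm (f (r k) x - h x) < e" using lim[OF e] by blast
    then show ?thesis unfolding real_norm_def by blast
  qed
  ultimately show thesis using r by (intro that)
qed

section \<open>Convergence of the states and lower semicontinuity of the cost\<close>

lemma cost_eq:
  fixes f :: "real^'n \<Rightarrow> real"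
  assumes \<Omega>: "open (Omega f)" "Omega f \<subseteq> D"
  shows "cost F z f = 1 / 2 * (l2norm lebesgue (zero_ext (Omega f) (\<lambda>x. zero_ext (Omega f) (state F (Omega f)) x - zero_ext D z x)))\<^sup>2"
proof -
  have m: "Omega f \<in> sets lebesgue" using \<Omega> by auto
  \<comment> \<open>The outer extension discards the values of \<open>z\<close> on the part of
    \<open>D\<close> outside \<open>Omega f\<close>.\<close>
  have e: "zero_ext (Omega f) (\<lambda>x. (state F (Omega f) x - z x)\<^sup>2) x
      = (norm (zero_ext (Omega f) (\<lambda>x. zero_ext (Omega f) (state F (Omega f)) x - zero_ext D z x) x))\<^sup>2" for x
    using \<Omega>(2) by (auto simp: zero_ext_def indicator_def)
  show ?thesis unfolding cost_def l2norm_square lebesgue_on_integral_eq[OF m] e ..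
qed

text \<open>Minimality needs only lower semicontinuity, and for this it suffices that the domains converge from inside; their
  boundaries may have positive measure.\<close>
lemma l2norm_zero_ext_lower_semicontinuous:
  fixes w :: "real^'n \<Rightarrow> real"
  assumes \<Omega>: "\<Omega> \<in> sets lebesgue" "\<And>k. \<Omega>s k \<in> sets lebesgue"
    and inner: "\<And>x. x \<in> \<Omega> \<Longrightarrow> \<forall>\<^sub>F k in sequentially. x \<in> \<Omega>s k"
    and w: "w \<in> square_integrable lebesgue" "\<And>k. ws k \<in> square_integrable lebesgue"
    and conv: "(\<lambda>k. l2norm lebesgue (\<lambda>x. w x - ws k x)) \<longlonglongrightarrow> 0"
    and c: "(\<lambda>k. l2norm lebesgue (zero_ext (\<Omega>s k) (ws k))) \<longlonglongrightarrow> c"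
  shows "l2norm lebesgue (zero_ext \<Omega> w) \<le> c"
proof -
  \<comment> \<open>Each point of \<Omega> eventually lies in \<open>\<Omega>s k\<close>, so the
    intersections exhaust \<Omega>, and the norm over an intersection is at most that over
    \<open>\<Omega>s k\<close>.\<close>
  have "(\<lambda>k. \<integral>x. (norm (zero_ext (\<Omega> \<inter> \<Omega>s k) w x))\<^sup>2 \<partial>lebesgue) \<longlonglongrightarrow> (\<integral>x. (norm (zero_ext \<Omega> w x))\<^sup>2 \<partial>lebesgue)"
  proof (rule integral_dominated_convergence[OF _ _ square_integrable_norm[OF w(1)]])
    show "(\<lambda>x. (norm (zero_ext \<Omega> w x))\<^sup>2) \<in> borel_measurable lebesgue"
      using square_integrable_norm[OF zero_ext_square_integrable[OF w(1) \<Omega>(1)]] by (rule borel_measurable_integrable)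
    show "(\<lambda>x. (norm (zero_ext (\<Omega> \<inter> \<Omega>s k) w x))\<^sup>2) \<in> borel_measurable lebesgue" for k
      using square_integrable_norm[OF zero_ext_square_integrable[OF w(1) sets.Int[OF \<Omega>(1) \<Omega>(2)[of k]]]]
      by (rule borel_measurable_integrable)
    show "AE x in lebesgue. (\<lambda>k. (norm (zero_ext (\<Omega> \<inter> \<Omega>s k) w x))\<^sup>2) \<longlonglongrightarrow> (norm (zero_ext \<Omega> w x))\<^sup>2"
    proof (rule AE_I2)
      fix x
      show "(\<lambda>k. (norm (zero_ext (\<Omega> \<inter> \<Omega>s k) w x))\<^sup>2) \<longlonglongrightarrow> (norm (zero_ext \<Omega> w x))\<^sup>2"
      proof (cases "x \<in> \<Omega>")
        case True
        show ?thesis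
          by (rule tendsto_eventually) (use inner[OF True] True in \<open>auto elim!: eventually_mono simp: zero_ext_def\<close>)
      qed (simp add: zero_ext_def)
    qed
  qed (auto simp: zero_ext_def indicator_def)
  then have h: "(\<lambda>k. l2norm lebesgue (zero_ext (\<Omega> \<inter> \<Omega>s k) w)) \<longlonglongrightarrow> l2norm lebesgue (zero_ext \<Omega> w)"
    unfolding l2norm_def by (rule tendsto_real_sqrt)
  have "l2norm lebesgue (zero_ext (\<Omega> \<inter> \<Omega>s k) w) \<le> l2norm lebesgue (zero_ext (\<Omega>s k) (ws k)) + l2norm lebesgue (\<lambda>x. w x - ws k x)" for k
  proof -
    have d: "(\<lambda>x. w x - ws k x) \<in> square_integrable lebesgue" by (intro square_integrable_diff w)
    have "zero_ext (\<Omega> \<inter> \<Omega>s k) w = zero_ext \<Omega> (zero_ext (\<Omega>s k) w)"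
      by (auto simp: zero_ext_def fun_eq_iff indicator_def)
    then have "l2norm lebesgue (zero_ext (\<Omega> \<inter> \<Omega>s k) w) \<le> l2norm lebesgue (zero_ext (\<Omega>s k) w)"
      using l2norm_zero_ext_le[OF zero_ext_square_integrable[OF w(1) \<Omega>(2)[of k]] \<Omega>(1)] by simp
    also have "zero_ext (\<Omega>s k) w = (\<lambda>x. zero_ext (\<Omega>s k) (ws k) x + zero_ext (\<Omega>s k) (\<lambda>x. w x - ws k x) x)"
      by (auto simp: zero_ext_def fun_eq_iff indicator_def)
    also have "l2norm lebesgue \<dots> \<le> l2norm lebesgue (zero_ext (\<Omega>s k) (ws k)) + l2norm lebesgue (zero_ext (\<Omega>s k) (\<lambda>x. w x - ws k x))"
      by (intro l2norm_triangle zero_ext_square_integrable w d \<Omega>)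
    also have "l2norm lebesgue (zero_ext (\<Omega>s k) (\<lambda>x. w x - ws k x)) \<le> l2norm lebesgue (\<lambda>x. w x - ws k x)"
      by (rule l2norm_zero_ext_le[OF d \<Omega>(2)])
    finally show ?thesis by simp
  qed
  then have "l2norm lebesgue (zero_ext \<Omega> w) \<le> c + 0"
    by (intro LIMSEQ_le[OF h tendsto_add[OF c conv]]) auto
  then show ?thesis by simp
qed

lemma state_tendsto:
  fixes f :: "nat \<Rightarrow> real^'n \<Rightarrow> real"
  assumes n: "2 \<le> CARD('n)" and L: "0 \<le> L" and \<rho>: "0 < \<rho>" and R: "0 < R"
    and F: "zero_ext D F \<in> square_integrable lebesgue" and D: "D = ball 0 R"
    and f: "\<And>k. f k \<in> admissible \<rho> L \<gamma>" and g: "g \<in> admissible \<rho> L \<gamma>"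
    and fR: "\<And>k \<omega>. \<omega> \<in> sphere 0 1 \<Longrightarrow> f k \<omega> \<le> R" and gR: "\<And>\<omega>. \<omega> \<in> sphere 0 1 \<Longrightarrow> g \<omega> \<le> R"
    and lim: "\<And>e. 0 < e \<Longrightarrow> \<exists>N. \<forall>k\<ge>N. \<forall>\<omega>\<in>sphere 0 1. \<bar>f k \<omega> - g \<omega>\<bar> < e"
  shows "(\<lambda>k. l2norm lebesgue (\<lambda>x. zero_ext (Omega g) (state F (Omega g)) x - zero_ext (Omega (f k)) (state F (Omega (f k))) x)) \<longlonglongrightarrow> 0"
proof -
  let ?F = "zero_ext D F"
  have fl: "\<And>\<omega>. \<omega> \<in> sphere 0 1 \<Longrightarrow> \<rho> \<le> f k \<omega>" and gl: "\<And>\<omega>. \<omega> \<in> sphere 0 1 \<Longrightarrow> \<rho> \<le> g \<omega>" for k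
    using f[of k] g by (auto simp: admissible_def)
  have of: "open (Omega (f k))" for k
    by (rule admissible_continuous[OF f[of k]]) (rule open_Omega[OF _ \<rho> fl])
  have og: "open (Omega g)" by (rule admissible_continuous[OF g]) (rule open_Omega[OF _ \<rho> gl])
  have bf: "Omega (f k) \<subseteq> ball 0 R" for k by (rule Omega_subset_ball[OF R fR])
  have bg: "Omega g \<subseteq> ball 0 R" by (rule Omega_subset_ball[OF R gR])
  have R2: "0 < 2 * R" using R by simp
  have b2: "ball 0 R \<subseteq> ball (0 :: real^'n) (2 * R)" using R by (intro subset_ball) simp
  obtain G where G: "H10_solution ?F (Omega g) (zero_ext (Omega g) (state F (Omega g))) G"
    by (rule state_H10_solution[OF og bg[folded D] order_trans[OF bg b2] R2 F])
  define u where "u = zero_ext (Omega g) (state F (Omega g))"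
  define v where "v k = zero_ext (Omega (f k)) (state F (Omega (f k)))" for k
  \<comment> \<open>The bound of \<open>H10_solution_stability\<close> for the ball of radius 2 R,
    which contains all dilates with s <= 2; it is continuous and vanishes at s = 1.\<close>
  define b where "b s = (let c = 2 * R * l2norm lebesgue ?F * (s - 1) in
      4 * (2 * R) * sqrt (4 * c * (l2norm lebesgue G + c)))" for s :: real
  have est: "l2norm lebesgue (\<lambda>x. u x - v k x) \<le> b s"
    if s: "1 \<le> s" "s \<le> 2" and d: "\<And>\<omega>. \<omega> \<in> sphere 0 1 \<Longrightarrow> \<bar>f k \<omega> - g \<omega>\<bar> \<le> (s - 1) * \<rho>" for k s
  proof -
    obtain H where H: "H10_solution ?F (Omega (f k)) (v k) H"
      unfolding v_def by (rule state_H10_solution[OF of bf[folded D] order_trans[OF bf b2] R2 F])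
    have sg: "(*\<^sub>R) s ` Omega g \<subseteq> ball 0 (2 * R)" "(*\<^sub>R) s ` Omega (f k) \<subseteq> ball 0 (2 * R)"
      using s R by (intro scaled_subset_ball bg bf; simp)+
    obtain w l where w: "H10_solution ?F ((*\<^sub>R) s ` Omega g) w l" by (rule H10_solution_exists[OF F sg(1) R2])
    obtain w' l' where w': "H10_solution ?F ((*\<^sub>R) s ` Omega (f k)) w' l'" by (rule H10_solution_exists[OF F sg(2) R2])
    \<comment> \<open>Both functions are at least \<rho>, so a gap of (s - 1) \<rho> is absorbed by
      multiplying either of them by s.\<close>
    have le: "(s - 1) * \<rho> \<le> (s - 1) * f k \<omega>" "(s - 1) * \<rho> \<le> (s - 1) * g \<omega>" if "\<omega> \<in> sphere 0 1" for \<omega>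
      using fl[OF that, of k] gl[OF that] s by (auto intro: mult_left_mono)
    have sub: "Omega g \<subseteq> (*\<^sub>R) s ` Omega g" "Omega (f k) \<subseteq> (*\<^sub>R) s ` Omega g" "Omega g \<subseteq> (*\<^sub>R) s ` Omega (f k)"
    proof -
      have s0: "0 < s" using s by simp
      have "g \<omega> \<le> s * g \<omega>" "f k \<omega> \<le> s * g \<omega>" "g \<omega> \<le> s * f k \<omega>" if "\<omega> \<in> sphere 0 1" for \<omega>
      proof -
        have "0 \<le> (s - 1) * \<rho>" using s \<rho> by simp
        then show "g \<omega> \<le> s * g \<omega>" "f k \<omega> \<le> s * g \<omega>" "g \<omega> \<le> s * f k \<omega>"
          using le[OF that] d[OF that] unfolding left_diff_distrib abs_le_iff by linarith+
      qed
      then show "Omega g \<subseteq> (*\<^sub>R) s ` Omega g" "Omega (f k) \<subseteq> (*\<^sub>R) s ` Omega g" "Omega g \<subseteq> (*\<^sub>R) s ` Omega (f k)"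
        by (intro Omega_subset_scaled[OF s0]; blast)+
    qed
    show ?thesis
      using H10_solution_stability[OF n F R2 s(1) G[folded u_def] H w w' sub sg] by (simp add: b_def Let_def)
  qed
  have "((\<lambda>t. b (1 + t)) \<longlongrightarrow> b (1 + 0)) (at_right 0)"
    unfolding b_def Let_def by (intro tendsto_intros)
  then have b0: "((\<lambda>t. b (1 + t)) \<longlongrightarrow> 0) (at_right 0)" by (simp add: b_def)
  have "(\<lambda>k. l2norm lebesgue (\<lambda>x. u x - v k x)) \<longlonglongrightarrow> 0"
  proof (rule LIMSEQ_I)
    fix e :: real assume "0 < e"
    then have "\<forall>\<^sub>F t in at_right 0. b (1 + t) < e" using order_tendstoD(2)[OF b0] by simp
    moreover have "\<forall>\<^sub>F t in at_right 0. 0 < t \<and> t < (1::real)"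
      unfolding eventually_at_right_field by (intro exI[of _ 1]) auto
    ultimately have "\<forall>\<^sub>F t in at_right 0. b (1 + t) < e \<and> 0 < t \<and> t < 1" by (rule eventually_conj)
    then obtain t where t: "b (1 + t) < e" "0 < t" "t < 1"
      using eventually_happens'[OF trivial_limit_at_right_real] by blast
    obtain N where N: "\<forall>k\<ge>N. \<forall>\<omega>\<in>sphere 0 1. \<bar>f k \<omega> - g \<omega>\<bar> < t * \<rho>" using lim[of "t * \<rho>"] t \<rho> by auto
    have "norm (l2norm lebesgue (\<lambda>x. u x - v k x) - 0) < e" if "k \<ge> N" for k
    proof -
      have "l2norm lebesgue (\<lambda>x. u x - v k x) \<le> b (1 + t)"
        using N that t by (intro est) (auto intro: less_imp_le)
      then show ?thesis using t(1) by (simp add: l2norm_nonneg)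
    qed
    then show "\<exists>N. \<forall>k\<ge>N. norm (l2norm lebesgue (\<lambda>x. u x - v k x) - 0) < e" by blast
  qed
  then show ?thesis by (simp add: u_def v_def)
qed

text \<open>The witness is the constant whose n-th power has integral \<gamma>; the lower bound on
  \<gamma> places it above \<rho>.\<close>

lemma admissible_nonempty:
  assumes n: "2 \<le> CARD('n)" and \<rho>: "0 < \<rho>" and L: "0 \<le> L"
    and \<gamma>: "\<rho> ^ CARD('n) * measure (sphere_measure :: (real^'n) measure) (sphere 0 1) < \<gamma>"
  shows "admissible \<rho> L \<gamma> \<noteq> ({} :: (real^'n \<Rightarrow> real) set)"
proof -
  let ?S = "measure (sphere_measure :: (real^'n) measure) (sphere 0 1)"
  have S: "0 < ?S" by (rule measure_sphere_pos[OF n])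
  define m where "m = root CARD('n) (\<gamma> / ?S)"
  have le: "\<rho> ^ CARD('n) \<le> \<gamma> / ?S" using \<gamma> S by (simp add: le_divide_eq)
  then have "root CARD('n) (\<rho> ^ CARD('n)) \<le> m" unfolding m_def by (intro real_root_le_mono) auto
  then have m: "\<rho> \<le> m" using \<rho> by (simp add: real_root_power_cancel)
  have "m ^ CARD('n) = \<gamma> / ?S"
    unfolding m_def by (rule real_root_pow_pos2) (use le \<rho> in \<open>auto intro: order_trans[rotated]\<close>)
  then have "m ^ CARD('n) * ?S = \<gamma>" using S by simp
  then have "(\<lambda>_ :: real^'n. m) \<in> admissible \<rho> L \<gamma>"
    unfolding admissible_iff[OF n L] using m L
    by (auto simp: geodesic_lipschitz_def space_sphere_measure mult.commute)
  then show ?thesis by blast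
qed

theorem theorem2p3:
  fixes \<rho> L \<gamma> R :: real
    and D :: "(real^'n) set"
    and F z :: "real^'n \<Rightarrow> real"
  assumes "CARD('n) \<ge> 2"
    and "\<rho> > 0" and "L > 0" and "\<gamma> > 0"
    and "\<gamma> > \<rho> ^ CARD('n) * measure (sphere_measure :: (real^'n) measure) (sphere 0 1)"
    and "R = root CARD('n) (\<gamma> / measure (sphere_measure :: (real^'n) measure) (sphere 0 1)) + pi * L"
    and "D = ball 0 R"
    and "F \<in> L2 D" and "z \<in> L2 D"
  shows "\<exists>f\<^sub>0\<in>admissible \<rho> L \<gamma>. \<forall>f\<in>admissible \<rho> L \<gamma>. cost F z f\<^sub>0 \<le> cost F z f"
proof -
  note n = assms(1) and \<rho> = assms(2) and D = assms(7)
  have L: "0 \<le> L" using assms(3) by simp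
  let ?A = "admissible \<rho> L \<gamma> :: (real^'n \<Rightarrow> real) set"
  have ne: "?A \<noteq> {}" by (rule admissible_nonempty[OF n \<rho> L assms(5)])
  have Dm: "D \<in> sets lebesgue" by (simp add: D)
  have F: "zero_ext D F \<in> square_integrable lebesgue" and z: "zero_ext D z \<in> square_integrable lebesgue"
    using assms(8,9) by (simp_all add: L2_iff_zero_ext[OF Dm])
  have le: "f \<omega> \<le> R" if "f \<in> ?A" "\<omega> \<in> sphere 0 1" for f \<omega>
    unfolding assms(6) by (rule admissible_le[OF n L \<rho> that])
  have R: "0 < R"
  proof -
    obtain f where f: "f \<in> ?A" using ne by blast
    \<comment> \<open>Any unit vector will do: the value of \<open>f\<close> there lies between
      \<rho> and \<open>R\<close>.\<close>
    have e: "axis undefined 1 \<in> sphere (0 :: real^'n) 1" by simp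
    have "\<rho> \<le> f (axis undefined 1)" using f e unfolding admissible_def by blast
    with le[OF f e] \<rho> show ?thesis by linarith
  qed
  have op: "open (Omega f)" if "f \<in> ?A" for f
    by (rule admissible_continuous[OF that]) (rule open_Omega[OF _ \<rho>], use that in \<open>auto simp: admissible_def\<close>)
  have sub: "Omega f \<subseteq> ball 0 R" if "f \<in> ?A" for f by (rule Omega_subset_ball[OF R le[OF that]])
  define u where "u f = zero_ext (Omega f) (state F (Omega f))" for f
  have us: "u f \<in> square_integrable lebesgue" if f: "f \<in> ?A" for f
    unfolding u_def
    by (rule state_H10_solution[OF op[OF f] sub[OF f, folded D] sub[OF f] R F]) (rule H10_solution_square_integrable)
  \<comment> \<open>Minimising \<open>E\<close> amounts to minimising the cost, and as a norm it
    obeys the triangle inequality behind the semicontinuity.\<close>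
  define E where "E f = l2norm lebesgue (zero_ext (Omega f) (\<lambda>x. u f x - zero_ext D z x))" for f
  have cost: "cost F z f = 1 / 2 * (E f)\<^sup>2" if "f \<in> ?A" for f
    unfolding E_def u_def using op sub that by (intro cost_eq) (auto simp: D)
  have E0: "0 \<le> E f" for f by (simp add: E_def l2norm_nonneg)
  define I where "I = Inf (E ` ?A)"
  have bdd: "bdd_below (E ` ?A)" using E0 by (intro bdd_belowI2)
  have I: "I \<le> E f" if "f \<in> ?A" for f unfolding I_def by (intro cInf_lower bdd imageI that)
  have "\<forall>k. \<exists>f. f \<in> ?A \<and> E f < I + inverse (real (Suc k))"
  proof
    fix k
    have "I < I + inverse (real (Suc k))" by simp
    then show "\<exists>f. f \<in> ?A \<and> E f < I + inverse (real (Suc k))"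
      unfolding I_def using cInf_lessD[of "E ` ?A"] ne by blast
  qed
  from choice[OF this]
  obtain f where f: "\<And>k. f k \<in> ?A" "\<And>k. E (f k) < I + inverse (real (Suc k))" by blast
  obtain g r where g: "g \<in> ?A" and r: "strict_mono (r :: nat \<Rightarrow> nat)"
    and lim: "\<And>e. 0 < e \<Longrightarrow> \<exists>N. \<forall>k\<ge>N. \<forall>\<omega>\<in>sphere 0 1. \<bar>f (r k) \<omega> - g \<omega>\<bar> < e"
    by (rule admissible_compact[where f=f, OF n L \<rho> f(1)]) (rule that)
  have "(\<lambda>k. E (f k)) \<longlonglongrightarrow> I"
  proof (rule tendsto_sandwich[where f="\<lambda>_. I" and h="\<lambda>k. I + inverse (real (Suc k))"])
    show "\<forall>\<^sub>F k in sequentially. I \<le> E (f k)" by (intro always_eventually allI I f(1))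
    show "\<forall>\<^sub>F k in sequentially. E (f k) \<le> I + inverse (real (Suc k))"
      by (intro always_eventually allI less_imp_le f(2))
    show "(\<lambda>k. I + inverse (real (Suc k))) \<longlonglongrightarrow> I"
      using tendsto_add[OF tendsto_const LIMSEQ_inverse_real_of_nat] by simp
  qed (rule tendsto_const)
  then have EI: "(\<lambda>k. E (f (r k))) \<longlonglongrightarrow> I" using LIMSEQ_subseq_LIMSEQ[OF _ r] by (simp add: comp_def)
  have conv: "(\<lambda>k. l2norm lebesgue (\<lambda>x. u g x - u (f (r k)) x)) \<longlonglongrightarrow> 0"
    unfolding u_def by (rule state_tendsto[OF n L \<rho> R F D f(1) g le[OF f(1)] le[OF g] lim])
  have "E g \<le> I"
    unfolding E_def
  proof (rule l2norm_zero_ext_lower_semicontinuous)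
    show "Omega g \<in> sets lebesgue" "Omega (f (r k)) \<in> sets lebesgue" for k using op g f by auto
    show "(\<lambda>x. u g x - zero_ext D z x) \<in> square_integrable lebesgue"
      "(\<lambda>x. u (f (r k)) x - zero_ext D z x) \<in> square_integrable lebesgue" for k
      by (intro square_integrable_diff us g f z)+
    show "(\<lambda>k. l2norm lebesgue (\<lambda>x. u g x - zero_ext D z x - (u (f (r k)) x - zero_ext D z x))) \<longlonglongrightarrow> 0"
      using conv by simp
    show "(\<lambda>k. l2norm lebesgue (zero_ext (Omega (f (r k))) (\<lambda>x. u (f (r k)) x - zero_ext D z x))) \<longlonglongrightarrow> I"
      using EI by (simp add: E_def)
    \<comment> \<open>The point has the radial margin g (x / |x|) - |x| > 0, which the uniform
      distance eventually undercuts.\<close>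
    show "\<forall>\<^sub>F k in sequentially. x \<in> Omega (f (r k))" if x: "x \<in> Omega g" for x
    proof (cases "x = 0")
      case False
      then have d: "0 < g (x /\<^sub>R norm x) - norm x" using x by (simp add: Omega_def)
      have s: "x /\<^sub>R norm x \<in> sphere 0 1" using False by simp
      obtain N where N: "\<forall>k\<ge>N. \<forall>\<omega>\<in>sphere 0 1. \<bar>f (r k) \<omega> - g \<omega>\<bar> < g (x /\<^sub>R norm x) - norm x" using lim[OF d] by blast
      have "x \<in> Omega (f (r k))" if "k \<ge> N" for k
      proof -
        have "\<bar>f (r k) (x /\<^sub>R norm x) - g (x /\<^sub>R norm x)\<bar> < g (x /\<^sub>R norm x) - norm x" using N that s by blast
        then have "norm x < f (r k) (x /\<^sub>R norm x)" by linarith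
        then show ?thesis by (simp add: Omega_def)
      qed
      then show ?thesis by (auto simp: eventually_sequentially)
    qed (simp add: Omega_def)
  qed
  then have "cost F z g \<le> cost F z h" if "h \<in> ?A" for h
    using power_mono[OF order_trans[OF _ I[OF that]] E0[of g], of 2] cost[OF g] cost[OF that] by simp
  then show ?thesis using g by blast
qed

end
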